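(* Let $\varepsilon>0$ be fixed and let $\varphi\in \mathcal{G}^{\beta}\cap\mathcal{U}$ be a local minimizer of the problem of minimizing $J_l^{D,\varepsilon}$ over $\mathcal{G}^{\beta}\cap\mathcal{U}$, i.e., there exists $\delta>0$ such that $$J_l^{D,\varepsilon}(\vartheta)\ge J_l^{D,\varepsilon}(\varphi)\quad\text{for all }\vartheta\in\mathcal{G}^{\beta}\cap\mathcal{U}\text{ with }\|\vartheta-\varphi\|_{L^\infty(\Omega)}<\delta.$$ Suppose that the Dirichlet eigenvalues $\lambda^{\varphi}_{i_1},\dots,\lambda^{\varphi}_{i_l}$ are simple, and fix associated eigenfunctions $w^{D,\varphi}_{i_1},\dots,w^{D,\varphi}_{i_l}\in H^1_0(\Omega)$, normalized by $\int_\Omega c_\varepsilon(\varphi)|w^{D,\varphi}_{i_j}|^2\,dx=1$. Then the following holds. (1) For all $j\in\{1,\dots,l\}$ the state equation $$-\nabla\cdot\big[a_\varepsilon(\varphi)\nabla w^{D,\varphi}_{i_j}\big]+b_\varepsilon(\varphi)w^{D,\varphi}_{i_j}=\lambda^{\varphi}_{i_j}c_\varepsilon(\varphi)w^{D,\varphi}_{i_j}\ \text{ in }\Omega,\qquad w^{D,\varphi}_{i_j}=0\ \text{ on }\partial\Omega$$ is fulfilled in the weak sense. (2) For all $\vartheta\in\mathcal{G}^{\beta}\cap\mathcal{U}$ the variational inequality $$\begin{aligned}0\le{}&\gamma\varepsilon\int_{\tilde\Omega}\nabla\varphi\cdot\nabla(\vartheta-\varphi)\,dx+\frac{\gamma}{\varepsilon}\int_{\tilde\Omega}\psi_0'(\varphi)(\vartheta-\varphi)\,dx\\&+\sum_{j=1}^{l}\partial_j\Psi(\lambda^{\varphi}_{i_1},\dots,\lambda^{\varphi}_{i_l})\Big(\int_\Omega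 a_\varepsilon'(\varphi)(\vartheta-\varphi)|\nabla w^{D,\varphi}_{i_j}|^2\,dx+\int_\Omega b_\varepsilon'(\varphi)(\vartheta-\varphi)|w^{D,\varphi}_{i_j}|^2\,dx\\&\qquad\qquad-\lambda^{\varphi}_{i_j}\int_\Omega c_\varepsilon'(\varphi)(\vartheta-\varphi)|w^{D,\varphi}_{i_j}|^2\,dx\Big)\end{aligned}$$ is satisfied, where $\partial_j\Psi$ denotes the partial derivative of $\Psi$ with respect to its $j$-th argument (the slot of $\lambda_{i_j}$).
   Context: Setting. $\Omega\subset\mathbb{R}^d$, $d\in\mathbb{N}$, is a bounded domain with Lipschitz boundary. $S_0,S_1\subset\Omega$ are disjoint measurable sets such that $\tilde\Omega:=\Omega\setminus(S_0\cup S_1)$ is a domain with Lipschitz boundary. $\beta_1,\beta_2\in(-1,1)$ with $\beta_1\le\beta_2$. Define $$\mathcal{U}=\{\varphi\in L^1(\Omega): \varphi=-1\text{ a.e. on }S_0,\ \varphi=1\text{ a.e. on }S_1\},$$ $$\mathcal{G}^\beta=\Big\{\varphi\in H^1(\tilde\Omega): |\varphi|\le1,\ \beta_1|\tilde\Omega|\le\int_{\tilde\Omega}\varphi\,dx\le\beta_2|\tilde\Omega|\Big\}.$$ $\mathcal{G}^\beta\cap\mathcal{U}$ is the set of $\varphi\in\mathcal{U}$ whose restriction to $\tilde\Omega$ lies in $\mathcal{G}^\beta$ (so $|\varphi|\le 1$ a.e. in $\Omega$). Coefficients. For the fixed $\varepsilon>0$, $a_\varepsilon,b_\varepsilon,c_\varepsilon\in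 C^{1,1}_{loc}(\mathbb{R})$ with $a_\varepsilon,c_\varepsilon>C_\varepsilon>0$ on $\mathbb{R}$ for some constant $C_\varepsilon$, and $b_\varepsilon\ge0$ on $\mathbb{R}$. Eigenvalues. For $\varphi\in L^\infty(\Omega)$, a Dirichlet eigenvalue is a number $\lambda$ for which there is $0\ne w\in H^1_0(\Omega)$ (an eigenfunction) with $$\int_\Omega a_\varepsilon(\varphi)\nabla w\cdot\nabla\eta\,dx+\int_\Omega b_\varepsilon(\varphi)w\eta\,dx=\lambda\int_\Omega c_\varepsilon(\varphi)w\eta\,dx\quad\text{for all }\eta\in H^1_0(\Omega)$$ (this is the weak form of the state equation). The Dirichlet eigenvalues, repeated according to multiplicity, form a sequence $0<\lambda_1^\varphi\le\lambda_2^\varphi\le\cdots\to\infty$. An eigenvalue is simple if its eigenspace is one-dimensional. Cost functional. $l\in\mathbb{N}$, $1\le i_1<\dots<i_l$ are fixed indices, $\Psi:(\mathbb{R}_{>0})^l\to\mathbb{R}$ is of class $C^1$, $\gamma>0$, and $$J_l^{D,\varepsilon}(\varphi)=\Psi(\lambda^\varphi_{i_1},\dots,\lambda^\varphi_{i_l})+\gamma E^\varepsilon_{GL}(\varphi),\qquad E^\varepsilon_{GL}(\varphi)=\int_{\tilde\Omega}\Big(\frac\varepsilon2|\nabla\varphi|^2+\frac1\varepsilon\psi(\varphi)\Big)dx.$$ The potential $\psi:\mathbb{R}\to\mathbb{R}\cup\{+\infty\}$ has exactly the two global minimum points $\pm1$, with $\min\psi=\psi(\pm1)=0$, and a local maximum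 point in between; moreover $\psi=\psi_0+I_{[-1,1]}$ with $\psi_0\in C^{1,1}_{loc}(\mathbb{R})$ and $I_{[-1,1]}$ equal to $0$ on $[-1,1]$ and $+\infty$ elsewhere. *)

theory Defs
  imports "HOL-Analysis.Analysis" "HOL-Probability.Essential_Supremum"
begin

section \<open>Domains and regularity classes\<close>

definition region :: "'a::euclidean_space set \<Rightarrow> bool" where
  "region \<Omega> \<longleftrightarrow> open \<Omega> \<and> connected \<Omega> \<and> \<Omega> \<noteq> {}"

text \<open>Near each boundary point the set is, in suitable orthonormal coordinates, the strict
  epigraph of a Lipschitz function. The unit vector \<open>\<nu>\<close> is the vertical direction and
  \<open>x - (x \<bullet> \<nu>) *\<^sub>R \<nu>\<close> is the projection of \<open>x\<close> to the hyperplane orthogonal to \<open>\<nu>\<close>.\<close>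

definition lipschitz_boundary :: "'a::euclidean_space set \<Rightarrow> bool" where
  "lipschitz_boundary \<Omega> \<longleftrightarrow>
     (\<forall>p\<in>frontier \<Omega>. \<exists>r>0. \<exists>\<nu>. norm \<nu> = 1 \<and>
       (\<exists>g::'a \<Rightarrow> real. \<exists>L. L-lipschitz_on UNIV g \<and>
         \<Omega> \<inter> ball p r = {x \<in> ball p r. g (x - (x \<bullet> \<nu>) *\<^sub>R \<nu>) < x \<bullet> \<nu>}))"

text \<open>\<open>C\<^sup>k\<close> on an open set \<open>S\<close>, by iterating partial derivatives.\<close>

fun Ck_on :: "nat \<Rightarrow> 'a::euclidean_space set \<Rightarrow> ('a \<Rightarrow> real) \<Rightarrow> bool" where
  "Ck_on 0 S f \<longleftrightarrow> continuous_on S f"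
| "Ck_on (Suc k) S f \<longleftrightarrow> (\<forall>x\<in>S. f differentiable (at x)) \<and>
     (\<forall>b\<in>Basis. Ck_on k S (\<lambda>x. frechet_derivative f (at x) b))"

definition C11_loc :: "(real \<Rightarrow> real) \<Rightarrow> bool" where
  "C11_loc f \<longleftrightarrow> (\<forall>x. f differentiable (at x)) \<and>
     (\<forall>K. compact K \<longrightarrow> (\<exists>L. L-lipschitz_on K (deriv f)))"


section \<open>Sobolev spaces\<close>

text \<open>Elements of the function spaces are represented by total functions, of which only the
  values on the underlying set matter; all notions below are invariant under changes on
  null sets.\<close>

definition L2 :: "'a::euclidean_space set \<Rightarrow> ('a \<Rightarrow> 'b::euclidean_space) set" where
  "L2 \<Omega> = {u \<in> borel_measurable (lebesgue_on \<Omega>). integrable (lebesgue_on \<Omega>) (\<lambda>x. (norm (u x))\<^sup>2)}"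

definition L1_loc :: "'a::euclidean_space set \<Rightarrow> ('a \<Rightarrow> 'b::euclidean_space) set" where
  "L1_loc \<Omega> = {u. \<forall>K. compact K \<and> K \<subseteq> \<Omega> \<longrightarrow> integrable (lebesgue_on K) u}"

definition test_functions :: "'a::euclidean_space set \<Rightarrow> ('a \<Rightarrow> real) set" where
  "test_functions \<Omega> =
     {\<zeta>. (\<forall>k. Ck_on k UNIV \<zeta>) \<and> compact (closure {x. \<zeta> x \<noteq> 0}) \<and> closure {x. \<zeta> x \<noteq> 0} \<subseteq> \<Omega>}"

definition has_weak_gradient ::
    "'a::euclidean_space set \<Rightarrow> ('a \<Rightarrow> real) \<Rightarrow> ('a \<Rightarrow> 'a) \<Rightarrow> bool" where
  "has_weak_gradient \<Omega> u G \<longleftrightarrow> u \<in> L1_loc \<Omega> \<and> G \<in> L1_loc \<Omega> \<and>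
     (\<forall>\<zeta>\<in>test_functions \<Omega>. \<forall>b\<in>Basis.
        (LINT x|lebesgue_on \<Omega>. u x * frechet_derivative \<zeta> (at x) b)
          = - (LINT x|lebesgue_on \<Omega>. (G x \<bullet> b) * \<zeta> x))"

text \<open>Weak gradients are unique only up to null sets; this picks a representative.\<close>

definition wgrad :: "'a::euclidean_space set \<Rightarrow> ('a \<Rightarrow> real) \<Rightarrow> 'a \<Rightarrow> 'a" where
  "wgrad \<Omega> u = (SOME G. has_weak_gradient \<Omega> u G)"

definition H1 :: "'a::euclidean_space set \<Rightarrow> ('a \<Rightarrow> real) set" where
  "H1 \<Omega> = {u \<in> L2 \<Omega>. \<exists>G\<in>L2 \<Omega>. has_weak_gradient \<Omega> u G}"

definition H1_norm :: "'a::euclidean_space set \<Rightarrow> ('a \<Rightarrow> real) \<Rightarrow> real" where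
  "H1_norm \<Omega> u = sqrt ((LINT x|lebesgue_on \<Omega>. (u x)\<^sup>2)
                     + (LINT x|lebesgue_on \<Omega>. (norm (wgrad \<Omega> u x))\<^sup>2))"

definition H10 :: "'a::euclidean_space set \<Rightarrow> ('a \<Rightarrow> real) set" where
  "H10 \<Omega> = {u \<in> H1 \<Omega>. \<forall>e>0. \<exists>\<zeta>\<in>test_functions \<Omega>. H1_norm \<Omega> (\<lambda>x. u x - \<zeta> x) < e}"

definition Linf_norm :: "'a::euclidean_space set \<Rightarrow> ('a \<Rightarrow> real) \<Rightarrow> ereal" where
  "Linf_norm \<Omega> u = esssup (lebesgue_on \<Omega>) (\<lambda>x. ereal \<bar>u x\<bar>)"


section \<open>Dirichlet eigenvalues\<close>

definition state_equation ::
    "'a::euclidean_space set \<Rightarrow> (real \<Rightarrow> real) \<Rightarrow> (real \<Rightarrow> real) \<Rightarrow> (real \<Rightarrow> real)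
      \<Rightarrow> ('a \<Rightarrow> real) \<Rightarrow> real \<Rightarrow> ('a \<Rightarrow> real) \<Rightarrow> bool" where
  "state_equation \<Omega> a b c \<phi> \<mu> w \<longleftrightarrow> w \<in> H10 \<Omega> \<and>
     (\<forall>\<eta>\<in>H10 \<Omega>.
        (LINT x|lebesgue_on \<Omega>. a (\<phi> x) * (wgrad \<Omega> w x \<bullet> wgrad \<Omega> \<eta> x))
          + (LINT x|lebesgue_on \<Omega>. b (\<phi> x) * w x * \<eta> x)
          = \<mu> * (LINT x|lebesgue_on \<Omega>. c (\<phi> x) * w x * \<eta> x))"

definition eigenfunction ::
    "'a::euclidean_space set \<Rightarrow> (real \<Rightarrow> real) \<Rightarrow> (real \<Rightarrow> real) \<Rightarrow> (real \<Rightarrow> real)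
      \<Rightarrow> ('a \<Rightarrow> real) \<Rightarrow> real \<Rightarrow> ('a \<Rightarrow> real) \<Rightarrow> bool" where
  "eigenfunction \<Omega> a b c \<phi> \<mu> w \<longleftrightarrow>
     state_equation \<Omega> a b c \<phi> \<mu> w \<and> \<not> (AE x in lebesgue_on \<Omega>. w x = 0)"

text \<open>\<open>ae_dim M E n\<close>: modulo equality almost everywhere, the space \<open>E\<close> of functions has a basis
  of \<open>n\<close> elements.\<close>

definition ae_dim :: "'a measure \<Rightarrow> ('a \<Rightarrow> real) set \<Rightarrow> nat \<Rightarrow> bool" where
  "ae_dim M E n \<longleftrightarrow>
     (\<exists>v :: nat \<Rightarrow> 'a \<Rightarrow> real. (\<forall>k<n. v k \<in> E) \<and>
        (\<forall>r :: nat \<Rightarrow> real. (AE x in M. (\<Sum>k<n. r k * v k x) = 0) \<longrightarrow> (\<forall>k<n. r k = 0)) \<and>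
        (\<forall>w\<in>E. \<exists>r :: nat \<Rightarrow> real. AE x in M. w x = (\<Sum>k<n. r k * v k x)))"

definition eigenspace_dim ::
    "'a::euclidean_space set \<Rightarrow> (real \<Rightarrow> real) \<Rightarrow> (real \<Rightarrow> real) \<Rightarrow> (real \<Rightarrow> real)
      \<Rightarrow> ('a \<Rightarrow> real) \<Rightarrow> real \<Rightarrow> nat \<Rightarrow> bool" where
  "eigenspace_dim \<Omega> a b c \<phi> \<mu> n \<longleftrightarrow>
     ae_dim (lebesgue_on \<Omega>) {w. state_equation \<Omega> a b c \<phi> \<mu> w} n"

text \<open>Nondecreasing enumeration (indices start at 1) of all eigenvalues, each repeated according
  to its multiplicity. A number that is not an eigenvalue has a zero-dimensional eigenspace and
  so does not occur.\<close>

definition eigenvalue_enumeration ::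
    "'a::euclidean_space set \<Rightarrow> (real \<Rightarrow> real) \<Rightarrow> (real \<Rightarrow> real) \<Rightarrow> (real \<Rightarrow> real)
      \<Rightarrow> ('a \<Rightarrow> real) \<Rightarrow> (nat \<Rightarrow> real) \<Rightarrow> bool" where
  "eigenvalue_enumeration \<Omega> a b c \<phi> \<Lambda> \<longleftrightarrow>
     (\<forall>m n. 1 \<le> m \<and> m \<le> n \<longrightarrow> \<Lambda> m \<le> \<Lambda> n) \<and>
     (\<forall>\<mu>. finite {k. 1 \<le> k \<and> \<Lambda> k = \<mu>} \<and> eigenspace_dim \<Omega> a b c \<phi> \<mu> (card {k. 1 \<le> k \<and> \<Lambda> k = \<mu>}))"

text \<open>The enumeration is determined uniquely at all indices \<open>k \<ge> 1\<close>.\<close>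

definition eigenvalue ::
    "'a::euclidean_space set \<Rightarrow> (real \<Rightarrow> real) \<Rightarrow> (real \<Rightarrow> real) \<Rightarrow> (real \<Rightarrow> real)
      \<Rightarrow> ('a \<Rightarrow> real) \<Rightarrow> nat \<Rightarrow> real" where
  "eigenvalue \<Omega> a b c \<phi> k = (SOME \<Lambda>. eigenvalue_enumeration \<Omega> a b c \<phi> \<Lambda>) k"

definition simple_eigenvalue ::
    "'a::euclidean_space set \<Rightarrow> (real \<Rightarrow> real) \<Rightarrow> (real \<Rightarrow> real) \<Rightarrow> (real \<Rightarrow> real)
      \<Rightarrow> ('a \<Rightarrow> real) \<Rightarrow> real \<Rightarrow> bool" where
  "simple_eigenvalue \<Omega> a b c \<phi> \<mu> \<longleftrightarrow> eigenspace_dim \<Omega> a b c \<phi> \<mu> 1"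


section \<open>The optimization problem\<close>

definition U_set :: "'a::euclidean_space set \<Rightarrow> 'a set \<Rightarrow> 'a set \<Rightarrow> ('a \<Rightarrow> real) set" where
  "U_set \<Omega> S0 S1 = {\<phi>. integrable (lebesgue_on \<Omega>) \<phi> \<and>
     (AE x in lebesgue_on \<Omega>. x \<in> S0 \<longrightarrow> \<phi> x = -1) \<and>
     (AE x in lebesgue_on \<Omega>. x \<in> S1 \<longrightarrow> \<phi> x = 1)}"

text \<open>Membership depends only on the restriction of the function to the given set.\<close>

definition G_set :: "'a::euclidean_space set \<Rightarrow> real \<Rightarrow> real \<Rightarrow> ('a \<Rightarrow> real) set" where
  "G_set \<Omega>t \<beta>1 \<beta>2 = {\<phi> \<in> H1 \<Omega>t. (AE x in lebesgue_on \<Omega>t. \<bar>\<phi> x\<bar> \<le> 1) \<and>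
     \<beta>1 * measure lebesgue \<Omega>t \<le> (LINT x|lebesgue_on \<Omega>t. \<phi> x) \<and>
     (LINT x|lebesgue_on \<Omega>t. \<phi> x) \<le> \<beta>2 * measure lebesgue \<Omega>t}"

definition obstacle :: "real \<Rightarrow> ereal" where
  "obstacle s = (if s \<in> {-1..1} then 0 else \<infinity>)"

definition double_well :: "(real \<Rightarrow> ereal) \<Rightarrow> (real \<Rightarrow> real) \<Rightarrow> bool" where
  "double_well \<psi> \<psi>0 \<longleftrightarrow>
     C11_loc \<psi>0 \<and> (\<forall>s. \<psi> s = ereal (\<psi>0 s) + obstacle s) \<and>
     (\<forall>s. 0 \<le> \<psi> s) \<and> (\<forall>s. \<psi> s = 0 \<longleftrightarrow> s = -1 \<or> s = 1) \<and>
     (\<exists>s\<in>{-1<..<1}. \<forall>\<^sub>F t in nhds s. \<psi> t \<le> \<psi> s)"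

text \<open>The energy density is nonnegative and may take the value \<open>\<infinity>\<close>.\<close>

definition E_GL :: "'a::euclidean_space set \<Rightarrow> (real \<Rightarrow> ereal) \<Rightarrow> real \<Rightarrow> ('a \<Rightarrow> real) \<Rightarrow> ereal" where
  "E_GL \<Omega>t \<psi> \<epsilon> \<phi> = enn2ereal (\<integral>\<^sup>+x. e2ennreal
     (ereal (\<epsilon> / 2 * (norm (wgrad \<Omega>t \<phi> x))\<^sup>2) + ereal (1 / \<epsilon>) * \<psi> (\<phi> x)) \<partial>lebesgue_on \<Omega>t)"

text \<open>The index set \<open>{1,\<dots>,l}\<close> is represented by a finite type \<open>'l\<close>; the order of the indices \<open>i j\<close>
  is expressed through a linear order on \<open>'l\<close>.\<close>

definition eigenvalue_vec ::
    "'a::euclidean_space set \<Rightarrow> (real \<Rightarrow> real) \<Rightarrow> (real \<Rightarrow> real) \<Rightarrow> (real \<Rightarrow> real)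
      \<Rightarrow> ('l::finite \<Rightarrow> nat) \<Rightarrow> ('a \<Rightarrow> real) \<Rightarrow> real ^ 'l" where
  "eigenvalue_vec \<Omega> a b c i \<phi> = (\<chi> j. eigenvalue \<Omega> a b c \<phi> (i j))"

definition J_cost ::
    "'a::euclidean_space set \<Rightarrow> 'a set \<Rightarrow> (real \<Rightarrow> real) \<Rightarrow> (real \<Rightarrow> real) \<Rightarrow> (real \<Rightarrow> real)
      \<Rightarrow> ('l::finite \<Rightarrow> nat) \<Rightarrow> (real ^ 'l \<Rightarrow> real) \<Rightarrow> real \<Rightarrow> (real \<Rightarrow> ereal) \<Rightarrow> real
      \<Rightarrow> ('a \<Rightarrow> real) \<Rightarrow> ereal" where
  "J_cost \<Omega> \<Omega>t a b c i \<Psi> \<gamma> \<psi> \<epsilon> \<phi> =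
     ereal (\<Psi> (eigenvalue_vec \<Omega> a b c i \<phi>)) + ereal \<gamma> * E_GL \<Omega>t \<psi> \<epsilon> \<phi>"

definition partial_deriv :: "'l::finite \<Rightarrow> (real ^ 'l \<Rightarrow> real) \<Rightarrow> real ^ 'l \<Rightarrow> real" where
  "partial_deriv j \<Psi> y = frechet_derivative \<Psi> (at y) (axis j 1)"

end

theory Submission
  imports Defs "HOL-Real_Asymp.Real_Asymp" "HOL-Complex_Analysis.Great_Picard"
begin

text \<open>For admissible \<open>\<theta>\<close> the functions \<open>\<phi>\<^sub>t = \<phi> + t (\<theta> - \<phi>)\<close>, \<open>0 \<le> t \<le> 1\<close>, are admissible and
  close to \<open>\<phi>\<close> in \<open>L\<^sup>\<infinity>\<close> for small \<open>t\<close>, so the one-sided derivative of the cost at \<open>t = 0\<close> is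
  nonnegative. The point is to differentiate a simple eigenvalue \<open>\<lambda>\<close> with normalized eigenfunction
  \<open>w\<close> along this segment. Poincare's inequality and Rellich's theorem give an eigenbasis for each
  pair of forms \<open>A\<^sub>t u v = \<integral> a(\<phi>\<^sub>t) \<nabla>u \<bullet> \<nabla>v + b(\<phi>\<^sub>t) u v\<close>, \<open>C\<^sub>t u v = \<integral> c(\<phi>\<^sub>t) u v\<close>, and
  \<open>A\<^sub>t - A\<^sub>0 - t A'\<close> and \<open>C\<^sub>t - C\<^sub>0 - t C'\<close> are \<open>O(t\<^sup>2)\<close> relative to \<open>A\<^sub>0\<close>. Let
  \<open>d = A' w w - \<lambda> C' w w\<close> and \<open>\<eta> > 0\<close>. For small \<open>t > 0\<close> the form \<open>A\<^sub>t - (\<lambda> + t (d + \<eta>)) C\<^sub>t\<close> is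
  nonpositive on the span of \<open>w\<close> and the lower unperturbed modes, and \<open>A\<^sub>t - (\<lambda> + t (d - \<eta>)) C\<^sub>t\<close> is
  nonnegative on the span of \<open>w\<close> and the higher ones, so by the min-max principle the perturbed
  eigenvalue lies between \<open>\<lambda> + t (d - \<eta>)\<close> and \<open>\<lambda> + t (d + \<eta>)\<close>.\<close>

section \<open>Linear algebra of functions modulo null sets\<close>

text \<open>Functions are plain representatives, identified only almost everywhere, and
  \<open>eigenvalue\<close> is a choice among enumerations that are constrained through dimensions
  of eigenspaces. The link between this choice and the analysis is algebraic: dimensions modulo null
  sets are unique, and a monotone enumeration is determined by its multiplicities. For the same
  reason all forms are treated as semidefinite, and equality of functions is replaced by vanishing
  of the mass form. The trial spaces in the perturbation argument are spanned by the unperturbed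
  eigenbasis, so no convergence of perturbed eigenfunctions enters. The error is O(t^2) because
  |\<phi>| and |\<theta>| are at most 1 almost everywhere: only values of the coefficients on [-1,1]
  occur, where their derivatives are Lipschitz. Both Poincare's inequality and compactness rest on
  one estimate for \<zeta>(x + h) - \<zeta>(x), proved for test functions and carried over to their
  closure.\<close>

lemma homogeneous_system_nontrivial_solution:
  fixes c :: "nat \<Rightarrow> 'k \<Rightarrow> real"
  assumes "finite K" "m < card K"
  shows "\<exists>r. (\<exists>k\<in>K. r k \<noteq> 0) \<and> (\<forall>i<m. (\<Sum>k\<in>K. c i k * r k) = 0)"
  using assms
proof (induction m arbitrary: K c)
  case 0
  then obtain k where "k \<in> K" by fastforce
  then show ?case by (intro exI[of _ "\<lambda>_. 1"]) auto
next
  case (Suc m)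
  show ?case
  proof (cases "\<forall>k\<in>K. c m k = 0")
    case True
    obtain r where r: "\<exists>k\<in>K. r k \<noteq> 0" "\<forall>i<m. (\<Sum>k\<in>K. c i k * r k) = 0"
      using Suc.IH[of K c] Suc.prems by auto
    have "(\<Sum>k\<in>K. c m k * r k) = 0" using True by (intro sum.neutral) auto
    with r show ?thesis by (intro exI[of _ r]) (auto simp: less_Suc_eq)
  next
    case False
    then obtain p where p: "p \<in> K" "c m p \<noteq> 0" by auto
    \<comment> \<open>Row reduction: equation \<open>m\<close> eliminates the unknown
      \<open>p\<close>, and \<open>c'\<close> are the coefficients of the reduced system on
      \<open>K - {p}\<close>.\<close>
    define c' where "c' i k = c i k - c i p * c m k / c m p" for i k
    have "m < card (K - {p})" using Suc.prems p by simp
    then obtain r where r: "\<exists>k\<in>K - {p}. r k \<noteq> 0"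
        "\<And>i. i < m \<Longrightarrow> (\<Sum>k\<in>K - {p}. c' i k * r k) = 0"
      using Suc.IH[of "K - {p}" c'] Suc.prems by auto
    define s where "s = (\<Sum>k\<in>K - {p}. c m k * r k)"
    \<comment> \<open>Back-substitution: the value at \<open>p\<close> is the one forced by equation
      \<open>m\<close>.\<close>
    define q where "q = r(p := - s / c m p)"
    have sum_q: "(\<Sum>k\<in>K. c i k * q k) = - c i p * s / c m p + (\<Sum>k\<in>K - {p}. c i k * r k)" for i
    proof -
      have "(\<Sum>k\<in>K. c i k * q k) = c i p * q p + (\<Sum>k\<in>K - {p}. c i k * q k)"
        using Suc.prems p by (intro sum.remove) auto
      also have "(\<Sum>k\<in>K - {p}. c i k * q k) = (\<Sum>k\<in>K - {p}. c i k * r k)"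
        by (intro sum.cong) (auto simp: q_def)
      finally show ?thesis by (simp add: q_def)
    qed
    have "(\<Sum>k\<in>K. c m k * q k) = 0" using p by (simp add: sum_q flip: s_def)
    moreover have "(\<Sum>k\<in>K. c i k * q k) = 0" if "i < m" for i
    proof -
      have "(\<Sum>k\<in>K - {p}. c' i k * r k)
          = (\<Sum>k\<in>K - {p}. c i k * r k) - c i p / c m p * s"
        unfolding c'_def s_def sum_distrib_left sum_subtractf[symmetric]
        by (intro sum.cong) (auto simp: algebra_simps)
      with r(2)[OF that] show ?thesis by (simp add: sum_q)
    qed
    moreover have "\<exists>k\<in>K. q k \<noteq> 0" using r(1) by (auto simp: q_def)
    ultimately show ?thesis by (intro exI[of _ q]) (auto simp: less_Suc_eq)
  qed
qed

text \<open>If \<open>m\<close> exceeded \<open>n\<close>, the matrix expressing the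
  \<open>u j\<close> by the \<open>v k\<close> would have a nontrivial kernel vector, and the
  combination of the \<open>u j\<close> with these coefficients would vanish almost
  everywhere.\<close>

lemma ae_independent_le_spanning:
  fixes u v :: "nat \<Rightarrow> 'x \<Rightarrow> real"
  assumes indep: "\<And>r. AE x in M. (\<Sum>k<m. r k * u k x) = 0 \<Longrightarrow> \<forall>k<m. r k = 0"
    and span: "\<And>j. j < m \<Longrightarrow> \<exists>r. AE x in M. u j x = (\<Sum>k<n. r k * v k x)"
  shows "m \<le> n"
proof (rule ccontr)
  assume "\<not> m \<le> n"
  obtain R where R: "\<And>j. j < m \<Longrightarrow> AE x in M. u j x = (\<Sum>k<n. R j k * v k x)"
    using span by metis
  obtain r where r: "\<exists>k\<in>{..<m}. r k \<noteq> 0" "\<forall>i<n. (\<Sum>k<m. R k i * r k) = 0"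
    using homogeneous_system_nontrivial_solution[of "{..<m}" n "\<lambda>i k. R k i"] \<open>\<not> m \<le> n\<close> by auto
  have "AE x in M. \<forall>j\<in>{..<m}. u j x = (\<Sum>k<n. R j k * v k x)"
    using R by (intro AE_finite_allI) auto
  then have "AE x in M. (\<Sum>j<m. r j * u j x) = 0"
  proof eventually_elim
    case (elim x)
    have "(\<Sum>j<m. r j * u j x) = (\<Sum>j<m. \<Sum>k<n. r j * (R j k * v k x))"
      using elim by (intro sum.cong) (auto simp: sum_distrib_left)
    also have "\<dots> = (\<Sum>k<n. (\<Sum>j<m. R j k * r j) * v k x)"
      by (subst sum.swap) (simp add: sum_distrib_right sum_distrib_left algebra_simps)
    also have "\<dots> = 0" using r by (intro sum.neutral) auto
    finally show ?case .
  qed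
  from indep[OF this] r show False by auto
qed

lemma ae_dim_unique:
  assumes "ae_dim M E m" "ae_dim M E n"
  shows "m = n"
proof -
  have "m \<le> n" if m: "ae_dim M E m" and n: "ae_dim M E n" for m n
  proof -
    obtain u where u: "\<forall>k<m. u k \<in> E"
      "\<And>r. AE x in M. (\<Sum>k<m. r k * u k x) = 0 \<Longrightarrow> \<forall>k<m. r k = 0"
      using m unfolding ae_dim_def by blast
    obtain v where v: "\<forall>w\<in>E. \<exists>r. AE x in M. w x = (\<Sum>k<n. r k * v k x)"
      using n unfolding ae_dim_def by blast
    show ?thesis using u v by (intro ae_independent_le_spanning[where u = u and v = v and M = M]) auto
  qed
  from this[OF assms] this[OF assms(2,1)] show ?thesis by simp
qed

text \<open>At the first index \<open>n\<close> where the sequences differ, the smaller value, say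
  \<open>f n < g n\<close>, is taken by \<open>g\<close> only at indices below \<open>n\<close>,
  where both agree. Its fibre under \<open>g\<close> is then a proper subset of its fibre under
  \<open>f\<close>, against equality of the cardinalities.\<close>

lemma mono_enumeration_unique:
  fixes f g :: "nat \<Rightarrow> real"
  assumes "mono f" "mono g"
    and fin: "\<And>\<mu>. finite {k. f k = \<mu>}" "\<And>\<mu>. finite {k. g k = \<mu>}"
    and card: "\<And>\<mu>. card {k. f k = \<mu>} = card {k. g k = \<mu>}"
  shows "f n = g n"
proof (induction n rule: less_induct)
  case IH: (less n)
  have *: "\<not> f n < g n" if "mono g" and IH: "\<And>k. k < n \<Longrightarrow> f k = g k"
    and fin: "finite {k. f k = f n}" and card: "card {k. f k = f n} = card {k. g k = f n}"
    for f g :: "nat \<Rightarrow> real"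
  proof
    assume lt: "f n < g n"
    have "{k. g k = f n} \<subset> {k. f k = f n}"
    proof
      show "{k. g k = f n} \<subseteq> {k. f k = f n}"
      proof safe
        fix k assume k: "g k = f n"
        have "k < n" using k lt monoD[OF \<open>mono g\<close>, of n k] by force
        then show "f k = f n" using IH k by simp
      qed
      have "n \<in> {k. f k = f n}" "n \<notin> {k. g k = f n}" using lt by auto
      then show "{k. g k = f n} \<noteq> {k. f k = f n}" by blast
    qed
    from psubset_card_mono[OF fin this] card show False by simp
  qed
  show ?case
  proof (cases "f n" "g n" rule: linorder_cases)
    case less
    then show ?thesis using *[of g f] assms IH by blast
  next
    case greater
    then show ?thesis using *[of f g] assms IH by metis
  qed
qed


section \<open>Symmetric bilinear forms on function spaces\<close>

text \<open>Closure is stated for pointwise operations on plain functions, because the Sobolev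
  spaces are sets of representatives and not types.\<close>

locale function_space =
  fixes V :: "('x \<Rightarrow> real) set"
  assumes zero_mem: "(\<lambda>x. 0) \<in> V"
    and add_mem: "u \<in> V \<Longrightarrow> v \<in> V \<Longrightarrow> (\<lambda>x. u x + v x) \<in> V"
    and scale_mem: "u \<in> V \<Longrightarrow> (\<lambda>x. r * u x) \<in> V"
begin

lemma diff_mem: "u \<in> V \<Longrightarrow> v \<in> V \<Longrightarrow> (\<lambda>x. u x - v x) \<in> V"
  using add_mem[of u "\<lambda>x. -1 * v x"] scale_mem[of v "-1"] by simp

lemma lincomb_mem:
  "finite K \<Longrightarrow> (\<And>k. k \<in> K \<Longrightarrow> v k \<in> V) \<Longrightarrow> (\<lambda>x. \<Sum>k\<in>K. r k * v k x) \<in> V"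
  by (induction K rule: finite_induct) (simp_all add: zero_mem add_mem scale_mem)

end

locale sym_form = function_space V for V :: "('x \<Rightarrow> real) set" +
  fixes B :: "('x \<Rightarrow> real) \<Rightarrow> ('x \<Rightarrow> real) \<Rightarrow> real"
  assumes add_left: "u \<in> V \<Longrightarrow> v \<in> V \<Longrightarrow> w \<in> V \<Longrightarrow> B (\<lambda>x. u x + v x) w = B u w + B v w"
    and scale_left: "u \<in> V \<Longrightarrow> w \<in> V \<Longrightarrow> B (\<lambda>x. r * u x) w = r * B u w"
    and sym: "u \<in> V \<Longrightarrow> v \<in> V \<Longrightarrow> B u v = B v u"
begin

lemma add_right: "u \<in> V \<Longrightarrow> v \<in> V \<Longrightarrow> w \<in> V \<Longrightarrow> B w (\<lambda>x. u x + v x) = B w u + B w v"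
  using add_left[of u v w] sym[of w u] sym[of w v] sym[of w "\<lambda>x. u x + v x"] add_mem by auto

lemma scale_right: "u \<in> V \<Longrightarrow> w \<in> V \<Longrightarrow> B w (\<lambda>x. r * u x) = r * B w u"
  using scale_left[of u w r] sym[of w u] sym[of w "\<lambda>x. r * u x"] scale_mem by auto

lemma diff_left: "u \<in> V \<Longrightarrow> v \<in> V \<Longrightarrow> w \<in> V \<Longrightarrow> B (\<lambda>x. u x - v x) w = B u w - B v w"
  using add_left[of u "\<lambda>x. -1 * v x" w] scale_left[of v w "-1"] scale_mem[of v "-1"] by simp

lemma diff_right: "u \<in> V \<Longrightarrow> v \<in> V \<Longrightarrow> w \<in> V \<Longrightarrow> B w (\<lambda>x. u x - v x) = B w u - B w v"
  using diff_left[of u v w] sym[of w u] sym[of w v] sym[of w "\<lambda>x. u x - v x"] diff_mem by auto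

lemma zero_left: "w \<in> V \<Longrightarrow> B (\<lambda>x. 0) w = 0"
  using scale_left[of "\<lambda>x. 0" w 0] zero_mem by simp

lemma lincomb_left:
  "finite K \<Longrightarrow> (\<And>k. k \<in> K \<Longrightarrow> v k \<in> V) \<Longrightarrow> w \<in> V \<Longrightarrow>
    B (\<lambda>x. \<Sum>k\<in>K. r k * v k x) w = (\<Sum>k\<in>K. r k * B (v k) w)"
  by (induction K rule: finite_induct)
    (auto simp: zero_left add_left scale_left lincomb_mem scale_mem)

lemma quadratic_add:
  assumes "u \<in> V" "v \<in> V"
  shows "B (\<lambda>x. u x + r * v x) (\<lambda>x. u x + r * v x) = B u u + 2 * r * B u v + r\<^sup>2 * B v v"
proof -
  note mem = assms scale_mem[OF assms(2), of r]
  have "B (\<lambda>x. u x + r * v x) (\<lambda>x. u x + r * v x)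
      = B u u + B u (\<lambda>x. r * v x) + (B (\<lambda>x. r * v x) u + B (\<lambda>x. r * v x) (\<lambda>x. r * v x))"
    using mem by (simp only: add_left add_right add_mem)
  then show ?thesis
    using mem sym[OF assms]
    by (simp only: scale_left scale_right power2_eq_square mult_2 distrib_right mult.assoc)
qed

lemma quadratic_diff:
  assumes "u \<in> V" "v \<in> V"
  shows "B (\<lambda>x. u x - v x) (\<lambda>x. u x - v x) = B u u - 2 * B u v + B v v"
  using quadratic_add[OF assms, of "-1"] by simp

lemma scale_both: "u \<in> V \<Longrightarrow> B (\<lambda>x. r * u x) (\<lambda>x. r * u x) = r\<^sup>2 * B u u"
  by (simp add: scale_left scale_right scale_mem power2_eq_square)

lemma sym_form_combination:
  assumes "sym_form V D"
  shows "sym_form V (\<lambda>u v. B u v - \<mu> * D u v)"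
proof -
  interpret D: sym_form V D by fact
  show ?thesis
  proof unfold_locales
    show "B u v - \<mu> * D u v = B v u - \<mu> * D v u" if "u \<in> V" "v \<in> V" for u v
      using sym[OF that] D.sym[OF that] by simp
  qed (simp_all add: add_left D.add_left scale_left D.scale_left algebra_simps)
qed

lemma sym_form_subspace: "function_space W \<Longrightarrow> W \<subseteq> V \<Longrightarrow> sym_form W B"
  by (intro sym_form.intro sym_form_axioms.intro)
    (simp_all add: add_left scale_left sym subsetD)

end

text \<open>Evaluate the polynomial at its minimum \<open>- b / q\<close>. If \<open>q = 0\<close>
  it is affine in \<open>r\<close>, and a nonzero slope would produce the value -1 at the chosen
  point.\<close>

lemma discriminant_le:
  fixes p b q :: real
  assumes nonneg: "\<And>r. 0 \<le> p + 2 * r * b + r\<^sup>2 * q" and q: "0 \<le> q"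
  shows "b\<^sup>2 \<le> p * q"
proof (cases "q = 0")
  case True
  have "b = 0"
  proof (rule ccontr)
    assume "b \<noteq> 0"
    then show False using nonneg[of "- (p + 1) / (2 * b)"] True by (simp add: field_simps)
  qed
  then show ?thesis using True by simp
next
  case False
  then have "q > 0" using q by simp
  then show ?thesis using nonneg[of "- b / q"] by (simp add: field_simps power2_eq_square)
qed

locale nonneg_form = sym_form +
  assumes nonneg: "u \<in> V \<Longrightarrow> 0 \<le> B u u"
begin

lemma Cauchy_Schwarz:
  assumes "u \<in> V" "v \<in> V"
  shows "(B u v)\<^sup>2 \<le> B u u * B v v"
proof (rule discriminant_le)
  show "0 \<le> B u u + 2 * r * B u v + r\<^sup>2 * B v v" for r
    using nonneg[OF add_mem[OF assms(1) scale_mem[OF assms(2), of r]]]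
    by (simp add: quadratic_add assms)
qed (use nonneg assms in blast)

text \<open>Adding the nonnegativity of \<open>K B + D\<close> at \<open>u + r v\<close> and of
  \<open>K B - D\<close> at \<open>u - r v\<close> cancels the diagonal terms of \<open>D\<close>
  and leaves a nonnegative quadratic in \<open>r\<close> with middle coefficient
  \<open>D u v\<close>. So the off-diagonal bound keeps the constant of the diagonal one.\<close>

lemma form_bound_of_diagonal:
  assumes "sym_form V D" and K: "0 \<le> K" "\<And>u. u \<in> V \<Longrightarrow> \<bar>D u u\<bar> \<le> K * B u u" and uv: "u \<in> V" "v \<in> V"
  shows "\<bar>D u v\<bar> \<le> K * (sqrt (B u u) * sqrt (B v v))"
proof -
  interpret D: sym_form V D by fact
  have "(D u v)\<^sup>2 \<le> (K * B u u) * (K * B v v)"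
  proof (rule discriminant_le)
    fix r
    have mem: "(\<lambda>x. u x + s * v x) \<in> V" for s using uv by (intro add_mem scale_mem)
    show "0 \<le> K * B u u + 2 * r * D u v + r\<^sup>2 * (K * B v v)"
      using abs_le_D2[OF K(2)[OF mem[of r]]] abs_le_D1[OF K(2)[OF mem[of "- r"]]]
      unfolding quadratic_add[OF uv] D.quadratic_add[OF uv]
      by (simp add: algebra_simps)
  qed (use K nonneg uv in simp)
  then have "sqrt ((D u v)\<^sup>2) \<le> sqrt ((K * K) * (B u u * B v v))"
    by (intro real_sqrt_le_mono) (simp add: algebra_simps)
  then show ?thesis using K(1) by (simp add: real_sqrt_mult)
qed

lemma null_left: "u \<in> V \<Longrightarrow> v \<in> V \<Longrightarrow> B u u = 0 \<Longrightarrow> B u v = 0"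
  using Cauchy_Schwarz[of u v] by simp

lemma abs_le_sqrt: "u \<in> V \<Longrightarrow> v \<in> V \<Longrightarrow> \<bar>B u v\<bar> \<le> sqrt (B u u) * sqrt (B v v)"
  using real_sqrt_le_mono[OF Cauchy_Schwarz[of u v]] by (simp add: real_sqrt_mult)

end

section \<open>Spectral theory of a pair of forms\<close>

text \<open>\<open>A\<close> stands for the elliptic energy and \<open>C\<close> for the weighted
  mass. \<open>compact\<close> is Rellich's theorem phrased with \<open>C\<close>-Cauchy
  subsequences, and \<open>infinite_dim\<close> ensures that the successive minimization never
  stops. \<open>null_iff\<close> ties the kernel of \<open>C\<close> to null sets, which connects
  the forms with \<open>ae_dim\<close>.\<close>

locale form_pair = A: nonneg_form V A + C: nonneg_form V C
  for V :: "('x \<Rightarrow> real) set" and A C :: "('x \<Rightarrow> real) \<Rightarrow> ('x \<Rightarrow> real) \<Rightarrow> real" +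
  fixes M :: "'x measure" and \<kappa> :: real
  assumes null_iff: "u \<in> V \<Longrightarrow> C u u = 0 \<longleftrightarrow> (AE x in M. u x = 0)"
    and kappa_pos: "0 < \<kappa>"
    and coercive: "u \<in> V \<Longrightarrow> C u u \<le> \<kappa> * A u u"
    and compact: "\<And>(v :: nat \<Rightarrow> 'x \<Rightarrow> real) K. (\<And>n. v n \<in> V) \<Longrightarrow> (\<And>n. A (v n) (v n) \<le> K) \<Longrightarrow>
      \<exists>s. strict_mono (s :: nat \<Rightarrow> nat) \<and> (\<forall>e>0. \<exists>N. \<forall>m\<ge>N. \<forall>n\<ge>N.
        C (\<lambda>x. v (s m) x - v (s n) x) (\<lambda>x. v (s m) x - v (s n) x) < e)"
    and complete: "\<And>v :: nat \<Rightarrow> 'x \<Rightarrow> real. (\<And>n. v n \<in> V) \<Longrightarrow>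
      (\<And>e. 0 < e \<Longrightarrow> \<exists>N. \<forall>m\<ge>N. \<forall>n\<ge>N. A (\<lambda>x. v m x - v n x) (\<lambda>x. v m x - v n x) < e) \<Longrightarrow>
      \<exists>u\<in>V. (\<lambda>n. A (\<lambda>x. v n x - u x) (\<lambda>x. v n x - u x)) \<longlonglongrightarrow> 0"
    and infinite_dim: "\<exists>v :: nat \<Rightarrow> 'x \<Rightarrow> real. (\<forall>k<n. v k \<in> V) \<and>
      (\<forall>r. C (\<lambda>x. \<Sum>k<n. r k * v k x) (\<lambda>x. \<Sum>k<n. r k * v k x) = 0 \<longrightarrow> (\<forall>k<n. r k = 0))"
begin

text \<open>Domination by \<open>A\<close> makes \<open>B\<close> small on the differences, and
  Cauchy-Schwarz for \<open>B\<close> turns this into convergence of the pairings. It is applied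
  with \<open>B = C\<close> and with \<open>B = A\<close>.\<close>

lemma tendsto_form:
  assumes B: "nonneg_form V B" and le: "\<And>u. u \<in> V \<Longrightarrow> B u u \<le> K * A u u"
    and mem: "\<And>n. v n \<in> V" "u \<in> V" "w \<in> V"
    and lim: "(\<lambda>n. A (\<lambda>x. v n x - u x) (\<lambda>x. v n x - u x)) \<longlonglongrightarrow> 0"
  shows "(\<lambda>n. B (v n) w) \<longlonglongrightarrow> B u w" "(\<lambda>n. B (v n) (v n)) \<longlonglongrightarrow> B u u"
proof -
  interpret B: nonneg_form V B by fact
  let ?d = "\<lambda>n x. v n x - u x"
  have d: "?d n \<in> V" for n using mem by (intro A.diff_mem) auto
  have lim0: "(\<lambda>n. B (?d n) (?d n)) \<longlonglongrightarrow> 0"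
  proof (rule tendsto_sandwich[OF _ _ tendsto_const])
    show "(\<lambda>n. K * A (?d n) (?d n)) \<longlonglongrightarrow> 0" using tendsto_mult_left[OF lim, of K] by simp
  qed (use d le B.nonneg in auto)
  have lim1: "(\<lambda>n. B (?d n) w) \<longlonglongrightarrow> 0" if w: "w \<in> V" for w
  proof (rule Lim_null_comparison)
    show "\<forall>\<^sub>F n in sequentially. norm (B (?d n) w) \<le> sqrt (B (?d n) (?d n)) * sqrt (B w w)"
      using B.abs_le_sqrt[OF d w] by simp
    show "(\<lambda>n. sqrt (B (?d n) (?d n)) * sqrt (B w w)) \<longlonglongrightarrow> 0"
      using tendsto_mult_right[OF tendsto_real_sqrt[OF lim0], of "sqrt (B w w)"] by simp
  qed
  have "B (?d n) w = B (v n) w - B u w" for n by (simp add: B.diff_left mem)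
  then show "(\<lambda>n. B (v n) w) \<longlonglongrightarrow> B u w"
    using tendsto_add[OF lim1[OF mem(3)] tendsto_const[of "B u w"]] by simp
  have "B (v n) (v n) = B (?d n) (?d n) + 2 * B (?d n) u + B u u" for n
    by (simp add: B.diff_left B.diff_right A.diff_mem mem B.sym[of u "v n"])
  then show "(\<lambda>n. B (v n) (v n)) \<longlonglongrightarrow> B u u"
    using tendsto_add[OF tendsto_add[OF lim0 tendsto_mult_left[OF lim1[OF mem(2)], of 2]]
      tendsto_const[of "B u u"]] by simp
qed

lemma tendsto_C:
  assumes "\<And>n. v n \<in> V" "u \<in> V" "w \<in> V"
    and "(\<lambda>n. A (\<lambda>x. v n x - u x) (\<lambda>x. v n x - u x)) \<longlonglongrightarrow> 0"
  shows "(\<lambda>n. C (v n) w) \<longlonglongrightarrow> C u w" "(\<lambda>n. C (v n) (v n)) \<longlonglongrightarrow> C u u"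
  using tendsto_form[OF C.nonneg_form_axioms coercive assms] by auto

lemma tendsto_A:
  assumes "\<And>n. v n \<in> V" "u \<in> V"
    and "(\<lambda>n. A (\<lambda>x. v n x - u x) (\<lambda>x. v n x - u x)) \<longlonglongrightarrow> 0"
  shows "(\<lambda>n. A (v n) (v n)) \<longlonglongrightarrow> A u u"
  using tendsto_form(2)[OF A.nonneg_form_axioms _ assms(1,2) assms(2,3), of 1] by auto

text \<open>Dimension count: \<open>n\<close> linear conditions cannot exclude every nonzero
  combination of \<open>n + 1\<close> independent functions. The conditions use a form
  \<open>D\<close> of their own, so that they may refer to one mass form while independence is
  measured in another.\<close>

lemma constrained_combination:
  fixes e v :: "nat \<Rightarrow> 'x \<Rightarrow> real"
  assumes D: "sym_form V D" and e: "\<And>i. i < n \<Longrightarrow> e i \<in> V" and v: "\<And>k. k < Suc n \<Longrightarrow> v k \<in> V"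
    and indep: "\<And>r. C (\<lambda>x. \<Sum>k<Suc n. r k * v k x) (\<lambda>x. \<Sum>k<Suc n. r k * v k x) = 0 \<Longrightarrow>
      \<forall>k<Suc n. r k = 0"
  shows "\<exists>r. (\<forall>i<n. D (\<lambda>x. \<Sum>k<Suc n. r k * v k x) (e i) = 0) \<and>
    0 < C (\<lambda>x. \<Sum>k<Suc n. r k * v k x) (\<lambda>x. \<Sum>k<Suc n. r k * v k x)"
proof -
  obtain r where r: "\<exists>k\<in>{..<Suc n}. r k \<noteq> 0" "\<forall>i<n. (\<Sum>k\<in>{..<Suc n}. D (v k) (e i) * r k) = 0"
    using homogeneous_system_nontrivial_solution[of "{..<Suc n}" n "\<lambda>i k. D (v k) (e i)"] by auto
  define y where "y = (\<lambda>x. \<Sum>k<Suc n. r k * v k x)"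
  have y: "y \<in> V" unfolding y_def using v by (intro A.lincomb_mem) simp_all
  have "\<not> (\<forall>k<Suc n. r k = 0)" using r(1) by blast
  then have "C y y \<noteq> 0" using indep[of r] unfolding y_def by blast
  then have pos: "C y y > 0" using C.nonneg[OF y] by simp
  have "D y (e i) = 0" if "i < n" for i
  proof -
    have "D y (e i) = (\<Sum>k\<in>{..<Suc n}. r k * D (v k) (e i))"
      unfolding y_def using v e[OF that] by (intro sym_form.lincomb_left[OF D]) simp_all
    also have "\<dots> = (\<Sum>k\<in>{..<Suc n}. D (v k) (e i) * r k)"
      by (intro sum.cong refl mult.commute)
    finally show ?thesis using r(2) that by simp
  qed
  with pos show ?thesis unfolding y_def by blast
qed

lemma constrained_nontrivial:
  fixes e :: "nat \<Rightarrow> 'x \<Rightarrow> real"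
  assumes "\<And>i. i < n \<Longrightarrow> e i \<in> V"
  shows "\<exists>v\<in>V. (\<forall>i<n. C v (e i) = 0) \<and> C v v = 1"
proof -
  obtain v where v: "\<forall>k<Suc n. v k \<in> V"
    "\<And>r. C (\<lambda>x. \<Sum>k<Suc n. r k * v k x) (\<lambda>x. \<Sum>k<Suc n. r k * v k x) = 0 \<Longrightarrow> \<forall>k<Suc n. r k = 0"
    using infinite_dim[of "Suc n"] by blast
  obtain r where r: "\<forall>i<n. C (\<lambda>x. \<Sum>k<Suc n. r k * v k x) (e i) = 0"
    "0 < C (\<lambda>x. \<Sum>k<Suc n. r k * v k x) (\<lambda>x. \<Sum>k<Suc n. r k * v k x)"
    using constrained_combination[where n = n and e = e and v = v,
        OF C.sym_form_axioms assms v(1)[rule_format] v(2)] by blast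
  define y where "y = (\<lambda>x. \<Sum>k<Suc n. r k * v k x)"
  have y: "y \<in> V" unfolding y_def using v(1) by (intro A.lincomb_mem) simp_all
  have pos: "C y y > 0" using r(2) unfolding y_def .
  have orth: "C y (e i) = 0" if "i < n" for i using r(1) that unfolding y_def by blast
  let ?r = "1 / sqrt (C y y)"
  show ?thesis
  proof (intro bexI conjI allI impI)
    show "(\<lambda>x. ?r * y x) \<in> V" using y by (rule A.scale_mem)
    show "C (\<lambda>x. ?r * y x) (e i) = 0" if "i < n" for i
      using C.scale_left[OF y assms[OF that], of ?r] orth[OF that] by simp
    show "C (\<lambda>x. ?r * y x) (\<lambda>x. ?r * y x) = 1"
      using C.scale_both[OF y, of ?r] pos by (simp add: power_divide)
  qed
qed

text \<open>Direct method: a minimizing sequence has bounded energy, so a subsequence is Cauchy for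
  \<open>C\<close>; almost minimality then makes it Cauchy for \<open>A\<close>, and completeness
  supplies the minimizer. The inequality is homogeneous in \<open>v\<close> and so includes
  functions with \<open>C v v = 0\<close>.\<close>

lemma constrained_minimizer:
  fixes e :: "nat \<Rightarrow> 'x \<Rightarrow> real"
  assumes e: "\<And>i. i < n \<Longrightarrow> e i \<in> V"
  shows "\<exists>u\<in>V. (\<forall>i<n. C u (e i) = 0) \<and> C u u = 1 \<and>
    (\<forall>v\<in>V. (\<forall>i<n. C v (e i) = 0) \<longrightarrow> A u u * C v v \<le> A v v)"
proof -
  define W where "W = {v \<in> V. \<forall>i<n. C v (e i) = 0}"
  define S where "S = {A v v | v. v \<in> W \<and> C v v = 1}"
  define l where "l = Inf S"
  have WV: "v \<in> V" if "v \<in> W" for v using that by (simp add: W_def)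
  have W_diff: "(\<lambda>x. u x - v x) \<in> W" if "u \<in> W" "v \<in> W" for u v
    using that e by (auto simp: W_def A.diff_mem C.diff_left)
  have W_scale: "(\<lambda>x. r * u x) \<in> W" if "u \<in> W" for u r
    using that e by (auto simp: W_def A.scale_mem C.scale_left)
  have W_add: "(\<lambda>x. u x + v x) \<in> W" if "u \<in> W" "v \<in> W" for u v
    using that e by (auto simp: W_def A.add_mem C.add_left)
  have ne: "S \<noteq> {}" using constrained_nontrivial[of n e] e by (auto simp: S_def W_def)
  have bdd: "bdd_below S"
    by (intro bdd_belowI[of _ 0]) (auto simp: S_def W_def A.nonneg)
  have min: "l * C v v \<le> A v v" if v: "v \<in> W" for v
  proof (cases "C v v = 0")
    case True
    then show ?thesis using A.nonneg[OF WV[OF v]] by simp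
  next
    case False
    then have pos: "C v v > 0" using C.nonneg[OF WV[OF v]] by simp
    let ?y = "\<lambda>x. (1 / sqrt (C v v)) * v x"
    have "C ?y ?y = 1" "A ?y ?y = A v v / C v v"
      using C.scale_both[OF WV[OF v], of "1 / sqrt (C v v)"]
        A.scale_both[OF WV[OF v], of "1 / sqrt (C v v)"] pos by (simp_all add: power_divide)
    then have "A v v / C v v \<in> S" using W_scale[OF v, of "1 / sqrt (C v v)"] unfolding S_def
      by (intro CollectI exI[of _ ?y]) simp
    then have "l \<le> A v v / C v v" unfolding l_def using bdd by (rule cInf_lower)
    then show ?thesis using pos by (simp add: field_simps)
  qed
  have "\<exists>v. v \<in> W \<and> C v v = 1 \<and> A v v < l + 1 / Suc k" for k
  proof -
    have "Inf S < l + 1 / Suc k" by (simp add: l_def)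
    then show ?thesis using cInf_lessD[OF ne] by (auto simp: S_def)
  qed
  then obtain v where v: "\<And>k. v k \<in> W" "\<And>k. C (v k) (v k) = 1" "\<And>k. A (v k) (v k) < l + 1 / Suc k"
    by metis
  have "A (v k) (v k) \<le> l + 1" for k
    using v(3)[of k] by (rule order_trans[OF less_imp_le]) simp
  from compact[of v "l + 1", OF WV[OF v(1)] this]
  obtain s :: "nat \<Rightarrow> nat" where s: "strict_mono s" "\<forall>e>0. \<exists>N. \<forall>m\<ge>N. \<forall>n\<ge>N.
      C (\<lambda>x. v (s m) x - v (s n) x) (\<lambda>x. v (s m) x - v (s n) x) < e"
    by blast
  define y where "y = v \<circ> s"
  have yW: "y k \<in> W" for k by (simp add: y_def v)
  note yV = WV[OF yW]
  have yC: "C (y k) (y k) = 1" for k by (simp add: y_def v)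
  have l0: "l \<ge> 0"
    unfolding l_def by (rule cInf_greatest[OF ne]) (auto simp: S_def W_def A.nonneg)
  have yA: "A (y k) (y k) < l + 1 / Suc k" for k
  proof -
    have "1 / real (Suc (s k)) \<le> 1 / real (Suc k)"
      using seq_suble[OF s(1), of k] by (simp add: field_simps)
    then show ?thesis using v(3)[of "s k"] by (simp add: y_def)
  qed
  \<comment> \<open>parallelogram identity: almost minimal elements that are close for \<open>C\<close> are close for \<open>A\<close>\<close>
  have cauchy: "\<exists>N. \<forall>m\<ge>N. \<forall>n\<ge>N. A (\<lambda>x. y m x - y n x) (\<lambda>x. y m x - y n x) < \<epsilon>" if "\<epsilon> > 0" for \<epsilon>
  proof -
    \<comment> \<open>\<open>l + 1\<close> instead of \<open>l\<close> in the denominator, because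
      \<open>l\<close> is only known to be nonnegative.\<close>
    have "\<epsilon> / (2 * (l + 1)) > 0" using that l0 by simp
    then obtain N1 where N1: "\<And>m n. m \<ge> N1 \<Longrightarrow> n \<ge> N1 \<Longrightarrow>
        C (\<lambda>x. y m x - y n x) (\<lambda>x. y m x - y n x) < \<epsilon> / (2 * (l + 1))"
      using s(2)[rule_format, of "\<epsilon> / (2 * (l + 1))"] unfolding y_def o_def by blast
    \<comment> \<open>\<open>8 / N2 < \<epsilon>\<close> makes the excess \<open>4 / N2\<close> of
      the almost minimal energies smaller than \<open>\<epsilon> / 2\<close>.\<close>
    obtain N2 :: nat where "8 / \<epsilon> < real N2" using reals_Archimedean2 by blast
    moreover have "0 < 8 / \<epsilon>" using that by simp
    ultimately have "0 < real N2" by linarith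
    with \<open>8 / \<epsilon> < real N2\<close> have N2: "N2 > 0" "8 / real N2 < \<epsilon>"
      using that by (simp_all add: field_simps)
    show ?thesis
    proof (intro exI[of _ "max N1 N2"] allI impI)
      fix m n assume mn: "m \<ge> max N1 N2" "n \<ge> max N1 N2"
      let ?p = "\<lambda>x. y m x + 1 * y n x"
      have pW: "?p \<in> W" using W_add[OF yW[of m] yW[of n]] by simp
      have cp: "C ?p ?p = 4 - C (\<lambda>x. y m x - y n x) (\<lambda>x. y m x - y n x)"
        using C.quadratic_add[OF yV[of m] yV[of n], of 1] C.quadratic_diff[OF yV[of m] yV[of n]]
        by (simp add: yC)
      have ap: "A (\<lambda>x. y m x - y n x) (\<lambda>x. y m x - y n x)
          = 2 * A (y m) (y m) + 2 * A (y n) (y n) - A ?p ?p"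
        using A.quadratic_add[OF yV[of m] yV[of n], of 1] A.quadratic_diff[OF yV[of m] yV[of n]]
        by simp
      have "l * C (\<lambda>x. y m x - y n x) (\<lambda>x. y m x - y n x) \<le> (l + 1) * (\<epsilon> / (2 * (l + 1)))"
        using l0 N1[of m n] mn C.nonneg[OF A.diff_mem[OF yV[of m] yV[of n]]]
        by (intro mult_mono) auto
      also have "\<dots> = \<epsilon> / 2" using l0 by (simp add: field_simps)
      finally have c: "l * C (\<lambda>x. y m x - y n x) (\<lambda>x. y m x - y n x) \<le> \<epsilon> / 2" .
      have inv: "1 / real (Suc k) < 1 / real N2" if "k \<ge> max N1 N2" for k
        using that N2(1) by (simp add: field_simps)
      have "A (\<lambda>x. y m x - y n x) (\<lambda>x. y m x - y n x)
          \<le> 2 * A (y m) (y m) + 2 * A (y n) (y n) - l * C ?p ?p"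
        using ap min[OF pW] by simp
      also have "\<dots> = 2 * A (y m) (y m) + 2 * A (y n) (y n) - 4 * l
          + l * C (\<lambda>x. y m x - y n x) (\<lambda>x. y m x - y n x)"
        unfolding cp by (simp add: algebra_simps)
      also have "\<dots> < 4 / real N2 + \<epsilon> / 2"
        using c yA[of m] yA[of n] inv[OF mn(1)] inv[OF mn(2)] by simp
      also have "\<dots> < \<epsilon>" using N2(2) by simp
      finally show "A (\<lambda>x. y m x - y n x) (\<lambda>x. y m x - y n x) < \<epsilon>" .
    qed
  qed
  obtain u where u: "u \<in> V" and lim: "(\<lambda>n. A (\<lambda>x. y n x - u x) (\<lambda>x. y n x - u x)) \<longlonglongrightarrow> 0"
    using complete[of y, OF yV cauchy] by blast
  have Cu: "C u u = 1"
    using tendsto_C(2)[OF yV u u lim] LIMSEQ_unique[OF _ tendsto_const] by (simp add: yC)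
  have orth: "C u (e i) = 0" if "i < n" for i
  proof -
    have "C (y k) (e i) = 0" for k using yW[of k] that by (simp add: W_def)
    then show ?thesis
      using tendsto_C(1)[OF yV u e[OF that] lim] by (simp add: LIMSEQ_const_iff)
  qed
  have "A u u \<le> l"
  proof (rule LIMSEQ_le[OF tendsto_A[OF yV u lim]])
    show "(\<lambda>k. l + 1 / Suc k) \<longlonglongrightarrow> l"
      using tendsto_add[OF tendsto_const LIMSEQ_inverse_real_of_nat, of l] 
      by (simp add: inverse_eq_divide)
    show "\<exists>N. \<forall>n\<ge>N. A (y n) (y n) \<le> l + 1 / Suc n" using yA less_imp_le by blast
  qed
  moreover have "l \<le> A u u" using min[of u] u orth Cu by (simp add: W_def)
  ultimately have "A u u = l" by simp
  with u Cu orth min show ?thesis by (intro bexI[of _ u]) (auto simp: W_def)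
qed

text \<open>Completeness of the system is contained in the last clause together with the
  unboundedness of \<Lambda>: a function that is \<open>C\<close>-orthogonal to all
  \<open>u n\<close> satisfies \<open>\<Lambda> n * C v v \<le> A v v\<close> for every
  \<open>n\<close>, which forces \<open>C v v = 0\<close>. Indices start at 0.\<close>

definition spectral_basis :: "(nat \<Rightarrow> real) \<Rightarrow> (nat \<Rightarrow> 'x \<Rightarrow> real) \<Rightarrow> bool" where
  "spectral_basis \<Lambda> u \<longleftrightarrow> (\<forall>n. u n \<in> V) \<and>
     (\<forall>m n. C (u m) (u n) = (if m = n then 1 else 0)) \<and>
     (\<forall>n. \<forall>\<eta>\<in>V. A (u n) \<eta> = \<Lambda> n * C (u n) \<eta>) \<and>
     mono \<Lambda> \<and> (\<forall>n. 0 < \<Lambda> n) \<and> (\<forall>K. \<exists>n. K < \<Lambda> n) \<and>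
     (\<forall>n. \<forall>v\<in>V. (\<forall>i<n. C v (u i) = 0) \<longrightarrow> \<Lambda> n * C v v \<le> A v v)"

text \<open>On the space \<open>W\<close> of functions orthogonal to the \<open>e i\<close>, the
  form \<open>F = A - (A u u) C\<close> is nonnegative and vanishes at \<open>u\<close>, so by
  Cauchy-Schwarz \<open>F u\<close> annihilates \<open>W\<close>. It also annihilates each
  \<open>e i\<close>, because these are eigenfunctions orthogonal to \<open>u\<close>; the two
  together reach every \<eta>.\<close>

lemma eigenfunction_step:
  fixes e :: "nat \<Rightarrow> 'x \<Rightarrow> real"
  assumes e: "\<And>i. i < n \<Longrightarrow> e i \<in> V"
    and orth: "\<And>i j. i < n \<Longrightarrow> j < n \<Longrightarrow> C (e i) (e j) = (if i = j then 1 else 0)"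
    and eig: "\<And>i \<eta>. i < n \<Longrightarrow> \<eta> \<in> V \<Longrightarrow> A (e i) \<eta> = l i * C (e i) \<eta>"
    and u: "u \<in> V" "\<And>i. i < n \<Longrightarrow> C u (e i) = 0" "C u u = 1"
    and min: "\<And>v. v \<in> V \<Longrightarrow> (\<And>i. i < n \<Longrightarrow> C v (e i) = 0) \<Longrightarrow> A u u * C v v \<le> A v v"
    and \<eta>: "\<eta> \<in> V"
  shows "A u \<eta> = A u u * C u \<eta>"
proof -
  define W where "W = {v \<in> V. \<forall>i<n. C v (e i) = 0}"
  define F where "F u' v = A u' v - A u u * C u' v" for u' v
  interpret F: sym_form V F
    unfolding F_def by (rule A.sym_form_combination[OF C.sym_form_axioms])
  have W: "function_space W"
    by unfold_locales (auto simp: W_def A.zero_mem A.add_mem A.scale_mem C.zero_left C.add_left C.scale_left e)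
  interpret FW: nonneg_form W F
    by (intro nonneg_form.intro F.sym_form_subspace[OF W] nonneg_form_axioms.intro)
      (auto simp: W_def F_def min)
  have uW: "u \<in> W" using u by (simp add: W_def)
  \<comment> \<open>The \<open>C\<close>-orthogonal projection of \<eta> onto the span of the
    \<open>e i\<close>; the remainder lies in \<open>W\<close>.\<close>
  define p where "p = (\<lambda>x. \<Sum>i<n. C \<eta> (e i) * e i x)"
  have p: "p \<in> V" unfolding p_def using e by (intro A.lincomb_mem) auto
  have Bp: "B p v = (\<Sum>i<n. C \<eta> (e i) * B (e i) v)" if "sym_form V B" "v \<in> V" for B v
    unfolding p_def using e that by (intro sym_form.lincomb_left) auto
  have "C (\<lambda>x. \<eta> x - p x) (e i) = 0" if "i < n" for i
  proof -
    have "C p (e i) = (\<Sum>j<n. C \<eta> (e j) * (if j = i then 1 else 0))"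
      using orth that by (subst Bp[OF C.sym_form_axioms]) (auto intro!: sum.cong simp: e)
    also have "\<dots> = (\<Sum>j\<in>{..<n}. if j = i then C \<eta> (e j) else 0)"
      by (intro sum.cong) auto
    also have "\<dots> = C \<eta> (e i)" using that by simp
    finally show ?thesis by (simp add: C.diff_left \<eta> p e that)
  qed
  then have "(\<lambda>x. \<eta> x - p x) \<in> W" by (simp add: W_def A.diff_mem \<eta> p)
  then have "F u (\<lambda>x. \<eta> x - p x) = 0"
    using FW.null_left[OF uW] u by (simp add: F_def)
  moreover have "F p u = 0"
  proof -
    have "F (e i) u = 0" if "i < n" for i
      using eig[OF that u(1)] u(2)[OF that] by (simp add: F_def C.sym[of "e i" u] e that u)
    then show ?thesis
      by (subst Bp[OF F.sym_form_axioms u(1)]) simp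
  qed
  ultimately have "F u \<eta> = 0" by (simp add: F.diff_right \<eta> p u F.sym[of p u])
  then show ?thesis by (simp add: F_def)
qed

theorem spectral_basis_exists: "\<exists>\<Lambda> u. spectral_basis \<Lambda> u"
proof -
  \<comment> \<open>\<open>P f n r\<close> says that \<open>r\<close> may serve as vector number
    \<open>n\<close> once the earlier ones are given by \<open>f\<close>. The eigenvalue is not
    separate data: it is \<open>A r r\<close>.\<close>
  define P where "P f n r \<longleftrightarrow> r \<in> V \<and> C r r = 1 \<and> (\<forall>i<n. C r (f i) = 0) \<and>
    (\<forall>v\<in>V. (\<forall>i<n. C v (f i) = 0) \<longrightarrow> A r r * C v v \<le> A v v) \<and>
    (\<forall>\<eta>\<in>V. A r \<eta> = A r r * C r \<eta>)" for f :: "nat \<Rightarrow> 'x \<Rightarrow> real" and n r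
  have PD: "r \<in> V" "C r r = 1" "\<And>i. i < n \<Longrightarrow> C r (f i) = 0"
    "\<And>v. v \<in> V \<Longrightarrow> \<forall>i<n. C v (f i) = 0 \<Longrightarrow> A r r * C v v \<le> A v v"
    "\<And>\<eta>. \<eta> \<in> V \<Longrightarrow> A r \<eta> = A r r * C r \<eta>" if "P f n r" for f n r
    using that unfolding P_def by blast+
  have "\<exists>f. \<forall>n. P f n (f n)"
  proof (rule dependent_wellorder_choice)
    show "P f n r = P g n r" if "\<And>y. y < n \<Longrightarrow> f y = g y" for r f g n
      using that by (simp add: P_def cong: all_cong)
  next
    fix n f assume IH: "\<And>y. y < n \<Longrightarrow> P f y (f y)"
    have e: "f i \<in> V" if "i < n" for i using PD(1)[OF IH[OF that]] .
    have orth: "C (f i) (f j) = (if i = j then 1 else 0)" if "i < n" "j < n" for i j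
    proof (cases i j rule: linorder_cases)
      case less
      then show ?thesis using PD(3)[OF IH[OF that(2)] less] C.sym[OF e[OF that(1)] e[OF that(2)]] less by simp
    next
      case equal
      then show ?thesis using PD(2)[OF IH[OF that(2)]] by simp
    next
      case greater
      then show ?thesis using PD(3)[OF IH[OF that(1)] greater] by simp
    qed
    have "\<exists>u\<in>V. (\<forall>i<n. C u (f i) = 0) \<and> C u u = 1 \<and>
        (\<forall>v\<in>V. (\<forall>i<n. C v (f i) = 0) \<longrightarrow> A u u * C v v \<le> A v v)"
      by (rule constrained_minimizer) (rule e)
    then obtain u where u0: "u \<in> V" "\<forall>i<n. C u (f i) = 0" "C u u = 1"
      "\<forall>v\<in>V. (\<forall>i<n. C v (f i) = 0) \<longrightarrow> A u u * C v v \<le> A v v"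
      by blast
    have u4: "A u u * C v v \<le> A v v" if "v \<in> V" "\<And>i. i < n \<Longrightarrow> C v (f i) = 0" for v
      using u0(4)[rule_format, OF that(1)] that(2) by blast
    note u = u0(1) u0(2)[rule_format] u0(3) u4
    have eig: "A (f i) \<eta> = A (f i) (f i) * C (f i) \<eta>" if "i < n" "\<eta> \<in> V" for i \<eta>
      using PD(5)[OF IH[OF that(1)] that(2)] .
    have "A u \<eta> = A u u * C u \<eta>" if "\<eta> \<in> V" for \<eta>
      by (rule eigenfunction_step[where l = "\<lambda>i. A (f i) (f i)", OF e orth eig u that])
    then have "P f n u" using u0 unfolding P_def by blast
    then show "\<exists>r. P f n r" by blast
  qed
  then obtain u where Pu: "\<And>n. P u n (u n)" by blast
  define \<Lambda> where "\<Lambda> n = A (u n) (u n)" for n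
  note mem = PD(1)[OF Pu]
  have orth: "C (u m) (u n) = (if m = n then 1 else 0)" for m n
  proof (cases m n rule: linorder_cases)
    case less
    then show ?thesis using PD(3)[OF Pu less] C.sym[OF mem mem, of m n] by simp
  next
    case equal
    then show ?thesis using PD(2)[OF Pu] by simp
  next
    case greater
    then show ?thesis using PD(3)[OF Pu greater] by simp
  qed
  have minm: "\<Lambda> n * C v v \<le> A v v" if "v \<in> V" "\<And>i. i < n \<Longrightarrow> C v (u i) = 0" for n v
    using PD(4)[OF Pu] that by (simp add: \<Lambda>_def)
  \<comment> \<open>\<open>u n\<close> satisfies the constraints of every earlier
    minimization.\<close>
  have "mono \<Lambda>"
  proof (rule monoI)
    fix m n :: nat assume "m \<le> n"
    then show "\<Lambda> m \<le> \<Lambda> n" using minm[OF mem, of m n] orth by (simp add: \<Lambda>_def)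
  qed
  moreover have "0 < \<Lambda> n" for n
    using coercive[OF mem, of n] orth[of n n] kappa_pos
    by (smt (verit) \<Lambda>_def mult_nonneg_nonpos)
  \<comment> \<open>If the values stayed bounded, compactness would give a \<open>C\<close>-Cauchy
    subsequence, but distinct members of an orthonormal system have squared
    \<open>C\<close>-distance 2.\<close>
  moreover have "\<exists>n. K < \<Lambda> n" for K
  proof (rule ccontr)
    assume "\<nexists>n. K < \<Lambda> n"
    then have "A (u n) (u n) \<le> K" for n by (simp add: \<Lambda>_def not_less)
    from compact[of u K, OF mem this] obtain s :: "nat \<Rightarrow> nat" where s0: "strict_mono s"
      "\<forall>e>0. \<exists>N. \<forall>m\<ge>N. \<forall>n\<ge>N.
        C (\<lambda>x. u (s m) x - u (s n) x) (\<lambda>x. u (s m) x - u (s n) x) < e"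
      by blast
    obtain N where s: "strict_mono s"
      "\<forall>m\<ge>N. \<forall>n\<ge>N. C (\<lambda>x. u (s m) x - u (s n) x) (\<lambda>x. u (s m) x - u (s n) x) < 1"
      using s0(1) s0(2)[rule_format, of 1] by auto
    have "C (\<lambda>x. u (s N) x - u (s (Suc N)) x) (\<lambda>x. u (s N) x - u (s (Suc N)) x) < 1"
      using s(2)[rule_format, of N "Suc N"] by simp
    moreover have "s N \<noteq> s (Suc N)" using s(1) by (metis n_not_Suc_n strict_mono_eq)
    ultimately show False by (simp add: C.quadratic_diff mem orth)
  qed
  ultimately have "spectral_basis \<Lambda> u"
    unfolding spectral_basis_def using mem orth minm PD(5)[OF Pu] by (simp flip: \<Lambda>_def)
  then show ?thesis by blast
qed

end

section \<open>Eigenspace dimensions and the two halves of the min-max principle\<close>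

context form_pair
begin

context
  fixes \<Lambda> u assumes sb: "spectral_basis \<Lambda> u"
begin

lemma basis_mem: "u n \<in> V"
  and basis_orth: "C (u m) (u n) = (if m = n then 1 else 0)"
  and basis_eigen: "\<eta> \<in> V \<Longrightarrow> A (u n) \<eta> = \<Lambda> n * C (u n) \<eta>"
  and eigenvalues_mono: "m \<le> n \<Longrightarrow> \<Lambda> m \<le> \<Lambda> n"
  and eigenvalue_pos: "0 < \<Lambda> n"
  and eigenvalues_unbounded: "\<exists>n. K < \<Lambda> n"
  and eigenvalue_min: "v \<in> V \<Longrightarrow> (\<And>i. i < n \<Longrightarrow> C v (u i) = 0) \<Longrightarrow> \<Lambda> n * C v v \<le> A v v"
  using sb unfolding spectral_basis_def mono_def by blast+

lemma basis_span_mem: "finite K \<Longrightarrow> (\<lambda>x. \<Sum>k\<in>K. r k * u k x) \<in> V"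
  by (intro A.lincomb_mem basis_mem)

lemma basis_coefficient:
  assumes "finite K"
  shows "C (\<lambda>x. \<Sum>k\<in>K. r k * u k x) (u j) = (if j \<in> K then r j else 0)"
proof -
  have "C (\<lambda>x. \<Sum>k\<in>K. r k * u k x) (u j) = (\<Sum>k\<in>K. r k * C (u k) (u j))"
    using assms basis_mem by (intro C.lincomb_left)
  also have "\<dots> = (\<Sum>k\<in>K. if k = j then r k else 0)"
    by (intro sum.cong refl) (simp add: basis_orth)
  finally show ?thesis using assms by simp
qed

lemma basis_span_C:
  assumes "finite K"
  shows "C (\<lambda>x. \<Sum>k\<in>K. r k * u k x) (\<lambda>x. \<Sum>k\<in>K. r k * u k x) = (\<Sum>k\<in>K. (r k)\<^sup>2)"
proof -
  let ?y = "\<lambda>x. \<Sum>k\<in>K. r k * u k x"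
  have "C ?y ?y = (\<Sum>k\<in>K. r k * C (u k) ?y)"
    using assms basis_mem basis_span_mem[OF assms] by (intro C.lincomb_left)
  also have "\<dots> = (\<Sum>k\<in>K. (r k)\<^sup>2)"
    using C.sym[OF basis_mem basis_span_mem[OF assms]] basis_coefficient[OF assms]
    by (intro sum.cong) (auto simp: power2_eq_square)
  finally show ?thesis .
qed

lemma basis_span_A:
  assumes "finite K"
  shows "A (\<lambda>x. \<Sum>k\<in>K. r k * u k x) (\<lambda>x. \<Sum>k\<in>K. r k * u k x) = (\<Sum>k\<in>K. \<Lambda> k * (r k)\<^sup>2)"
proof -
  let ?y = "\<lambda>x. \<Sum>k\<in>K. r k * u k x"
  have "A ?y ?y = (\<Sum>k\<in>K. r k * A (u k) ?y)"
    using assms basis_mem basis_span_mem[OF assms] by (intro A.lincomb_left)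
  also have "\<dots> = (\<Sum>k\<in>K. \<Lambda> k * (r k)\<^sup>2)"
    using C.sym[OF basis_mem basis_span_mem[OF assms]] basis_coefficient[OF assms]
      basis_eigen[OF basis_span_mem[OF assms]]
    by (intro sum.cong) (auto simp: power2_eq_square)
  finally show ?thesis .
qed

lemma basis_span_null:
  assumes "finite K" "C (\<lambda>x. \<Sum>k\<in>K. r k * u k x) (\<lambda>x. \<Sum>k\<in>K. r k * u k x) = 0" "k \<in> K"
  shows "r k = 0"
proof -
  have "C (\<lambda>x. \<Sum>k\<in>K. r k * u k x) (u k) = 0"
    using C.null_left[OF basis_span_mem basis_mem] assms by blast
  then show ?thesis using basis_coefficient[OF assms(1)] assms(3) by simp
qed

lemma finite_multiplicity: "finite {n. \<Lambda> n = \<mu>}"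
proof -
  obtain N where "\<mu> < \<Lambda> N" using eigenvalues_unbounded by blast
  then have "{n. \<Lambda> n = \<mu>} \<subseteq> {..<N}" using eigenvalues_mono[of N] by (force simp: not_le[symmetric])
  then show ?thesis using finite_subset by blast
qed

text \<open>Subtract from an eigenfunction its components along the \<open>u j\<close> with
  \<open>\<Lambda> j = \<mu>\<close>. The remainder \<open>z\<close> is orthogonal to the whole
  system, since components with \<open>\<Lambda> n \<noteq> \<mu>\<close> vanish by symmetry of the
  forms, and a function orthogonal to everything is null. Numbers \<mu> that are not eigenvalues are
  included, with dimension 0.\<close>

lemma ae_dim_eigenspace:
  "ae_dim M {w \<in> V. \<forall>\<eta>\<in>V. A w \<eta> = \<mu> * C w \<eta>} (card {n. \<Lambda> n = \<mu>})"
proof -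
  let ?S = "{n. \<Lambda> n = \<mu>}"
  note fin = finite_multiplicity[of \<mu>]
  \<comment> \<open>\<open>ae_dim\<close> indexes a basis by an initial segment of the natural
    numbers, hence this renumbering of the indices with value \<mu>.\<close>
  obtain h where h: "bij_betw h {..<card ?S} ?S"
    using ex_bij_betw_nat_finite[OF fin] by (auto simp: atLeast0LessThan)
  have reindex': "(\<Sum>j\<in>?S. r j * u j x) = (\<Sum>k<card ?S. r (h k) * u (h k) x)" for r x
    by (rule sum.reindex_bij_betw[OF h, symmetric])
  have "the_inv_into {..<card ?S} h (h k) = k" if "k < card ?S" for k
    using h that by (simp add: the_inv_into_f_f bij_betw_def)
  then have reindex: "(\<Sum>k<card ?S. r k * u (h k) x)
      = (\<Sum>j\<in>?S. r (the_inv_into {..<card ?S} h j) * u j x)" for r x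
    unfolding reindex' by (intro sum.cong refl) simp
  show ?thesis
    unfolding ae_dim_def
  proof (intro exI[of _ "\<lambda>k. u (h k)"] conjI allI ballI impI)
    show "u (h k) \<in> {w \<in> V. \<forall>\<eta>\<in>V. A w \<eta> = \<mu> * C w \<eta>}" if "k < card ?S" for k
    proof -
      have "\<Lambda> (h k) = \<mu>" using h that by (auto simp: bij_betw_def)
      then show ?thesis using basis_mem basis_eigen[of _ "h k"] by simp
    qed
    show "r k = 0" if "AE x in M. (\<Sum>k<card ?S. r k * u (h k) x) = 0" "k < card ?S" for r k
    proof -
      let ?r = "\<lambda>j. r (the_inv_into {..<card ?S} h j)"
      have null: "C (\<lambda>x. \<Sum>j\<in>?S. ?r j * u j x) (\<lambda>x. \<Sum>j\<in>?S. ?r j * u j x) = 0"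
        using that(1) unfolding reindex null_iff[OF basis_span_mem[OF fin]] .
      have "h k \<in> ?S" using h that(2) by (auto simp: bij_betw_def)
      from basis_span_null[where r = ?r, OF fin null this]
      have "r (the_inv_into {..<card ?S} h (h k)) = 0" .
      then show ?thesis using h that(2) by (simp add: the_inv_into_f_f bij_betw_def)
    qed
    fix w assume "w \<in> {w \<in> V. \<forall>\<eta>\<in>V. A w \<eta> = \<mu> * C w \<eta>}"
    then have w: "w \<in> V" "\<And>\<eta>. \<eta> \<in> V \<Longrightarrow> A w \<eta> = \<mu> * C w \<eta>" by blast+
    let ?p = "\<lambda>x. \<Sum>j\<in>?S. C w (u j) * u j x"
    note pV = basis_span_mem[OF fin, of "\<lambda>j. C w (u j)"]
    define z where "z = (\<lambda>x. w x - ?p x)"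
    have z: "z \<in> V" unfolding z_def by (rule A.diff_mem[OF w(1) pV])
    have "C z (u n) = 0" for n
    proof -
      have "\<mu> * C w (u n) = \<Lambda> n * C w (u n)"
        using w(2)[OF basis_mem, of n] basis_eigen[OF w(1), of n]
          A.sym[OF w(1) basis_mem, of n] C.sym[OF w(1) basis_mem, of n] by metis
      then have "C w (u n) = 0" if "\<Lambda> n \<noteq> \<mu>" using that by simp
      then show ?thesis
        unfolding z_def C.diff_left[OF w(1) pV basis_mem] basis_coefficient[OF fin] by auto
    qed
    then have min: "\<Lambda> n * C z z \<le> A z z" for n using eigenvalue_min[OF z] by simp
    have "C z z = 0"
    proof (rule ccontr)
      assume "C z z \<noteq> 0"
      then have pos: "C z z > 0" using C.nonneg[OF z] by simp
      obtain n where "A z z / C z z < \<Lambda> n" using eigenvalues_unbounded by blast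
      with min[of n] pos show False by (simp add: field_simps)
    qed
    then have "AE x in M. z x = 0" using null_iff[OF z] by blast
    then have "AE x in M. w x = ?p x" by (simp add: z_def)
    then show "\<exists>r. AE x in M. w x = (\<Sum>k<card ?S. r k * u (h k) x)"
      unfolding reindex' by (intro exI[of _ "\<lambda>k. C w (u (h k))"])
  qed
qed

lemma simple_isolated:
  assumes "ae_dim M {w \<in> V. \<forall>\<eta>\<in>V. A w \<eta> = \<Lambda> k * C w \<eta>} 1" "n \<noteq> k"
  shows "\<Lambda> n \<noteq> \<Lambda> k"
proof
  assume *: "\<Lambda> n = \<Lambda> k"
  have "card {m. \<Lambda> m = \<Lambda> k} = 1" using ae_dim_unique[OF ae_dim_eigenspace assms(1)] .
  then obtain m where "{m. \<Lambda> m = \<Lambda> k} = {m}" by (rule card_1_singletonE)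
  then have "n \<in> {m}" "k \<in> {m}" using * by auto
  then show False using assms(2) by simp
qed

text \<open>A trial space of dimension \<open>n + 1\<close> contains a vector of positive mass that
  is \<open>C\<close>-orthogonal to the first \<open>n\<close> basis vectors, and there the Rayleigh
  quotient is at least \<open>\<Lambda> n\<close>.\<close>

lemma eigenvalue_le:
  assumes v: "\<And>i. i < Suc n \<Longrightarrow> v i \<in> V"
    and indep: "\<And>r. C (\<lambda>x. \<Sum>i<Suc n. r i * v i x) (\<lambda>x. \<Sum>i<Suc n. r i * v i x) = 0 \<Longrightarrow>
      \<forall>i<Suc n. r i = 0"
    and le: "\<And>r. A (\<lambda>x. \<Sum>i<Suc n. r i * v i x) (\<lambda>x. \<Sum>i<Suc n. r i * v i x)
      \<le> \<mu> * C (\<lambda>x. \<Sum>i<Suc n. r i * v i x) (\<lambda>x. \<Sum>i<Suc n. r i * v i x)"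
  shows "\<Lambda> n \<le> \<mu>"
proof -
  obtain r where r: "\<forall>i<n. C (\<lambda>x. \<Sum>k<Suc n. r k * v k x) (u i) = 0"
    "0 < C (\<lambda>x. \<Sum>k<Suc n. r k * v k x) (\<lambda>x. \<Sum>k<Suc n. r k * v k x)"
    using constrained_combination[where n = n and e = u and v = v,
        OF C.sym_form_axioms basis_mem v indep] by blast
  define y where "y = (\<lambda>x. \<Sum>k<Suc n. r k * v k x)"
  have y: "y \<in> V" unfolding y_def using v by (intro A.lincomb_mem) simp_all
  have "\<Lambda> n * C y y \<le> A y y" using eigenvalue_min[OF y] r(1) unfolding y_def by blast
  also have "\<dots> \<le> \<mu> * C y y" using le unfolding y_def .
  finally show ?thesis using r(2) unfolding y_def[symmetric] by simp
qed

text \<open>The span of \<open>u 0, ..., u n\<close> meets every subspace cut out by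
  \<open>n\<close> linear conditions, and on this span the Rayleigh quotient is at most
  \<open>\<Lambda> n\<close>. The application formulates the conditions with the unperturbed mass
  form while \<open>A\<close> and \<open>C\<close> are the perturbed forms.\<close>

lemma eigenvalue_ge:
  assumes D: "sym_form V D" and e: "\<And>i. i < n \<Longrightarrow> e i \<in> V"
    and ge: "\<And>v. v \<in> V \<Longrightarrow> (\<And>i. i < n \<Longrightarrow> D v (e i) = 0) \<Longrightarrow> \<mu> * C v v \<le> A v v"
  shows "\<mu> \<le> \<Lambda> n"
proof -
  have indep: "\<forall>k<Suc n. r k = 0"
    if "C (\<lambda>x. \<Sum>k<Suc n. r k * u k x) (\<lambda>x. \<Sum>k<Suc n. r k * u k x) = 0" for r
    using basis_span_null[OF _ that] by blast
  obtain r where r: "\<forall>i<n. D (\<lambda>x. \<Sum>k<Suc n. r k * u k x) (e i) = 0"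
    "0 < C (\<lambda>x. \<Sum>k<Suc n. r k * u k x) (\<lambda>x. \<Sum>k<Suc n. r k * u k x)"
    using constrained_combination[where n = n and e = e and v = u, OF D e basis_mem indep] by blast
  define y where "y = (\<lambda>x. \<Sum>k<Suc n. r k * u k x)"
  have y: "y \<in> V" unfolding y_def by (rule basis_span_mem) simp
  have "\<mu> * C y y \<le> A y y" using ge[OF y] r(1) unfolding y_def by blast
  also have "\<dots> = (\<Sum>k<Suc n. \<Lambda> k * (r k)\<^sup>2)" unfolding y_def by (rule basis_span_A) simp
  also have "\<dots> \<le> (\<Sum>k<Suc n. \<Lambda> n * (r k)\<^sup>2)"
    by (intro sum_mono mult_right_mono eigenvalues_mono) auto
  also have "\<dots> = \<Lambda> n * C y y"
    unfolding y_def basis_span_C[OF finite_lessThan] sum_distrib_left ..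
  finally show ?thesis using r(2) unfolding y_def[symmetric] by simp
qed

end

end

section \<open>Perturbation of a simple eigenvalue\<close>

lemma quadratic_nonneg:
  fixes p q c n r :: real
  assumes "0 \<le> p" "0 < q" "c\<^sup>2 \<le> p * q"
  shows "0 \<le> p * n\<^sup>2 - 2 * c * r * n + q * r\<^sup>2"
proof -
  have "q * (p * n\<^sup>2 - 2 * c * r * n + q * r\<^sup>2) = (q * r - c * n)\<^sup>2 + (p * q - c\<^sup>2) * n\<^sup>2"
    by (simp add: power2_eq_square algebra_simps)
  also have "\<dots> \<ge> 0" using assms by simp
  finally show ?thesis using assms(2) by (simp add: zero_le_mult_iff)
qed

text \<open>All errors are measured in the unperturbed energy norm \<open>sqrt (A v v)\<close>, with
  one constant \<open>K\<close> for all times up to \<open>T\<close>. The derivatives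
  \<open>A'\<close> and \<open>C'\<close> are symmetric and bounded but carry no sign; each
  perturbed pair has a coercivity constant of its own.\<close>

locale perturbed_form_pair = form_pair V A C M \<kappa>
  for V :: "('x \<Rightarrow> real) set" and A C :: "('x \<Rightarrow> real) \<Rightarrow> ('x \<Rightarrow> real) \<Rightarrow> real" and M \<kappa> +
  fixes T :: real and At Ct :: "real \<Rightarrow> ('x \<Rightarrow> real) \<Rightarrow> ('x \<Rightarrow> real) \<Rightarrow> real"
    and A' C' :: "('x \<Rightarrow> real) \<Rightarrow> ('x \<Rightarrow> real) \<Rightarrow> real" and \<kappa>t :: "real \<Rightarrow> real" and K :: real
  assumes T_pos: "0 < T"
    and pair_t: "\<And>t. 0 < t \<Longrightarrow> t \<le> T \<Longrightarrow> form_pair V (At t) (Ct t) M (\<kappa>t t)"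
    and form_A': "sym_form V A'" and form_C': "sym_form V C'"
    and K_nonneg: "0 \<le> K"
    and bound_A': "\<And>v w. v \<in> V \<Longrightarrow> w \<in> V \<Longrightarrow> \<bar>A' v w\<bar> \<le> K * (sqrt (A v v) * sqrt (A w w))"
    and bound_C': "\<And>v w. v \<in> V \<Longrightarrow> w \<in> V \<Longrightarrow> \<bar>C' v w\<bar> \<le> K * (sqrt (A v v) * sqrt (A w w))"
    and expand_A: "\<And>t v w. 0 < t \<Longrightarrow> t \<le> T \<Longrightarrow> v \<in> V \<Longrightarrow> w \<in> V \<Longrightarrow>
      \<bar>At t v w - A v w - t * A' v w\<bar> \<le> K * t\<^sup>2 * (sqrt (A v v) * sqrt (A w w))"
    and expand_C: "\<And>t v w. 0 < t \<Longrightarrow> t \<le> T \<Longrightarrow> v \<in> V \<Longrightarrow> w \<in> V \<Longrightarrow>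
      \<bar>Ct t v w - C v w - t * C' v w\<bar> \<le> K * t\<^sup>2 * (sqrt (A v v) * sqrt (A w w))"
begin

lemma bound_C: "v \<in> V \<Longrightarrow> w \<in> V \<Longrightarrow> \<bar>C v w\<bar> \<le> \<kappa> * (sqrt (A v v) * sqrt (A w w))"
proof -
  assume v: "v \<in> V" and w: "w \<in> V"
  have "\<bar>C v w\<bar> \<le> sqrt (C v v) * sqrt (C w w)" by (rule C.abs_le_sqrt[OF v w])
  also have "\<dots> \<le> sqrt (\<kappa> * A v v) * sqrt (\<kappa> * A w w)"
    using coercive[OF v] coercive[OF w] C.nonneg[OF v] C.nonneg[OF w]
    by (intro mult_mono real_sqrt_le_mono) (auto intro: order_trans)
  also have "\<dots> = \<kappa> * (sqrt (A v v) * sqrt (A w w))"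
    using kappa_pos by (simp add: real_sqrt_mult)
  finally show ?thesis .
qed

text \<open>Near a simple eigenvalue \<open>l\<close> with eigenfunction \<open>U\<close> the form \<open>A\<^sub>t - \<mu> C\<^sub>t\<close> keeps a sign on
  \<open>Z + span U\<close>, where \<open>A - l C\<close> is definite on \<open>Z\<close>: the mixed terms are of order \<open>t\<close> and the
  diagonal term of \<open>U\<close> is of the same order \<open>t\<close>, so their squares are absorbed.\<close>

lemma perturbed_sign:
  fixes l d \<sigma> g \<eta> :: real
  assumes \<sigma>: "\<sigma> = 1 \<or> \<sigma> = -1" and g: "0 < g" and \<eta>: "0 < \<eta>"
    and U: "U \<in> V" "C U U = 1" and l: "0 < l" and eig: "\<And>\<zeta>. \<zeta> \<in> V \<Longrightarrow> A U \<zeta> = l * C U \<zeta>"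
    and d: "d = A' U U - l * C' U U"
    and Z: "\<And>z. z \<in> Z \<Longrightarrow> z \<in> V" "\<And>z. z \<in> Z \<Longrightarrow> C z U = 0"
      "\<And>z. z \<in> Z \<Longrightarrow> g * A z z \<le> \<sigma> * (A z z - l * C z z)"
  shows "\<exists>t0>0. t0 \<le> T \<and> (\<forall>t z r. 0 < t \<longrightarrow> t < t0 \<longrightarrow> z \<in> Z \<longrightarrow>
    0 \<le> \<sigma> * (At t (\<lambda>x. z x + r * U x) (\<lambda>x. z x + r * U x)
      - (l + t * (d - \<sigma> * \<eta>)) * Ct t (\<lambda>x. z x + r * U x) (\<lambda>x. z x + r * U x)))"
proof -
  \<comment> \<open>\<sigma> selects the case: -1 for the nonpositive form with the lower modes, 1
    for the nonnegative form with the higher ones. \<open>s\<close> is the trial slope of the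
    eigenvalue.\<close>
  define s where "s = d - \<sigma> * \<eta>"
  define N where "N v = sqrt (A v v)" for v
  \<comment> \<open>\<open>K2\<close> bounds the remainder of second order in \<open>t\<close>,
    \<open>K3\<close> the derivative form \<open>G\<close> introduced below, and \<open>K4\<close>
    both together when \<open>t \<le> 1\<close>.\<close>
  define K2 where "K2 = K * (1 + l + 2 * \<bar>s\<bar>)"
  define K3 where "K3 = K + l * K + \<bar>s\<bar> * \<kappa>"
  define K4 where "K4 = K3 + K2"
  define m where "m = sqrt l"
  have [simp]: "\<sigma> * \<sigma> = 1" "\<bar>\<sigma>\<bar> = 1" using \<sigma> by auto
  have K2: "K2 \<ge> 0" using K_nonneg l by (simp add: K2_def)
  have K3: "K3 \<ge> 0" using K_nonneg l kappa_pos by (simp add: K3_def)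
  have K4: "K4 \<ge> 0" using K2 K3 by (simp add: K4_def)
  have N: "N v \<ge> 0" "(N v)\<^sup>2 = A v v" if "v \<in> V" for v using A.nonneg[OF that] by (auto simp: N_def)
  have NU: "N U = m" using eig[OF U(1)] U by (simp add: N_def m_def)
  \<comment> \<open>The last three bounds ensure, in this order, that the perturbation consumes at
    most half of the gap \<open>g\<close>, that the remainder at \<open>U\<close> consumes at most
    half of \<eta>, and that the square of the mixed term fits into the product of the diagonal
    terms. The summands 1 keep the denominators positive.\<close>
  define t0 where "t0 = min T (min 1 (min (g / (2 * (K4 + 1)))
    (min (\<eta> / (2 * (K2 * l + 1))) (g * \<eta> / (4 * ((K4 * m)\<^sup>2 + 1))))))"
  have den: "0 < 2 * (K4 + 1)" "0 < 2 * (K2 * l + 1)" "0 < 4 * ((K4 * m)\<^sup>2 + 1)"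
    using K4 K2 l by (simp_all add: add_nonneg_pos)
  have "t0 > 0" using T_pos g \<eta> den unfolding t0_def by (simp add: divide_pos_pos)
  moreover have "0 \<le> \<sigma> * (At t (\<lambda>x. z x + r * U x) (\<lambda>x. z x + r * U x)
      - (l + t * s) * Ct t (\<lambda>x. z x + r * U x) (\<lambda>x. z x + r * U x))"
    if t: "0 < t" "t < t0" and z: "z \<in> Z" for t z r
  proof -
    have tT: "t \<le> T" "t \<le> 1" using t by (simp_all add: t0_def)
    have "t < g / (2 * (K4 + 1))" "t < \<eta> / (2 * (K2 * l + 1))" "t < g * \<eta> / (4 * ((K4 * m)\<^sup>2 + 1))"
      using t by (simp_all add: t0_def)
    then have "t * (2 * (K4 + 1)) < g" "t * (2 * (K2 * l + 1)) < \<eta>"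
        "t * (4 * ((K4 * m)\<^sup>2 + 1)) < g * \<eta>"
      using den by (simp_all add: pos_less_divide_eq)
    then have t1: "t * K4 \<le> g / 2" and t2: "K2 * l * t \<le> \<eta> / 2" and t3: "t * (K4 * m)\<^sup>2 \<le> g * \<eta> / 4"
      using t(1) by (simp_all add: algebra_simps)
    interpret Pt: form_pair V "At t" "Ct t" M "\<kappa>t t" by (rule pair_t[OF t(1) tT(1)])
    define F where "F v w = At t v w - (l + t * s) * Ct t v w" for v w
    interpret F: sym_form V F
      unfolding F_def by (rule Pt.A.sym_form_combination[OF Pt.C.sym_form_axioms])
    \<comment> \<open>The derivative at t = 0 of the form \<open>F\<close>. By the choice of
      \<open>s\<close> it takes the value \<open>\<sigma> * \<eta>\<close> at the pair
      \<open>U\<close>, \<open>U\<close>.\<close>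
    define G where "G v w = A' v w - l * C' v w - s * C v w" for v w
    have remainder: "\<bar>F v w - (A v w - l * C v w) - t * G v w\<bar> \<le> K2 * t\<^sup>2 * (N v * N w)"
      if v: "v \<in> V" and w: "w \<in> V" for v w
    proof -
      let ?RA = "At t v w - A v w - t * A' v w" and ?RC = "Ct t v w - C v w - t * C' v w"
      let ?n = "N v * N w"
      have n: "?n \<ge> 0" using N[OF v] N[OF w] by simp
      have eq: "F v w - (A v w - l * C v w) - t * G v w = ?RA - (l + t * s) * ?RC - t\<^sup>2 * s * C' v w"
        by (simp add: F_def G_def power2_eq_square algebra_simps)
      have "\<bar>l + t * s\<bar> \<le> l + \<bar>s\<bar>"
      proof -
        have "\<bar>t * s\<bar> \<le> 1 * \<bar>s\<bar>" unfolding abs_mult using t tT by (intro mult_mono) auto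
        then show ?thesis using l by linarith
      qed
      then have "\<bar>(l + t * s) * ?RC\<bar> \<le> (l + \<bar>s\<bar>) * (K * t\<^sup>2 * ?n)"
        unfolding abs_mult using expand_C[OF t(1) tT(1) v w] l by (intro mult_mono) (auto simp: N_def)
      moreover have "\<bar>t\<^sup>2 * s * C' v w\<bar> \<le> t\<^sup>2 * \<bar>s\<bar> * (K * ?n)"
        unfolding abs_mult using bound_C'[OF v w] by (intro mult_mono) (auto simp: N_def)
      moreover have "\<bar>?RA\<bar> \<le> K * t\<^sup>2 * ?n" using expand_A[OF t(1) tT(1) v w] by (simp add: N_def)
      ultimately have "\<bar>?RA - (l + t * s) * ?RC - t\<^sup>2 * s * C' v w\<bar>
          \<le> K * t\<^sup>2 * ?n + (l + \<bar>s\<bar>) * (K * t\<^sup>2 * ?n) + t\<^sup>2 * \<bar>s\<bar> * (K * ?n)"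
        by linarith
      also have "\<dots> = K2 * t\<^sup>2 * ?n" by (simp add: K2_def algebra_simps)
      finally show ?thesis unfolding eq .
    qed
    have coarse: "\<bar>F v w - (A v w - l * C v w)\<bar> \<le> t * K4 * (N v * N w)"
      if v: "v \<in> V" and w: "w \<in> V" for v w
    proof -
      let ?n = "N v * N w"
      have n: "?n \<ge> 0" using N[OF v] N[OF w] by simp
      have "\<bar>l * C' v w\<bar> \<le> l * (K * ?n)" "\<bar>s * C v w\<bar> \<le> \<bar>s\<bar> * (\<kappa> * ?n)"
        unfolding abs_mult using bound_C'[OF v w] bound_C[OF v w] l
        by (auto simp: N_def intro!: mult_mono)
      then have "\<bar>G v w\<bar> \<le> K * ?n + l * (K * ?n) + \<bar>s\<bar> * (\<kappa> * ?n)"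
        using bound_A'[OF v w] unfolding G_def N_def by linarith
      also have "\<dots> = K3 * ?n" by (simp add: K3_def algebra_simps)
      finally have "\<bar>t * G v w\<bar> \<le> t * (K3 * ?n)"
        unfolding abs_mult using t by (intro mult_mono) auto
      moreover have "K2 * t\<^sup>2 * ?n \<le> t * (K2 * ?n)"
      proof -
        have "t * t * (K2 * ?n) \<le> 1 * t * (K2 * ?n)"
          using t tT K2 n by (intro mult_right_mono) auto
        then show ?thesis by (simp add: power2_eq_square algebra_simps)
      qed
      ultimately have "\<bar>F v w - (A v w - l * C v w)\<bar> \<le> t * (K3 * ?n) + t * (K2 * ?n)"
        using remainder[OF v w] by linarith
      then show ?thesis by (simp add: K4_def algebra_simps)
    qed
    note zV = Z(1)[OF z]
    \<comment> \<open>The mixed term has no part of order zero, because \<open>U\<close> is an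
      eigenfunction orthogonal to \<open>z\<close>; only the error of order \<open>t\<close>
      remains.\<close>
    have "A z U - l * C z U = 0"
      using eig[OF zV] A.sym[OF zV U(1)] C.sym[OF zV U(1)] by simp
    with coarse[OF zV U(1)] have "\<bar>\<sigma> * F z U\<bar> \<le> t * K4 * m * N z"
      by (simp add: abs_mult NU algebra_simps)
    then have "\<bar>2 * r * (\<sigma> * F z U)\<bar> \<le> 2 * (t * K4 * m) * \<bar>r\<bar> * N z"
      using mult_left_mono[of "\<bar>\<sigma> * F z U\<bar>" "t * K4 * m * N z" "2 * \<bar>r\<bar>"]
      by (simp add: abs_mult mult_ac)
    moreover have "\<sigma> * F z z \<ge> g / 2 * (N z)\<^sup>2"
    proof -
      have "\<bar>\<sigma> * F z z - \<sigma> * (A z z - l * C z z)\<bar> = \<bar>F z z - (A z z - l * C z z)\<bar>"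
        by (simp add: abs_mult flip: right_diff_distrib)
      also have "\<dots> \<le> t * K4 * (N z)\<^sup>2" using coarse[OF zV zV] by (simp add: power2_eq_square)
      also have "\<dots> \<le> g / 2 * (N z)\<^sup>2" using t1 by (intro mult_right_mono) auto
      finally show ?thesis using Z(3)[OF z] unfolding N(2)[OF zV] by linarith
    qed
    moreover have "\<sigma> * F U U \<ge> t * \<eta> / 2"
    proof -
      have "G U U = \<sigma> * \<eta>" using d U by (simp add: G_def s_def)
      then have "\<bar>F U U - t * (\<sigma> * \<eta>)\<bar> \<le> K2 * t\<^sup>2 * l"
        using remainder[OF U(1) U(1)] eig[OF U(1)] U N(2)[OF U(1)] by (simp add: power2_eq_square)
      then have "\<bar>\<sigma> * (F U U - t * (\<sigma> * \<eta>))\<bar> \<le> K2 * t\<^sup>2 * l" by (simp add: abs_mult)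
      then have "\<bar>\<sigma> * F U U - t * \<eta>\<bar> \<le> K2 * t\<^sup>2 * l"
        by (simp add: algebra_simps) (simp add: mult.assoc[symmetric])
      moreover have "K2 * t\<^sup>2 * l \<le> t * (\<eta> / 2)"
        using mult_left_mono[OF t2, of t] t by (simp add: power2_eq_square algebra_simps)
      ultimately show ?thesis by (simp add: algebra_simps)
    qed
    then have "r\<^sup>2 * (\<sigma> * F U U) \<ge> r\<^sup>2 * (t * \<eta> / 2)" by (intro mult_left_mono) auto
    \<comment> \<open>In the variables \<open>N z\<close> and \<open>\<bar>r\<bar>\<close> the
      square of the mixed coefficient is of order t^2, while the product of the two diagonal
      coefficients is of order t.\<close>
    moreover have "0 \<le> g / 2 * (N z)\<^sup>2 - 2 * (t * K4 * m) * \<bar>r\<bar> * N z + t * \<eta> / 2 * \<bar>r\<bar>\<^sup>2"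
    proof (rule quadratic_nonneg)
      have "(t * K4 * m)\<^sup>2 = t * (t * (K4 * m)\<^sup>2)" by (simp add: power2_eq_square algebra_simps)
      also have "\<dots> \<le> t * (g * \<eta> / 4)" using t t3 by (intro mult_left_mono) auto
      finally show "(t * K4 * m)\<^sup>2 \<le> g / 2 * (t * \<eta> / 2)" by (simp add: algebra_simps)
    qed (use g \<eta> t in auto)
    moreover have "\<sigma> * F (\<lambda>x. z x + r * U x) (\<lambda>x. z x + r * U x)
        = \<sigma> * F z z + 2 * r * (\<sigma> * F z U) + r\<^sup>2 * (\<sigma> * F U U)"
      unfolding F.quadratic_add[OF zV U(1)] by (simp add: algebra_simps)
    ultimately have "0 \<le> \<sigma> * F (\<lambda>x. z x + r * U x) (\<lambda>x. z x + r * U x)"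
      by (simp add: mult.commute[of "r\<^sup>2"])
    then show ?thesis unfolding F_def .
  qed
  moreover have "t0 \<le> T" by (simp add: t0_def)
  ultimately show ?thesis unfolding s_def by blast
qed

theorem simple_eigenvalue_derivative:
  assumes sb: "spectral_basis \<Lambda> u" and simple: "\<And>n. n \<noteq> k \<Longrightarrow> \<Lambda> n \<noteq> \<Lambda> k"
    and sbt: "\<And>t. 0 < t \<Longrightarrow> t \<le> T \<Longrightarrow> form_pair.spectral_basis V (At t) (Ct t) (\<Lambda>t t) (ut t)"
  shows "((\<lambda>t. (\<Lambda>t t k - \<Lambda> k) / t) \<longlongrightarrow> A' (u k) (u k) - \<Lambda> k * C' (u k) (u k)) (at_right 0)"
proof -
  define d where "d = A' (u k) (u k) - \<Lambda> k * C' (u k) (u k)"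
  note basis = basis_mem[OF sb] basis_orth[OF sb] basis_eigen[OF sb]
  have less: "\<Lambda> i < \<Lambda> k" if "i < k" for i
    using eigenvalues_mono[OF sb, of i k] simple[of i] that by force
  have greater: "\<Lambda> k < \<Lambda> (Suc k)" using eigenvalues_mono[OF sb, of k "Suc k"] simple[of "Suc k"] by force
  have upper: "\<exists>t0>0. t0 \<le> T \<and> (\<forall>t. 0 < t \<longrightarrow> t < t0 \<longrightarrow> \<Lambda>t t k \<le> \<Lambda> k + t * (d + \<eta>))"
    if \<eta>: "0 < \<eta>" for \<eta>
  proof -
    \<comment> \<open>Relative gap below \<open>\<Lambda> k\<close>, determined by the largest lower
      eigenvalue \<open>\<Lambda> k'\<close> with \<open>k' = k - 1\<close>. For
      \<open>k = 0\<close> the condition is void and any positive \<open>g\<close> will do.\<close>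
    obtain g where g: "0 < g" "\<And>i. i < k \<Longrightarrow> (1 + g) * \<Lambda> i \<le> \<Lambda> k"
    proof (cases k)
      case 0
      then show ?thesis using that[of 1] by simp
    next
      case (Suc k')
      let ?g = "\<Lambda> k / \<Lambda> k' - 1"
      have pos: "0 < \<Lambda> k'" by (rule eigenvalue_pos[OF sb])
      have "(1 + ?g) * \<Lambda> i \<le> \<Lambda> k" if "i < k" for i
      proof -
        have "(1 + ?g) * \<Lambda> i \<le> (1 + ?g) * \<Lambda> k'"
          using eigenvalues_mono[OF sb, of i k'] eigenvalue_pos[OF sb, of k] pos that Suc
          by (intro mult_left_mono) auto
        then show ?thesis using pos by simp
      qed
      moreover have "0 < ?g" using less[of k'] pos Suc by simp
      ultimately show ?thesis using that[of ?g] by blast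
    qed
    define Z where "Z = {\<lambda>x. \<Sum>i<k. r i * u i x | r. True}"
    have "\<exists>t0>0. t0 \<le> T \<and> (\<forall>t z r. 0 < t \<longrightarrow> t < t0 \<longrightarrow> z \<in> Z \<longrightarrow>
      0 \<le> (-1) * (At t (\<lambda>x. z x + r * u k x) (\<lambda>x. z x + r * u k x)
      - (\<Lambda> k + t * (d - (-1) * \<eta>)) * Ct t (\<lambda>x. z x + r * u k x) (\<lambda>x. z x + r * u k x)))"
    proof (rule perturbed_sign)
      fix z assume "z \<in> Z"
      then obtain r where r: "z = (\<lambda>x. \<Sum>i<k. r i * u i x)" by (auto simp: Z_def)
      show "z \<in> V" unfolding r by (rule basis_span_mem[OF sb]) simp
      show "C z (u k) = 0" unfolding r by (subst basis_coefficient[OF sb]) auto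
      have "(1 + g) * A z z = (\<Sum>i<k. (1 + g) * \<Lambda> i * (r i)\<^sup>2)"
        unfolding r basis_span_A[OF sb finite_lessThan] by (simp add: sum_distrib_left mult.assoc)
      also have "\<dots> \<le> (\<Sum>i<k. \<Lambda> k * (r i)\<^sup>2)"
        using g by (intro sum_mono mult_right_mono) auto
      also have "\<dots> = \<Lambda> k * C z z"
        unfolding r basis_span_C[OF sb finite_lessThan] by (simp add: sum_distrib_left)
      finally show "g * A z z \<le> -1 * (A z z - \<Lambda> k * C z z)" by (simp add: algebra_simps)
    qed (use g \<eta> basis eigenvalue_pos[OF sb] in \<open>auto simp: d_def\<close>)
    then obtain t0 where t0: "0 < t0" "t0 \<le> T" "\<And>t z r. 0 < t \<Longrightarrow> t < t0 \<Longrightarrow> z \<in> Z \<Longrightarrow>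
      0 \<le> (-1) * (At t (\<lambda>x. z x + r * u k x) (\<lambda>x. z x + r * u k x)
      - (\<Lambda> k + t * (d - (-1) * \<eta>)) * Ct t (\<lambda>x. z x + r * u k x) (\<lambda>x. z x + r * u k x))"
      by blast
    have "\<Lambda>t t k \<le> \<Lambda> k + t * (d + \<eta>)" if t: "0 < t" "t < t0" for t
    proof -
      have tT: "t \<le> T" using t t0 by simp
      interpret Pt: form_pair V "At t" "Ct t" M "\<kappa>t t" by (rule pair_t[OF t(1) tT])
      show ?thesis
      proof (rule Pt.eigenvalue_le[OF sbt[OF t(1) tT], of k u])
        fix r :: "nat \<Rightarrow> real"
        let ?y = "\<lambda>x. \<Sum>i<Suc k. r i * u i x"
        have yV: "?y \<in> V" by (rule basis_span_mem[OF sb]) simp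
        show "\<forall>i<Suc k. r i = 0" if "Ct t ?y ?y = 0"
        proof -
          \<comment> \<open>The mass forms at time \<open>t\<close> and at time 0 have the same
            kernel: the functions vanishing almost everywhere.\<close>
          have "C ?y ?y = 0" using that null_iff[OF yV] Pt.null_iff[OF yV] by blast
          then show ?thesis using basis_span_null[OF sb finite_lessThan] by blast
        qed
        have "(\<lambda>x. \<Sum>i<k. r i * u i x) \<in> Z" by (auto simp: Z_def)
        from t0(3)[OF t this, of "r k"]
        show "At t ?y ?y \<le> (\<Lambda> k + t * (d + \<eta>)) * Ct t ?y ?y" by simp
      qed (rule basis)
    qed
    with t0 show ?thesis by blast
  qed
  have lower: "\<exists>t0>0. t0 \<le> T \<and> (\<forall>t. 0 < t \<longrightarrow> t < t0 \<longrightarrow> \<Lambda> k + t * (d - \<eta>) \<le> \<Lambda>t t k)"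
    if \<eta>: "0 < \<eta>" for \<eta>
  proof -
    \<comment> \<open>Relative gap above: on functions orthogonal to the first \<open>k + 1\<close>
      basis vectors, \<open>\<Lambda> k * C\<close> is at most \<open>(1 - g) * A\<close> on the
      diagonal.\<close>
    define g where "g = 1 - \<Lambda> k / \<Lambda> (Suc k)"
    have g: "0 < g" using greater eigenvalue_pos[OF sb, of "Suc k"] by (simp add: g_def)
    define Z where "Z = {z \<in> V. \<forall>i<Suc k. C z (u i) = 0}"
    have "\<exists>t0>0. t0 \<le> T \<and> (\<forall>t z r. 0 < t \<longrightarrow> t < t0 \<longrightarrow> z \<in> Z \<longrightarrow>
      0 \<le> 1 * (At t (\<lambda>x. z x + r * u k x) (\<lambda>x. z x + r * u k x)
      - (\<Lambda> k + t * (d - 1 * \<eta>)) * Ct t (\<lambda>x. z x + r * u k x) (\<lambda>x. z x + r * u k x)))"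
    proof (rule perturbed_sign)
      fix z assume "z \<in> Z"
      then show z: "z \<in> V" and "C z (u k) = 0" by (auto simp: Z_def)
      have "\<Lambda> (Suc k) * C z z \<le> A z z"
        using eigenvalue_min[OF sb z, of "Suc k"] \<open>z \<in> Z\<close> by (auto simp: Z_def)
      then have "\<Lambda> k / \<Lambda> (Suc k) * (\<Lambda> (Suc k) * C z z) \<le> \<Lambda> k / \<Lambda> (Suc k) * A z z"
        using eigenvalue_pos[OF sb] by (intro mult_left_mono) (auto simp: less_imp_le)
      then have "\<Lambda> k * C z z \<le> \<Lambda> k / \<Lambda> (Suc k) * A z z"
        using eigenvalue_pos[OF sb, of "Suc k"] by simp
      then show "g * A z z \<le> 1 * (A z z - \<Lambda> k * C z z)" by (simp add: g_def algebra_simps)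
    qed (use g \<eta> basis eigenvalue_pos[OF sb] in \<open>auto simp: d_def\<close>)
    then obtain t0 where t0: "0 < t0" "t0 \<le> T" "\<And>t z r. 0 < t \<Longrightarrow> t < t0 \<Longrightarrow> z \<in> Z \<Longrightarrow>
      0 \<le> 1 * (At t (\<lambda>x. z x + r * u k x) (\<lambda>x. z x + r * u k x)
      - (\<Lambda> k + t * (d - 1 * \<eta>)) * Ct t (\<lambda>x. z x + r * u k x) (\<lambda>x. z x + r * u k x))"
      by blast
    have "\<Lambda> k + t * (d - \<eta>) \<le> \<Lambda>t t k" if t: "0 < t" "t < t0" for t
    proof -
      have tT: "t \<le> T" using t t0 by simp
      interpret Pt: form_pair V "At t" "Ct t" M "\<kappa>t t" by (rule pair_t[OF t(1) tT])
      show ?thesis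
      proof (rule Pt.eigenvalue_ge[OF sbt[OF t(1) tT] C.sym_form_axioms, of k u])
        fix v assume v: "v \<in> V" "\<And>i. i < k \<Longrightarrow> C v (u i) = 0"
        \<comment> \<open>The constraints are orthogonality to \<open>u 0, ..., u (k - 1)\<close> in
          the unperturbed mass form; removing the \<open>u k\<close> component as well lands in
          \<open>Z\<close>.\<close>
        define z where "z = (\<lambda>x. v x - C v (u k) * u k x)"
        have scV: "(\<lambda>x. C v (u k) * u k x) \<in> V" by (rule A.scale_mem[OF basis(1)])
        have zV: "z \<in> V" unfolding z_def by (rule A.diff_mem[OF v(1) scV])
        have "C z (u i) = C v (u i) - C v (u k) * C (u k) (u i)" for i
          unfolding z_def C.diff_left[OF v(1) scV basis(1)] C.scale_left[OF basis(1) basis(1)] ..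
        then have "z \<in> Z" using zV v(2) by (auto simp: Z_def basis(2) less_Suc_eq)
        from t0(3)[OF t this, of "C v (u k)"]
        show "(\<Lambda> k + t * (d - \<eta>)) * Ct t v v \<le> At t v v" by (simp add: z_def)
      qed (rule basis)
    qed
    with t0 show ?thesis by blast
  qed
  have "((\<lambda>t. (\<Lambda>t t k - \<Lambda> k) / t) \<longlongrightarrow> d) (at_right 0)"
  proof (rule tendstoI)
    fix e :: real assume "0 < e"
    then have e: "0 < e / 2" by simp
    obtain t1 t2 where t1: "0 < t1" "\<And>t. 0 < t \<Longrightarrow> t < t1 \<Longrightarrow> \<Lambda>t t k \<le> \<Lambda> k + t * (d + e / 2)"
      and t2: "0 < t2" "\<And>t. 0 < t \<Longrightarrow> t < t2 \<Longrightarrow> \<Lambda> k + t * (d - e / 2) \<le> \<Lambda>t t k"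
      using upper[OF e] lower[OF e] by blast
    have "dist ((\<Lambda>t t k - \<Lambda> k) / t) d < e" if t: "0 < t" "t < min t1 t2" for t
    proof -
      have "(\<Lambda>t t k - \<Lambda> k) / t \<le> d + e / 2" "d - e / 2 \<le> (\<Lambda>t t k - \<Lambda> k) / t"
        using t1(2)[of t] t2(2)[of t] t unfolding pos_divide_le_eq[OF t(1)] pos_le_divide_eq[OF t(1)]
        by (simp_all add: mult.commute[of t])
      then have "\<bar>(\<Lambda>t t k - \<Lambda> k) / t - d\<bar> \<le> e / 2" by linarith
      with \<open>0 < e\<close> show ?thesis by (simp add: dist_real_def)
    qed
    then show "\<forall>\<^sub>F t in at_right 0. dist ((\<Lambda>t t k - \<Lambda> k) / t) d < e"
      using t1(1) t2(1) by (auto simp: eventually_at_right_field intro!: exI[of _ "min t1 t2"])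
  qed
  then show ?thesis unfolding d_def .
qed

end

section \<open>Test functions\<close>

lemma Ck_on_SucI:
  assumes "\<And>x. (f has_derivative D x) (at x)" "\<And>b. b \<in> Basis \<Longrightarrow> Ck_on k UNIV (\<lambda>x. D x b)"
  shows "Ck_on (Suc k) UNIV f"
proof -
  have "frechet_derivative f (at x) = D x" for x using frechet_derivative_at[OF assms(1)[of x]] by simp
  then show ?thesis using assms by (auto simp: differentiable_def)
qed

lemma Ck_on_SucD:
  assumes "Ck_on (Suc k) UNIV f"
  shows "(f has_derivative frechet_derivative f (at x)) (at x)"
    and "b \<in> Basis \<Longrightarrow> Ck_on k UNIV (\<lambda>x. frechet_derivative f (at x) b)"
  using assms by (auto simp: frechet_derivative_works)

lemma Ck_on_lower: "Ck_on (Suc k) UNIV f \<Longrightarrow> Ck_on k UNIV f"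
proof (induction k arbitrary: f)
  case 0
  then show ?case by (auto intro!: continuous_at_imp_continuous_on differentiable_imp_continuous_within)
next
  case (Suc k)
  have "f differentiable at x" for x using Suc.prems by simp
  moreover have "Ck_on k UNIV (\<lambda>x. frechet_derivative f (at x) b)" if "b \<in> Basis" for b
    by (rule Suc.IH) (use Suc.prems that in simp)
  ultimately show ?case by simp
qed

lemma Ck_on_const: "Ck_on k UNIV (\<lambda>x. c)"
proof (induction k arbitrary: c)
  case (Suc k)
  show ?case by (rule Ck_on_SucI[where D = "\<lambda>x h. 0"]) (use Suc in auto)
qed simp

lemma Ck_on_add: "Ck_on k UNIV f \<Longrightarrow> Ck_on k UNIV g \<Longrightarrow> Ck_on k UNIV (\<lambda>x. f x + g x)"
proof (induction k arbitrary: f g)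
  case 0
  then show ?case by (simp add: continuous_on_add)
next
  case (Suc k)
  note f = Ck_on_SucD[OF Suc.prems(1)] and g = Ck_on_SucD[OF Suc.prems(2)]
  show ?case
    by (rule Ck_on_SucI[OF has_derivative_add[OF f(1) g(1)]]) (intro Suc.IH f(2) g(2))
qed

lemma Ck_on_mult: "Ck_on k UNIV f \<Longrightarrow> Ck_on k UNIV g \<Longrightarrow> Ck_on k UNIV (\<lambda>x. f x * g x)"
proof (induction k arbitrary: f g)
  case 0
  then show ?case by (simp add: continuous_on_mult)
next
  case (Suc k)
  note f = Ck_on_SucD[OF Suc.prems(1)] and g = Ck_on_SucD[OF Suc.prems(2)]
  note low = Ck_on_lower[OF Suc.prems(1)] Ck_on_lower[OF Suc.prems(2)]
  show ?case
    by (rule Ck_on_SucI[OF has_derivative_mult[OF f(1) g(1)]])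
      (intro Ck_on_add Suc.IH f(2) g(2) low)
qed

lemma Ck_on_prod: "finite I \<Longrightarrow> (\<And>i. i \<in> I \<Longrightarrow> Ck_on k UNIV (f i)) \<Longrightarrow> Ck_on k UNIV (\<lambda>x. \<Prod>i\<in>I. f i x)"
  by (induction I rule: finite_induct) (auto intro: Ck_on_const Ck_on_mult)

text \<open>The functions \<open>t\<^sup>-\<^sup>m exp(-1/t)\<close> for \<open>t > 0\<close>, extended by \<open>0\<close>; their span is closed under
  differentiation.\<close>

definition flat :: "nat \<Rightarrow> real \<Rightarrow> real" where
  "flat m t = (if t > 0 then exp (-1 / t) / t ^ m else 0)"

section \<open>Smoothness of the flat functions, and bump functions on boxes\<close>

lemma flat_tendsto_0: "(flat m \<longlongrightarrow> 0) (at 0)"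
proof -
  have "((\<lambda>t. exp (-1 / t) / t ^ m) \<longlongrightarrow> (0::real)) (at_right 0)" by real_asymp
  then have "(flat m \<longlongrightarrow> 0) (at_right 0)"
    by (rule Lim_transform_eventually) (auto simp: flat_def eventually_at_right_field intro!: exI[of _ 1])
  moreover have "(flat m \<longlongrightarrow> 0) (at_left 0)"
    by (rule Lim_transform_eventually[OF tendsto_const])
      (auto simp: flat_def eventually_at_left_field intro!: exI[of _ "-1"])
  ultimately show ?thesis by (rule filterlim_split_at[OF _ _, rotated])
qed

lemma flat_has_derivative:
  "(flat m has_real_derivative (flat (m + 2) t - of_nat m * flat (m + 1) t)) (at t)"
proof (cases t "0 :: real" rule: linorder_cases)
  case less
  have "((\<lambda>t. 0) has_real_derivative (flat (m + 2) t - of_nat m * flat (m + 1) t)) (at t)"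
    using less by (auto simp: flat_def)
  then show ?thesis
    by (rule has_field_derivative_transform_within_open[of _ _ _ "{..<0}"]) (use less in \<open>auto simp: flat_def\<close>)
next
  case equal
  have "((\<lambda>h. flat (m + 1) h) \<longlongrightarrow> 0) (at 0)" by (rule flat_tendsto_0)
  \<comment> \<open>At 0 the difference quotient of \<open>flat m\<close> is exactly
    \<open>flat (m + 1)\<close>, on both sides, so the limit already known is the
    derivative.\<close>
  moreover have "flat (m + 1) h = (flat m (0 + h) - flat m 0) / h" for h by (simp add: flat_def)
  ultimately have "(flat m has_real_derivative 0) (at 0)" by (simp add: DERIV_def)
  then show ?thesis using equal by (simp add: flat_def)
next
  case greater
  have "((\<lambda>t. exp (-1 / t) / t ^ m) has_real_derivative
      (exp (-1 / t) * (1 / t\<^sup>2) * t ^ m - exp (-1 / t) * (of_nat m * t ^ (m - 1))) / (t ^ m * t ^ m)) (at t)"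
    using greater by (auto intro!: derivative_eq_intros simp: power2_eq_square)
  moreover have "(exp (-1 / t) * (1 / t\<^sup>2) * t ^ m - exp (-1 / t) * (of_nat m * t ^ (m - 1))) / (t ^ m * t ^ m)
      = flat (m + 2) t - of_nat m * flat (m + 1) t"
    using greater by (cases m) (simp_all add: flat_def field_simps power2_eq_square)
  ultimately have "((\<lambda>t. exp (-1 / t) / t ^ m) has_real_derivative
      flat (m + 2) t - of_nat m * flat (m + 1) t) (at t)" by simp
  then show ?thesis
    by (rule has_field_derivative_transform_within_open[of _ _ _ "{0<..}"]) (use greater in \<open>auto simp: flat_def\<close>)
qed

lemma Ck_on_flat: "Ck_on k UNIV (\<lambda>x. flat m (x \<bullet> v + s))"
proof (induction k arbitrary: m)
  case 0
  have "continuous_on UNIV (flat m)"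
    by (intro continuous_at_imp_continuous_on ballI DERIV_isCont[OF flat_has_derivative])
  then have "continuous_on UNIV (\<lambda>x. flat m (x \<bullet> v + s))"
    by (rule continuous_on_compose2) (auto intro!: continuous_intros)
  then show ?case by simp
next
  case (Suc k)
  have "((\<lambda>x. flat m (x \<bullet> v + s)) has_derivative
      (\<lambda>h. (h \<bullet> v) * (flat (m + 2) (x \<bullet> v + s) - of_nat m * flat (m + 1) (x \<bullet> v + s)))) (at x)" for x
  proof -
    have "((\<lambda>x. x \<bullet> v + s) has_derivative (\<lambda>h. h \<bullet> v)) (at x)" by (auto intro!: derivative_eq_intros)
    from has_derivative_compose[OF this flat_has_derivative[unfolded has_field_derivative_def]]
    show ?thesis by (simp add: mult.commute)
  qed
  then show ?case
  proof (rule Ck_on_SucI)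
    fix b :: 'a
    have "Ck_on k UNIV (\<lambda>x. (b \<bullet> v) * (flat (m + 2) (x \<bullet> v + s) + (- of_nat m) * flat (m + 1) (x \<bullet> v + s)))"
      by (intro Ck_on_mult Ck_on_add Ck_on_const Suc.IH)
    then show "Ck_on k UNIV (\<lambda>x. (b \<bullet> v) * (flat (m + 2) (x \<bullet> v + s) - of_nat m * flat (m + 1) (x \<bullet> v + s)))"
      by simp
  qed
qed

text \<open>A smooth function with values in [0,1] that is positive exactly on the open box. The
  factor \<open>Suc n\<close> steepens its sides, so that for growing \<open>n\<close> it tends to
  the indicator of the box.\<close>

definition box_bump :: "'a::euclidean_space \<Rightarrow> 'a \<Rightarrow> nat \<Rightarrow> 'a \<Rightarrow> real" where
  "box_bump l u n x = (\<Prod>b\<in>Basis. flat 0 (real (Suc n) * (x \<bullet> b - l \<bullet> b)) * flat 0 (real (Suc n) * (u \<bullet> b - x \<bullet> b)))"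

lemma flat_0_bounds: "0 \<le> flat 0 t" "flat 0 t \<le> 1" "flat 0 t \<noteq> 0 \<longleftrightarrow> 0 < t"
  by (auto simp: flat_def)

lemma box_bump_nonzero_iff: "box_bump l u n x \<noteq> 0 \<longleftrightarrow> x \<in> box l u"
  by (simp add: box_bump_def prod_zero_iff flat_0_bounds(3) mem_box zero_less_mult_iff)

lemma box_bump_nonneg: "0 \<le> box_bump l u n x"
  unfolding box_bump_def by (intro prod_nonneg ballI mult_nonneg_nonneg flat_0_bounds)

lemma box_bump_le_1: "box_bump l u n x \<le> 1"
  unfolding box_bump_def by (intro prod_le_1 conjI mult_nonneg_nonneg mult_le_one flat_0_bounds)

lemma box_bump_tendsto: "(\<lambda>n. box_bump l u n x) \<longlonglongrightarrow> indicat_real (box l u) x"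
proof (cases "x \<in> box l u")
  case True
  have flat1: "(\<lambda>n. flat 0 (real (Suc n) * t)) \<longlonglongrightarrow> 1" if "0 < t" for t
  proof -
    have "(\<lambda>n. exp (-1 / (real (Suc n) * t))) \<longlonglongrightarrow> 1" using that by real_asymp
    then show ?thesis using that by (simp add: flat_def)
  qed
  have "(\<lambda>n. box_bump l u n x) \<longlonglongrightarrow> (\<Prod>b\<in>(Basis::'a set). 1 * 1)"
    unfolding box_bump_def using True
    by (intro tendsto_prod tendsto_mult flat1) (auto simp: mem_box inner_commute)
  then show ?thesis using True by simp
next
  case False
  then have "box_bump l u n x = 0" for n using box_bump_nonzero_iff by blast
  then show ?thesis using False by simp
qed

lemma box_bump_test_function:
  assumes "cbox l u \<subseteq> \<Omega>"
  shows "box_bump l u n \<in> test_functions \<Omega>"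
proof -
  \<comment> \<open>\<open>Ck_on_flat\<close> covers arguments of the form
    \<open>x \<bullet> v + s\<close>, so the slope is moved into the vector
    \<open>v\<close>.\<close>
  have "Ck_on k UNIV (\<lambda>x. \<Prod>b\<in>Basis. flat 0 (x \<bullet> (real (Suc n) *\<^sub>R b) + - (real (Suc n) * (l \<bullet> b)))
      * flat 0 (x \<bullet> (- real (Suc n) *\<^sub>R b) + real (Suc n) * (u \<bullet> b)))" for k
    by (intro Ck_on_prod Ck_on_mult Ck_on_flat finite_Basis)
  moreover have "(\<lambda>x. \<Prod>b\<in>Basis. flat 0 (x \<bullet> (real (Suc n) *\<^sub>R b) + - (real (Suc n) * (l \<bullet> b)))
      * flat 0 (x \<bullet> (- real (Suc n) *\<^sub>R b) + real (Suc n) * (u \<bullet> b))) = box_bump l u n"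
    by (auto simp: fun_eq_iff box_bump_def algebra_simps intro!: prod.cong)
  ultimately have "Ck_on k UNIV (box_bump l u n)" for k by simp
  moreover have "closure {x. box_bump l u n x \<noteq> 0} \<subseteq> cbox l u"
    unfolding box_bump_nonzero_iff by (intro closure_minimal) (auto simp: box_subset_cbox[THEN subsetD])
  ultimately show ?thesis using assms
    by (auto simp: test_functions_def compact_eq_bounded_closed intro: bounded_subset[OF bounded_cbox])
qed

section \<open>Gradients of test functions and integration by parts\<close>

definition test_grad :: "('a::euclidean_space \<Rightarrow> real) \<Rightarrow> 'a \<Rightarrow> 'a" where
  "test_grad \<zeta> x = (\<Sum>b\<in>Basis. frechet_derivative \<zeta> (at x) b *\<^sub>R b)"

context
  fixes \<zeta> :: "'a::euclidean_space \<Rightarrow> real" and S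
  assumes \<zeta>: "\<zeta> \<in> test_functions S"
begin

lemma test_support: "compact (closure {x. \<zeta> x \<noteq> 0})" "closure {x. \<zeta> x \<noteq> 0} \<subseteq> S"
  using \<zeta> by (auto simp: test_functions_def)

lemma test_zero_outside: "x \<notin> closure {x. \<zeta> x \<noteq> 0} \<Longrightarrow> \<zeta> x = 0" "x \<notin> S \<Longrightarrow> \<zeta> x = 0"
  using closure_subset[of "{x. \<zeta> x \<noteq> 0}"] test_support by auto

lemma test_partial: "b \<in> Basis \<Longrightarrow> frechet_derivative \<zeta> (at x) b = test_grad \<zeta> x \<bullet> b"
  by (simp add: test_grad_def inner_sum_left inner_Basis if_distrib cong: if_cong)

lemma test_has_derivative: "(\<zeta> has_derivative (\<lambda>h. test_grad \<zeta> x \<bullet> h)) (at x)"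
proof -
  have "Ck_on 1 UNIV \<zeta>" using \<zeta> by (simp add: test_functions_def)
  then have d: "(\<zeta> has_derivative frechet_derivative \<zeta> (at x)) (at x)"
    by (simp add: frechet_derivative_works)
  then interpret bounded_linear "frechet_derivative \<zeta> (at x)" by (rule has_derivative_bounded_linear)
  have "frechet_derivative \<zeta> (at x) h = test_grad \<zeta> x \<bullet> h" for h
  proof -
    have "frechet_derivative \<zeta> (at x) h = frechet_derivative \<zeta> (at x) (\<Sum>b\<in>Basis. (h \<bullet> b) *\<^sub>R b)"
      by (simp add: euclidean_representation)
    also have "\<dots> = (\<Sum>b\<in>Basis. (h \<bullet> b) * frechet_derivative \<zeta> (at x) b)"
      by (simp add: sum scaleR)
    also have "\<dots> = test_grad \<zeta> x \<bullet> h"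
      by (simp add: test_grad_def inner_sum_left inner_commute[of h] mult.commute)
    finally show ?thesis .
  qed
  then have "frechet_derivative \<zeta> (at x) = (\<lambda>h. test_grad \<zeta> x \<bullet> h)" by (rule ext)
  then show ?thesis using d by simp
qed

lemma test_continuous: "continuous_on X \<zeta>"
  by (intro continuous_at_imp_continuous_on ballI has_derivative_continuous[OF test_has_derivative])

lemma test_grad_continuous: "continuous_on X (test_grad \<zeta>)"
proof -
  have "Ck_on (Suc 0) UNIV \<zeta>" using \<zeta> by (simp add: test_functions_def)
  then have "continuous_on UNIV (\<lambda>x. frechet_derivative \<zeta> (at x) b)" if "b \<in> Basis" for b
    using that by simp
  then have "continuous_on UNIV (test_grad \<zeta>)"
    unfolding test_grad_def[abs_def] by (intro continuous_intros) auto
  then show ?thesis by (rule continuous_on_subset) simp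
qed

lemma test_grad_zero_outside: "x \<notin> closure {x. \<zeta> x \<noteq> 0} \<Longrightarrow> test_grad \<zeta> x = 0"
proof -
  assume x: "x \<notin> closure {x. \<zeta> x \<noteq> 0}"
  have "((\<lambda>x. 0) has_derivative (\<lambda>h. test_grad \<zeta> x \<bullet> h)) (at x)"
  proof (rule has_derivative_transform_within_open[OF test_has_derivative])
    show "open (- closure {x. \<zeta> x \<noteq> 0})" by (intro open_Compl closed_closure)
    show "x \<in> - closure {x. \<zeta> x \<noteq> 0}" unfolding Compl_iff by (rule x)
    show "\<zeta> y = 0" if "y \<in> - closure {x. \<zeta> x \<noteq> 0}" for y
      using that unfolding Compl_iff by (rule test_zero_outside(1))
  qed
  then have "(\<lambda>h. test_grad \<zeta> x \<bullet> h) = (\<lambda>h. 0)"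
    by (rule has_derivative_unique[OF _ has_derivative_const])
  from fun_cong[OF this, of "test_grad \<zeta> x"] have "test_grad \<zeta> x \<bullet> test_grad \<zeta> x = 0" .
  then show ?thesis by simp
qed

lemma continuous_vanishing_outside_support_bounded:
  fixes f :: "'a \<Rightarrow> 'b::real_normed_vector"
  assumes "continuous_on UNIV f" "\<And>x. x \<notin> closure {x. \<zeta> x \<noteq> 0} \<Longrightarrow> f x = 0"
  shows "\<exists>B>0. \<forall>x. norm (f x) \<le> B"
proof -
  have "bounded (f ` closure {x. \<zeta> x \<noteq> 0})"
    using test_support(1) assms(1) by (intro compact_imp_bounded compact_continuous_image) (auto intro: continuous_on_subset)
  then obtain B where B: "B > 0" "\<forall>x\<in>closure {x. \<zeta> x \<noteq> 0}. norm (f x) \<le> B"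
    unfolding bounded_pos by auto
  then have "norm (f x) \<le> B" for x using assms(2)[of x] by (cases "x \<in> closure {x. \<zeta> x \<noteq> 0}") auto
  then show ?thesis using B by blast
qed

lemma test_bounded: "\<exists>B>0. \<forall>x. \<bar>\<zeta> x\<bar> \<le> B"
proof -
  have "\<exists>B>0. \<forall>x. norm (\<zeta> x) \<le> B"
    by (rule continuous_vanishing_outside_support_bounded[OF test_continuous test_zero_outside(1)])
  then show ?thesis by simp
qed

lemma test_grad_bounded: "\<exists>B>0. \<forall>x. norm (test_grad \<zeta> x) \<le> B"
  by (rule continuous_vanishing_outside_support_bounded[OF test_grad_continuous test_grad_zero_outside])

lemma test_borel [measurable]: "\<zeta> \<in> borel_measurable borel" "test_grad \<zeta> \<in> borel_measurable borel"
  by (rule borel_measurable_continuous_onI[OF test_continuous])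
    (rule borel_measurable_continuous_onI[OF test_grad_continuous])

lemma continuous_vanishing_outside_support_integrable:
  fixes f :: "'a \<Rightarrow> 'b::euclidean_space"
  assumes "continuous_on UNIV f" "\<And>x. x \<notin> closure {x. \<zeta> x \<noteq> 0} \<Longrightarrow> f x = 0"
  shows "integrable lborel f"
proof -
  let ?K = "closure {x. \<zeta> x \<noteq> 0}"
  have "integrable lborel (\<lambda>x. indicator ?K x *\<^sub>R f x)"
    using test_support(1) assms(1)
    by (intro borel_integrable_compact[unfolded set_integrable_def]) (auto intro: continuous_on_subset)
  moreover have "(\<lambda>x. indicator ?K x *\<^sub>R f x) = f"
    using assms(2) by (auto simp: indicator_def fun_eq_iff)
  ultimately show ?thesis by simp
qed

end

lemma test_add: "\<zeta> \<in> test_functions S \<Longrightarrow> \<xi> \<in> test_functions S \<Longrightarrow> (\<lambda>x. \<zeta> x + \<xi> x) \<in> test_functions S"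
proof -
  assume *: "\<zeta> \<in> test_functions S" "\<xi> \<in> test_functions S"
  have sub: "closure {x. \<zeta> x + \<xi> x \<noteq> 0} \<subseteq> closure {x. \<zeta> x \<noteq> 0} \<union> closure {x. \<xi> x \<noteq> 0}"
    unfolding closure_Un[symmetric] by (intro closure_mono) auto
  have "compact (closure {x. \<zeta> x + \<xi> x \<noteq> 0})"
    using compact_Un[OF test_support(1)[OF *(1)] test_support(1)[OF *(2)]] sub
    by (meson bounded_subset closed_closure compact_eq_bounded_closed)
  then show ?thesis
    using * sub test_support(2)[OF *(1)] test_support(2)[OF *(2)]
    by (auto simp: test_functions_def intro: Ck_on_add)
qed

lemma test_mult_smooth:
  assumes \<zeta>: "\<zeta> \<in> test_functions S" and g: "\<And>k. Ck_on k UNIV g"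
  shows "(\<lambda>x. g x * \<zeta> x) \<in> test_functions S"
proof -
  have sub: "closure {x. g x * \<zeta> x \<noteq> 0} \<subseteq> closure {x. \<zeta> x \<noteq> 0}"
    by (intro closure_mono) auto
  have "compact (closure {x. g x * \<zeta> x \<noteq> 0})"
    using test_support(1)[OF \<zeta>] sub by (meson bounded_subset closed_closure compact_eq_bounded_closed)
  then show ?thesis
    using \<zeta> g sub test_support(2)[OF \<zeta>] by (auto simp: test_functions_def intro!: Ck_on_mult)
qed

lemma test_scale: "\<zeta> \<in> test_functions S \<Longrightarrow> (\<lambda>x. r * \<zeta> x) \<in> test_functions S"
  by (rule test_mult_smooth[OF _ Ck_on_const])

lemma test_zero: "(\<lambda>x. 0) \<in> test_functions S"
  by (simp add: test_functions_def Ck_on_const)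

lemma test_grad_mult:
  assumes "\<zeta> \<in> test_functions S" "\<xi> \<in> test_functions S"
  shows "test_grad (\<lambda>x. \<zeta> x * \<xi> x) x = \<zeta> x *\<^sub>R test_grad \<xi> x + \<xi> x *\<^sub>R test_grad \<zeta> x"
proof -
  have p: "(\<lambda>x. \<zeta> x * \<xi> x) \<in> test_functions S"
    using assms by (intro test_mult_smooth) (auto simp: test_functions_def)
  have "((\<lambda>x. \<zeta> x * \<xi> x) has_derivative
      (\<lambda>h. \<zeta> x * (test_grad \<xi> x \<bullet> h) + test_grad \<zeta> x \<bullet> h * \<xi> x)) (at x)"
    by (intro has_derivative_mult test_has_derivative[OF assms(1)] test_has_derivative[OF assms(2)])
  from has_derivative_unique[OF test_has_derivative[OF p] this]
  have "test_grad (\<lambda>x. \<zeta> x * \<xi> x) x \<bullet> h = (\<zeta> x *\<^sub>R test_grad \<xi> x + \<xi> x *\<^sub>R test_grad \<zeta> x) \<bullet> h" for h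
    by (simp add: fun_eq_iff inner_add_left mult.commute)
  then show ?thesis by (metis euclidean_eqI)
qed

lemma lborel_integral_translate:
  fixes f :: "'a::euclidean_space \<Rightarrow> real"
  assumes [measurable]: "f \<in> borel_measurable borel"
  shows "(LINT x|lborel. f (x + c)) = (LINT x|lborel. f x)"
proof -
  have "(LINT x|lborel. f x) = (LINT x|distr lborel borel ((+) c). f x)" by (simp add: lborel_distr_plus)
  also have "\<dots> = (LINT x|lborel. f (c + x))" by (subst integral_distr) auto
  finally show ?thesis by (simp add: add.commute)
qed

lemma lborel_nn_integral_translate:
  fixes f :: "'a::euclidean_space \<Rightarrow> ennreal"
  assumes [measurable]: "f \<in> borel_measurable borel"
  shows "(\<integral>\<^sup>+x. f (x + c) \<partial>lborel) = (\<integral>\<^sup>+x. f x \<partial>lborel)"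
proof -
  have "(\<integral>\<^sup>+x. f x \<partial>lborel) = (\<integral>\<^sup>+x. f x \<partial>distr lborel borel ((+) c))" by (simp add: lborel_distr_plus)
  also have "\<dots> = (\<integral>\<^sup>+x. f (c + x) \<partial>lborel)" by (subst nn_integral_distr) auto
  finally show ?thesis by (simp add: add.commute)
qed

text \<open>Difference quotients of \<zeta> integrate to 0 by translation invariance and converge to
  the directional derivative. Dominated convergence applies, as they all live on one ball and are
  bounded through a Lipschitz constant of \<zeta>.\<close>

lemma integral_test_grad_zero:
  fixes \<zeta> :: "'a::euclidean_space \<Rightarrow> real"
  assumes \<zeta>: "\<zeta> \<in> test_functions S"
  shows "(LINT x|lborel. test_grad \<zeta> x \<bullet> b) = 0"
proof -
  note [measurable] = test_borel[OF \<zeta>]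
  let ?K = "closure {x. \<zeta> x \<noteq> 0}"
  obtain B where B: "B > 0" "\<And>x. norm (test_grad \<zeta> x) \<le> B" using test_grad_bounded[OF \<zeta>] by blast
  have "bounded ?K" using test_support(1)[OF \<zeta>] by (rule compact_imp_bounded)
  then obtain R where R: "\<And>x. x \<in> ?K \<Longrightarrow> norm x \<le> R" by (auto simp: bounded_iff)
  define h where "h n = 1 / real (Suc n)" for n
  have h: "0 < h n" "h n \<le> 1" for n by (auto simp: h_def)
  have h0: "h \<longlonglongrightarrow> 0" unfolding h_def by (rule LIMSEQ_Suc[OF lim_1_over_n])
  define q where "q n x = (\<zeta> (x + h n *\<^sub>R b) - \<zeta> x) / h n" for n x
  have lip: "\<bar>\<zeta> x - \<zeta> y\<bar> \<le> B * norm (x - y)" for x y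
  proof -
    have "norm (\<zeta> x - \<zeta> y) \<le> B * norm (x - y)"
    proof (rule differentiable_bound[of UNIV])
      show "(\<zeta> has_derivative (\<lambda>h. test_grad \<zeta> x \<bullet> h)) (at x within UNIV)" for x
        using test_has_derivative[OF \<zeta>] .
      show "onorm (\<lambda>h. test_grad \<zeta> x \<bullet> h) \<le> B" for x
      proof (rule onorm_bound)
        fix y
        have "\<bar>test_grad \<zeta> x \<bullet> y\<bar> \<le> norm (test_grad \<zeta> x) * norm y" by (rule Cauchy_Schwarz_ineq2)
        also have "\<dots> \<le> B * norm y" using B by (intro mult_right_mono) auto
        finally show "norm (test_grad \<zeta> x \<bullet> y) \<le> B * norm y" by simp
      qed (use B in simp)
    qed auto
    then show ?thesis by simp
  qed
  \<comment> \<open>The steps \<open>h n\<close> are at most 1, so a point farther out than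
    \<open>R + norm b\<close> and its translate both miss the support.\<close>
  have q_bound: "norm (q n x) \<le> indicator (cball 0 (R + norm b)) x * (B * norm b)" for n x
  proof (cases "x \<in> cball 0 (R + norm b)")
    case True
    have "\<bar>\<zeta> (x + h n *\<^sub>R b) - \<zeta> x\<bar> \<le> B * (h n * norm b)"
      using lip[of "x + h n *\<^sub>R b" x] h(1)[of n] by simp
    then show ?thesis using True h(1)[of n] by (simp add: q_def field_simps)
  next
    case False
    then have x: "norm x > R + norm b" by (simp add: dist_norm)
    have "norm (h n *\<^sub>R b) \<le> norm b" using h[of n] by (simp add: mult_left_le_one_le)
    then have "norm (x + h n *\<^sub>R b) > R" using x norm_triangle_ineq4[of "x + h n *\<^sub>R b" "h n *\<^sub>R b"] by simp
    moreover have "norm x > R" using x norm_ge_zero[of b] by linarith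
    ultimately have "\<zeta> (x + h n *\<^sub>R b) = 0" "\<zeta> x = 0"
      using test_zero_outside(1)[OF \<zeta>] R by (meson not_le)+
    then show ?thesis using False by (simp add: q_def)
  qed
  have "(\<lambda>n. LINT x|lborel. q n x) \<longlonglongrightarrow> (LINT x|lborel. test_grad \<zeta> x \<bullet> b)"
  proof (rule integral_dominated_convergence[where w = "\<lambda>x. indicator (cball 0 (R + norm b)) x * (B * norm b)"])
    show "integrable lborel (\<lambda>x. indicator (cball 0 (R + norm b)) x * (B * norm b))"
      by (intro integrable_mult_left integrable_real_indicator)
        (use emeasure_bounded_finite[OF bounded_cball, of 0 "R + norm b"] in \<open>auto simp: infinity_ennreal_def\<close>)
    show "AE x in lborel. (\<lambda>n. q n x) \<longlonglongrightarrow> test_grad \<zeta> x \<bullet> b"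
    proof (intro AE_I2)
      fix x
      have "((\<lambda>t. \<zeta> (x + t *\<^sub>R b)) has_derivative (\<lambda>t. test_grad \<zeta> x \<bullet> (t *\<^sub>R b))) (at 0)"
      proof -
        have "((\<lambda>t::real. x + t *\<^sub>R b) has_derivative (\<lambda>t. t *\<^sub>R b)) (at 0)" by (auto intro!: derivative_eq_intros)
        moreover have "(\<zeta> has_derivative (\<lambda>h. test_grad \<zeta> x \<bullet> h)) (at (x + 0 *\<^sub>R b))"
          using test_has_derivative[OF \<zeta>, of x] by simp
        ultimately show ?thesis by (rule has_derivative_compose)
      qed
      then have "((\<lambda>t. \<zeta> (x + t *\<^sub>R b)) has_real_derivative (test_grad \<zeta> x \<bullet> b)) (at 0)"
        by (simp add: has_field_derivative_def mult_commute_abs)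
      then have "((\<lambda>t. (\<zeta> (x + t *\<^sub>R b) - \<zeta> x) / t) \<longlongrightarrow> test_grad \<zeta> x \<bullet> b) (at 0)"
        by (simp add: DERIV_def)
      moreover have "filterlim h (at 0) sequentially"
        unfolding filterlim_at using h0 h(1) by (auto intro!: always_eventually simp: less_imp_neq[OF h(1), symmetric])
      ultimately show "(\<lambda>n. q n x) \<longlonglongrightarrow> test_grad \<zeta> x \<bullet> b"
        unfolding q_def by (rule filterlim_compose)
    qed
  qed (use q_bound in \<open>auto simp: q_def\<close>)
  moreover have "(LINT x|lborel. q n x) = 0" for n
  proof -
    have i: "integrable lborel \<zeta>"
      by (rule continuous_vanishing_outside_support_integrable[OF \<zeta> test_continuous[OF \<zeta>] test_zero_outside(1)[OF \<zeta>]])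
    have "integrable (distr lborel borel ((+) (h n *\<^sub>R b))) \<zeta>" using i by (simp add: lborel_distr_plus)
    then have i': "integrable lborel (\<lambda>x. \<zeta> (x + h n *\<^sub>R b))"
      by (subst (asm) integrable_distr_eq) (auto simp: add.commute)
    show ?thesis unfolding q_def
      using lborel_integral_translate[of \<zeta> "h n *\<^sub>R b"] i i' by simp
  qed
  ultimately show ?thesis by (simp add: LIMSEQ_const_iff)
qed

text \<open>The product of the two functions is again a test function, so the integral of its
  derivative vanishes.\<close>

lemma test_integration_by_parts:
  assumes "\<zeta> \<in> test_functions S" "\<xi> \<in> test_functions S"
  shows "(LINT x|lborel. \<zeta> x * (test_grad \<xi> x \<bullet> b)) = - (LINT x|lborel. (test_grad \<zeta> x \<bullet> b) * \<xi> x)"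
proof -
  have p: "(\<lambda>x. \<zeta> x * \<xi> x) \<in> test_functions S"
    using assms by (intro test_mult_smooth) (auto simp: test_functions_def)
  have i: "integrable lborel (\<lambda>x. \<zeta> x * (test_grad \<xi> x \<bullet> b))" "integrable lborel (\<lambda>x. (test_grad \<zeta> x \<bullet> b) * \<xi> x)"
    by (rule continuous_vanishing_outside_support_integrable[OF assms(1)],
        intro continuous_intros test_continuous[OF assms(1)] test_continuous[OF assms(2)]
          test_grad_continuous[OF assms(1)] test_grad_continuous[OF assms(2)],
        drule test_zero_outside(1)[OF assms(1)] test_grad_zero_outside[OF assms(1)], simp)+
  have "0 = (LINT x|lborel. \<zeta> x * (test_grad \<xi> x \<bullet> b) + (test_grad \<zeta> x \<bullet> b) * \<xi> x)"
    using integral_test_grad_zero[OF p, of b] unfolding test_grad_mult[OF assms]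
    by (simp add: inner_add_left mult.commute)
  then show ?thesis using i by simp
qed

section \<open>Weak gradients\<close>

lemma AE_lebesgue_on_iff:
  "S \<in> sets lebesgue \<Longrightarrow> (AE x in lebesgue_on S. P x) \<longleftrightarrow> (AE x in lebesgue. x \<in> S \<longrightarrow> P x)"
  by (rule AE_restrict_space_iff) simp

lemma integrable_lebesgue_on_iff:
  fixes f :: "'a::euclidean_space \<Rightarrow> 'b::euclidean_space"
  shows "S \<in> sets lebesgue \<Longrightarrow> integrable (lebesgue_on S) f \<longleftrightarrow> integrable lebesgue (\<lambda>x. indicator S x *\<^sub>R f x)"
  by (rule integrable_restrict_space) simp

lemma integral_lebesgue_on_eq:
  fixes f :: "'a::euclidean_space \<Rightarrow> 'b::euclidean_space"
  shows "S \<in> sets lebesgue \<Longrightarrow> (LINT x|lebesgue_on S. f x) = (LINT x|lebesgue. indicator S x *\<^sub>R f x)"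
  by (rule integral_restrict_space) simp

lemma borel_measurable_lebesgue_on_iff:
  fixes f :: "'a::euclidean_space \<Rightarrow> 'b::euclidean_space"
  shows "S \<in> sets lebesgue \<Longrightarrow> f \<in> borel_measurable (lebesgue_on S) \<longleftrightarrow>
    (\<lambda>x. indicator S x *\<^sub>R f x) \<in> borel_measurable lebesgue"
  by (rule borel_measurable_restrict_space_iff) simp

lemma borel_measurable_lebesgue_onI:
  "f \<in> borel_measurable borel \<Longrightarrow> f \<in> borel_measurable (lebesgue_on S)"
  by (intro measurable_restrict_space1 measurable_completion) simp

lemma borel_measurable_lebesgue_on_AE:
  fixes f :: "'a::euclidean_space \<Rightarrow> 'b::euclidean_space"
  assumes S: "S \<in> sets lebesgue" and f: "f \<in> borel_measurable (lebesgue_on S)"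
    and eq: "AE x in lebesgue_on S. f x = g x"
  shows "g \<in> borel_measurable (lebesgue_on S)"
  unfolding borel_measurable_lebesgue_on_iff[OF S]
proof (rule borel_measurable_AE)
  show "(\<lambda>x. indicator S x *\<^sub>R f x) \<in> borel_measurable lebesgue"
    using f unfolding borel_measurable_lebesgue_on_iff[OF S] .
  show "AE x in lebesgue. indicator S x *\<^sub>R f x = indicator S x *\<^sub>R g x"
    using eq unfolding AE_lebesgue_on_iff[OF S] by eventually_elim (auto simp: indicator_def)
qed

lemma integral_lebesgue_on_borel:
  fixes f :: "'a::euclidean_space \<Rightarrow> real"
  assumes S: "S \<in> sets lebesgue" and f: "f \<in> borel_measurable borel" and 0: "\<And>x. x \<notin> S \<Longrightarrow> f x = 0"
  shows "(LINT x|lebesgue_on S. f x) = (LINT x|lborel. f x)"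
    and "integrable (lebesgue_on S) f \<longleftrightarrow> integrable lborel f"
proof -
  have eq: "(\<lambda>x. indicator S x *\<^sub>R f x) = f" using 0 by (auto simp: indicator_def fun_eq_iff)
  show "(LINT x|lebesgue_on S. f x) = (LINT x|lborel. f x)"
    unfolding integral_lebesgue_on_eq[OF S] eq using f by (intro integral_completion) simp
  show "integrable (lebesgue_on S) f \<longleftrightarrow> integrable lborel f"
    unfolding integrable_lebesgue_on_iff[OF S] eq using f by (intro integrable_completion) simp
qed

text \<open>Open boxes form an intersection-stable generator of the Borel sets, so a Dynkin argument
  extends the vanishing to integrals over all Borel sets. The integral over the whole space serves
  the complement step.\<close>

lemma AE_zero_of_box_integrals:
  fixes f :: "'a::euclidean_space \<Rightarrow> real"
  assumes f: "integrable lborel f" and box: "\<And>l u. (LINT x:box l u|lborel. f x) = 0"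
    and all: "(LINT x|lborel. f x) = 0"
  shows "AE x in lborel. f x = 0"
proof (rule sigma_finite_measure.density_zero[OF sigma_finite_lborel f])
  fix A :: "'a set" assume "A \<in> sets lborel"
  then have A: "A \<in> sigma_sets UNIV (range (\<lambda>(a, b). box a b))"
    by (simp add: borel_eq_box)
  have borel: "X \<in> sets borel" if "X \<in> sigma_sets UNIV (range (\<lambda>(a, b). box a b))" for X :: "'a set"
    using that by (simp add: borel_eq_box)
  have fX: "set_integrable lborel X f" if "X \<in> sets borel" for X
    unfolding set_integrable_def using f that by (intro integrable_mult_indicator) auto
  have "Int_stable (range (\<lambda>(a, b). box a b :: 'a set))"
    by (auto simp: Int_stable_def box_Int_box)
  moreover have "range (\<lambda>(a, b). box a b :: 'a set) \<subseteq> Pow UNIV" by simp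
  ultimately show "set_lebesgue_integral lborel A f = 0"
    using A
  proof (induction rule: sigma_sets_induct_disjoint)
    case (basic A)
    then show ?case using box by auto
  next
    case empty
    then show ?case by (simp add: set_lebesgue_integral_def)
  next
    case (compl A)
    have "set_lebesgue_integral lborel (A \<union> (UNIV - A)) f
        = set_lebesgue_integral lborel A f + set_lebesgue_integral lborel (UNIV - A) f"
      using borel[OF compl(1)] by (intro set_integral_Un fX) auto
    moreover have "set_lebesgue_integral lborel (A \<union> (UNIV - A)) f = (LINT x|lborel. f x)"
      by (simp add: set_lebesgue_integral_def)
    ultimately show ?case using compl all by simp
  next
    case (union A)
    have "set_lebesgue_integral lborel (\<Union>i. A i) f = (\<Sum>i. set_lebesgue_integral lborel (A i) f)"
    proof (rule lebesgue_integral_countable_add)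
      show "A i \<in> sets lborel" for i using borel union(2) by auto
      show "A i \<inter> A j = {}" if "i \<noteq> j" for i j using union(1) that by (auto simp: disjoint_family_on_def)
      show "set_integrable lborel (\<Union>i. A i) f" using borel union(2) by (intro fX sets.countable_UN) auto
    qed
    then show ?case using union(3) by simp
  qed
qed

lemma L1_loc_mult_integrable:
  fixes v :: "'a::euclidean_space \<Rightarrow> 'b::euclidean_space"
  assumes v: "v \<in> L1_loc \<Omega>" and K: "compact K" "K \<subseteq> \<Omega>" and \<Omega>: "\<Omega> \<in> sets lebesgue"
    and f: "f \<in> borel_measurable borel" "\<And>x. \<bar>f x\<bar> \<le> B" "\<And>x. x \<notin> K \<Longrightarrow> f x = 0"
  shows "integrable (lebesgue_on \<Omega>) (\<lambda>x. f x *\<^sub>R v x)"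
proof -
  have KL: "K \<in> sets lebesgue" using K(1) by (simp add: compact_imp_closed)
  have vK: "integrable lebesgue (\<lambda>x. indicator K x *\<^sub>R v x)"
    using v K unfolding L1_loc_def integrable_lebesgue_on_iff[OF KL, symmetric] by blast
  have fm: "f \<in> borel_measurable lebesgue" using f(1) by (intro measurable_completion) simp
  have "integrable lebesgue (\<lambda>x. f x *\<^sub>R (indicator K x *\<^sub>R v x))"
  proof (rule Bochner_Integration.integrable_bound[of _ "\<lambda>x. B *\<^sub>R (indicator K x *\<^sub>R v x)"])
    show "integrable lebesgue (\<lambda>x. B *\<^sub>R (indicator K x *\<^sub>R v x))"
      using vK by (intro integrable_scaleR_right)
    show "(\<lambda>x. f x *\<^sub>R (indicator K x *\<^sub>R v x)) \<in> borel_measurable lebesgue"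
      using fm borel_measurable_integrable[OF vK] by (rule borel_measurable_scaleR)
    show "AE x in lebesgue. norm (f x *\<^sub>R (indicator K x *\<^sub>R v x)) \<le> norm (B *\<^sub>R (indicator K x *\<^sub>R v x))"
    proof (intro AE_I2)
      fix x
      have "\<bar>f x\<bar> \<le> \<bar>B\<bar>" using f(2)[of x] by linarith
      then show "norm (f x *\<^sub>R (indicator K x *\<^sub>R v x)) \<le> norm (B *\<^sub>R (indicator K x *\<^sub>R v x))"
        unfolding norm_scaleR by (rule mult_right_mono) simp
    qed
  qed
  moreover have "(\<lambda>x. f x *\<^sub>R (indicator K x *\<^sub>R v x)) = (\<lambda>x. indicator \<Omega> x *\<^sub>R (f x *\<^sub>R v x))"
    using K(2) f(3) by (auto simp: indicator_def fun_eq_iff)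
  ultimately show ?thesis unfolding integrable_lebesgue_on_iff[OF \<Omega>] by (simp only:)
qed

lemma L1_loc_test_integrable:
  fixes v :: "'a::euclidean_space \<Rightarrow> 'b::euclidean_space"
  assumes "v \<in> L1_loc \<Omega>" "\<zeta> \<in> test_functions \<Omega>" "\<Omega> \<in> sets lebesgue"
  shows "integrable (lebesgue_on \<Omega>) (\<lambda>x. \<zeta> x *\<^sub>R v x)"
    and "integrable (lebesgue_on \<Omega>) (\<lambda>x. (test_grad \<zeta> x \<bullet> b) *\<^sub>R v x)"
proof -
  note [measurable] = test_borel[OF assms(2)]
  obtain B where B: "\<And>x. \<bar>\<zeta> x\<bar> \<le> B" using test_bounded[OF assms(2)] by blast
  show "integrable (lebesgue_on \<Omega>) (\<lambda>x. \<zeta> x *\<^sub>R v x)"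
    by (rule L1_loc_mult_integrable[OF assms(1) test_support[OF assms(2)] assms(3) test_borel(1)[OF assms(2)] B
          test_zero_outside(1)[OF assms(2)]])
  obtain B' where B': "\<And>x. norm (test_grad \<zeta> x) \<le> B'" using test_grad_bounded[OF assms(2)] by blast
  have "\<bar>test_grad \<zeta> x \<bullet> b\<bar> \<le> B' * norm b" for x
    using Cauchy_Schwarz_ineq2[of "test_grad \<zeta> x" b] mult_right_mono[OF B', of "norm b" x] by simp
  moreover have "test_grad \<zeta> x \<bullet> b = 0" if "x \<notin> closure {x. \<zeta> x \<noteq> 0}" for x
    using test_grad_zero_outside[OF assms(2) that] by simp
  ultimately show "integrable (lebesgue_on \<Omega>) (\<lambda>x. (test_grad \<zeta> x \<bullet> b) *\<^sub>R v x)"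
    by (intro L1_loc_mult_integrable[OF assms(1) test_support[OF assms(2)] assms(3)]) auto
qed

lemma L1_loc_lincomb:
  fixes u v :: "'a::euclidean_space \<Rightarrow> 'b::euclidean_space"
  shows "u \<in> L1_loc \<Omega> \<Longrightarrow> v \<in> L1_loc \<Omega> \<Longrightarrow> (\<lambda>x. u x + r *\<^sub>R v x) \<in> L1_loc \<Omega>"
  by (auto simp: L1_loc_def)

text \<open>Bump functions tending to indicators give vanishing integrals over all boxes whose
  closed box lies in \<Omega>. Inside one such box the Dynkin argument applies, and countably many
  closed boxes cover \<Omega>.\<close>

lemma fundamental_lemma:
  fixes g :: "'a::euclidean_space \<Rightarrow> real"
  assumes \<Omega>: "open \<Omega>" and g: "g \<in> L1_loc \<Omega>"
    and zero: "\<And>\<zeta>. \<zeta> \<in> test_functions \<Omega> \<Longrightarrow> (LINT x|lebesgue_on \<Omega>. g x * \<zeta> x) = 0"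
  shows "AE x in lebesgue_on \<Omega>. g x = 0"
proof -
  have \<Omega>L: "\<Omega> \<in> sets lebesgue" using \<Omega> by simp
  have gbox: "integrable lebesgue (\<lambda>x. indicator (box l u) x *\<^sub>R g x)"
    and box: "(LINT x|lebesgue. indicator (box l u) x *\<^sub>R g x) = 0" if sub: "cbox l u \<subseteq> \<Omega>" for l u
  proof -
    have dom: "integrable (lebesgue_on \<Omega>) (\<lambda>x. indicat_real (cbox l u) x *\<^sub>R g x)"
      by (rule L1_loc_mult_integrable[OF g compact_cbox sub \<Omega>L, of _ 1]) (auto simp: indicator_def)
    have gm: "(\<lambda>x. f x * (indicator (cbox l u) x *\<^sub>R g x)) \<in> borel_measurable (lebesgue_on \<Omega>)"
      if "f \<in> borel_measurable borel" for f :: "'a \<Rightarrow> real"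
      using borel_measurable_lebesgue_onI[OF that] borel_measurable_integrable[OF dom]
      by (rule borel_measurable_times)
    note bump = box_bump_test_function[OF sub]
    have eq: "box_bump l u n x * (indicator (cbox l u) x *\<^sub>R g x) = g x * box_bump l u n x" for n x
      using box_bump_nonzero_iff[of l u n x] box_subset_cbox[of l u] by (auto simp: indicator_def)
    have eq': "indicator (box l u) x * (indicator (cbox l u) x *\<^sub>R g x) = indicator (box l u) x *\<^sub>R g x" for x
      using box_subset_cbox[of l u] by (auto simp: indicator_def)
    have "(\<lambda>n. LINT x|lebesgue_on \<Omega>. g x * box_bump l u n x) \<longlonglongrightarrow>
        (LINT x|lebesgue_on \<Omega>. indicator (box l u) x *\<^sub>R g x)"
    proof (rule integral_dominated_convergence[where w = "\<lambda>x. norm (indicat_real (cbox l u) x *\<^sub>R g x)"])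
      show "(\<lambda>x. indicator (box l u) x *\<^sub>R g x) \<in> borel_measurable (lebesgue_on \<Omega>)"
        unfolding eq'[symmetric] by (rule gm) simp
      show "(\<lambda>x. g x * box_bump l u n x) \<in> borel_measurable (lebesgue_on \<Omega>)" for n
        unfolding eq[symmetric] by (rule gm) (rule test_borel(1)[OF bump])
      show "integrable (lebesgue_on \<Omega>) (\<lambda>x. norm (indicat_real (cbox l u) x *\<^sub>R g x))"
        using dom by (rule integrable_norm)
      show "AE x in lebesgue_on \<Omega>. (\<lambda>n. g x * box_bump l u n x) \<longlonglongrightarrow> indicator (box l u) x *\<^sub>R g x"
      proof (rule AE_I2)
        show "(\<lambda>n. g x * box_bump l u n x) \<longlonglongrightarrow> indicator (box l u) x *\<^sub>R g x" for x
          using tendsto_mult_left[OF box_bump_tendsto[of l u x], of "g x"] by (simp add: mult.commute)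
      qed
      show "AE x in lebesgue_on \<Omega>. norm (g x * box_bump l u n x) \<le> norm (indicat_real (cbox l u) x *\<^sub>R g x)" for n
      proof (rule AE_I2)
        fix x
        have "norm (g x * box_bump l u n x) = box_bump l u n x * norm (indicat_real (cbox l u) x *\<^sub>R g x)"
          unfolding eq[symmetric] using box_bump_nonneg[of l u n x] by (simp add: abs_mult)
        also have "\<dots> \<le> 1 * norm (indicat_real (cbox l u) x *\<^sub>R g x)"
          by (intro mult_right_mono box_bump_le_1 norm_ge_zero)
        finally show "norm (g x * box_bump l u n x) \<le> norm (indicat_real (cbox l u) x *\<^sub>R g x)" by simp
      qed
    qed
    then have 0: "(LINT x|lebesgue_on \<Omega>. indicator (box l u) x *\<^sub>R g x) = 0"
      using zero[OF bump] by (simp add: LIMSEQ_const_iff)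
    have \<Omega>eq: "indicat_real \<Omega> x *\<^sub>R (indicator (box l u) x *\<^sub>R g x) = indicator (box l u) x *\<^sub>R g x" for x
      using sub box_subset_cbox[of l u] by (auto simp: indicator_def)
    show "(LINT x|lebesgue. indicator (box l u) x *\<^sub>R g x) = 0"
      using 0 unfolding integral_lebesgue_on_eq[OF \<Omega>L] \<Omega>eq .
    have "integrable (lebesgue_on \<Omega>) (\<lambda>x. indicat_real (box l u) x *\<^sub>R g x)"
      using dom
    proof (rule Bochner_Integration.integrable_bound)
      show "(\<lambda>x. indicator (box l u) x *\<^sub>R g x) \<in> borel_measurable (lebesgue_on \<Omega>)"
        unfolding eq'[symmetric] by (rule gm) simp
      show "AE x in lebesgue_on \<Omega>. norm (indicat_real (box l u) x *\<^sub>R g x)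
          \<le> norm (indicat_real (cbox l u) x *\<^sub>R g x)"
        using box_subset_cbox[of l u] by (intro AE_I2) (auto simp: indicator_def)
    qed
    then show "integrable lebesgue (\<lambda>x. indicator (box l u) x *\<^sub>R g x)"
      unfolding integrable_lebesgue_on_iff[OF \<Omega>L] \<Omega>eq .
  qed
  have on_box: "AE x in lebesgue. x \<in> cbox l u \<longrightarrow> g x = 0" if sub: "cbox l u \<subseteq> \<Omega>" for l u
  proof -
    let ?h = "\<lambda>x. indicat_real (box l u) x *\<^sub>R g x"
    \<comment> \<open>The Dynkin argument concerns Borel sets, so the Lebesgue measurable function
      is replaced by a Borel representative.\<close>
    obtain h where h [measurable]: "h \<in> borel_measurable lborel" and eq: "AE x in lborel. ?h x = h x"
      using completion_ex_borel_measurable_real[OF borel_measurable_integrable[OF gbox[OF sub]]] by blast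
    have eqL: "AE x in lebesgue. ?h x = h x" using eq by (rule AE_completion)
    have hL: "h \<in> borel_measurable lebesgue" using h by (rule measurable_completion)
    have "integrable lebesgue h"
      using gbox[OF sub] integrable_cong_AE[OF borel_measurable_integrable[OF gbox[OF sub]] hL eqL] by blast
    then have hi: "integrable lborel h" using integrable_completion[OF h] by blast
    have set_int: "(LINT x|lborel. indicator X x *\<^sub>R h x) = (LINT x|lebesgue. indicator X x *\<^sub>R ?h x)"
      if [measurable]: "X \<in> sets borel" for X
    proof -
      have Xh: "(\<lambda>x. indicator X x *\<^sub>R h x) \<in> borel_measurable lborel" by measurable
      have "(LINT x|lborel. indicator X x *\<^sub>R h x) = (LINT x|lebesgue. indicator X x *\<^sub>R h x)"
        by (rule integral_completion[OF Xh, symmetric])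
      also have "\<dots> = (LINT x|lebesgue. indicator X x *\<^sub>R ?h x)"
      proof (rule integral_cong_AE)
        show "(\<lambda>x. indicator X x *\<^sub>R h x) \<in> borel_measurable lebesgue" using Xh by (rule measurable_completion)
        have "integrable lebesgue (\<lambda>x. indicator X x *\<^sub>R ?h x)"
          using that by (intro integrable_mult_indicator gbox[OF sub]) simp
        then show "(\<lambda>x. indicator X x *\<^sub>R ?h x) \<in> borel_measurable lebesgue"
          by (rule borel_measurable_integrable)
        show "AE x in lebesgue. indicator X x *\<^sub>R h x = indicator X x *\<^sub>R ?h x"
          using eqL by eventually_elim simp
      qed
      finally show ?thesis .
    qed
    have "AE x in lborel. h x = 0"
    proof (rule AE_zero_of_box_integrals[OF hi])
      show "(LINT x:box l' u'|lborel. h x) = 0" for l' u'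
      proof -
        \<comment> \<open>The intersection of two open boxes is an open box. If it is empty, the
          inverted corners \<open>One\<close> and \<open>0\<close> represent it, which keeps its
          closed box inside \<Omega>.\<close>
        obtain l'' u'' where lu: "box l' u' \<inter> box l u = box l'' u''" and sub'': "cbox l'' u'' \<subseteq> \<Omega>"
        proof (cases "box l' u' \<inter> box l u = {}")
          case True
          have "box One (0::'a) = {}" "cbox One (0::'a) = {}"
            by (auto simp: box_eq_empty intro!: SOME_Basis)
          then show ?thesis using that[of One 0] True by simp
        next
          case False
          obtain l'' u'' where lu: "box l' u' \<inter> box l u = box l'' u''" using box_Int_box[of l' u' l u] by blast
          then have "box l'' u'' \<subseteq> box l u" "box l'' u'' \<noteq> {}" using False by auto
          moreover have "box l'' u'' \<subseteq> cbox l u" using calculation(1) box_subset_cbox[of l u] by (rule subset_trans)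
          ultimately have "cbox l'' u'' \<subseteq> cbox l u"
            using closure_minimal[OF _ closed_cbox, of "box l'' u''" l u] closure_box[of l'' u''] by simp
          then show ?thesis using that[OF lu] sub by blast
        qed
        have "indicator (box l' u') x *\<^sub>R ?h x = indicator (box l'' u'') x *\<^sub>R g x" for x
          unfolding lu[symmetric] by (simp add: indicator_inter_arith)
        then show ?thesis
          unfolding set_lebesgue_integral_def set_int[OF borel_open[OF open_box]] using box[OF sub''] by (simp only:)
      qed
      show "(LINT x|lborel. h x) = 0"
        using set_int[of UNIV] box[OF sub] by simp
    qed
    then have "AE x in lebesgue. h x = 0" by (rule AE_completion)
    \<comment> \<open>The faces are null; this passes from the open box, on which \<open>h\<close>
      represents \<open>g\<close>, to the closed box.\<close>
    moreover have "AE x in lebesgue. x \<notin> cbox l u - box l u"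
    proof (rule AE_not_in)
      have "negligible (cbox l u - box l u)" by (rule negligible_frontier_interval)
      then show "cbox l u - box l u \<in> null_sets lebesgue" by (simp add: negligible_iff_null_sets)
    qed
    ultimately show ?thesis using eqL by eventually_elim (auto simp: indicator_def split: if_splits)
  qed
  obtain D where D: "countable D" "D \<subseteq> Pow \<Omega>" "\<And>X. X \<in> D \<Longrightarrow> \<exists>a b. X = cbox a b" "\<Union>D = \<Omega>"
    using open_countable_Union_open_cbox[OF \<Omega>] by blast
  have "AE x in lebesgue. \<forall>X\<in>D. x \<in> X \<longrightarrow> g x = 0"
    unfolding AE_ball_countable[OF D(1)]
  proof
    fix X assume X: "X \<in> D"
    then obtain a b where "X = cbox a b" using D(3) by blast
    then show "AE x in lebesgue. x \<in> X \<longrightarrow> g x = 0" using on_box X D(2) by blast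
  qed
  then show ?thesis
    unfolding AE_lebesgue_on_iff[OF \<Omega>L] by eventually_elim (use D(4) in blast)
qed

text \<open>The basis vector can be pulled out of the integral because local integrability of
  \<open>G\<close> makes \<zeta> G integrable. In this form linearity in the pair of function and
  gradient reduces to linearity of the integral.\<close>

lemma has_weak_gradient_iff:
  assumes \<Omega>: "\<Omega> \<in> sets lebesgue"
  shows "has_weak_gradient \<Omega> u G \<longleftrightarrow> u \<in> L1_loc \<Omega> \<and> G \<in> L1_loc \<Omega> \<and>
     (\<forall>\<zeta>\<in>test_functions \<Omega>. \<forall>b\<in>Basis.
        (LINT x|lebesgue_on \<Omega>. (test_grad \<zeta> x \<bullet> b) *\<^sub>R u x) = - (LINT x|lebesgue_on \<Omega>. \<zeta> x *\<^sub>R G x) \<bullet> b)"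
proof -
  have "(LINT x|lebesgue_on \<Omega>. u x * frechet_derivative \<zeta> (at x) b) = - (LINT x|lebesgue_on \<Omega>. (G x \<bullet> b) * \<zeta> x)
    \<longleftrightarrow> (LINT x|lebesgue_on \<Omega>. (test_grad \<zeta> x \<bullet> b) *\<^sub>R u x) = - (LINT x|lebesgue_on \<Omega>. \<zeta> x *\<^sub>R G x) \<bullet> b"
    if G: "G \<in> L1_loc \<Omega>" and \<zeta>: "\<zeta> \<in> test_functions \<Omega>" and b: "b \<in> Basis" for \<zeta> b
  proof -
    have "(LINT x|lebesgue_on \<Omega>. (\<zeta> x *\<^sub>R G x) \<bullet> b) = (LINT x|lebesgue_on \<Omega>. \<zeta> x *\<^sub>R G x) \<bullet> b"
      using L1_loc_test_integrable(1)[OF G \<zeta> \<Omega>] by (intro integral_inner_left)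
    then show ?thesis
      by (simp add: test_partial[OF \<zeta> b] mult.commute)
  qed
  then show ?thesis unfolding has_weak_gradient_def by blast
qed

text \<open>This makes the arbitrary representative \<open>wgrad\<close> harmless. The difference of
  two weak gradients is annihilated by all test functions, component by component.\<close>

lemma weak_gradient_unique:
  assumes \<Omega>: "open \<Omega>" and G: "has_weak_gradient \<Omega> u G" and H: "has_weak_gradient \<Omega> u H"
  shows "AE x in lebesgue_on \<Omega>. G x = H x"
proof -
  have \<Omega>L: "\<Omega> \<in> sets lebesgue" using \<Omega> by simp
  note G = G[unfolded has_weak_gradient_iff[OF \<Omega>L]] and H = H[unfolded has_weak_gradient_iff[OF \<Omega>L]]
  have d: "(\<lambda>x. G x + (-1) *\<^sub>R H x) \<in> L1_loc \<Omega>" using G H by (intro L1_loc_lincomb) auto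
  have "AE x in lebesgue_on \<Omega>. (G x + (-1) *\<^sub>R H x) \<bullet> b = 0" if b: "b \<in> Basis" for b
  proof (rule fundamental_lemma[OF \<Omega>])
    show "(\<lambda>x. (G x + (-1) *\<^sub>R H x) \<bullet> b) \<in> L1_loc \<Omega>" using d by (auto simp: L1_loc_def)
    fix \<zeta> assume \<zeta>: "\<zeta> \<in> test_functions \<Omega>"
    note i = L1_loc_test_integrable(1)[OF _ \<zeta> \<Omega>L]
    have "(LINT x|lebesgue_on \<Omega>. (\<zeta> x *\<^sub>R (G x + (-1) *\<^sub>R H x)) \<bullet> b)
        = (LINT x|lebesgue_on \<Omega>. \<zeta> x *\<^sub>R (G x + (-1) *\<^sub>R H x)) \<bullet> b"
      using i[OF d] by (intro integral_inner_left)
    also have "(LINT x|lebesgue_on \<Omega>. \<zeta> x *\<^sub>R (G x + (-1) *\<^sub>R H x))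
        = (LINT x|lebesgue_on \<Omega>. \<zeta> x *\<^sub>R G x) - (LINT x|lebesgue_on \<Omega>. \<zeta> x *\<^sub>R H x)"
      using i[of G] i[of H] G H by (simp add: scaleR_diff_right)
    also have "\<dots> \<bullet> b = 0"
    proof -
      have "- (LINT x|lebesgue_on \<Omega>. \<zeta> x *\<^sub>R G x) \<bullet> b = - (LINT x|lebesgue_on \<Omega>. \<zeta> x *\<^sub>R H x) \<bullet> b"
        using bspec[OF bspec[OF conjunct2[OF conjunct2[OF G]] \<zeta>] b]
          bspec[OF bspec[OF conjunct2[OF conjunct2[OF H]] \<zeta>] b] by (rule trans[OF sym])
      then show ?thesis by (simp add: inner_diff_left)
    qed
    finally show "(LINT x|lebesgue_on \<Omega>. (G x + (-1) *\<^sub>R H x) \<bullet> b * \<zeta> x) = 0"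
      by (simp add: mult.commute)
  qed
  then have "AE x in lebesgue_on \<Omega>. \<forall>b\<in>Basis. (G x + (-1) *\<^sub>R H x) \<bullet> b = 0"
    by (intro AE_finite_allI) auto
  then show ?thesis
  proof eventually_elim
    case (elim x)
    have "G x + (-1) *\<^sub>R H x = 0"
    proof (rule euclidean_eqI)
      show "(G x + (-1) *\<^sub>R H x) \<bullet> b = 0 \<bullet> b" if "b \<in> Basis" for b
        using bspec[OF elim that] by (simp only: inner_zero_left)
    qed
    then show ?case by simp
  qed
qed

lemma weak_gradient_lincomb:
  assumes \<Omega>: "\<Omega> \<in> sets lebesgue" and u: "has_weak_gradient \<Omega> u G" and v: "has_weak_gradient \<Omega> v H"
  shows "has_weak_gradient \<Omega> (\<lambda>x. u x + r * v x) (\<lambda>x. G x + r *\<^sub>R H x)"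
proof -
  note u = u[unfolded has_weak_gradient_iff[OF \<Omega>]] and v = v[unfolded has_weak_gradient_iff[OF \<Omega>]]
  have L: "(\<lambda>x. u x + r *\<^sub>R v x) \<in> L1_loc \<Omega>" "(\<lambda>x. G x + r *\<^sub>R H x) \<in> L1_loc \<Omega>"
    by (intro L1_loc_lincomb conjunct1[OF u] conjunct1[OF v] conjunct1[OF conjunct2[OF u]] conjunct1[OF conjunct2[OF v]])+
  have "(LINT x|lebesgue_on \<Omega>. (test_grad \<zeta> x \<bullet> b) *\<^sub>R (u x + r *\<^sub>R v x))
      = - (LINT x|lebesgue_on \<Omega>. \<zeta> x *\<^sub>R (G x + r *\<^sub>R H x)) \<bullet> b"
    if \<zeta>: "\<zeta> \<in> test_functions \<Omega>" and b: "b \<in> Basis" for \<zeta> b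
  proof -
    note i = L1_loc_test_integrable[OF _ \<zeta> \<Omega>]
    have "(LINT x|lebesgue_on \<Omega>. (test_grad \<zeta> x \<bullet> b) *\<^sub>R (u x + r *\<^sub>R v x))
        = (LINT x|lebesgue_on \<Omega>. (test_grad \<zeta> x \<bullet> b) *\<^sub>R u x + r *\<^sub>R ((test_grad \<zeta> x \<bullet> b) *\<^sub>R v x))"
      by (simp add: algebra_simps)
    also have "\<dots> = (LINT x|lebesgue_on \<Omega>. (test_grad \<zeta> x \<bullet> b) *\<^sub>R u x)
        + r *\<^sub>R (LINT x|lebesgue_on \<Omega>. (test_grad \<zeta> x \<bullet> b) *\<^sub>R v x)"
      unfolding Bochner_Integration.integral_add[OF i(2)[OF conjunct1[OF u]]
          integrable_scaleR_right[OF i(2)[OF conjunct1[OF v]]]] integral_scaleR_right ..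
    also have "\<dots> = - (LINT x|lebesgue_on \<Omega>. \<zeta> x *\<^sub>R G x) \<bullet> b + r *\<^sub>R (- (LINT x|lebesgue_on \<Omega>. \<zeta> x *\<^sub>R H x) \<bullet> b)"
      using u v \<zeta> b by simp
    also have "\<dots> = - ((LINT x|lebesgue_on \<Omega>. \<zeta> x *\<^sub>R G x) + r *\<^sub>R (LINT x|lebesgue_on \<Omega>. \<zeta> x *\<^sub>R H x)) \<bullet> b"
      by (simp add: inner_add_left inner_diff_left inner_minus_left)
    also have "(LINT x|lebesgue_on \<Omega>. \<zeta> x *\<^sub>R G x) + r *\<^sub>R (LINT x|lebesgue_on \<Omega>. \<zeta> x *\<^sub>R H x)
        = (LINT x|lebesgue_on \<Omega>. \<zeta> x *\<^sub>R G x + r *\<^sub>R (\<zeta> x *\<^sub>R H x))"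
      unfolding Bochner_Integration.integral_add[OF i(1)[OF conjunct1[OF conjunct2[OF u]]]
          integrable_scaleR_right[OF i(1)[OF conjunct1[OF conjunct2[OF v]]]]] integral_scaleR_right ..
    also have "\<dots> = (LINT x|lebesgue_on \<Omega>. \<zeta> x *\<^sub>R (G x + r *\<^sub>R H x))"
      by (simp add: algebra_simps)
    finally show ?thesis .
  qed
  with L show ?thesis unfolding has_weak_gradient_iff[OF \<Omega>] by simp
qed

lemma test_function_weak_gradient:
  assumes \<Omega>: "\<Omega> \<in> sets lebesgue" and \<zeta>: "\<zeta> \<in> test_functions \<Omega>"
  shows "has_weak_gradient \<Omega> \<zeta> (test_grad \<zeta>)"
proof -
  have loc: "f \<in> L1_loc \<Omega>" if "continuous_on UNIV f" for f :: "'a \<Rightarrow> 'b::euclidean_space"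
    unfolding L1_loc_def
  proof safe
    fix K :: "'a set" assume K: "compact K"
    have "integrable lborel (\<lambda>x. indicator K x *\<^sub>R f x)"
      using K that by (intro borel_integrable_compact[unfolded set_integrable_def]) (auto intro: continuous_on_subset)
    then have "integrable lebesgue (\<lambda>x. indicator K x *\<^sub>R f x)"
      using integrable_completion[OF borel_measurable_integrable] by blast
    then show "integrable (lebesgue_on K) f"
      using K by (subst integrable_lebesgue_on_iff) (auto simp: compact_imp_closed)
  qed
  have "(LINT x|lebesgue_on \<Omega>. \<zeta> x * frechet_derivative \<xi> (at x) b) = - (LINT x|lebesgue_on \<Omega>. (test_grad \<zeta> x \<bullet> b) * \<xi> x)"
    if \<xi>: "\<xi> \<in> test_functions \<Omega>" and b: "b \<in> Basis" for \<xi> b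
  proof -
    note [measurable] = test_borel[OF \<zeta>] test_borel[OF \<xi>]
    have "(LINT x|lebesgue_on \<Omega>. \<zeta> x * (test_grad \<xi> x \<bullet> b)) = (LINT x|lborel. \<zeta> x * (test_grad \<xi> x \<bullet> b))"
      by (intro integral_lebesgue_on_borel(1)[OF \<Omega>]) (simp_all add: test_zero_outside(2)[OF \<zeta>])
    moreover have "(LINT x|lebesgue_on \<Omega>. (test_grad \<zeta> x \<bullet> b) * \<xi> x) = (LINT x|lborel. (test_grad \<zeta> x \<bullet> b) * \<xi> x)"
      by (intro integral_lebesgue_on_borel(1)[OF \<Omega>]) (simp_all add: test_zero_outside(2)[OF \<xi>])
    ultimately show ?thesis
      using test_integration_by_parts[OF \<zeta> \<xi>] by (simp add: test_partial[OF \<xi> b])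
  qed
  with loc[OF test_continuous[OF \<zeta>]] loc[OF test_grad_continuous[OF \<zeta>]] show ?thesis
    unfolding has_weak_gradient_def by blast
qed

text \<open>Parallelogram law with one nonnegative term dropped. It takes the place of the triangle
  inequality in the density arguments, where only squared seminorms occur.\<close>

lemma nonneg_form_sum_bound:
  assumes "nonneg_form V B" "u \<in> V" "v \<in> V"
  shows "B (\<lambda>x. u x + r * v x) (\<lambda>x. u x + r * v x) \<le> 2 * B u u + 2 * r\<^sup>2 * B v v"
proof -
  interpret nonneg_form V B by fact
  have "0 \<le> B (\<lambda>x. u x + (- r) * v x) (\<lambda>x. u x + (- r) * v x)"
    by (intro nonneg add_mem scale_mem assms)
  then show ?thesis using quadratic_add[OF assms(2,3), of r] quadratic_add[OF assms(2,3), of "- r"]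
    by (simp add: algebra_simps)
qed

section \<open>The spaces \<open>L\<^sup>2\<close>, \<open>H\<^sup>1\<close> and \<open>H\<^sup>1\<^sub>0\<close>\<close>

lemma L2_iff: "u \<in> L2 S \<longleftrightarrow> u \<in> borel_measurable (lebesgue_on S) \<and> integrable (lebesgue_on S) (\<lambda>x. (norm (u x))\<^sup>2)"
  by (simp add: L2_def)

lemma L2_lincomb:
  fixes u v :: "'a::euclidean_space \<Rightarrow> 'b::euclidean_space"
  assumes u: "u \<in> L2 S" and v: "v \<in> L2 S"
  shows "(\<lambda>x. u x + r *\<^sub>R v x) \<in> L2 S"
proof -
  note [measurable] = conjunct1[OF u[unfolded L2_iff]] conjunct1[OF v[unfolded L2_iff]]
  have "integrable (lebesgue_on S) (\<lambda>x. (norm (u x + r *\<^sub>R v x))\<^sup>2)"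
  proof (rule Bochner_Integration.integrable_bound)
    show "integrable (lebesgue_on S) (\<lambda>x. 2 * (norm (u x))\<^sup>2 + 2 * r\<^sup>2 * (norm (v x))\<^sup>2)"
      using u v by (simp add: L2_iff)
    show "AE x in lebesgue_on S. norm ((norm (u x + r *\<^sub>R v x))\<^sup>2) \<le> norm (2 * (norm (u x))\<^sup>2 + 2 * r\<^sup>2 * (norm (v x))\<^sup>2)"
    proof (rule AE_I2)
      fix x
      have "(norm (u x + r *\<^sub>R v x))\<^sup>2 \<le> (norm (u x) + \<bar>r\<bar> * norm (v x))\<^sup>2"
        using norm_triangle_ineq[of "u x" "r *\<^sub>R v x"] by (intro power_mono) auto
      also have "\<dots> \<le> 2 * (norm (u x))\<^sup>2 + 2 * (\<bar>r\<bar> * norm (v x))\<^sup>2"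
        using sum_squares_bound[of "norm (u x)" "\<bar>r\<bar> * norm (v x)"] by (simp add: power2_sum)
      finally show "norm ((norm (u x + r *\<^sub>R v x))\<^sup>2) \<le> norm (2 * (norm (u x))\<^sup>2 + 2 * r\<^sup>2 * (norm (v x))\<^sup>2)"
        by (simp add: power_mult_distrib)
    qed
  qed measurable
  then show ?thesis by (simp add: L2_iff)
qed

lemma L2_cong_AE:
  fixes u v :: "'a::euclidean_space \<Rightarrow> 'b::euclidean_space"
  assumes S: "S \<in> sets lebesgue" and u: "u \<in> L2 S" and eq: "AE x in lebesgue_on S. u x = v x"
  shows "v \<in> L2 S"
proof -
  have v: "v \<in> borel_measurable (lebesgue_on S)"
    using borel_measurable_lebesgue_on_AE[OF S _ eq] u by (simp add: L2_iff)
  moreover have "integrable (lebesgue_on S) (\<lambda>x. (norm (v x))\<^sup>2)"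
  proof (rule integrable_cong_AE_imp)
    show "integrable (lebesgue_on S) (\<lambda>x. (norm (u x))\<^sup>2)" using u by (simp add: L2_iff)
    show "(\<lambda>x. (norm (v x))\<^sup>2) \<in> borel_measurable (lebesgue_on S)" using v by measurable
    show "AE x in lebesgue_on S. (norm (u x))\<^sup>2 = (norm (v x))\<^sup>2" using eq by eventually_elim simp
  qed
  ultimately show ?thesis by (simp add: L2_iff)
qed

text \<open>The coefficients that occur are compositions such as a(\<phi>), whose bounds hold only
  almost everywhere because |\<phi>| \<le> 1 does.\<close>

definition bounded_coeff :: "'a::euclidean_space set \<Rightarrow> real \<Rightarrow> ('a \<Rightarrow> real) \<Rightarrow> bool" where
  "bounded_coeff S K \<alpha> \<longleftrightarrow> \<alpha> \<in> borel_measurable (lebesgue_on S) \<and> (AE x in lebesgue_on S. \<bar>\<alpha> x\<bar> \<le> K)"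

lemma L2_inner_integrable:
  fixes u v :: "'a::euclidean_space \<Rightarrow> 'b::euclidean_space"
  assumes \<alpha>: "bounded_coeff S K \<alpha>" and u: "u \<in> L2 S" and v: "v \<in> L2 S"
  shows "integrable (lebesgue_on S) (\<lambda>x. \<alpha> x * (u x \<bullet> v x))"
proof (rule Bochner_Integration.integrable_bound)
  note [measurable] = conjunct1[OF u[unfolded L2_iff]] conjunct1[OF v[unfolded L2_iff]]
    conjunct1[OF \<alpha>[unfolded bounded_coeff_def]]
  show "integrable (lebesgue_on S) (\<lambda>x. K * ((norm (u x))\<^sup>2 + (norm (v x))\<^sup>2))"
    using u v by (simp add: L2_iff)
  show "(\<lambda>x. \<alpha> x * (u x \<bullet> v x)) \<in> borel_measurable (lebesgue_on S)" by measurable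
  show "AE x in lebesgue_on S. norm (\<alpha> x * (u x \<bullet> v x)) \<le> norm (K * ((norm (u x))\<^sup>2 + (norm (v x))\<^sup>2))"
    using conjunct2[OF \<alpha>[unfolded bounded_coeff_def]]
  proof eventually_elim
    case (elim x)
    have "2 * (norm (u x) * norm (v x)) \<le> (norm (u x))\<^sup>2 + (norm (v x))\<^sup>2"
      using sum_squares_bound[of "norm (u x)" "norm (v x)"] by simp
    then have "\<bar>u x \<bullet> v x\<bar> \<le> (norm (u x))\<^sup>2 + (norm (v x))\<^sup>2"
      using Cauchy_Schwarz_ineq2[of "u x" "v x"] mult_nonneg_nonneg[OF norm_ge_zero norm_ge_zero, of "u x" "v x"]
      by linarith
    then have "\<bar>\<alpha> x\<bar> * \<bar>u x \<bullet> v x\<bar> \<le> \<bar>K\<bar> * ((norm (u x))\<^sup>2 + (norm (v x))\<^sup>2)"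
      using elim by (intro mult_mono) auto
    then show ?case by (simp add: abs_mult)
  qed
qed

lemma L2_L1_loc:
  fixes u :: "'a::euclidean_space \<Rightarrow> 'b::euclidean_space"
  assumes S: "S \<in> sets lebesgue" and u: "u \<in> L2 S"
  shows "u \<in> L1_loc S"
  unfolding L1_loc_def
proof safe
  fix K assume K: "compact K" "K \<subseteq> S"
  have KL: "K \<in> sets lebesgue" using K(1) by (simp add: compact_imp_closed)
  have one: "integrable lebesgue (\<lambda>x. indicat_real K x)"
    using lmeasurable_compact[OF K(1)] by (simp add: lmeasurable_iff_integrable)
  have sq: "integrable lebesgue (\<lambda>x. indicat_real S x *\<^sub>R (norm (u x))\<^sup>2)"
    using u unfolding L2_iff integrable_lebesgue_on_iff[OF S] by blast
  have um: "(\<lambda>x. indicat_real S x *\<^sub>R u x) \<in> borel_measurable lebesgue"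
    using u unfolding L2_iff borel_measurable_lebesgue_on_iff[OF S] by blast
  have "integrable lebesgue (\<lambda>x. indicat_real K x *\<^sub>R u x)"
  proof (rule Bochner_Integration.integrable_bound)
    show "integrable lebesgue (\<lambda>x. indicat_real K x + indicat_real S x *\<^sub>R (norm (u x))\<^sup>2)"
      using one sq by (rule Bochner_Integration.integrable_add)
    have "(\<lambda>x. indicat_real K x *\<^sub>R (indicat_real S x *\<^sub>R u x)) \<in> borel_measurable lebesgue"
      using KL by (intro borel_measurable_scaleR um) simp
    moreover have "indicat_real K x *\<^sub>R (indicat_real S x *\<^sub>R u x) = indicat_real K x *\<^sub>R u x" for x
      using K(2) by (auto simp: indicator_def)
    ultimately show "(\<lambda>x. indicat_real K x *\<^sub>R u x) \<in> borel_measurable lebesgue" by (simp only:)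
    have "t \<le> 1 + t\<^sup>2" for t :: real
      using sum_squares_bound[of t 1] zero_le_power2[of t] unfolding mult_1_right power_one by linarith
    then show "AE x in lebesgue. norm (indicat_real K x *\<^sub>R u x)
        \<le> norm (indicat_real K x + indicat_real S x *\<^sub>R (norm (u x))\<^sup>2)"
      using K(2) by (intro AE_I2) (auto simp: indicator_def)
  qed
  then show "integrable (lebesgue_on K) u" unfolding integrable_lebesgue_on_iff[OF KL] .
qed

lemma test_function_L2:
  assumes S: "S \<in> sets lebesgue" and \<zeta>: "\<zeta> \<in> test_functions S"
  shows "\<zeta> \<in> L2 S" "test_grad \<zeta> \<in> L2 S"
proof -
  note [measurable] = test_borel[OF \<zeta>]
  have cont: "continuous_on UNIV (\<lambda>x. (norm (\<zeta> x))\<^sup>2)" "continuous_on UNIV (\<lambda>x. (norm (test_grad \<zeta> x))\<^sup>2)"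
    by (intro continuous_intros test_continuous[OF \<zeta>] test_grad_continuous[OF \<zeta>])+
  have z: "(norm (\<zeta> x))\<^sup>2 = 0" "(norm (test_grad \<zeta> x))\<^sup>2 = 0" if "x \<notin> closure {x. \<zeta> x \<noteq> 0}" for x
    using test_zero_outside(1)[OF \<zeta> that] test_grad_zero_outside[OF \<zeta> that] by simp_all
  have zS: "(norm (\<zeta> x))\<^sup>2 = 0" "(norm (test_grad \<zeta> x))\<^sup>2 = 0" if "x \<notin> S" for x
    using z[of x] test_support(2)[OF \<zeta>] that by blast+
  have "integrable (lebesgue_on S) (\<lambda>x. (norm (\<zeta> x))\<^sup>2)"
    using continuous_vanishing_outside_support_integrable[OF \<zeta> cont(1) z(1)]
      integral_lebesgue_on_borel(2)[OF S _ zS(1)] by simp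
  moreover have "integrable (lebesgue_on S) (\<lambda>x. (norm (test_grad \<zeta> x))\<^sup>2)"
    using continuous_vanishing_outside_support_integrable[OF \<zeta> cont(2) z(2)]
      integral_lebesgue_on_borel(2)[OF S _ zS(2)] by simp
  ultimately show "\<zeta> \<in> L2 S" "test_grad \<zeta> \<in> L2 S"
    using borel_measurable_lebesgue_onI[OF test_borel(1)[OF \<zeta>]] borel_measurable_lebesgue_onI[OF test_borel(2)[OF \<zeta>]]
    by (simp_all add: L2_iff)
qed

text \<open>One formula for all forms of the problem: the energy with \<alpha> = a(\<phi>) and
  \<beta> = b(\<phi>), the mass form with \<alpha> = 0, the derivatives of both, the Dirichlet
  integral and the plain mass. The product of real values is written as an inner product, so that
  gradient and zero-order terms share their lemmas.\<close>

definition sobolev_form :: "'a::euclidean_space set \<Rightarrow> ('a \<Rightarrow> real) \<Rightarrow> ('a \<Rightarrow> real)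
    \<Rightarrow> ('a \<Rightarrow> real) \<Rightarrow> ('a \<Rightarrow> real) \<Rightarrow> real" where
  "sobolev_form \<Omega> \<alpha> \<beta> u v = (LINT x|lebesgue_on \<Omega>. \<alpha> x * (wgrad \<Omega> u x \<bullet> wgrad \<Omega> v x))
    + (LINT x|lebesgue_on \<Omega>. \<beta> x * (u x \<bullet> v x))"

section \<open>Bilinear forms on \<open>H1\<close> with bounded coefficients\<close>

context
  fixes \<Omega> :: "'a::euclidean_space set"
  assumes \<Omega>: "open \<Omega>"
begin

lemma open_lebesgue: "\<Omega> \<in> sets lebesgue"
  using \<Omega> by simp

lemma wgrad_unique:
  assumes "has_weak_gradient \<Omega> u G"
  shows "AE x in lebesgue_on \<Omega>. wgrad \<Omega> u x = G x"
proof -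
  have "has_weak_gradient \<Omega> u (wgrad \<Omega> u)" unfolding wgrad_def
    by (rule someI[of "has_weak_gradient \<Omega> u", OF assms])
  then show ?thesis using assms by (rule weak_gradient_unique[OF \<Omega>])
qed

lemma H1_wgrad:
  assumes "u \<in> H1 \<Omega>"
  shows "has_weak_gradient \<Omega> u (wgrad \<Omega> u)" "wgrad \<Omega> u \<in> L2 \<Omega>" "u \<in> L2 \<Omega>"
proof -
  obtain G where G: "G \<in> L2 \<Omega>" "has_weak_gradient \<Omega> u G" using assms by (auto simp: H1_def)
  show "has_weak_gradient \<Omega> u (wgrad \<Omega> u)" unfolding wgrad_def
    by (rule someI[of "has_weak_gradient \<Omega> u", OF G(2)])
  have "AE x in lebesgue_on \<Omega>. G x = wgrad \<Omega> u x"
    using wgrad_unique[OF G(2)] by eventually_elim simp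
  then show "wgrad \<Omega> u \<in> L2 \<Omega>" by (rule L2_cong_AE[OF open_lebesgue G(1)])
  show "u \<in> L2 \<Omega>" using assms by (simp add: H1_def)
qed

lemma H1_lincomb:
  assumes u: "u \<in> H1 \<Omega>" and v: "v \<in> H1 \<Omega>"
  shows "(\<lambda>x. u x + r * v x) \<in> H1 \<Omega>"
    and "AE x in lebesgue_on \<Omega>. wgrad \<Omega> (\<lambda>x. u x + r * v x) x = wgrad \<Omega> u x + r *\<^sub>R wgrad \<Omega> v x"
proof -
  note wg = weak_gradient_lincomb[OF open_lebesgue H1_wgrad(1)[OF u] H1_wgrad(1)[OF v], of r]
  show "AE x in lebesgue_on \<Omega>. wgrad \<Omega> (\<lambda>x. u x + r * v x) x = wgrad \<Omega> u x + r *\<^sub>R wgrad \<Omega> v x"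
    by (rule wgrad_unique[OF wg])
  have "(\<lambda>x. u x + r *\<^sub>R v x) \<in> L2 \<Omega>" by (rule L2_lincomb[OF H1_wgrad(3)[OF u] H1_wgrad(3)[OF v]])
  then show "(\<lambda>x. u x + r * v x) \<in> H1 \<Omega>"
    using wg L2_lincomb[OF H1_wgrad(2)[OF u] H1_wgrad(2)[OF v], of r] by (auto simp: H1_def)
qed

lemma test_function_H1:
  assumes \<zeta>: "\<zeta> \<in> test_functions \<Omega>"
  shows "\<zeta> \<in> H1 \<Omega>" "AE x in lebesgue_on \<Omega>. wgrad \<Omega> \<zeta> x = test_grad \<zeta> x"
  using test_function_weak_gradient[OF open_lebesgue \<zeta>] test_function_L2[OF open_lebesgue \<zeta>]
  by (auto simp: H1_def intro: wgrad_unique)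

lemma H1_function_space: "function_space (H1 \<Omega>)"
proof
  show zero: "(\<lambda>x. 0) \<in> H1 \<Omega>" by (rule test_function_H1(1)[OF test_zero])
  show "(\<lambda>x. u x + v x) \<in> H1 \<Omega>" if "u \<in> H1 \<Omega>" "v \<in> H1 \<Omega>" for u v
    using H1_lincomb(1)[OF that, of 1] by simp
  show "(\<lambda>x. r * u x) \<in> H1 \<Omega>" if "u \<in> H1 \<Omega>" for u r
    using H1_lincomb(1)[OF zero that, of r] by simp
qed

lemma sobolev_form_integrable:
  assumes "u \<in> H1 \<Omega>" "v \<in> H1 \<Omega>" "bounded_coeff \<Omega> K \<alpha>"
  shows "integrable (lebesgue_on \<Omega>) (\<lambda>x. \<alpha> x * (wgrad \<Omega> u x \<bullet> wgrad \<Omega> v x))"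
    "integrable (lebesgue_on \<Omega>) (\<lambda>x. \<alpha> x * (u x \<bullet> v x))"
  using L2_inner_integrable[OF assms(3) H1_wgrad(2)[OF assms(1)] H1_wgrad(2)[OF assms(2)]]
    L2_inner_integrable[OF assms(3) H1_wgrad(3)[OF assms(1)] H1_wgrad(3)[OF assms(2)]] by auto

lemma sobolev_form_lincomb_left:
  assumes u: "u \<in> H1 \<Omega>" and v: "v \<in> H1 \<Omega>" and w: "w \<in> H1 \<Omega>"
    and \<alpha>: "bounded_coeff \<Omega> K \<alpha>" and \<beta>: "bounded_coeff \<Omega> L \<beta>"
  shows "sobolev_form \<Omega> \<alpha> \<beta> (\<lambda>x. u x + r * v x) w = sobolev_form \<Omega> \<alpha> \<beta> u w + r * sobolev_form \<Omega> \<alpha> \<beta> v w"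
proof -
  note l = H1_lincomb[OF u v, of r]
  note i = sobolev_form_integrable
  have "(LINT x|lebesgue_on \<Omega>. \<alpha> x * (wgrad \<Omega> (\<lambda>x. u x + r * v x) x \<bullet> wgrad \<Omega> w x))
      = (LINT x|lebesgue_on \<Omega>. \<alpha> x * (wgrad \<Omega> u x \<bullet> wgrad \<Omega> w x) + r * (\<alpha> x * (wgrad \<Omega> v x \<bullet> wgrad \<Omega> w x)))"
  proof (rule integral_cong_AE)
    show "(\<lambda>x. \<alpha> x * (wgrad \<Omega> (\<lambda>x. u x + r * v x) x \<bullet> wgrad \<Omega> w x)) \<in> borel_measurable (lebesgue_on \<Omega>)"
      using i(1)[OF l(1) w \<alpha>] by (rule borel_measurable_integrable)
    show "(\<lambda>x. \<alpha> x * (wgrad \<Omega> u x \<bullet> wgrad \<Omega> w x) + r * (\<alpha> x * (wgrad \<Omega> v x \<bullet> wgrad \<Omega> w x)))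
        \<in> borel_measurable (lebesgue_on \<Omega>)"
      using i(1)[OF u w \<alpha>] i(1)[OF v w \<alpha>] by (intro borel_measurable_integrable) simp
    show "AE x in lebesgue_on \<Omega>. \<alpha> x * (wgrad \<Omega> (\<lambda>x. u x + r * v x) x \<bullet> wgrad \<Omega> w x)
        = \<alpha> x * (wgrad \<Omega> u x \<bullet> wgrad \<Omega> w x) + r * (\<alpha> x * (wgrad \<Omega> v x \<bullet> wgrad \<Omega> w x))"
      using l(2) by eventually_elim (simp add: inner_add_left algebra_simps)
  qed
  also have "\<dots> = (LINT x|lebesgue_on \<Omega>. \<alpha> x * (wgrad \<Omega> u x \<bullet> wgrad \<Omega> w x))
      + r * (LINT x|lebesgue_on \<Omega>. \<alpha> x * (wgrad \<Omega> v x \<bullet> wgrad \<Omega> w x))"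
    using i(1)[OF u w \<alpha>] i(1)[OF v w \<alpha>] by simp
  finally have 1: "(LINT x|lebesgue_on \<Omega>. \<alpha> x * (wgrad \<Omega> (\<lambda>x. u x + r * v x) x \<bullet> wgrad \<Omega> w x))
      = (LINT x|lebesgue_on \<Omega>. \<alpha> x * (wgrad \<Omega> u x \<bullet> wgrad \<Omega> w x))
      + r * (LINT x|lebesgue_on \<Omega>. \<alpha> x * (wgrad \<Omega> v x \<bullet> wgrad \<Omega> w x))" .
  have "(LINT x|lebesgue_on \<Omega>. \<beta> x * ((u x + r * v x) \<bullet> w x))
      = (LINT x|lebesgue_on \<Omega>. \<beta> x * (u x \<bullet> w x) + r * (\<beta> x * (v x \<bullet> w x)))"
    by (simp add: algebra_simps)
  also have "\<dots> = (LINT x|lebesgue_on \<Omega>. \<beta> x * (u x \<bullet> w x)) + r * (LINT x|lebesgue_on \<Omega>. \<beta> x * (v x \<bullet> w x))"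
    using i(2)[OF u w \<beta>] i(2)[OF v w \<beta>]
    by (subst Bochner_Integration.integral_add) (simp_all del: inner_real_def)
  finally show ?thesis using 1 by (simp add: sobolev_form_def algebra_simps)
qed

lemma sobolev_form_sym: "sobolev_form \<Omega> \<alpha> \<beta> u v = sobolev_form \<Omega> \<alpha> \<beta> v u"
  unfolding sobolev_form_def inner_commute[of "wgrad \<Omega> u _"] inner_commute[of "u _"] ..

lemma sym_form_sobolev:
  assumes \<alpha>: "bounded_coeff \<Omega> K \<alpha>" and \<beta>: "bounded_coeff \<Omega> L \<beta>"
  shows "sym_form (H1 \<Omega>) (sobolev_form \<Omega> \<alpha> \<beta>)"
proof -
  interpret function_space "H1 \<Omega>" by (rule H1_function_space)
  show ?thesis
  proof
    fix u v w assume u: "u \<in> H1 \<Omega>" and v: "v \<in> H1 \<Omega>" and w: "w \<in> H1 \<Omega>"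
    show "sobolev_form \<Omega> \<alpha> \<beta> (\<lambda>x. u x + v x) w = sobolev_form \<Omega> \<alpha> \<beta> u w + sobolev_form \<Omega> \<alpha> \<beta> v w"
      using sobolev_form_lincomb_left[OF u v w \<alpha> \<beta>, of 1] by simp
  next
    fix u w r assume u: "u \<in> H1 \<Omega>" and w: "w \<in> H1 \<Omega>"
    have "sobolev_form \<Omega> \<alpha> \<beta> (\<lambda>x. 0) w = 0"
      using sobolev_form_lincomb_left[OF zero_mem zero_mem w \<alpha> \<beta>, of 1] by simp
    then show "sobolev_form \<Omega> \<alpha> \<beta> (\<lambda>x. r * u x) w = r * sobolev_form \<Omega> \<alpha> \<beta> u w"
      using sobolev_form_lincomb_left[OF zero_mem u w \<alpha> \<beta>, of r] by simp
  qed (rule sobolev_form_sym)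
qed

lemma sobolev_form_diff_coeff:
  assumes "u \<in> H1 \<Omega>" "v \<in> H1 \<Omega>"
    and "bounded_coeff \<Omega> K \<alpha>" "bounded_coeff \<Omega> L \<beta>" "bounded_coeff \<Omega> K' \<alpha>'" "bounded_coeff \<Omega> L' \<beta>'"
  shows "sobolev_form \<Omega> (\<lambda>x. \<alpha> x + r * \<alpha>' x) (\<lambda>x. \<beta> x + r * \<beta>' x) u v
    = sobolev_form \<Omega> \<alpha> \<beta> u v + r * sobolev_form \<Omega> \<alpha>' \<beta>' u v"
proof -
  note i = sobolev_form_integrable[OF assms(1,2)]
  have "(LINT x|lebesgue_on \<Omega>. (\<alpha> x + r * \<alpha>' x) * (wgrad \<Omega> u x \<bullet> wgrad \<Omega> v x))
      = (LINT x|lebesgue_on \<Omega>. \<alpha> x * (wgrad \<Omega> u x \<bullet> wgrad \<Omega> v x) + r * (\<alpha>' x * (wgrad \<Omega> u x \<bullet> wgrad \<Omega> v x)))"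
    "(LINT x|lebesgue_on \<Omega>. (\<beta> x + r * \<beta>' x) * (u x \<bullet> v x))
      = (LINT x|lebesgue_on \<Omega>. \<beta> x * (u x \<bullet> v x) + r * (\<beta>' x * (u x \<bullet> v x)))"
    by (simp_all add: algebra_simps)
  then show ?thesis
    using i(1)[OF assms(3)] i(1)[OF assms(5)] i(2)[OF assms(4)] i(2)[OF assms(6)]
    by (simp add: sobolev_form_def algebra_simps del: inner_real_def)
qed

lemma sobolev_form_mono:
  assumes u: "u \<in> H1 \<Omega>"
    and "bounded_coeff \<Omega> K \<alpha>" "bounded_coeff \<Omega> L \<beta>" "bounded_coeff \<Omega> K' \<alpha>'" "bounded_coeff \<Omega> L' \<beta>'"
    and le: "AE x in lebesgue_on \<Omega>. \<alpha> x \<le> \<alpha>' x" "AE x in lebesgue_on \<Omega>. \<beta> x \<le> \<beta>' x"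
  shows "sobolev_form \<Omega> \<alpha> \<beta> u u \<le> sobolev_form \<Omega> \<alpha>' \<beta>' u u"
proof -
  note i = sobolev_form_integrable[OF u u]
  show ?thesis
    unfolding sobolev_form_def
  proof (rule add_mono)
    show "(LINT x|lebesgue_on \<Omega>. \<alpha> x * (wgrad \<Omega> u x \<bullet> wgrad \<Omega> u x))
        \<le> (LINT x|lebesgue_on \<Omega>. \<alpha>' x * (wgrad \<Omega> u x \<bullet> wgrad \<Omega> u x))"
      by (rule integral_mono_AE[OF i(1)[OF assms(2)] i(1)[OF assms(4)]])
        (use le(1) in \<open>eventually_elim, intro mult_right_mono, auto\<close>)
    show "(LINT x|lebesgue_on \<Omega>. \<beta> x * (u x \<bullet> u x)) \<le> (LINT x|lebesgue_on \<Omega>. \<beta>' x * (u x \<bullet> u x))"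
      by (rule integral_mono_AE[OF i(2)[OF assms(3)] i(2)[OF assms(5)]])
        (use le(2) in \<open>eventually_elim, intro mult_right_mono, auto\<close>)
  qed
qed

lemma sobolev_form_nonneg:
  assumes "AE x in lebesgue_on \<Omega>. 0 \<le> \<alpha> x" "AE x in lebesgue_on \<Omega>. 0 \<le> \<beta> x"
  shows "0 \<le> sobolev_form \<Omega> \<alpha> \<beta> u u"
  unfolding sobolev_form_def
  by (intro add_nonneg_nonneg integral_nonneg_AE) (use assms in \<open>eventually_elim, simp\<close>)+

abbreviation "dirichlet \<equiv> sobolev_form \<Omega> (\<lambda>x. 1) (\<lambda>x. 0)"
abbreviation "mass \<equiv> sobolev_form \<Omega> (\<lambda>x. 0) (\<lambda>x. 1)"

lemma dirichlet_form: "nonneg_form (H1 \<Omega>) dirichlet"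
  by (intro nonneg_form.intro nonneg_form_axioms.intro sym_form_sobolev[of 1 _ 1] sobolev_form_nonneg)
    (auto simp: bounded_coeff_def)

lemma mass_form: "nonneg_form (H1 \<Omega>) mass"
  by (intro nonneg_form.intro nonneg_form_axioms.intro sym_form_sobolev[of 1 _ 1] sobolev_form_nonneg)
    (auto simp: bounded_coeff_def)

text \<open>Monotonicity in the coefficients, applied with the constants K, L and with -K,
  -L.\<close>

lemma sobolev_form_diagonal_bound:
  assumes u: "u \<in> H1 \<Omega>" and \<alpha>: "bounded_coeff \<Omega> K \<alpha>" and \<beta>: "bounded_coeff \<Omega> L \<beta>" and nn: "0 \<le> K" "0 \<le> L"
  shows "\<bar>sobolev_form \<Omega> \<alpha> \<beta> u u\<bar> \<le> K * dirichlet u u + L * mass u u"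
proof -
  have b: "bounded_coeff \<Omega> K (\<lambda>x. K)" "bounded_coeff \<Omega> K (\<lambda>x. - K)"
    "bounded_coeff \<Omega> L (\<lambda>x. L)" "bounded_coeff \<Omega> L (\<lambda>x. - L)"
    using nn by (auto simp: bounded_coeff_def)
  have eq: "sobolev_form \<Omega> (\<lambda>x. c) (\<lambda>x. d) u u = c * dirichlet u u + d * mass u u" for c d
    by (simp add: sobolev_form_def)
  have abs: "AE x in lebesgue_on \<Omega>. \<bar>\<alpha> x\<bar> \<le> K" "AE x in lebesgue_on \<Omega>. \<bar>\<beta> x\<bar> \<le> L"
    using \<alpha> \<beta> by (simp_all add: bounded_coeff_def)
  have "sobolev_form \<Omega> \<alpha> \<beta> u u \<le> K * dirichlet u u + L * mass u u"
    unfolding eq[symmetric]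
    by (rule sobolev_form_mono[OF u \<alpha> \<beta> b(1,3)]; use abs in \<open>eventually_elim, linarith\<close>)
  moreover have "- K * dirichlet u u + - L * mass u u \<le> sobolev_form \<Omega> \<alpha> \<beta> u u"
    unfolding eq[symmetric]
    by (rule sobolev_form_mono[OF u b(2,4) \<alpha> \<beta>]; use abs in \<open>eventually_elim, linarith\<close>)
  ultimately show ?thesis by (simp add: abs_le_iff)
qed

lemma H1_norm_eq: "H1_norm \<Omega> u = sqrt (dirichlet u u + mass u u)"
  by (simp add: H1_norm_def sobolev_form_def dot_square_norm power2_eq_square add.commute)

text \<open>The square of the norm is a sum of two forms, so closeness to test functions can be
  handled without square roots.\<close>

lemma H10_iff:
  "u \<in> H10 \<Omega> \<longleftrightarrow> u \<in> H1 \<Omega> \<and> (\<forall>e>0. \<exists>\<zeta>\<in>test_functions \<Omega>.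
    dirichlet (\<lambda>x. u x - \<zeta> x) (\<lambda>x. u x - \<zeta> x) + mass (\<lambda>x. u x - \<zeta> x) (\<lambda>x. u x - \<zeta> x) < e)"
proof -
  have nn: "0 \<le> dirichlet v v + mass v v" for v
    by (intro add_nonneg_nonneg sobolev_form_nonneg) auto
  have "(\<forall>e>0. \<exists>\<zeta>\<in>Z. sqrt (f \<zeta>) < e) \<longleftrightarrow> (\<forall>e>0. \<exists>\<zeta>\<in>Z. f \<zeta> < e)" if "\<And>\<zeta>. 0 \<le> f \<zeta>"
    for Z :: "('a \<Rightarrow> real) set" and f :: "('a \<Rightarrow> real) \<Rightarrow> real"
  proof safe
    fix e :: real assume *: "\<forall>e>0. \<exists>\<zeta>\<in>Z. sqrt (f \<zeta>) < e" "0 < e"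
    then obtain \<zeta> where "\<zeta> \<in> Z" "sqrt (f \<zeta>) < sqrt e" by (meson real_sqrt_gt_zero)
    then show "\<exists>\<zeta>\<in>Z. f \<zeta> < e" by auto
  next
    fix e :: real assume *: "\<forall>e>0. \<exists>\<zeta>\<in>Z. f \<zeta> < e" "0 < e"
    then obtain \<zeta> where "\<zeta> \<in> Z" "f \<zeta> < e\<^sup>2" by (meson zero_less_power)
    then show "\<exists>\<zeta>\<in>Z. sqrt (f \<zeta>) < e" using *(2) by (auto intro!: bexI[of _ \<zeta>] real_less_lsqrt)
  qed
  from this[of "\<lambda>\<zeta>. dirichlet (\<lambda>x. u x - \<zeta> x) (\<lambda>x. u x - \<zeta> x) + mass (\<lambda>x. u x - \<zeta> x) (\<lambda>x. u x - \<zeta> x)"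
      "test_functions \<Omega>", OF nn]
  show ?thesis unfolding H10_def H1_norm_eq by simp
qed

lemma H10_H1: "u \<in> H10 \<Omega> \<Longrightarrow> u \<in> H1 \<Omega>"
  by (simp add: H10_iff)

lemma test_function_H10: "\<zeta> \<in> test_functions \<Omega> \<Longrightarrow> \<zeta> \<in> H10 \<Omega>"
proof -
  assume \<zeta>: "\<zeta> \<in> test_functions \<Omega>"
  interpret D: nonneg_form "H1 \<Omega>" dirichlet by (rule dirichlet_form)
  interpret M: nonneg_form "H1 \<Omega>" mass by (rule mass_form)
  have 0: "dirichlet (\<lambda>x. \<zeta> x - \<zeta> x) (\<lambda>x. \<zeta> x - \<zeta> x) + mass (\<lambda>x. \<zeta> x - \<zeta> x) (\<lambda>x. \<zeta> x - \<zeta> x) = 0"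
    using D.zero_left[OF D.zero_mem] M.zero_left[OF D.zero_mem] by simp
  show ?thesis
    unfolding H10_iff
  proof (intro conjI allI impI)
    show "\<zeta> \<in> H1 \<Omega>" by (rule test_function_H1(1)[OF \<zeta>])
    fix e :: real assume "0 < e"
    then show "\<exists>\<xi>\<in>test_functions \<Omega>.
        dirichlet (\<lambda>x. \<zeta> x - \<xi> x) (\<lambda>x. \<zeta> x - \<xi> x) + mass (\<lambda>x. \<zeta> x - \<xi> x) (\<lambda>x. \<zeta> x - \<xi> x) < e"
      using 0 by (intro bexI[OF _ \<zeta>]) linarith
  qed
qed

lemma H10_function_space: "function_space (H10 \<Omega>)"
proof -
  interpret H1: function_space "H1 \<Omega>" by (rule H1_function_space)
  let ?Q = "\<lambda>u. dirichlet u u + mass u u"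
  have zero: "(\<lambda>x. 0) \<in> H10 \<Omega>" by (rule test_function_H10[OF test_zero])
  have comb: "(\<lambda>x. u x + r * v x) \<in> H10 \<Omega>" if u: "u \<in> H10 \<Omega>" and v: "v \<in> H10 \<Omega>" for u v r
    unfolding H10_iff
  proof (intro conjI allI impI)
    show "(\<lambda>x. u x + r * v x) \<in> H1 \<Omega>" by (rule H1_lincomb(1)[OF H10_H1[OF u] H10_H1[OF v]])
    fix e :: real assume e: "0 < e"
    obtain \<zeta> where \<zeta>: "\<zeta> \<in> test_functions \<Omega>" "?Q (\<lambda>x. u x - \<zeta> x) < e / 4"
      using conjunct2[OF u[unfolded H10_iff], rule_format, of "e / 4"] e by auto
    \<comment> \<open>The summand 1 covers \<open>r = 0\<close>.\<close>
    have r: "0 < e / (4 * (r\<^sup>2 + 1))" using e by (simp add: add_nonneg_pos)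
    obtain \<xi> where \<xi>: "\<xi> \<in> test_functions \<Omega>" "?Q (\<lambda>x. v x - \<xi> x) < e / (4 * (r\<^sup>2 + 1))"
      using conjunct2[OF v[unfolded H10_iff], rule_format, OF r] by blast
    have mem: "(\<lambda>x. u x - \<zeta> x) \<in> H1 \<Omega>" "(\<lambda>x. v x - \<xi> x) \<in> H1 \<Omega>"
      by (rule H1.diff_mem[OF H10_H1[OF u] test_function_H1(1)[OF \<zeta>(1)]],
          rule H1.diff_mem[OF H10_H1[OF v] test_function_H1(1)[OF \<xi>(1)]])
    show "\<exists>\<zeta>'\<in>test_functions \<Omega>. ?Q (\<lambda>x. (u x + r * v x) - \<zeta>' x) < e"
    proof (intro bexI)
      show "(\<lambda>x. \<zeta> x + r * \<xi> x) \<in> test_functions \<Omega>" using \<zeta> \<xi> by (intro test_add test_scale)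
      have eq: "(\<lambda>x. (u x + r * v x) - (\<zeta> x + r * \<xi> x)) = (\<lambda>x. (u x - \<zeta> x) + r * (v x - \<xi> x))"
        by (simp add: algebra_simps)
      have "?Q (\<lambda>x. (u x - \<zeta> x) + r * (v x - \<xi> x)) \<le> 2 * ?Q (\<lambda>x. u x - \<zeta> x) + 2 * r\<^sup>2 * ?Q (\<lambda>x. v x - \<xi> x)"
        using nonneg_form_sum_bound[OF dirichlet_form mem, of r] nonneg_form_sum_bound[OF mass_form mem, of r]
        by (simp add: algebra_simps)
      also have "\<dots> < e"
      proof -
        have "r\<^sup>2 * ?Q (\<lambda>x. v x - \<xi> x) \<le> r\<^sup>2 * (e / (4 * (r\<^sup>2 + 1)))" using \<xi>(2) by (intro mult_left_mono) auto
        also have "\<dots> \<le> e / 4"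
        proof -
          have "0 < 4 * (r\<^sup>2 + 1)" by (simp add: add_nonneg_pos)
          then have "r\<^sup>2 * e / (4 * (r\<^sup>2 + 1)) \<le> e / 4"
            using e by (subst pos_divide_le_eq) (auto simp: algebra_simps)
          then show ?thesis by simp
        qed
        finally have "r\<^sup>2 * ?Q (\<lambda>x. v x - \<xi> x) \<le> e / 4" .
        moreover have "2 * p + 2 * s * q < e" if "s * q \<le> e / 4" "p < e / 4" for p q s :: real
          using that by simp
        ultimately show ?thesis using \<zeta>(2) by blast
      qed
      finally show "?Q (\<lambda>x. (u x + r * v x) - (\<zeta> x + r * \<xi> x)) < e" unfolding eq .
    qed
  qed
  show ?thesis
  proof
    show "(\<lambda>x. u x + v x) \<in> H10 \<Omega>" if "u \<in> H10 \<Omega>" "v \<in> H10 \<Omega>" for u v using comb[OF that, of 1] by simp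
    show "(\<lambda>x. r * u x) \<in> H10 \<Omega>" if "u \<in> H10 \<Omega>" for u r using comb[OF zero that, of r] by simp
  qed (rule zero)
qed

end

section \<open>Poincare inequality and Rellich compactness\<close>

text \<open>Cauchy-Schwarz against the constant function 1, read off from the integral of (g + r)^2
  as a polynomial in \<open>r\<close>.\<close>

lemma square_integral_le:
  assumes M: "finite_measure M" and g: "integrable M g" "integrable M (\<lambda>x. (g x)\<^sup>2)"
  shows "(LINT x|M. g x)\<^sup>2 \<le> (LINT x|M. (g x)\<^sup>2) * measure M (space M)"
proof (rule discriminant_le)
  interpret finite_measure M by fact
  fix r :: real
  have "0 \<le> (LINT x|M. (g x + r)\<^sup>2)" by (rule integral_nonneg_AE) simp
  also have "(LINT x|M. (g x + r)\<^sup>2) = (LINT x|M. (g x)\<^sup>2 + 2 * r * g x + r\<^sup>2)"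
    by (simp add: power2_sum algebra_simps)
  also have "\<dots> = (LINT x|M. (g x)\<^sup>2) + 2 * r * (LINT x|M. g x) + r\<^sup>2 * measure M (space M)"
    using g by simp
  finally show "0 \<le> (LINT x|M. (g x)\<^sup>2) + 2 * r * (LINT x|M. g x) + r\<^sup>2 * measure M (space M)" .
qed simp

section \<open>Translation estimates for test functions\<close>

context
  fixes \<zeta> :: "'a::euclidean_space \<Rightarrow> real" and S
  assumes \<zeta>: "\<zeta> \<in> test_functions S"
begin

definition energy :: real where "energy = (LINT x|lborel. (norm (test_grad \<zeta> x))\<^sup>2)"

lemma energy_nonneg: "0 \<le> energy"
  unfolding energy_def by (rule integral_nonneg_AE) simp

lemma test_square_integrable:
  "integrable lborel (\<lambda>x. (\<zeta> x)\<^sup>2)" "integrable lborel (\<lambda>x. (norm (test_grad \<zeta> x))\<^sup>2)"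
proof -
  have c: "continuous_on UNIV (\<lambda>x. (\<zeta> x)\<^sup>2)" "continuous_on UNIV (\<lambda>x. (norm (test_grad \<zeta> x))\<^sup>2)"
    by (intro continuous_intros test_continuous[OF \<zeta>] test_grad_continuous[OF \<zeta>])+
  have z: "(\<zeta> x)\<^sup>2 = 0" "(norm (test_grad \<zeta> x))\<^sup>2 = 0" if "x \<notin> closure {x. \<zeta> x \<noteq> 0}" for x
    using test_zero_outside(1)[OF \<zeta> that] test_grad_zero_outside[OF \<zeta> that] by simp_all
  show "integrable lborel (\<lambda>x. (\<zeta> x)\<^sup>2)"
    by (rule continuous_vanishing_outside_support_integrable[OF \<zeta> c(1) z(1)])
  show "integrable lborel (\<lambda>x. (norm (test_grad \<zeta> x))\<^sup>2)"
    by (rule continuous_vanishing_outside_support_integrable[OF \<zeta> c(2) z(2)])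
qed

lemma nn_integral_energy: "(\<integral>\<^sup>+x. ennreal ((norm (test_grad \<zeta> x))\<^sup>2) \<partial>lborel) = ennreal energy"
  unfolding energy_def by (rule nn_integral_eq_integral[OF test_square_integrable(2)]) simp

text \<open>The difference is the integral of the directional derivative along the segment from x to
  x + h, and Cauchy-Schwarz on [0,1] moves the square inside. With a nonnegative integral on the
  right, the later exchange of integrals asks only for measurability.\<close>

lemma difference_square_le:
  "ennreal ((\<zeta> (x + h) - \<zeta> x)\<^sup>2) \<le>
    (\<integral>\<^sup>+s. indicator {0..1} s * ennreal ((norm h)\<^sup>2 * (norm (test_grad \<zeta> (x + s *\<^sub>R h)))\<^sup>2) \<partial>lborel)"
proof -
  note [measurable] = test_borel[OF \<zeta>]
  define g where "g s = test_grad \<zeta> (x + s *\<^sub>R h) \<bullet> h" for s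
  let ?I = "{0..1::real}"
  let ?M = "restrict_space lborel ?I"
  have cont: "continuous_on UNIV g" unfolding g_def
    by (intro continuous_intros continuous_on_compose2[OF test_grad_continuous[OF \<zeta>, of UNIV]]) auto
  have IL: "?I \<inter> space lborel \<in> sets lborel" by simp
  have int: "integrable ?M f" if "continuous_on UNIV f" for f :: "real \<Rightarrow> real"
    unfolding integrable_restrict_space[OF IL]
    using that by (intro borel_integrable_compact[unfolded set_integrable_def]) (auto intro: continuous_on_subset)
  have fin: "finite_measure ?M"
    by (intro finite_measureI) (simp add: emeasure_restrict_space space_restrict_space)
  have "((\<lambda>s. \<zeta> (x + s *\<^sub>R h)) has_vector_derivative g s) (at s within ?I)" for s
  proof -
    have "((\<lambda>s::real. x + s *\<^sub>R h) has_derivative (\<lambda>t. t *\<^sub>R h)) (at s within ?I)"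
      by (auto intro!: derivative_eq_intros)
    moreover have "(\<zeta> has_derivative (\<lambda>k. test_grad \<zeta> (x + s *\<^sub>R h) \<bullet> k)) (at (x + s *\<^sub>R h))"
      by (rule test_has_derivative[OF \<zeta>])
    ultimately have "((\<lambda>s. \<zeta> (x + s *\<^sub>R h)) has_derivative (\<lambda>t. test_grad \<zeta> (x + s *\<^sub>R h) \<bullet> (t *\<^sub>R h))) (at s within ?I)"
      by (rule has_derivative_compose)
    then show ?thesis by (simp add: has_vector_derivative_def g_def)
  qed
  then have I1: "(g has_integral (\<zeta> (x + 1 *\<^sub>R h) - \<zeta> (x + 0 *\<^sub>R h))) ?I"
    by (intro fundamental_theorem_of_calculus) auto
  have I2: "(g has_integral (LINT s|?M. g s)) ?I"
  proof -
    have "set_integrable lborel ?I g"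
      unfolding set_integrable_def using cont
      by (intro borel_integrable_compact[unfolded set_integrable_def]) (auto intro: continuous_on_subset)
    then have "(g has_integral (LINT s:?I|lborel. g s)) ?I"
      using set_borel_integral_eq_integral[of ?I g] by (simp add: has_integral_iff)
    then show ?thesis
      unfolding integral_restrict_space[OF IL] set_lebesgue_integral_def .
  qed
  have ftc: "\<zeta> (x + h) - \<zeta> x = (LINT s|?M. g s)" using has_integral_unique[OF I1 I2] by simp
  have "(\<zeta> (x + h) - \<zeta> x)\<^sup>2 \<le> (LINT s|?M. (g s)\<^sup>2) * measure ?M (space ?M)"
    unfolding ftc using cont by (intro square_integral_le fin int continuous_intros)
  also have "measure ?M (space ?M) = 1"
    by (simp add: measure_restrict_space space_restrict_space)
  finally have "ennreal ((\<zeta> (x + h) - \<zeta> x)\<^sup>2) \<le> ennreal (LINT s|?M. (g s)\<^sup>2)" by (simp add: ennreal_leI)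
  also have "\<dots> = (\<integral>\<^sup>+s. ennreal ((g s)\<^sup>2) \<partial>?M)"
    using cont by (intro nn_integral_eq_integral[symmetric] int continuous_intros AE_I2 zero_le_power2)
  also have "\<dots> = (\<integral>\<^sup>+s. indicator ?I s * ennreal ((g s)\<^sup>2) \<partial>lborel)"
    by (subst nn_integral_restrict_space) (auto simp: mult.commute)
  also have "\<dots> \<le> (\<integral>\<^sup>+s. indicator ?I s * ennreal ((norm h)\<^sup>2 * (norm (test_grad \<zeta> (x + s *\<^sub>R h)))\<^sup>2) \<partial>lborel)"
  proof (intro nn_integral_mono mult_left_mono ennreal_leI)
    fix s
    have "\<bar>g s\<bar>\<^sup>2 \<le> (norm (test_grad \<zeta> (x + s *\<^sub>R h)) * norm h)\<^sup>2"
      unfolding g_def by (intro power_mono Cauchy_Schwarz_ineq2) simp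
    then show "(g s)\<^sup>2 \<le> (norm h)\<^sup>2 * (norm (test_grad \<zeta> (x + s *\<^sub>R h)))\<^sup>2"
      by (simp add: power_mult_distrib mult.commute)
  qed simp
  finally show ?thesis .
qed

text \<open>After exchanging the integrals the shift by \<open>s *\<^sub>R h\<close> disappears by
  translation invariance, and the integral over \<open>s\<close> contributes the factor 1.\<close>

lemma translation_estimate:
  "(\<integral>\<^sup>+x. ennreal ((\<zeta> (x + h) - \<zeta> x)\<^sup>2) \<partial>lborel) \<le> ennreal ((norm h)\<^sup>2 * energy)"
proof -
  note [measurable] = test_borel[OF \<zeta>]
  have "(\<integral>\<^sup>+x. ennreal ((\<zeta> (x + h) - \<zeta> x)\<^sup>2) \<partial>lborel) \<le> (\<integral>\<^sup>+x. \<integral>\<^sup>+s. indicator {0..1::real} s *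
      ennreal ((norm h)\<^sup>2 * (norm (test_grad \<zeta> (x + s *\<^sub>R h)))\<^sup>2) \<partial>lborel \<partial>lborel)"
    by (intro nn_integral_mono difference_square_le)
  also have "\<dots> = (\<integral>\<^sup>+s. \<integral>\<^sup>+x. indicator {0..1::real} s *
      ennreal ((norm h)\<^sup>2 * (norm (test_grad \<zeta> (x + s *\<^sub>R h)))\<^sup>2) \<partial>lborel \<partial>lborel)"
    by (rule pair_sigma_finite.Fubini'[symmetric]) (auto intro: pair_sigma_finite.intro sigma_finite_lborel)
  also have "\<dots> = (\<integral>\<^sup>+s. indicator {0..1::real} s * ennreal ((norm h)\<^sup>2 * energy) \<partial>lborel)"
  proof (rule nn_integral_cong)
    fix s :: real
    have "(\<integral>\<^sup>+x. indicator {0..1::real} s * ennreal ((norm h)\<^sup>2 * (norm (test_grad \<zeta> (x + s *\<^sub>R h)))\<^sup>2) \<partial>lborel)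
        = indicator {0..1::real} s * (ennreal ((norm h)\<^sup>2) * (\<integral>\<^sup>+x. ennreal ((norm (test_grad \<zeta> (x + s *\<^sub>R h)))\<^sup>2) \<partial>lborel))"
      by (simp add: nn_integral_cmult ennreal_mult)
    also have "(\<integral>\<^sup>+x. ennreal ((norm (test_grad \<zeta> (x + s *\<^sub>R h)))\<^sup>2) \<partial>lborel)
        = (\<integral>\<^sup>+x. ennreal ((norm (test_grad \<zeta> x))\<^sup>2) \<partial>lborel)"
      by (rule lborel_nn_integral_translate) measurable
    finally show "(\<integral>\<^sup>+x. indicator {0..1::real} s * ennreal ((norm h)\<^sup>2 * (norm (test_grad \<zeta> (x + s *\<^sub>R h)))\<^sup>2) \<partial>lborel)
        = indicator {0..1::real} s * ennreal ((norm h)\<^sup>2 * energy)"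
      by (simp add: nn_integral_energy ennreal_mult energy_nonneg)
  qed
  also have "\<dots> = ennreal ((norm h)\<^sup>2 * energy)"
    by (simp add: nn_integral_multc)
  finally show ?thesis .
qed

text \<open>A translation by length 2R moves the ball off itself, so \<zeta> and its translate are
  nowhere both nonzero and their squared distance is twice the squared norm of \<zeta>. The
  translation estimate bounds this distance by 4 R^2 times the energy.\<close>

lemma test_Poincare:
  assumes S: "S \<subseteq> ball 0 R" and R: "0 < R"
  shows "(LINT x|lborel. (\<zeta> x)\<^sup>2) \<le> 2 * R\<^sup>2 * energy"
proof -
  note [measurable] = test_borel[OF \<zeta>]
  obtain b :: 'a where b: "b \<in> Basis" using nonempty_Basis by blast
  define h where "h = (2 * R) *\<^sub>R b"
  have h: "norm h = 2 * R" using b R by (simp add: h_def)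
  have "\<zeta> x * \<zeta> (x + h) = 0" for x
  proof (rule ccontr)
    assume *: "\<zeta> x * \<zeta> (x + h) \<noteq> 0"
    then have "x \<in> S" "x + h \<in> S" using test_zero_outside(2)[OF \<zeta>] by (metis mult_eq_0_iff)+
    then have "norm x < R" "norm (x + h) < R" using S by (auto simp: subset_iff)
    then have "norm h < 2 * R" using norm_triangle_ineq4[of "x + h" x] by simp
    then show False using h by simp
  qed
  then have sq: "(\<zeta> (x + h) - \<zeta> x)\<^sup>2 = (\<zeta> (x + h))\<^sup>2 + (\<zeta> x)\<^sup>2" for x
    by (simp add: power2_diff mult.commute)
  have nn: "(\<integral>\<^sup>+x. ennreal ((\<zeta> x)\<^sup>2) \<partial>lborel) = ennreal (LINT x|lborel. (\<zeta> x)\<^sup>2)"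
    by (rule nn_integral_eq_integral[OF test_square_integrable(1)]) simp
  have "(\<integral>\<^sup>+x. ennreal ((\<zeta> (x + h) - \<zeta> x)\<^sup>2) \<partial>lborel)
      = (\<integral>\<^sup>+x. ennreal ((\<zeta> (x + h))\<^sup>2) \<partial>lborel) + (\<integral>\<^sup>+x. ennreal ((\<zeta> x)\<^sup>2) \<partial>lborel)"
    unfolding sq by (simp add: nn_integral_add)
  also have "(\<integral>\<^sup>+x. ennreal ((\<zeta> (x + h))\<^sup>2) \<partial>lborel) = (\<integral>\<^sup>+x. ennreal ((\<zeta> x)\<^sup>2) \<partial>lborel)"
    by (rule lborel_nn_integral_translate) measurable
  also have "\<dots> + \<dots> = ennreal (2 * (LINT x|lborel. (\<zeta> x)\<^sup>2))"
    unfolding nn by (simp flip: ennreal_plus)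
  finally have "ennreal (2 * (LINT x|lborel. (\<zeta> x)\<^sup>2)) \<le> ennreal ((norm h)\<^sup>2 * energy)"
    using translation_estimate[of h] by simp
  then have "2 * (LINT x|lborel. (\<zeta> x)\<^sup>2) \<le> (norm h)\<^sup>2 * energy"
    using energy_nonneg by (subst (asm) ennreal_le_iff) auto
  then show ?thesis unfolding h by (simp add: power_mult_distrib mult_ac)
qed

text \<open>Each point of \<open>S\<close> lies in one of finitely many balls of radius \<open>\<delta>\<close>; there \<open>\<zeta>\<close> is compared with its
  mean over that ball, and the deviation is a mean of differences \<open>\<zeta>(x + h) - \<zeta>(x)\<close> with \<open>|h| < 2\<delta>\<close>.\<close>

lemma test_finite_rank_bound:
  assumes S: "S \<in> sets lebesgue" "bounded S" and \<delta>: "0 < \<delta>" and Y: "finite Y" "S \<subseteq> (\<Union>y\<in>Y. ball y \<delta>)"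
  shows "(LINT x|lborel. (\<zeta> x)\<^sup>2) \<le>
    2 * measure lebesgue S / (measure lborel (ball 0 \<delta> :: 'a set))\<^sup>2 * (\<Sum>y\<in>Y. (LINT x|lborel. indicator (ball y \<delta>) x * \<zeta> x)\<^sup>2)
    + 8 * 2 ^ DIM('a) * \<delta>\<^sup>2 * energy"
proof -
  note [measurable] = test_borel[OF \<zeta>]
  define m where "m = measure lborel (ball (0::'a) \<delta>)"
  have m_ball: "measure lborel (ball y \<delta>) = m" for y :: 'a using \<delta> by (simp add: m_def content_ball)
  have m: "0 < m" using \<delta> by (simp add: m_def content_ball)
  have em: "emeasure lborel (ball y \<delta>) = ennreal m" for y :: 'a
    unfolding m_ball[of y, symmetric] by (rule emeasure_eq_ennreal_measure) (metis emeasure_lborel_ball_finite infinity_ennreal_def less_irrefl)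
  define l where "l y = (LINT x|lborel. indicator (ball y \<delta>) x * \<zeta> x)" for y
  \<comment> \<open>\<open>?D x\<close> collects the squared differences over all shifts shorter
    than 2\<delta>; any two points of a ball of radius \<delta> differ by such a shift.\<close>
  let ?D = "\<lambda>x. (\<integral>\<^sup>+h. indicator (ball 0 (2 * \<delta>)) h * ennreal ((\<zeta> (x + h) - \<zeta> x)\<^sup>2) \<partial>lborel)"
  have [measurable]: "ball (0::'a) (2 * \<delta>) \<in> sets borel" by simp
  have [measurable]: "?D \<in> borel_measurable borel" by measurable
  define L where "L = (\<Sum>y\<in>Y. (l y / m)\<^sup>2)"
  have L: "0 \<le> L" unfolding L_def by (intro sum_nonneg) simp
  have dev: "ennreal ((\<zeta> x - l y / m)\<^sup>2) \<le> ennreal (1 / m) * ?D x" if xy: "x \<in> ball y \<delta>" for x y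
  proof -
    let ?B = "ball y \<delta>"
    let ?M = "restrict_space lborel ?B"
    have [measurable]: "?B \<in> sets borel" by simp
    have BL: "?B \<inter> space lborel \<in> sets lborel" by simp
    have spM: "measure ?M (space ?M) = m" by (simp add: measure_restrict_space space_restrict_space m_ball)
    interpret finite_measure ?M
      by (intro finite_measureI) (simp add: emeasure_restrict_space space_restrict_space em)
    obtain B where B: "\<And>x. \<bar>\<zeta> x\<bar> \<le> B" using test_bounded[OF \<zeta>] by blast
    have bint: "integrable ?M f" if [measurable]: "f \<in> borel_measurable borel" and b: "\<And>z. \<bar>f z\<bar> \<le> K" for f :: "'a \<Rightarrow> real" and K
      by (rule integrable_const_bound[of _ K]) (auto intro!: AE_I2 b measurable_restrict_space1)
    have B0: "0 \<le> B" using B[of 0] by simp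
    have i1: "integrable ?M \<zeta>" by (rule bint[OF _ B]) measurable
    have d: "\<bar>\<zeta> z - \<zeta> x\<bar> \<le> 2 * B" for z using B[of z] B[of x] by linarith
    have i2: "integrable ?M (\<lambda>z. \<zeta> z - \<zeta> x)" by (rule bint[OF _ d]) measurable
    have i3: "integrable ?M (\<lambda>z. (\<zeta> z - \<zeta> x)\<^sup>2)"
    proof (rule bint)
      show "\<bar>(\<zeta> z - \<zeta> x)\<^sup>2\<bar> \<le> (2 * B)\<^sup>2" for z using power_mono[OF d[of z], of 2] by simp
    qed measurable
    have "(LINT z|?M. \<zeta> z - \<zeta> x) = l y - \<zeta> x * m"
    proof -
      have "(LINT z|?M. \<zeta> z) = l y" by (simp add: l_def integral_restrict_space[OF BL])
      moreover have "(LINT z|?M. \<zeta> x) = \<zeta> x * m" unfolding lebesgue_integral_const spM by simp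
      ultimately show ?thesis using Bochner_Integration.integral_diff[OF i1, of "\<lambda>_. \<zeta> x"] by simp
    qed
    then have sq: "(l y - \<zeta> x * m)\<^sup>2 \<le> (LINT z|?M. (\<zeta> z - \<zeta> x)\<^sup>2) * m"
      using square_integral_le[OF finite_measure_axioms i2 i3] spM by simp
    have "(\<zeta> x - l y / m)\<^sup>2 = (l y - \<zeta> x * m)\<^sup>2 / m\<^sup>2"
      using m by (simp add: field_simps power2_eq_square)
    also have "\<dots> \<le> (LINT z|?M. (\<zeta> z - \<zeta> x)\<^sup>2) * m / m\<^sup>2"
      using sq by (rule divide_right_mono) simp
    also have "\<dots> = 1 / m * (LINT z|?M. (\<zeta> z - \<zeta> x)\<^sup>2)"
      using m by (simp add: power2_eq_square)
    finally have "(\<zeta> x - l y / m)\<^sup>2 \<le> 1 / m * (LINT z|?M. (\<zeta> z - \<zeta> x)\<^sup>2)" .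
    then have "ennreal ((\<zeta> x - l y / m)\<^sup>2) \<le> ennreal (1 / m) * ennreal (LINT z|?M. (\<zeta> z - \<zeta> x)\<^sup>2)"
      using m by (subst ennreal_mult[symmetric]) (auto intro!: ennreal_leI integral_nonneg_AE)
    also have "ennreal (LINT z|?M. (\<zeta> z - \<zeta> x)\<^sup>2) = (\<integral>\<^sup>+z. indicator ?B z * ennreal ((\<zeta> z - \<zeta> x)\<^sup>2) \<partial>lborel)"
      by (subst nn_integral_eq_integral[OF i3, symmetric])
        (auto simp: nn_integral_restrict_space mult.commute)
    also have "\<dots> = (\<integral>\<^sup>+h. indicator ?B (h + x) * ennreal ((\<zeta> (h + x) - \<zeta> x)\<^sup>2) \<partial>lborel)"
      by (rule lborel_nn_integral_translate[symmetric]) measurable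
    also have "\<dots> \<le> ?D x"
    proof (rule nn_integral_mono)
      fix h
      have "h \<in> ball 0 (2 * \<delta>)" if "h + x \<in> ?B"
      proof -
        have "norm h \<le> dist (h + x) y + dist y x"
          using dist_triangle[of "h + x" x y] by (simp add: dist_norm)
        then show ?thesis using that xy by (simp add: dist_commute)
      qed
      then show "indicator ?B (h + x) * ennreal ((\<zeta> (h + x) - \<zeta> x)\<^sup>2)
          \<le> indicator (ball 0 (2 * \<delta>)) h * ennreal ((\<zeta> (x + h) - \<zeta> x)\<^sup>2)"
        by (auto simp: indicator_def add.commute)
    qed
    finally show ?thesis by (simp add: mult_left_mono)
  qed
  have pointwise: "ennreal ((\<zeta> x)\<^sup>2) \<le> indicator S x * ennreal (2 * L) + ennreal (2 / m) * ?D x" for x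
  proof (cases "x \<in> S")
    case True
    then obtain y where y: "y \<in> Y" "x \<in> ball y \<delta>" using Y(2) by blast
    have "(l y / m)\<^sup>2 \<le> L"
      unfolding L_def using Y(1) y(1) by (intro member_le_sum[of y Y "\<lambda>y. (l y / m)\<^sup>2"]) auto
    moreover have "(\<zeta> x)\<^sup>2 \<le> 2 * (l y / m)\<^sup>2 + 2 * (\<zeta> x - l y / m)\<^sup>2"
      using sum_squares_bound[of "l y / m" "\<zeta> x - l y / m"] power2_sum[of "l y / m" "\<zeta> x - l y / m"] by simp
    ultimately have "(\<zeta> x)\<^sup>2 \<le> 2 * L + 2 * (\<zeta> x - l y / m)\<^sup>2" by linarith
    then have "ennreal ((\<zeta> x)\<^sup>2) \<le> ennreal (2 * L + 2 * (\<zeta> x - l y / m)\<^sup>2)" by (rule ennreal_leI)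
    also have "\<dots> = ennreal (2 * L) + 2 * ennreal ((\<zeta> x - l y / m)\<^sup>2)"
      using L by (simp add: ennreal_mult)
    also have "2 * ennreal ((\<zeta> x - l y / m)\<^sup>2) \<le> 2 * (ennreal (1 / m) * ?D x)"
      by (intro mult_left_mono dev[OF y(2)]) simp
    also have "\<dots> = ennreal (2 / m) * ?D x"
    proof -
      have "2 * ennreal (1 / m) = ennreal (2 / m)"
        using m by (subst ennreal_numeral[symmetric], subst ennreal_mult[symmetric]) auto
      then show ?thesis by (simp add: mult.assoc[symmetric])
    qed
    finally show ?thesis using True by (simp add: add_left_mono)
  next
    case False
    then show ?thesis using test_zero_outside(2)[OF \<zeta> False] by simp
  qed
  \<comment> \<open>The estimates are integrals for the Borel measure, so \<open>S\<close> is
    replaced by a Borel superset of the same measure.\<close>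
  obtain S' where S': "S \<subseteq> S'" "S' \<in> sets borel" "emeasure lebesgue S = emeasure lborel S'"
    using completion_upper[OF S(1)] by (metis sets_lborel)
  have eS': "emeasure lborel S' = ennreal (measure lebesgue S)"
    using S'(3) emeasure_bounded_finite[OF S(2)] S by (metis emeasure_eq_ennreal_measure fmeasurableD2 bounded_set_imp_lmeasurable)
  have "(\<integral>\<^sup>+x. ennreal ((\<zeta> x)\<^sup>2) \<partial>lborel) \<le> (\<integral>\<^sup>+x. indicator S' x * ennreal (2 * L) + ennreal (2 / m) * ?D x \<partial>lborel)"
    using S'(1) by (intro nn_integral_mono order_trans[OF pointwise] add_right_mono mult_right_mono)
      (auto simp: indicator_def)
  also have "\<dots> = (\<integral>\<^sup>+x. indicator S' x * ennreal (2 * L) \<partial>lborel) + ennreal (2 / m) * (\<integral>\<^sup>+x. ?D x \<partial>lborel)"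
    using S'(2) by (subst nn_integral_add) (auto simp: nn_integral_cmult)
  also have "(\<integral>\<^sup>+x. indicator S' x * ennreal (2 * L) \<partial>lborel) = ennreal (2 * L * measure lebesgue S)"
    using S'(2) L by (simp add: nn_integral_multc eS' ennreal_mult[symmetric] mult.commute)
  also have "(\<integral>\<^sup>+x. ?D x \<partial>lborel)
      = (\<integral>\<^sup>+h. \<integral>\<^sup>+x. indicator (ball 0 (2 * \<delta>)) h * ennreal ((\<zeta> (x + h) - \<zeta> x)\<^sup>2) \<partial>lborel \<partial>lborel)"
    by (rule pair_sigma_finite.Fubini'[symmetric]) (auto intro: pair_sigma_finite.intro sigma_finite_lborel)
  also have "\<dots> \<le> (\<integral>\<^sup>+h. indicator (ball (0::'a) (2 * \<delta>)) h * ennreal ((2 * \<delta>)\<^sup>2 * energy) \<partial>lborel)"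
  proof (rule nn_integral_mono)
    fix h :: 'a
    show "(\<integral>\<^sup>+x. indicator (ball 0 (2 * \<delta>)) h * ennreal ((\<zeta> (x + h) - \<zeta> x)\<^sup>2) \<partial>lborel)
        \<le> indicator (ball 0 (2 * \<delta>)) h * ennreal ((2 * \<delta>)\<^sup>2 * energy)"
    proof (cases "h \<in> ball 0 (2 * \<delta>)")
      case True
      have "ennreal ((norm h)\<^sup>2 * energy) \<le> ennreal ((2 * \<delta>)\<^sup>2 * energy)"
        using True energy_nonneg by (intro ennreal_leI mult_right_mono power_mono) auto
      then show ?thesis using True translation_estimate[of h] by simp
    qed simp
  qed
  \<comment> \<open>Doubling the radius multiplies the volume \<open>m\<close> by
    \<open>2 ^ DIM('a)\<close>. With the factor 4\<delta>^2 from the shifts and the prefactor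
    \<open>2 / m\<close> this produces the constant \<open>8 * 2 ^ DIM('a)\<close>.\<close>
  also have "\<dots> = ennreal (2 ^ DIM('a) * m) * ennreal ((2 * \<delta>)\<^sup>2 * energy)"
  proof -
    have "emeasure lborel (ball (0::'a) (2 * \<delta>)) = ennreal (measure lborel (ball (0::'a) (2 * \<delta>)))"
      by (rule emeasure_eq_ennreal_measure) (metis emeasure_lborel_ball_finite infinity_ennreal_def less_irrefl)
    also have "measure lborel (ball (0::'a) (2 * \<delta>)) = 2 ^ DIM('a) * m"
      using \<delta> by (simp add: m_def content_ball power_mult_distrib)
    finally show ?thesis by (simp add: nn_integral_multc)
  qed
  finally have "(\<integral>\<^sup>+x. ennreal ((\<zeta> x)\<^sup>2) \<partial>lborel) \<le>
      ennreal (2 * L * measure lebesgue S) + ennreal (2 / m) * (ennreal (2 ^ DIM('a) * m) * ennreal ((2 * \<delta>)\<^sup>2 * energy))"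
    by (simp add: add_left_mono mult_left_mono)
  also have "\<dots> = ennreal (2 * L * measure lebesgue S + 2 / m * (2 ^ DIM('a) * m * ((2 * \<delta>)\<^sup>2 * energy)))"
    using m L energy_nonneg by (simp flip: ennreal_mult ennreal_plus)
  finally have "ennreal (LINT x|lborel. (\<zeta> x)\<^sup>2)
      \<le> ennreal (2 * L * measure lebesgue S + 2 / m * (2 ^ DIM('a) * m * ((2 * \<delta>)\<^sup>2 * energy)))"
    by (subst (asm) nn_integral_eq_integral[OF test_square_integrable(1)]) simp_all
  then have "(LINT x|lborel. (\<zeta> x)\<^sup>2) \<le> 2 * L * measure lebesgue S + 2 / m * (2 ^ DIM('a) * m * ((2 * \<delta>)\<^sup>2 * energy))"
    using m L energy_nonneg by (subst (asm) ennreal_le_iff) auto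
  also have "2 / m * (2 ^ DIM('a) * m * ((2 * \<delta>)\<^sup>2 * energy)) = 8 * 2 ^ DIM('a) * \<delta>\<^sup>2 * energy"
    using m by (simp add: power_mult_distrib)
  also have "2 * L * measure lebesgue S = 2 * measure lebesgue S / m\<^sup>2 * (\<Sum>y\<in>Y. (l y)\<^sup>2)"
    by (simp add: L_def power_divide sum_divide_distrib[symmetric])
  finally show ?thesis unfolding m_def l_def .
qed

end

section \<open>Passage from test functions to \<open>H10\<close>\<close>

context
  fixes \<Omega> :: "'a::euclidean_space set"
  assumes \<Omega>: "open \<Omega>"
begin

lemma test_dirichlet_mass:
  assumes \<zeta>: "\<zeta> \<in> test_functions \<Omega>"
  shows "dirichlet \<Omega> \<zeta> \<zeta> = energy \<zeta>" "mass \<Omega> \<zeta> \<zeta> = (LINT x|lborel. (\<zeta> x)\<^sup>2)"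
proof -
  note [measurable] = test_borel[OF \<zeta>]
  note \<Omega>L = open_lebesgue[OF \<Omega>]
  have "test_grad \<zeta> x = 0" if "x \<notin> \<Omega>" for x
    using test_grad_zero_outside[OF \<zeta>] test_support(2)[OF \<zeta>] that by blast
  then have "(LINT x|lebesgue_on \<Omega>. (norm (test_grad \<zeta> x))\<^sup>2) = energy \<zeta>"
    unfolding energy_def[OF \<zeta>] by (intro integral_lebesgue_on_borel(1)[OF \<Omega>L]) auto
  moreover have "(LINT x|lebesgue_on \<Omega>. (norm (test_grad \<zeta> x))\<^sup>2)
      = (LINT x|lebesgue_on \<Omega>. 1 * (wgrad \<Omega> \<zeta> x \<bullet> wgrad \<Omega> \<zeta> x))"
  proof (rule integral_cong_AE)
    show "(\<lambda>x. (norm (test_grad \<zeta> x))\<^sup>2) \<in> borel_measurable (lebesgue_on \<Omega>)"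
      by (rule borel_measurable_lebesgue_onI) measurable
    show "(\<lambda>x. 1 * (wgrad \<Omega> \<zeta> x \<bullet> wgrad \<Omega> \<zeta> x)) \<in> borel_measurable (lebesgue_on \<Omega>)"
      by (rule borel_measurable_integrable[OF sobolev_form_integrable(1)[OF \<Omega>, where K = 1]])
        (auto simp: test_function_H1(1)[OF \<Omega> \<zeta>] bounded_coeff_def)
    show "AE x in lebesgue_on \<Omega>. (norm (test_grad \<zeta> x))\<^sup>2 = 1 * (wgrad \<Omega> \<zeta> x \<bullet> wgrad \<Omega> \<zeta> x)"
      using test_function_H1(2)[OF \<Omega> \<zeta>] by eventually_elim (simp add: dot_square_norm)
  qed
  ultimately show "dirichlet \<Omega> \<zeta> \<zeta> = energy \<zeta>" by (simp add: sobolev_form_def)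
  have "(LINT x|lebesgue_on \<Omega>. (\<zeta> x)\<^sup>2) = (LINT x|lborel. (\<zeta> x)\<^sup>2)"
    using test_zero_outside(2)[OF \<zeta>] by (intro integral_lebesgue_on_borel(1)[OF \<Omega>L]) auto
  then show "mass \<Omega> \<zeta> \<zeta> = (LINT x|lborel. (\<zeta> x)\<^sup>2)" by (simp add: sobolev_form_def power2_eq_square)
qed

text \<open>Approximate \<open>u\<close> by a test function and split twice, once in the mass and
  once in \<open>N\<close>. Each splitting costs a factor 2, hence the 4, and \<open>bound\<close>
  makes the approximation errors arbitrarily small.\<close>

lemma H10_bound_by_density:
  assumes test: "\<And>\<zeta>. \<zeta> \<in> test_functions \<Omega> \<Longrightarrow> mass \<Omega> \<zeta> \<zeta> \<le> N \<zeta>"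
    and diff: "\<And>u v. u \<in> H1 \<Omega> \<Longrightarrow> v \<in> H1 \<Omega> \<Longrightarrow> N (\<lambda>x. u x - v x) \<le> 2 * N u + 2 * N v"
    and bound: "\<And>u. u \<in> H1 \<Omega> \<Longrightarrow> N u \<le> K * (dirichlet \<Omega> u u + mass \<Omega> u u)" and K: "0 \<le> K"
    and u: "u \<in> H10 \<Omega>"
  shows "mass \<Omega> u u \<le> 4 * N u"
proof (rule field_le_epsilon)
  fix e :: real assume e: "0 < e"
  interpret H1: function_space "H1 \<Omega>" by (rule H1_function_space[OF \<Omega>])
  \<comment> \<open>Chosen so that the collected errors \<open>4 * (K * q) + 2 * q\<close> add up to
    \<open>e\<close>.\<close>
  define q where "q = e / (4 * K + 2)"
  have q: "0 < q" using e K by (simp add: q_def add_nonneg_pos)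
  obtain \<zeta> where \<zeta>: "\<zeta> \<in> test_functions \<Omega>" and Q: "dirichlet \<Omega> (\<lambda>x. u x - \<zeta> x) (\<lambda>x. u x - \<zeta> x)
      + mass \<Omega> (\<lambda>x. u x - \<zeta> x) (\<lambda>x. u x - \<zeta> x) < q"
    using conjunct2[OF u[unfolded H10_iff[OF \<Omega>]], rule_format, OF q] by blast
  note uH = H10_H1[OF \<Omega> u] and \<zeta>H = test_function_H1(1)[OF \<Omega> \<zeta>]
  let ?d = "\<lambda>x. u x - \<zeta> x"
  have dH: "?d \<in> H1 \<Omega>" by (rule H1.diff_mem[OF uH \<zeta>H])
  have nn: "0 \<le> dirichlet \<Omega> ?d ?d" by (rule nonneg_form.nonneg[OF dirichlet_form[OF \<Omega>] dH])
  have s1: "mass \<Omega> u u \<le> 2 * mass \<Omega> \<zeta> \<zeta> + 2 * mass \<Omega> ?d ?d"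
    using nonneg_form_sum_bound[OF mass_form[OF \<Omega>] \<zeta>H dH, of 1] by simp
  have s2: "mass \<Omega> \<zeta> \<zeta> \<le> 2 * N u + 2 * N ?d"
    using test[OF \<zeta>] diff[OF uH dH] by simp
  have s3: "N ?d \<le> K * q"
    using bound[OF dH] mult_left_mono[OF less_imp_le[OF Q] K] by linarith
  have "mass \<Omega> u u \<le> 4 * N u + (4 * (K * q) + 2 * q)" using s1 s2 s3 Q nn by linarith
  also have "\<dots> = 4 * N u + e"
  proof -
    have "4 * (K * q) + 2 * q = (4 * K + 2) * q" by (simp add: algebra_simps)
    also have "\<dots> = e" using K by (simp add: q_def)
    finally show ?thesis by simp
  qed
  finally show "mass \<Omega> u u \<le> 4 * N u + e" .
qed

lemma Poincare:
  assumes b: "bounded \<Omega>"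
  shows "\<exists>P>0. \<forall>u\<in>H10 \<Omega>. mass \<Omega> u u \<le> P * dirichlet \<Omega> u u"
proof -
  interpret D: nonneg_form "H1 \<Omega>" "dirichlet \<Omega>" by (rule dirichlet_form[OF \<Omega>])
  interpret M: nonneg_form "H1 \<Omega>" "mass \<Omega>" by (rule mass_form[OF \<Omega>])
  obtain R where R: "0 < R" "\<Omega> \<subseteq> ball 0 R" using bounded_subset_ballD[OF b, of 0] by blast
  let ?N = "\<lambda>u. 2 * R\<^sup>2 * dirichlet \<Omega> u u"
  have "mass \<Omega> u u \<le> 4 * ?N u" if u: "u \<in> H10 \<Omega>" for u
  proof (rule H10_bound_by_density[where N = ?N and K = "2 * R\<^sup>2"])
    show "mass \<Omega> \<zeta> \<zeta> \<le> ?N \<zeta>" if "\<zeta> \<in> test_functions \<Omega>" for \<zeta>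
      using test_Poincare[OF that R(2,1)] test_dirichlet_mass[OF that] by simp
    show "?N (\<lambda>x. u x - v x) \<le> 2 * ?N u + 2 * ?N v" if "u \<in> H1 \<Omega>" "v \<in> H1 \<Omega>" for u v
      using mult_left_mono[OF nonneg_form_sum_bound[OF D.nonneg_form_axioms that, of "-1"], of "2 * R\<^sup>2"]
      by (simp add: algebra_simps)
    show "?N u \<le> 2 * R\<^sup>2 * (dirichlet \<Omega> u u + mass \<Omega> u u)" if "u \<in> H1 \<Omega>" for u
      using M.nonneg[OF that] by (intro mult_left_mono) auto
  qed (use u in auto)
  then show ?thesis using R(1) by (intro exI[of _ "8 * R\<^sup>2"]) (auto simp: mult.assoc)
qed

text \<open>The plain integral over the part of \<open>B\<close> inside \<Omega>, not divided by a
  volume; the normalization sits in the constant of the bound in which it is used.\<close>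

definition local_mean :: "'a set \<Rightarrow> ('a \<Rightarrow> real) \<Rightarrow> real" where
  "local_mean B u = (LINT x|lebesgue_on \<Omega>. indicator B x * u x)"

lemma local_mean_integrable:
  assumes b: "bounded \<Omega>" and u: "u \<in> H1 \<Omega>" and B: "B \<in> sets borel"
  shows "integrable (lebesgue_on \<Omega>) (\<lambda>x. indicator B x * u x)"
    "integrable (lebesgue_on \<Omega>) (\<lambda>x. (indicator B x * u x)\<^sup>2)"
proof -
  note \<Omega>L = open_lebesgue[OF \<Omega>]
  interpret finite_measure "lebesgue_on \<Omega>"
    by (rule finite_measure_lebesgue_on[OF bounded_set_imp_lmeasurable[OF b \<Omega>L]])
  have u2: "u \<in> borel_measurable (lebesgue_on \<Omega>)" "integrable (lebesgue_on \<Omega>) (\<lambda>x. (u x)\<^sup>2)"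
    using H1_wgrad(3)[OF \<Omega> u] by (auto simp: L2_iff)
  have m: "(\<lambda>x. indicator B x * u x) \<in> borel_measurable (lebesgue_on \<Omega>)"
    using B by (intro borel_measurable_times u2 borel_measurable_lebesgue_onI) simp
  show "integrable (lebesgue_on \<Omega>) (\<lambda>x. (indicator B x * u x)\<^sup>2)"
    by (rule Bochner_Integration.integrable_bound[OF u2(2)])
      (use m in \<open>auto simp: indicator_def\<close>)
  show "integrable (lebesgue_on \<Omega>) (\<lambda>x. indicator B x * u x)"
  proof (rule Bochner_Integration.integrable_bound[OF _ m])
    show "integrable (lebesgue_on \<Omega>) (\<lambda>x. 1 + (u x)\<^sup>2)" using u2 by simp
    have "\<bar>t\<bar> \<le> 1 + t\<^sup>2" for t :: real
      using sum_squares_bound[of "\<bar>t\<bar>" 1] zero_le_power2[of t] unfolding mult_1_right power_one power2_abs by linarith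
    then show "AE x in lebesgue_on \<Omega>. norm (indicator B x * u x) \<le> norm (1 + (u x)\<^sup>2)"
      by (intro AE_I2) (auto simp: indicator_def)
  qed
qed

lemma local_mean_diff:
  assumes b: "bounded \<Omega>" and u: "u \<in> H1 \<Omega>" and v: "v \<in> H1 \<Omega>" and B: "B \<in> sets borel"
  shows "local_mean B (\<lambda>x. u x - v x) = local_mean B u - local_mean B v"
  using local_mean_integrable(1)[OF b u B] local_mean_integrable(1)[OF b v B]
  by (simp add: local_mean_def right_diff_distrib)

lemma local_mean_bound:
  assumes b: "bounded \<Omega>" and u: "u \<in> H1 \<Omega>" and B: "B \<in> sets borel"
  shows "(local_mean B u)\<^sup>2 \<le> measure lebesgue \<Omega> * mass \<Omega> u u"
proof -
  note \<Omega>L = open_lebesgue[OF \<Omega>]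
  have fin: "finite_measure (lebesgue_on \<Omega>)"
    by (rule finite_measure_lebesgue_on[OF bounded_set_imp_lmeasurable[OF b \<Omega>L]])
  have u2: "integrable (lebesgue_on \<Omega>) (\<lambda>x. (u x)\<^sup>2)"
    using H1_wgrad(3)[OF \<Omega> u] by (auto simp: L2_iff)
  have "(local_mean B u)\<^sup>2 \<le> (LINT x|lebesgue_on \<Omega>. (indicator B x * u x)\<^sup>2) * measure (lebesgue_on \<Omega>) (space (lebesgue_on \<Omega>))"
    unfolding local_mean_def by (rule square_integral_le[OF fin local_mean_integrable[OF b u B]])
  also have "\<dots> \<le> (LINT x|lebesgue_on \<Omega>. (u x)\<^sup>2) * measure (lebesgue_on \<Omega>) (space (lebesgue_on \<Omega>))"
    by (intro mult_right_mono integral_mono local_mean_integrable(2)[OF b u B] u2) (auto simp: indicator_def)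
  also have "measure (lebesgue_on \<Omega>) (space (lebesgue_on \<Omega>)) = measure lebesgue \<Omega>"
    using \<Omega>L by (simp add: measure_restrict_space space_restrict_space)
  also have "(LINT x|lebesgue_on \<Omega>. (u x)\<^sup>2) = mass \<Omega> u u" by (simp add: sobolev_form_def power2_eq_square)
  finally show ?thesis by (simp add: mult.commute)
qed

text \<open>Quantitative form of compactness: up to a small multiple of the energy, the mass is
  controlled by finitely many linear functionals. For sequences of bounded energy this leaves the
  convergence of countably many numerical sequences.\<close>

lemma Rellich_bound:
  assumes b: "bounded \<Omega>" and e: "0 < e"
  shows "\<exists>Y C \<delta>. finite Y \<and> 0 \<le> C \<and>
    (\<forall>u\<in>H10 \<Omega>. mass \<Omega> u u \<le> C * (\<Sum>y\<in>Y. (local_mean (ball y \<delta>) u)\<^sup>2) + e * dirichlet \<Omega> u u)"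
proof -
  interpret D: nonneg_form "H1 \<Omega>" "dirichlet \<Omega>" by (rule dirichlet_form[OF \<Omega>])
  interpret M: nonneg_form "H1 \<Omega>" "mass \<Omega>" by (rule mass_form[OF \<Omega>])
  note \<Omega>L = open_lebesgue[OF \<Omega>]
  \<comment> \<open>With this radius the energy term for test functions has the coefficient e / 4,
    which the factor 4 of the density argument turns into \<open>e\<close>.\<close>
  define \<delta> where "\<delta> = sqrt (e / (32 * 2 ^ DIM('a)))"
  have \<delta>: "0 < \<delta>" using e by (simp add: \<delta>_def)
  have \<delta>2: "8 * 2 ^ DIM('a) * \<delta>\<^sup>2 = e / 4" using e by (simp add: \<delta>_def)
  obtain Y where Y: "finite Y" "\<Omega> \<subseteq> (\<Union>y\<in>Y. ball y \<delta>)"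
  proof -
    have "compact (closure \<Omega>)" using b by (simp add: compact_closure)
    then obtain Y where "finite Y" "closure \<Omega> \<subseteq> (\<Union>y\<in>Y. ball y \<delta>)"
      by (rule compactE_image[of _ "closure \<Omega>" "\<lambda>y. ball y \<delta>"]) (use \<delta> in auto)
    then show ?thesis using that closure_subset[of \<Omega>] by blast
  qed
  define C where "C = 2 * measure lebesgue \<Omega> / (measure lborel (ball 0 \<delta> :: 'a set))\<^sup>2"
  have C: "0 \<le> C" by (simp add: C_def)
  define N where "N u = C * (\<Sum>y\<in>Y. (local_mean (ball y \<delta>) u)\<^sup>2) + e / 4 * dirichlet \<Omega> u u" for u
  have Bb: "ball y \<delta> \<in> sets borel" for y :: 'a by simp
  have "mass \<Omega> u u \<le> 4 * N u" if u: "u \<in> H10 \<Omega>" for u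
  proof (rule H10_bound_by_density[where N = N and K = "C * (card Y * measure lebesgue \<Omega>) + e / 4"])
    fix \<zeta> assume \<zeta>: "\<zeta> \<in> test_functions \<Omega>"
    note [measurable] = test_borel[OF \<zeta>]
    have "local_mean (ball y \<delta>) \<zeta> = (LINT x|lborel. indicator (ball y \<delta>) x * \<zeta> x)" for y
      unfolding local_mean_def
    proof (rule integral_lebesgue_on_borel(1)[OF \<Omega>L])
      have [measurable]: "ball y \<delta> \<in> sets borel" by simp
      show "(\<lambda>x. indicat_real (ball y \<delta>) x * \<zeta> x) \<in> borel_measurable borel" by measurable
    qed (use test_zero_outside(2)[OF \<zeta>] in auto)
    then show "mass \<Omega> \<zeta> \<zeta> \<le> N \<zeta>"
      using test_finite_rank_bound[OF \<zeta> \<Omega>L b \<delta> Y] unfolding test_dirichlet_mass(2)[OF \<zeta>] \<delta>2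
      by (simp add: N_def test_dirichlet_mass(1)[OF \<zeta>] C_def)
  next
    fix u v assume u: "u \<in> H1 \<Omega>" and v: "v \<in> H1 \<Omega>"
    have "(local_mean (ball y \<delta>) (\<lambda>x. u x - v x))\<^sup>2 \<le> 2 * (local_mean (ball y \<delta>) u)\<^sup>2 + 2 * (local_mean (ball y \<delta>) v)\<^sup>2" for y
    proof -
      have "(p - q)\<^sup>2 \<le> 2 * p\<^sup>2 + 2 * q\<^sup>2" for p q :: real
        using zero_le_power2[of "p + q"] by (simp add: power2_sum power2_diff)
      then show ?thesis unfolding local_mean_diff[OF b u v Bb] .
    qed
    then have "(\<Sum>y\<in>Y. (local_mean (ball y \<delta>) (\<lambda>x. u x - v x))\<^sup>2)
        \<le> (\<Sum>y\<in>Y. 2 * (local_mean (ball y \<delta>) u)\<^sup>2 + 2 * (local_mean (ball y \<delta>) v)\<^sup>2)"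
      by (rule sum_mono)
    then have "C * (\<Sum>y\<in>Y. (local_mean (ball y \<delta>) (\<lambda>x. u x - v x))\<^sup>2)
        \<le> C * (\<Sum>y\<in>Y. 2 * (local_mean (ball y \<delta>) u)\<^sup>2 + 2 * (local_mean (ball y \<delta>) v)\<^sup>2)"
      using C by (rule mult_left_mono)
    moreover have "e / 4 * dirichlet \<Omega> (\<lambda>x. u x - v x) (\<lambda>x. u x - v x) \<le> e / 4 * (2 * dirichlet \<Omega> u u + 2 * dirichlet \<Omega> v v)"
      using nonneg_form_sum_bound[OF D.nonneg_form_axioms u v, of "-1"] e by (intro mult_left_mono) auto
    ultimately show "N (\<lambda>x. u x - v x) \<le> 2 * N u + 2 * N v"
      by (simp add: N_def sum.distrib sum_distrib_left[symmetric] algebra_simps)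
  next
    fix u assume u: "u \<in> H1 \<Omega>"
    have "(\<Sum>y\<in>Y. (local_mean (ball y \<delta>) u)\<^sup>2) \<le> (\<Sum>y\<in>Y. measure lebesgue \<Omega> * mass \<Omega> u u)"
      by (intro sum_mono local_mean_bound[OF b u Bb])
    also have "\<dots> = card Y * measure lebesgue \<Omega> * mass \<Omega> u u" by simp
    also have "\<dots> \<le> card Y * measure lebesgue \<Omega> * (dirichlet \<Omega> u u + mass \<Omega> u u)"
      using D.nonneg[OF u] by (intro mult_left_mono) auto
    finally have "C * (\<Sum>y\<in>Y. (local_mean (ball y \<delta>) u)\<^sup>2) \<le> C * (card Y * measure lebesgue \<Omega> * (dirichlet \<Omega> u u + mass \<Omega> u u))"
      using C by (rule mult_left_mono)
    moreover have "e / 4 * dirichlet \<Omega> u u \<le> e / 4 * (dirichlet \<Omega> u u + mass \<Omega> u u)"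
      using M.nonneg[OF u] e by (intro mult_left_mono) auto
    ultimately show "N u \<le> (C * (card Y * measure lebesgue \<Omega>) + e / 4) * (dirichlet \<Omega> u u + mass \<Omega> u u)"
      unfolding N_def by (simp add: algebra_simps)
  qed (use u C e in auto)
  then have "mass \<Omega> u u \<le> 4 * C * (\<Sum>y\<in>Y. (local_mean (ball y \<delta>) u)\<^sup>2) + e * dirichlet \<Omega> u u" if "u \<in> H10 \<Omega>" for u
    using that by (simp add: N_def algebra_simps)
  then show ?thesis using Y(1) C by (intro exI[of _ Y] exI[of _ "4 * C"] exI[of _ \<delta>]) auto
qed

text \<open>A diagonal subsequence makes the integrals over countably many balls converge
  simultaneously. For differences along it, the finite rank part belonging to the accuracy
  \<open>ep k\<close> becomes small, and the energy part is at most
  \<open>ep k * (4 * \<bar>K\<bar>)\<close>.\<close>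

theorem Rellich:
  assumes b: "bounded \<Omega>" and v: "\<And>n::nat. v n \<in> H10 \<Omega>" and K: "\<And>n. dirichlet \<Omega> (v n) (v n) \<le> K"
  shows "\<exists>s. strict_mono (s :: nat \<Rightarrow> nat) \<and> (\<forall>e>0. \<exists>N. \<forall>m\<ge>N. \<forall>n\<ge>N.
    mass \<Omega> (\<lambda>x. v (s m) x - v (s n) x) (\<lambda>x. v (s m) x - v (s n) x) < e)"
proof -
  interpret D: nonneg_form "H1 \<Omega>" "dirichlet \<Omega>" by (rule dirichlet_form[OF \<Omega>])
  interpret H10: function_space "H10 \<Omega>" by (rule H10_function_space[OF \<Omega>])
  note vH = H10_H1[OF \<Omega> v]
  define ep where "ep k = 1 / real (Suc k)" for k
  have ep: "0 < ep k" for k by (simp add: ep_def)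
  have "\<forall>k. \<exists>Y C \<delta>. finite Y \<and> 0 \<le> C \<and>
    (\<forall>u\<in>H10 \<Omega>. mass \<Omega> u u \<le> C * (\<Sum>y\<in>Y. (local_mean (ball y \<delta>) u)\<^sup>2) + ep k * dirichlet \<Omega> u u)"
    using Rellich_bound[OF b ep] by blast
  then obtain Y C \<delta> where Y: "\<And>k. finite (Y k)" and C: "\<And>k. 0 \<le> C k"
    and bound: "\<And>k u. u \<in> H10 \<Omega> \<Longrightarrow>
      mass \<Omega> u u \<le> C k * (\<Sum>y\<in>Y k. (local_mean (ball y (\<delta> k)) u)\<^sup>2) + ep k * dirichlet \<Omega> u u"
    by metis
  \<comment> \<open>The balls for all accuracies at once: a countable union of finite families, so
    that one subsequence serves every \<open>k\<close>.\<close>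
  define \<B> where "\<B> = (\<Union>k. (\<lambda>y. ball y (\<delta> k)) ` Y k)"
  have "countable \<B>" unfolding \<B>_def using Y by (intro countable_UN countable_image) (auto intro: countable_finite)
  obtain P where P: "0 < P" "\<And>u. u \<in> H10 \<Omega> \<Longrightarrow> mass \<Omega> u u \<le> P * dirichlet \<Omega> u u" using Poincare[OF b] by blast
  have bd: "norm (local_mean B (v n)) \<le> sqrt (measure lebesgue \<Omega> * (P * K))" if B: "B \<in> \<B>" for n B
  proof -
    have "B \<in> sets borel" using B by (auto simp: \<B>_def)
    from local_mean_bound[OF b vH this]
    have "(local_mean B (v n))\<^sup>2 \<le> measure lebesgue \<Omega> * mass \<Omega> (v n) (v n)" .
    also have "\<dots> \<le> measure lebesgue \<Omega> * (P * K)"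
      using order_trans[OF P(2)[OF v[of n]] mult_left_mono[OF K[of n], of P]] P(1) by (intro mult_left_mono) auto
    finally show ?thesis by (simp add: real_le_rsqrt)
  qed
  obtain s :: "nat \<Rightarrow> nat" where s: "strict_mono s"
    and conv: "\<And>B. B \<in> \<B> \<Longrightarrow> \<exists>l. (\<lambda>n. local_mean B (v (s n))) \<longlonglongrightarrow> l"
    by (rule function_convergent_subsequence[where f = "\<lambda>n B. local_mean B (v n)", OF \<open>countable \<B>\<close> bd]) auto
  let ?d = "\<lambda>m n x. v (s m) x - v (s n) x"
  have "\<exists>N. \<forall>m\<ge>N. \<forall>n\<ge>N. mass \<Omega> (?d m n) (?d m n) < e" if e: "0 < e" for e
  proof -
    obtain k where k: "ep k * (4 * \<bar>K\<bar>) < e / 2"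
    proof -
      obtain k :: nat where "4 * \<bar>K\<bar> * 2 / e < real k" using reals_Archimedean2 by blast
      then have "4 * \<bar>K\<bar> * 2 / e < real (Suc k)" by simp
      then have "ep k * (4 * \<bar>K\<bar>) < e / 2" using e by (simp add: ep_def field_simps)
      then show ?thesis by (rule that)
    qed
    define f where "f m n = C k * (\<Sum>y\<in>Y k. (local_mean (ball y (\<delta> k)) (?d m n))\<^sup>2)" for m n
    have "\<exists>N. \<forall>m\<ge>N. \<forall>n\<ge>N. f m n < e / 2"
    proof -
      \<comment> \<open>When each of the \<open>card (Y k)\<close> squares is below \<tau>, their
        sum weighted with \<open>C k\<close> is below e / 2; the summand 1 keeps the denominator
        positive.\<close>
      define \<tau> where "\<tau> = e / (2 * (C k * card (Y k) + 1))"
      have den: "0 < 2 * (C k * card (Y k) + 1)" using C[of k] by (simp add: add_nonneg_pos)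
      have \<tau>: "0 < \<tau>" using e den by (simp add: \<tau>_def)
      have "\<forall>y\<in>Y k. \<exists>N. \<forall>m\<ge>N. \<forall>n\<ge>N. (local_mean (ball y (\<delta> k)) (?d m n))\<^sup>2 < \<tau>"
      proof
        fix y assume y: "y \<in> Y k"
        then have "ball y (\<delta> k) \<in> \<B>" by (auto simp: \<B>_def)
        then have "Cauchy (\<lambda>n. local_mean (ball y (\<delta> k)) (v (s n)))"
          using conv LIMSEQ_imp_Cauchy by blast
        then obtain N where N: "\<And>m n. N \<le> m \<Longrightarrow> N \<le> n \<Longrightarrow>
            dist (local_mean (ball y (\<delta> k)) (v (s m))) (local_mean (ball y (\<delta> k)) (v (s n))) < sqrt \<tau>"
          using \<tau> unfolding Cauchy_def by (metis real_sqrt_gt_zero)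
        have "(local_mean (ball y (\<delta> k)) (?d m n))\<^sup>2 < \<tau>" if "N \<le> m" "N \<le> n" for m n
        proof -
          have "\<bar>local_mean (ball y (\<delta> k)) (?d m n)\<bar> < sqrt \<tau>"
            using N[OF that] local_mean_diff[OF b vH vH, of "ball y (\<delta> k)"] by (simp add: dist_real_def)
          then have "\<bar>local_mean (ball y (\<delta> k)) (?d m n)\<bar>\<^sup>2 < (sqrt \<tau>)\<^sup>2" by (intro power_strict_mono) auto
          then show ?thesis using \<tau> by simp
        qed
        then show "\<exists>N. \<forall>m\<ge>N. \<forall>n\<ge>N. (local_mean (ball y (\<delta> k)) (?d m n))\<^sup>2 < \<tau>" by blast
      qed
      then obtain N where N: "\<And>y m n. y \<in> Y k \<Longrightarrow> N y \<le> m \<Longrightarrow> N y \<le> n \<Longrightarrow>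
          (local_mean (ball y (\<delta> k)) (?d m n))\<^sup>2 < \<tau>" by metis
      have "f m n < e / 2" if mn: "(\<Sum>y\<in>Y k. N y) \<le> m" "(\<Sum>y\<in>Y k. N y) \<le> n" for m n
      proof -
        have le: "N y \<le> (\<Sum>y\<in>Y k. N y)" if "y \<in> Y k" for y using Y[of k] that by (intro member_le_sum) auto
        have "(\<Sum>y\<in>Y k. (local_mean (ball y (\<delta> k)) (?d m n))\<^sup>2) \<le> (\<Sum>y\<in>Y k. \<tau>)"
          using mn le by (intro sum_mono less_imp_le[OF N]) (auto intro: order_trans)
        then have "f m n \<le> C k * (card (Y k) * \<tau>)" unfolding f_def using C[of k] by (intro mult_left_mono) auto
        also have "\<dots> < (C k * card (Y k) + 1) * \<tau>" using \<tau> by (simp add: algebra_simps)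
        also have "\<dots> = e / 2"
        proof -
          have "D * (e / (2 * D)) = e / 2" if "0 < 2 * D" for D :: real using that by simp
          from this[OF den] show ?thesis unfolding \<tau>_def .
        qed
        finally show ?thesis .
      qed
      then show ?thesis by blast
    qed
    then obtain N where N: "\<And>m n. N \<le> m \<Longrightarrow> N \<le> n \<Longrightarrow> f m n < e / 2" by blast
    have "mass \<Omega> (?d m n) (?d m n) < e" if "N \<le> m" "N \<le> n" for m n
    proof -
      have "dirichlet \<Omega> (?d m n) (?d m n) \<le> 2 * dirichlet \<Omega> (v (s m)) (v (s m)) + 2 * dirichlet \<Omega> (v (s n)) (v (s n))"
        using nonneg_form_sum_bound[OF D.nonneg_form_axioms vH vH, where r = "-1"] by simp
      also have "\<dots> \<le> 4 * \<bar>K\<bar>" using K[of "s m"] K[of "s n"] by linarith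
      finally have "ep k * dirichlet \<Omega> (?d m n) (?d m n) \<le> ep k * (4 * \<bar>K\<bar>)"
        using ep[of k] by (intro mult_left_mono) auto
      moreover have "mass \<Omega> (?d m n) (?d m n) \<le> f m n + ep k * dirichlet \<Omega> (?d m n) (?d m n)"
        unfolding f_def by (rule bound[OF H10.diff_mem[OF v v]])
      ultimately show ?thesis using k N[OF that] by linarith
    qed
    then show ?thesis by blast
  qed
  with s show ?thesis by blast
qed

end

section \<open>Completeness of \<open>H\<^sup>1\<^sub>0\<close>\<close>

text \<open>On a bounded set the L^2 Cauchy property implies the L^1 one, which yields a subsequence
  that is Cauchy almost everywhere. Fatou's lemma, applied to the squared distances to this
  subsequence, shows that its pointwise limit is the L^2 limit.\<close>

lemma L2_complete:
  fixes f :: "nat \<Rightarrow> 'a::euclidean_space \<Rightarrow> 'b::euclidean_space"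
  assumes S: "S \<in> sets lebesgue" "bounded S" and f: "\<And>n. f n \<in> L2 S"
    and cauchy: "\<And>e. 0 < e \<Longrightarrow> \<exists>N. \<forall>m\<ge>N. \<forall>n\<ge>N. (LINT x|lebesgue_on S. (norm (f m x - f n x))\<^sup>2) < e"
  shows "\<exists>g\<in>L2 S. (\<lambda>n. LINT x|lebesgue_on S. (norm (f n x - g x))\<^sup>2) \<longlonglongrightarrow> 0"
proof -
  let ?M = "lebesgue_on S"
  have fin: "finite_measure ?M"
    by (rule finite_measure_lebesgue_on[OF bounded_set_imp_lmeasurable[OF S(2,1)]])
  interpret finite_measure ?M by (rule fin)
  define \<mu> where "\<mu> = measure ?M (space ?M)"
  have \<mu>: "0 \<le> \<mu>" by (simp add: \<mu>_def)
  have [measurable]: "f n \<in> borel_measurable ?M" for n using f by (simp add: L2_iff)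
  have d: "(\<lambda>x. f m x - f n x) \<in> L2 S" for m n
    using L2_lincomb[OF f f, of m "-1" n] by simp
  have sq: "integrable ?M (\<lambda>x. (norm (g x))\<^sup>2)" if "g \<in> L2 S" for g :: "'a \<Rightarrow> 'b"
    using that by (simp add: L2_iff)
  have norm_int: "integrable ?M (\<lambda>x. norm (g x))" if g: "g \<in> L2 S" for g :: "'a \<Rightarrow> 'b"
  proof (rule Bochner_Integration.integrable_bound)
    show "integrable ?M (\<lambda>x. 1 + (norm (g x))\<^sup>2)" using sq[OF g] by simp
    show "(\<lambda>x. norm (g x)) \<in> borel_measurable ?M"
      using conjunct1[OF g[unfolded L2_iff]] by measurable
    have "t \<le> 1 + t\<^sup>2" for t :: real
      using sum_squares_bound[of t 1] zero_le_power2[of t] unfolding mult_1_right power_one by linarith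
    then show "AE x in ?M. norm (norm (g x)) \<le> norm (1 + (norm (g x))\<^sup>2)" by (intro AE_I2) simp
  qed
  have "integrable ?M (f n)" for n using norm_int[OF f[of n]] by (simp add: integrable_norm_iff)
  moreover have "\<exists>N. \<forall>i\<ge>N. \<forall>j\<ge>N. (LINT x|?M. norm (f i x - f j x)) < e" if e: "0 < e" for e
  proof -
    have "0 < e\<^sup>2 / (\<mu> + 1)" using e \<mu> by (simp add: add_nonneg_pos)
    then obtain N where N: "\<And>i j. N \<le> i \<Longrightarrow> N \<le> j \<Longrightarrow> (LINT x|?M. (norm (f i x - f j x))\<^sup>2) < e\<^sup>2 / (\<mu> + 1)"
      using cauchy by blast
    have "(LINT x|?M. norm (f i x - f j x)) < e" if ij: "N \<le> i" "N \<le> j" for i j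
    proof -
      have "(LINT x|?M. norm (f i x - f j x))\<^sup>2 \<le> (LINT x|?M. (norm (f i x - f j x))\<^sup>2) * \<mu>"
        unfolding \<mu>_def using square_integral_le[OF fin norm_int[OF d] sq[OF d]] .
      also have "\<dots> \<le> e\<^sup>2 / (\<mu> + 1) * \<mu>" using N[OF ij] \<mu> by (intro mult_right_mono) auto
      also have "\<dots> < e\<^sup>2"
      proof -
        have "e\<^sup>2 * \<mu> < e\<^sup>2 * (\<mu> + 1)" using e by (intro mult_strict_left_mono) auto
        then show ?thesis using \<mu> by (simp add: pos_divide_less_eq add_nonneg_pos)
      qed
      finally show ?thesis using e by (simp add: power2_less_imp_less)
    qed
    then show ?thesis by blast
  qed
  ultimately obtain r where r: "strict_mono r" and ae: "AE x in ?M. Cauchy (\<lambda>i. f (r i) x)"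
    by (rule cauchy_L1_AE_cauchy_subseq[where M = ?M and s = f]) auto
  define g where "g x = lim (\<lambda>i. f (r i) x)" for x
  have [measurable]: "g \<in> borel_measurable ?M"
    unfolding g_def[abs_def] by (rule borel_measurable_lim_metric) simp
  have lim: "AE x in ?M. (\<lambda>i. f (r i) x) \<longlonglongrightarrow> g x"
    using ae by eventually_elim (simp add: g_def Cauchy_convergent convergent_LIMSEQ_iff[symmetric])
  \<comment> \<open>Stated for nonnegative integrals, because the square integrability of
    \<open>f n - g\<close> is deduced from it.\<close>
  have fatou: "(\<integral>\<^sup>+x. ennreal ((norm (f n x - g x))\<^sup>2) \<partial>?M) \<le> ennreal e"
    if N: "\<forall>m\<ge>N. \<forall>n\<ge>N. (LINT x|?M. (norm (f m x - f n x))\<^sup>2) < e" and n: "N \<le> n" for n N e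
  proof -
    have "(\<integral>\<^sup>+x. ennreal ((norm (f n x - g x))\<^sup>2) \<partial>?M) = (\<integral>\<^sup>+x. liminf (\<lambda>i. ennreal ((norm (f n x - f (r i) x))\<^sup>2)) \<partial>?M)"
    proof (rule nn_integral_cong_AE)
      show "AE x in ?M. ennreal ((norm (f n x - g x))\<^sup>2) = liminf (\<lambda>i. ennreal ((norm (f n x - f (r i) x))\<^sup>2))"
        using lim
      proof eventually_elim
        case (elim x)
        have "(\<lambda>i. ennreal ((norm (f n x - f (r i) x))\<^sup>2)) \<longlonglongrightarrow> ennreal ((norm (f n x - g x))\<^sup>2)"
          using elim by (intro tendsto_ennrealI tendsto_intros)
        then show ?case by (rule lim_imp_Liminf[OF sequentially_bot, symmetric])
      qed
    qed
    also have "\<dots> \<le> liminf (\<lambda>i. \<integral>\<^sup>+x. ennreal ((norm (f n x - f (r i) x))\<^sup>2) \<partial>?M)"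
      by (rule nn_integral_liminf) measurable
    also have "\<dots> \<le> ennreal e"
    proof (rule Liminf_le)
      have "(\<integral>\<^sup>+x. ennreal ((norm (f n x - f (r i) x))\<^sup>2) \<partial>?M) \<le> ennreal e" if "N \<le> i" for i
      proof -
        have "(\<integral>\<^sup>+x. ennreal ((norm (f n x - f (r i) x))\<^sup>2) \<partial>?M) = ennreal (LINT x|?M. (norm (f n x - f (r i) x))\<^sup>2)"
          by (rule nn_integral_eq_integral[OF sq[OF d]]) simp
        also have "\<dots> \<le> ennreal e"
          using N n that seq_suble[OF r, of i] by (intro ennreal_leI less_imp_le) auto
        finally show ?thesis .
      qed
      then show "\<forall>\<^sub>F i in sequentially. (\<integral>\<^sup>+x. ennreal ((norm (f n x - f (r i) x))\<^sup>2) \<partial>?M) \<le> ennreal e"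
        by (auto simp: eventually_sequentially)
    qed simp
    finally show ?thesis .
  qed
  obtain N1 where N1: "\<forall>m\<ge>N1. \<forall>n\<ge>N1. (LINT x|?M. (norm (f m x - f n x))\<^sup>2) < 1" using cauchy[of 1] by auto
  have diff: "(\<lambda>x. f n x - g x) \<in> L2 S" if "N1 \<le> n" for n
  proof -
    have "integrable ?M (\<lambda>x. (norm (f n x - g x))\<^sup>2)"
      by (rule integrableI_nonneg) (use fatou[OF N1 that] in \<open>auto simp: le_less_trans\<close>)
    then show ?thesis by (simp add: L2_iff)
  qed
  have gL2: "g \<in> L2 S"
    using L2_lincomb[OF f[of N1] diff[of N1], of "-1"] by simp
  have "(\<lambda>n. LINT x|?M. (norm (f n x - g x))\<^sup>2) \<longlonglongrightarrow> 0"
  proof (rule LIMSEQ_I)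
    fix e :: real assume e: "0 < e"
    obtain N where N: "\<forall>m\<ge>N. \<forall>n\<ge>N. (LINT x|?M. (norm (f m x - f n x))\<^sup>2) < e / 2" using cauchy[of "e / 2"] e by auto
    have "norm ((LINT x|?M. (norm (f n x - g x))\<^sup>2) - 0) < e" if n: "max N N1 \<le> n" for n
    proof -
      have "ennreal (LINT x|?M. (norm (f n x - g x))\<^sup>2) \<le> ennreal (e / 2)"
      proof -
        have "ennreal (LINT x|?M. (norm (f n x - g x))\<^sup>2) = (\<integral>\<^sup>+x. ennreal ((norm (f n x - g x))\<^sup>2) \<partial>?M)"
          using n by (intro nn_integral_eq_integral[symmetric] sq diff) auto
        also have "\<dots> \<le> ennreal (e / 2)" using fatou[OF N, of n] n by simp
        finally show ?thesis .
      qed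
      then have "(LINT x|?M. (norm (f n x - g x))\<^sup>2) \<le> e / 2" using e by (subst (asm) ennreal_le_iff) auto
      moreover have "0 \<le> (LINT x|?M. (norm (f n x - g x))\<^sup>2)" by (rule integral_nonneg_AE) simp
      ultimately show ?thesis using e by simp
    qed
    then show "\<exists>no. \<forall>n\<ge>no. norm ((LINT x|?M. (norm (f n x - g x))\<^sup>2) - 0) < e" by blast
  qed
  with gL2 show ?thesis by blast
qed

lemma integral_mult_bounded_tendsto_0:
  fixes w :: "nat \<Rightarrow> 'a::euclidean_space \<Rightarrow> real"
  assumes S: "S \<in> sets lebesgue" "bounded S" and w: "\<And>n. w n \<in> L2 S"
    and lim: "(\<lambda>n. LINT x|lebesgue_on S. (w n x)\<^sup>2) \<longlonglongrightarrow> 0"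
    and p: "p \<in> borel_measurable borel" "\<And>x. \<bar>p x\<bar> \<le> B"
  shows "(\<lambda>n. LINT x|lebesgue_on S. w n x * p x) \<longlonglongrightarrow> 0"
    and "integrable (lebesgue_on S) (\<lambda>x. w n x * p x)"
proof -
  let ?M = "lebesgue_on S"
  have fin: "finite_measure ?M"
    by (rule finite_measure_lebesgue_on[OF bounded_set_imp_lmeasurable[OF S(2,1)]])
  interpret finite_measure ?M by (rule fin)
  note [measurable] = borel_measurable_lebesgue_onI[OF p(1), of S]
  have [measurable]: "w n \<in> borel_measurable ?M" for n using w by (simp add: L2_iff)
  have w2: "integrable ?M (\<lambda>x. (w n x)\<^sup>2)" for n using w[of n] by (simp add: L2_iff)
  have B: "0 \<le> B" using p(2)[of undefined] by simp
  have pB: "(p x)\<^sup>2 \<le> B\<^sup>2" for x using power_mono[OF p(2)[of x], of 2] by simp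
  have wp: "(w n x * p x)\<^sup>2 \<le> B\<^sup>2 * (w n x)\<^sup>2" for n x
    using mult_right_mono[OF pB, of "(w n x)\<^sup>2" x] by (simp add: power_mult_distrib mult.commute)
  have sq: "integrable ?M (\<lambda>x. (w n x * p x)\<^sup>2)" for n
  proof (rule Bochner_Integration.integrable_bound)
    show "integrable ?M (\<lambda>x. B\<^sup>2 * (w n x)\<^sup>2)" using w2 by simp
    show "AE x in ?M. norm ((w n x * p x)\<^sup>2) \<le> norm (B\<^sup>2 * (w n x)\<^sup>2)"
    proof (rule AE_I2)
      show "norm ((w n x * p x)\<^sup>2) \<le> norm (B\<^sup>2 * (w n x)\<^sup>2)" for x
        using order_trans[OF wp abs_ge_self] by simp
    qed
  qed measurable
  show int: "integrable ?M (\<lambda>x. w n x * p x)" for n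
  proof (rule Bochner_Integration.integrable_bound)
    show "integrable ?M (\<lambda>x. 1 + (w n x * p x)\<^sup>2)" using sq by simp
    have "\<bar>t\<bar> \<le> 1 + t\<^sup>2" for t :: real
      using sum_squares_bound[of "\<bar>t\<bar>" 1] zero_le_power2[of t] unfolding mult_1_right power_one power2_abs by linarith
    then show "AE x in ?M. norm (w n x * p x) \<le> norm (1 + (w n x * p x)\<^sup>2)" by (intro AE_I2) simp
  qed measurable
  have bound: "(LINT x|?M. w n x * p x)\<^sup>2 \<le> (B\<^sup>2 * measure ?M (space ?M)) * (LINT x|?M. (w n x)\<^sup>2)" for n
  proof -
    have "(LINT x|?M. w n x * p x)\<^sup>2 \<le> (LINT x|?M. (w n x * p x)\<^sup>2) * measure ?M (space ?M)"
      by (rule square_integral_le[OF fin int sq])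
    also have "(LINT x|?M. (w n x * p x)\<^sup>2) \<le> (LINT x|?M. B\<^sup>2 * (w n x)\<^sup>2)"
      by (rule integral_mono[OF sq integrable_mult_right[OF w2] wp])
    finally show ?thesis by (simp add: mult_right_mono mult_ac)
  qed
  have "(\<lambda>n. (LINT x|?M. w n x * p x)\<^sup>2) \<longlonglongrightarrow> 0"
  proof (rule tendsto_sandwich[OF _ _ tendsto_const])
    show "(\<lambda>n. (B\<^sup>2 * measure ?M (space ?M)) * (LINT x|?M. (w n x)\<^sup>2)) \<longlonglongrightarrow> 0"
      using tendsto_mult_left[OF lim, of "B\<^sup>2 * measure ?M (space ?M)"] by simp
  qed (use bound in auto)
  then have "(\<lambda>n. sqrt ((LINT x|?M. w n x * p x)\<^sup>2)) \<longlonglongrightarrow> 0" using tendsto_real_sqrt by fastforce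
  then show "(\<lambda>n. LINT x|?M. w n x * p x) \<longlonglongrightarrow> 0" by (simp add: tendsto_rabs_zero_iff)
qed

lemma mem_L2_inner:
  fixes g :: "'a::euclidean_space \<Rightarrow> 'b::euclidean_space"
  assumes g: "g \<in> L2 S" and b: "b \<in> Basis"
  shows "(\<lambda>x. g x \<bullet> b) \<in> L2 S" "(LINT x|lebesgue_on S. (g x \<bullet> b)\<^sup>2) \<le> (LINT x|lebesgue_on S. (norm (g x))\<^sup>2)"
proof -
  note [measurable] = conjunct1[OF g[unfolded L2_iff]]
  have i: "integrable (lebesgue_on S) (\<lambda>x. (norm (g x))\<^sup>2)" using g by (simp add: L2_iff)
  have le: "(g x \<bullet> b)\<^sup>2 \<le> (norm (g x))\<^sup>2" for x
    using power_mono[OF Basis_le_norm[OF b, of "g x"], of 2] by simp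
  have i': "integrable (lebesgue_on S) (\<lambda>x. (g x \<bullet> b)\<^sup>2)"
    by (rule Bochner_Integration.integrable_bound[OF i]) (use le in auto)
  then show "(\<lambda>x. g x \<bullet> b) \<in> L2 S" by (simp add: L2_iff)
  show "(LINT x|lebesgue_on S. (g x \<bullet> b)\<^sup>2) \<le> (LINT x|lebesgue_on S. (norm (g x))\<^sup>2)"
    by (rule integral_mono[OF i' i]) (rule le)
qed

lemma weak_gradient_closed:
  fixes v :: "nat \<Rightarrow> 'a::euclidean_space \<Rightarrow> real"
  assumes \<Omega>: "\<Omega> \<in> sets lebesgue" "bounded \<Omega>"
    and v: "\<And>n. v n \<in> L2 \<Omega>" "\<And>n. G n \<in> L2 \<Omega>" "\<And>n. has_weak_gradient \<Omega> (v n) (G n)"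
    and u: "u \<in> L2 \<Omega>" "(\<lambda>n. LINT x|lebesgue_on \<Omega>. (norm (v n x - u x))\<^sup>2) \<longlonglongrightarrow> 0"
    and H: "H \<in> L2 \<Omega>" "(\<lambda>n. LINT x|lebesgue_on \<Omega>. (norm (G n x - H x))\<^sup>2) \<longlonglongrightarrow> 0"
  shows "has_weak_gradient \<Omega> u H"
  unfolding has_weak_gradient_def
proof (intro conjI ballI)
  show "u \<in> L1_loc \<Omega>" "H \<in> L1_loc \<Omega>" using L2_L1_loc \<Omega>(1) u(1) H(1) by blast+
  fix \<zeta> b assume \<zeta>: "\<zeta> \<in> test_functions \<Omega>" and b: "b \<in> (Basis :: 'a set)"
  note [measurable] = test_borel[OF \<zeta>]
  obtain B where B: "\<And>x. \<bar>\<zeta> x\<bar> \<le> B" using test_bounded[OF \<zeta>] by blast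
  obtain B' where B': "\<And>x. norm (test_grad \<zeta> x) \<le> B'" using test_grad_bounded[OF \<zeta>] by blast
  have B'': "\<bar>test_grad \<zeta> x \<bullet> b\<bar> \<le> B'" for x using Basis_le_norm[OF b, of "test_grad \<zeta> x"] B'[of x] by linarith
  have pm: "(\<lambda>x. test_grad \<zeta> x \<bullet> b) \<in> borel_measurable borel" by measurable
  have vu: "(\<lambda>x. v n x - u x) \<in> L2 \<Omega>" for n using L2_lincomb[OF v(1) u(1), of n "-1"] by simp
  have GH: "(\<lambda>x. G n x - H x) \<in> L2 \<Omega>" for n using L2_lincomb[OF v(2) H(1), of n "-1"] by simp
  have lim1: "(\<lambda>n. LINT x|lebesgue_on \<Omega>. (v n x - u x) * (test_grad \<zeta> x \<bullet> b)) \<longlonglongrightarrow> 0"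
    by (rule integral_mult_bounded_tendsto_0(1)[OF \<Omega> vu _ pm B'']) (use u(2) in simp)
  have limGH: "(\<lambda>n. LINT x|lebesgue_on \<Omega>. ((G n x - H x) \<bullet> b)\<^sup>2) \<longlonglongrightarrow> 0"
    by (rule tendsto_sandwich[OF _ _ tendsto_const H(2)]) (use mem_L2_inner(2)[OF GH b] in auto)
  have lim2: "(\<lambda>n. LINT x|lebesgue_on \<Omega>. ((G n x - H x) \<bullet> b) * \<zeta> x) \<longlonglongrightarrow> 0"
    by (rule integral_mult_bounded_tendsto_0(1)[OF \<Omega> mem_L2_inner(1)[OF GH b] limGH test_borel(1)[OF \<zeta>] B])
  \<comment> \<open>The weak gradient identity for \<open>v n\<close> cancels the terms containing
    \<open>v n\<close> and \<open>G n\<close>, so the sum of two vanishing sequences is independent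
    of \<open>n\<close> and therefore 0.\<close>
  have eq: "(LINT x|lebesgue_on \<Omega>. (v n x - u x) * (test_grad \<zeta> x \<bullet> b)) + (LINT x|lebesgue_on \<Omega>. ((G n x - H x) \<bullet> b) * \<zeta> x)
      = - (LINT x|lebesgue_on \<Omega>. u x * (test_grad \<zeta> x \<bullet> b)) - (LINT x|lebesgue_on \<Omega>. (H x \<bullet> b) * \<zeta> x)" for n
  proof -
    have 0: "(\<lambda>n::nat. LINT x|lebesgue_on \<Omega>. ((\<lambda>x. 0::real) x)\<^sup>2) \<longlonglongrightarrow> 0" by simp
    have i: "integrable (lebesgue_on \<Omega>) (\<lambda>x. w x * p x)"
      if "w \<in> L2 \<Omega>" "p \<in> borel_measurable borel" "\<And>x. \<bar>p x\<bar> \<le> K" for w p :: "'a \<Rightarrow> real" and K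
    proof -
      have "bounded_coeff \<Omega> K p"
        using that borel_measurable_lebesgue_onI[OF that(2)] by (simp add: bounded_coeff_def)
      moreover have "(\<lambda>x. 1) \<in> L2 \<Omega>"
        using finite_measure.integrable_const[OF finite_measure_lebesgue_on[OF bounded_set_imp_lmeasurable[OF \<Omega>(2,1)]]]
        by (simp add: L2_iff)
      ultimately show ?thesis using L2_inner_integrable[of \<Omega> K p w "\<lambda>x. 1"] that(1) by (simp add: mult.commute)
    qed
    have iv: "integrable (lebesgue_on \<Omega>) (\<lambda>x. v n x * (test_grad \<zeta> x \<bullet> b))"
      "integrable (lebesgue_on \<Omega>) (\<lambda>x. u x * (test_grad \<zeta> x \<bullet> b))"
      by (rule i[OF _ pm B''], rule v u)+
    have iG: "integrable (lebesgue_on \<Omega>) (\<lambda>x. (G n x \<bullet> b) * \<zeta> x)" "integrable (lebesgue_on \<Omega>) (\<lambda>x. (H x \<bullet> b) * \<zeta> x)"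
      by (rule i[OF mem_L2_inner(1)[OF _ b] test_borel(1)[OF \<zeta>] B], rule v H)+
    have "(LINT x|lebesgue_on \<Omega>. v n x * (test_grad \<zeta> x \<bullet> b)) = - (LINT x|lebesgue_on \<Omega>. (G n x \<bullet> b) * \<zeta> x)"
      using bspec[OF bspec[OF conjunct2[OF conjunct2[OF v(3)[of n, unfolded has_weak_gradient_def]]] \<zeta>] b]
      unfolding test_partial[OF \<zeta> b] .
    then show ?thesis using iv iG by (simp add: left_diff_distrib inner_diff_left)
  qed
  have "(\<lambda>n. (LINT x|lebesgue_on \<Omega>. (v n x - u x) * (test_grad \<zeta> x \<bullet> b)) + (LINT x|lebesgue_on \<Omega>. ((G n x - H x) \<bullet> b) * \<zeta> x)) \<longlonglongrightarrow> 0 + 0"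
    by (rule tendsto_add[OF lim1 lim2])
  then have "- (LINT x|lebesgue_on \<Omega>. u x * (test_grad \<zeta> x \<bullet> b)) - (LINT x|lebesgue_on \<Omega>. (H x \<bullet> b) * \<zeta> x) = 0"
    unfolding eq by (simp add: LIMSEQ_const_iff)
  then show "(LINT x|lebesgue_on \<Omega>. u x * frechet_derivative \<zeta> (at x) b) = - (LINT x|lebesgue_on \<Omega>. (H x \<bullet> b) * \<zeta> x)"
    by (simp add: test_partial[OF \<zeta> b])
qed

context
  fixes \<Omega> :: "'a::euclidean_space set"
  assumes \<Omega>: "open \<Omega>" and bdd: "bounded \<Omega>"
begin

lemma mass_eq: "mass \<Omega> u u = (LINT x|lebesgue_on \<Omega>. (norm (u x))\<^sup>2)"
  by (simp add: sobolev_form_def power2_eq_square)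

text \<open>\<open>G\<close> may be any weak gradient of \<open>v\<close>, so the formula can be
  used with the L^2 limit of the gradients rather than with the representative chosen by
  \<open>wgrad\<close>.\<close>

lemma dirichlet_diff_eq:
  assumes u: "u \<in> H1 \<Omega>" and v: "v \<in> H1 \<Omega>" and G: "has_weak_gradient \<Omega> v G" "G \<in> L2 \<Omega>"
  shows "dirichlet \<Omega> (\<lambda>x. u x - v x) (\<lambda>x. u x - v x) = (LINT x|lebesgue_on \<Omega>. (norm (wgrad \<Omega> u x - G x))\<^sup>2)"
proof -
  have mem: "(\<lambda>x. u x - v x) \<in> H1 \<Omega>" using H1_lincomb(1)[OF \<Omega> u v, of "-1"] by simp
  have "(LINT x|lebesgue_on \<Omega>. 1 * (wgrad \<Omega> (\<lambda>x. u x - v x) x \<bullet> wgrad \<Omega> (\<lambda>x. u x - v x) x))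
      = (LINT x|lebesgue_on \<Omega>. (norm (wgrad \<Omega> u x - G x))\<^sup>2)"
  proof (rule integral_cong_AE)
    show "(\<lambda>x. 1 * (wgrad \<Omega> (\<lambda>x. u x - v x) x \<bullet> wgrad \<Omega> (\<lambda>x. u x - v x) x)) \<in> borel_measurable (lebesgue_on \<Omega>)"
      by (rule borel_measurable_integrable[OF sobolev_form_integrable(1)[OF \<Omega> mem mem, where K = 1]])
        (simp add: bounded_coeff_def)
    show "(\<lambda>x. (norm (wgrad \<Omega> u x - G x))\<^sup>2) \<in> borel_measurable (lebesgue_on \<Omega>)"
      using H1_wgrad(2)[OF \<Omega> u] G(2) by (auto simp: L2_iff)
    have "AE x in lebesgue_on \<Omega>. wgrad \<Omega> (\<lambda>x. u x - v x) x = wgrad \<Omega> u x - wgrad \<Omega> v x"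
      using H1_lincomb(2)[OF \<Omega> u v, of "-1"] by simp
    then show "AE x in lebesgue_on \<Omega>. 1 * (wgrad \<Omega> (\<lambda>x. u x - v x) x \<bullet> wgrad \<Omega> (\<lambda>x. u x - v x) x)
        = (norm (wgrad \<Omega> u x - G x))\<^sup>2"
      using wgrad_unique[OF \<Omega> G(1)] by eventually_elim (simp add: dot_square_norm)
  qed
  then show ?thesis by (simp add: sobolev_form_def)
qed

text \<open>Poincare's inequality turns the energy Cauchy property into an L^2 one. Functions and
  gradients converge separately, closedness of the weak gradient joins the two limits, and test
  functions close to a late \<open>v n\<close> are close to the limit as well.\<close>

theorem H10_complete:
  fixes v :: "nat \<Rightarrow> 'a \<Rightarrow> real"
  assumes v: "\<And>n. v n \<in> H10 \<Omega>"
    and cauchy: "\<And>e. 0 < e \<Longrightarrow> \<exists>N. \<forall>m\<ge>N. \<forall>n\<ge>N. dirichlet \<Omega> (\<lambda>x. v m x - v n x) (\<lambda>x. v m x - v n x) < e"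
  shows "\<exists>u\<in>H10 \<Omega>. (\<lambda>n. dirichlet \<Omega> (\<lambda>x. v n x - u x) (\<lambda>x. v n x - u x)) \<longlonglongrightarrow> 0"
proof -
  interpret H1: function_space "H1 \<Omega>" by (rule H1_function_space[OF \<Omega>])
  interpret H10: function_space "H10 \<Omega>" by (rule H10_function_space[OF \<Omega>])
  note \<Omega>L = open_lebesgue[OF \<Omega>]
  note vH = H10_H1[OF \<Omega> v]
  obtain P where P: "0 < P" "\<And>u. u \<in> H10 \<Omega> \<Longrightarrow> mass \<Omega> u u \<le> P * dirichlet \<Omega> u u" using Poincare[OF \<Omega> bdd] by blast
  have "\<exists>N. \<forall>m\<ge>N. \<forall>n\<ge>N. (LINT x|lebesgue_on \<Omega>. (norm (v m x - v n x))\<^sup>2) < e" if e: "0 < e" for e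
  proof -
    obtain N where N: "\<And>m n. N \<le> m \<Longrightarrow> N \<le> n \<Longrightarrow> dirichlet \<Omega> (\<lambda>x. v m x - v n x) (\<lambda>x. v m x - v n x) < e / P"
      using cauchy[of "e / P"] e P(1) by auto
    have "(LINT x|lebesgue_on \<Omega>. (norm (v m x - v n x))\<^sup>2) < e" if "N \<le> m" "N \<le> n" for m n
    proof -
      have "(LINT x|lebesgue_on \<Omega>. (norm (v m x - v n x))\<^sup>2) \<le> P * dirichlet \<Omega> (\<lambda>x. v m x - v n x) (\<lambda>x. v m x - v n x)"
        unfolding mass_eq[symmetric] by (rule P(2)[OF H10.diff_mem[OF v v]])
      also have "\<dots> < P * (e / P)" using N[OF that] P(1) by (rule mult_strict_left_mono)
      finally show ?thesis using P(1) by simp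
    qed
    then show ?thesis by blast
  qed
  from L2_complete[of _ v, OF \<Omega>L bdd H1_wgrad(3)[OF \<Omega> vH] this]
  obtain u where u: "u \<in> L2 \<Omega>" "(\<lambda>n. LINT x|lebesgue_on \<Omega>. (norm (v n x - u x))\<^sup>2) \<longlonglongrightarrow> 0"
    by blast
  have "\<exists>N. \<forall>m\<ge>N. \<forall>n\<ge>N. (LINT x|lebesgue_on \<Omega>. (norm (wgrad \<Omega> (v m) x - wgrad \<Omega> (v n) x))\<^sup>2) < e" if "0 < e" for e
    using cauchy[OF that] unfolding dirichlet_diff_eq[OF vH vH H1_wgrad(1,2)[OF \<Omega> vH]] .
  from L2_complete[of _ "\<lambda>n. wgrad \<Omega> (v n)", OF \<Omega>L bdd H1_wgrad(2)[OF \<Omega> vH] this]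
  obtain G where G: "G \<in> L2 \<Omega>" "(\<lambda>n. LINT x|lebesgue_on \<Omega>. (norm (wgrad \<Omega> (v n) x - G x))\<^sup>2) \<longlonglongrightarrow> 0"
    by blast
  have uG: "has_weak_gradient \<Omega> u G"
    by (rule weak_gradient_closed[OF \<Omega>L bdd H1_wgrad(3)[OF \<Omega> vH] H1_wgrad(2)[OF \<Omega> vH] H1_wgrad(1)[OF \<Omega> vH] u G])
  then have uH: "u \<in> H1 \<Omega>" using u(1) G(1) by (auto simp: H1_def)
  have dlim: "(\<lambda>n. dirichlet \<Omega> (\<lambda>x. v n x - u x) (\<lambda>x. v n x - u x)) \<longlonglongrightarrow> 0"
    using G(2) unfolding dirichlet_diff_eq[OF vH uH uG G(1)] .
  have mlim: "(\<lambda>n. mass \<Omega> (\<lambda>x. v n x - u x) (\<lambda>x. v n x - u x)) \<longlonglongrightarrow> 0"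
    using u(2) unfolding mass_eq .
  let ?Q = "\<lambda>w. dirichlet \<Omega> w w + mass \<Omega> w w"
  have "u \<in> H10 \<Omega>"
    unfolding H10_iff[OF \<Omega>]
  proof (intro conjI allI impI uH)
    fix e :: real assume e: "0 < e"
    have "(\<lambda>n. ?Q (\<lambda>x. v n x - u x)) \<longlonglongrightarrow> 0" using tendsto_add[OF dlim mlim] by simp
    from order_tendstoD(2)[OF this, of "e / 4"] e obtain n where n: "?Q (\<lambda>x. v n x - u x) < e / 4"
      by (auto simp: eventually_sequentially)
    obtain \<zeta> where \<zeta>: "\<zeta> \<in> test_functions \<Omega>" "?Q (\<lambda>x. v n x - \<zeta> x) < e / 4"
      using conjunct2[OF v[of n, unfolded H10_iff[OF \<Omega>]], rule_format, of "e / 4"] e by auto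
    have mem: "(\<lambda>x. v n x - \<zeta> x) \<in> H1 \<Omega>" "(\<lambda>x. v n x - u x) \<in> H1 \<Omega>"
      by (rule H1.diff_mem[OF vH test_function_H1(1)[OF \<Omega> \<zeta>(1)]], rule H1.diff_mem[OF vH uH])
    have "?Q (\<lambda>x. u x - \<zeta> x) \<le> 2 * ?Q (\<lambda>x. v n x - \<zeta> x) + 2 * ?Q (\<lambda>x. v n x - u x)"
      using nonneg_form_sum_bound[OF dirichlet_form[OF \<Omega>] mem, of "-1"]
        nonneg_form_sum_bound[OF mass_form[OF \<Omega>] mem, of "-1"] by simp
    moreover have "p < e" if "p \<le> 2 * q + 2 * r" "q < e / 4" "r < e / 4" for p q r :: real
      using that by simp
    ultimately have "?Q (\<lambda>x. u x - \<zeta> x) < e" using n \<zeta>(2) by blast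
    then show "\<exists>\<zeta>\<in>test_functions \<Omega>. ?Q (\<lambda>x. u x - \<zeta> x) < e" using \<zeta>(1) by blast
  qed
  with dlim show ?thesis by blast
qed

lemma weighted_mass_null_iff:
  assumes u: "u \<in> H1 \<Omega>" and \<gamma>: "bounded_coeff \<Omega> K \<gamma>" and pos: "AE x in lebesgue_on \<Omega>. 0 < \<gamma> x"
  shows "sobolev_form \<Omega> (\<lambda>x. 0) \<gamma> u u = 0 \<longleftrightarrow> (AE x in lebesgue_on \<Omega>. u x = 0)"
proof -
  have i: "integrable (lebesgue_on \<Omega>) (\<lambda>x. \<gamma> x * (u x \<bullet> u x))"
    by (rule sobolev_form_integrable(2)[OF \<Omega> u u \<gamma>])
  have "AE x in lebesgue_on \<Omega>. 0 \<le> \<gamma> x * (u x \<bullet> u x)"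
    using pos by eventually_elim simp
  then have "(LINT x|lebesgue_on \<Omega>. \<gamma> x * (u x \<bullet> u x)) = 0 \<longleftrightarrow> (AE x in lebesgue_on \<Omega>. \<gamma> x * (u x \<bullet> u x) = 0)"
    by (rule integral_nonneg_eq_0_iff_AE[OF i])
  also have "\<dots> \<longleftrightarrow> (AE x in lebesgue_on \<Omega>. u x = 0)"
  proof
    assume "AE x in lebesgue_on \<Omega>. \<gamma> x * (u x \<bullet> u x) = 0"
    then show "AE x in lebesgue_on \<Omega>. u x = 0" using pos by eventually_elim auto
  next
    assume "AE x in lebesgue_on \<Omega>. u x = 0"
    then show "AE x in lebesgue_on \<Omega>. \<gamma> x * (u x \<bullet> u x) = 0" by eventually_elim auto
  qed
  finally show ?thesis by (simp add: sobolev_form_def)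
qed

section \<open>Infinite dimension of \<open>H10\<close>, and the Dirichlet problem as a pair of
  forms\<close>

lemma Ck_on_inner_power: "Ck_on k UNIV (\<lambda>x::'a. (x \<bullet> b) ^ j)"
proof (induction j)
  case 0
  then show ?case by (simp add: Ck_on_const)
next
  case (Suc j)
  have "Ck_on k UNIV (\<lambda>x::'a. x \<bullet> b)"
  proof (cases k)
    case 0
    then show ?thesis by (simp add: continuous_intros)
  next
    case (Suc k')
    have "((\<lambda>x::'a. x \<bullet> b) has_derivative (\<lambda>h. h \<bullet> b)) (at x)" for x by (auto intro!: derivative_eq_intros)
    then show ?thesis unfolding Suc by (rule Ck_on_SucI) (rule Ck_on_const)
  qed
  then show ?case using Suc by (simp add: Ck_on_mult)
qed

text \<open>Products of a bump function with powers of one coordinate are linearly independent.\<close>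

lemma H10_infinite_dim:
  assumes ne: "\<Omega> \<noteq> {}"
  shows "\<exists>v :: nat \<Rightarrow> 'a \<Rightarrow> real. (\<forall>k<n. v k \<in> H10 \<Omega>) \<and>
    (\<forall>r. (AE x in lebesgue_on \<Omega>. (\<Sum>k<n. r k * v k x) = 0) \<longrightarrow> (\<forall>k<n. r k = 0))"
proof -
  obtain p where p: "p \<in> \<Omega>" using ne by blast
  obtain l u where lu: "p \<in> box l u" "cbox l u \<subseteq> \<Omega>" using open_contains_cbox[of \<Omega>] \<Omega> p by metis
  obtain b :: 'a where b: "b \<in> Basis" using nonempty_Basis by blast
  define v where "v k x = (x \<bullet> b) ^ k * box_bump l u 0 x" for k x
  have mem: "v k \<in> test_functions \<Omega>" for k
    unfolding v_def by (rule test_mult_smooth[OF box_bump_test_function[OF lu(2)] Ck_on_inner_power])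
  have "r k = 0" if ae: "AE x in lebesgue_on \<Omega>. (\<Sum>k<n. r k * v k x) = 0" and k: "k < n" for r k
  proof (rule ccontr)
    assume rk: "r k \<noteq> 0"
    have cont: "continuous_on UNIV (\<lambda>x. \<Sum>k<n. r k * v k x)"
      by (intro continuous_intros test_continuous[OF mem])
    \<comment> \<open>A continuous function that vanishes almost everywhere on an open set vanishes
      there identically.\<close>
    have zero: "(\<Sum>k<n. r k * v k x) = 0" if x: "x \<in> \<Omega>" for x
    proof -
      have "closed {x. (\<Sum>k<n. r k * v k x) = 0}" using cont by (intro closed_Collect_eq) auto
      moreover have "AE x\<in>\<Omega> in lebesgue. x \<in> {x. (\<Sum>k<n. r k * v k x) = 0}"
        using ae unfolding AE_lebesgue_on_iff[OF open_lebesgue[OF \<Omega>]] by simp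
      ultimately show ?thesis using mem_closed_if_AE_lebesgue_open[OF \<Omega> _ _ x] by blast
    qed
    have poly: "(\<Sum>k<n. r k * t ^ k) = 0" if t: "l \<bullet> b < t" "t < u \<bullet> b" for t
    proof -
      \<comment> \<open>Only the coordinate of \<open>p\<close> along \<open>b\<close> is changed,
        so the point stays in the box and every \<open>t\<close> strictly between the two faces is
        attained.\<close>
      define x where "x = p + (t - p \<bullet> b) *\<^sub>R b"
      have xb: "x \<bullet> b' = (if b' = b then t else p \<bullet> b')" if "b' \<in> Basis" for b'
        using b that by (simp add: x_def inner_add_left inner_Basis)
      then have x: "x \<in> box l u" using lu(1) t by (auto simp: mem_box)
      then have "x \<in> \<Omega>" using lu(2) box_subset_cbox by blast
      from zero[OF this] have "(\<Sum>k<n. r k * t ^ k) * box_bump l u 0 x = 0"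
        using xb[OF b] by (simp add: v_def sum_distrib_right mult.assoc)
      then show ?thesis using box_bump_nonzero_iff[of l u 0 x] x by simp
    qed
    have "infinite {l \<bullet> b<..<u \<bullet> b}" using lu(1) b by (intro infinite_Ioo) (auto simp: mem_box)
    moreover have "{l \<bullet> b<..<u \<bullet> b} \<subseteq> {t. (\<Sum>i\<le>n - 1. r i * t ^ i) = 0}"
    proof -
      have "{..n - 1} = {..<n}" using k by auto
      then show ?thesis using poly by auto
    qed
    moreover have "finite {t. (\<Sum>i\<le>n - 1. r i * t ^ i) = 0}"
      using rk k by (subst polyfun_finite_roots) (auto intro!: exI[of _ k])
    ultimately show False using finite_subset by blast
  qed
  then show ?thesis using mem test_function_H10[OF \<Omega>] by (intro exI[of _ v]) auto
qed

text \<open>On \<open>H10\<close> the energy and the Dirichlet integral control each other, by the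
  lower bound on \<alpha> and Poincare's inequality, and the weighted mass is dominated by the plain
  mass. Coercivity, compactness and completeness are inherited along these comparisons.\<close>

theorem sobolev_form_pair:
  assumes ne: "\<Omega> \<noteq> {}"
    and \<alpha>: "bounded_coeff \<Omega> K \<alpha>" and \<beta>: "bounded_coeff \<Omega> K \<beta>" and \<gamma>: "bounded_coeff \<Omega> K \<gamma>" and K: "0 \<le> K"
    and c0: "0 < c0" and \<alpha>0: "AE x in lebesgue_on \<Omega>. c0 \<le> \<alpha> x" and \<beta>0: "AE x in lebesgue_on \<Omega>. 0 \<le> \<beta> x"
    and \<gamma>0: "AE x in lebesgue_on \<Omega>. c0 \<le> \<gamma> x"
  shows "\<exists>\<kappa>. form_pair (H10 \<Omega>) (sobolev_form \<Omega> \<alpha> \<beta>) (sobolev_form \<Omega> (\<lambda>x. 0) \<gamma>) (lebesgue_on \<Omega>) \<kappa>"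
proof -
  let ?A = "sobolev_form \<Omega> \<alpha> \<beta>" and ?C = "sobolev_form \<Omega> (\<lambda>x. 0) \<gamma>"
  interpret V: function_space "H10 \<Omega>" by (rule H10_function_space[OF \<Omega>])
  have sub: "H10 \<Omega> \<subseteq> H1 \<Omega>" using H10_H1[OF \<Omega>] by blast
  have 0: "bounded_coeff \<Omega> K (\<lambda>x. 0)" using K by (simp add: bounded_coeff_def)
  have symA: "sym_form (H10 \<Omega>) ?A"
    by (rule sym_form.sym_form_subspace[OF sym_form_sobolev[OF \<Omega> \<alpha> \<beta>] V.function_space_axioms sub])
  have symC: "sym_form (H10 \<Omega>) ?C"
    by (rule sym_form.sym_form_subspace[OF sym_form_sobolev[OF \<Omega> 0 \<gamma>] V.function_space_axioms sub])
  have \<alpha>p: "AE x in lebesgue_on \<Omega>. 0 \<le> \<alpha> x" using \<alpha>0 by eventually_elim (use c0 in simp)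
  have \<gamma>p: "AE x in lebesgue_on \<Omega>. 0 \<le> \<gamma> x" using \<gamma>0 by eventually_elim (use c0 in simp)
  have \<gamma>pp: "AE x in lebesgue_on \<Omega>. 0 < \<gamma> x" using \<gamma>0 by eventually_elim (use c0 in simp)
  interpret A: nonneg_form "H10 \<Omega>" ?A
    by (intro nonneg_form.intro symA nonneg_form_axioms.intro sobolev_form_nonneg[OF \<Omega>] \<alpha>p \<beta>0)
  interpret C: nonneg_form "H10 \<Omega>" ?C
    by (intro nonneg_form.intro symC nonneg_form_axioms.intro sobolev_form_nonneg[OF \<Omega>] \<gamma>p) simp
  obtain P where P: "0 < P" "\<And>u. u \<in> H10 \<Omega> \<Longrightarrow> mass \<Omega> u u \<le> P * dirichlet \<Omega> u u" using Poincare[OF \<Omega> bdd] by blast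
  have dirA: "c0 * dirichlet \<Omega> u u \<le> ?A u u" if "u \<in> H10 \<Omega>" for u
  proof -
    have "sobolev_form \<Omega> (\<lambda>x. c0) (\<lambda>x. 0) u u \<le> ?A u u"
    proof (rule sobolev_form_mono[OF \<Omega> H10_H1[OF \<Omega> that] _ 0 \<alpha> \<beta> \<alpha>0 \<beta>0])
      show "bounded_coeff \<Omega> c0 (\<lambda>x. c0)" using c0 by (simp add: bounded_coeff_def)
    qed
    then show ?thesis by (simp add: sobolev_form_def)
  qed
  have Adir: "?A u u \<le> (K + K * P) * dirichlet \<Omega> u u" if "u \<in> H10 \<Omega>" for u
    using sobolev_form_diagonal_bound[OF \<Omega> H10_H1[OF \<Omega> that] \<alpha> \<beta> K K] mult_left_mono[OF P(2)[OF that] K]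
    by (simp add: algebra_simps)
  have Cmas: "?C u u \<le> K * mass \<Omega> u u" if "u \<in> H10 \<Omega>" for u
    using sobolev_form_diagonal_bound[OF \<Omega> H10_H1[OF \<Omega> that] _ \<gamma> order_refl K, of "\<lambda>x. 0"]
    by (simp add: bounded_coeff_def)
  \<comment> \<open>The summand 1 keeps the constant positive also for \<open>K = 0\<close>.\<close>
  define \<kappa> where "\<kappa> = (K * P + 1) / c0"
  show ?thesis
  proof (intro exI[of _ \<kappa>] form_pair.intro A.nonneg_form_axioms C.nonneg_form_axioms form_pair_axioms.intro)
    show "?C u u = 0 \<longleftrightarrow> (AE x in lebesgue_on \<Omega>. u x = 0)" if "u \<in> H10 \<Omega>" for u
      by (rule weighted_mass_null_iff[OF H10_H1[OF \<Omega> that] \<gamma> \<gamma>pp])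
    have KP: "0 < K * P + 1" using K P(1) by (simp add: add_nonneg_pos)
    then show "0 < \<kappa>" using c0 by (simp add: \<kappa>_def)
    show "?C u u \<le> \<kappa> * ?A u u" if u: "u \<in> H10 \<Omega>" for u
    proof -
      have d0: "0 \<le> dirichlet \<Omega> u u" by (rule nonneg_form.nonneg[OF dirichlet_form[OF \<Omega>] H10_H1[OF \<Omega> u]])
      have "?C u u \<le> K * (P * dirichlet \<Omega> u u)" using Cmas[OF u] mult_left_mono[OF P(2)[OF u] K] by linarith
      also have "\<dots> \<le> (K * P + 1) * dirichlet \<Omega> u u" using d0 by (simp add: algebra_simps)
      also have "\<dots> \<le> (K * P + 1) * (?A u u / c0)"
        using dirA[OF u] c0 KP by (intro mult_left_mono) (auto simp: pos_le_divide_eq mult.commute)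
      finally show ?thesis by (simp add: \<kappa>_def)
    qed
  next
    fix v :: "nat \<Rightarrow> 'a \<Rightarrow> real" and L
    assume v: "\<And>n. v n \<in> H10 \<Omega>" and L: "\<And>n. ?A (v n) (v n) \<le> L"
    have "dirichlet \<Omega> (v n) (v n) \<le> L / c0" for n
      using dirA[OF v[of n]] L[of n] c0 by (simp add: pos_le_divide_eq mult.commute)
    from Rellich[of _ v, OF \<Omega> bdd v this] obtain s :: "nat \<Rightarrow> nat" where s: "strict_mono s"
      "\<forall>e>0. \<exists>N. \<forall>m\<ge>N. \<forall>n\<ge>N. mass \<Omega> (\<lambda>x. v (s m) x - v (s n) x) (\<lambda>x. v (s m) x - v (s n) x) < e"
      by blast
    have "\<exists>N. \<forall>m\<ge>N. \<forall>n\<ge>N. ?C (\<lambda>x. v (s m) x - v (s n) x) (\<lambda>x. v (s m) x - v (s n) x) < e" if e: "0 < e" for e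
    proof -
      have "0 < e / (K + 1)" using e K by simp
      from s(2)[rule_format, OF this] obtain N where N: "\<And>m n. N \<le> m \<Longrightarrow> N \<le> n \<Longrightarrow>
          mass \<Omega> (\<lambda>x. v (s m) x - v (s n) x) (\<lambda>x. v (s m) x - v (s n) x) < e / (K + 1)" by blast
      have "?C (\<lambda>x. v (s m) x - v (s n) x) (\<lambda>x. v (s m) x - v (s n) x) < e" if "N \<le> m" "N \<le> n" for m n
      proof -
        have "?C (\<lambda>x. v (s m) x - v (s n) x) (\<lambda>x. v (s m) x - v (s n) x)
            \<le> K * mass \<Omega> (\<lambda>x. v (s m) x - v (s n) x) (\<lambda>x. v (s m) x - v (s n) x)"
          by (rule Cmas[OF V.diff_mem[OF v v]])
        also have "\<dots> \<le> K * (e / (K + 1))" using N[OF that] K by (intro mult_left_mono) auto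
        also have "\<dots> < e"
        proof -
          have "K * e < (K + 1) * e" using e by simp
          then show ?thesis using K by (simp add: pos_divide_less_eq mult.commute)
        qed
        finally show ?thesis .
      qed
      then show ?thesis by blast
    qed
    with s(1) show "\<exists>s. strict_mono (s :: nat \<Rightarrow> nat) \<and> (\<forall>e>0. \<exists>N. \<forall>m\<ge>N. \<forall>n\<ge>N.
        ?C (\<lambda>x. v (s m) x - v (s n) x) (\<lambda>x. v (s m) x - v (s n) x) < e)" by blast
  next
    fix v :: "nat \<Rightarrow> 'a \<Rightarrow> real"
    assume v: "\<And>n. v n \<in> H10 \<Omega>"
      and cauchy: "\<And>e. 0 < e \<Longrightarrow> \<exists>N. \<forall>m\<ge>N. \<forall>n\<ge>N. ?A (\<lambda>x. v m x - v n x) (\<lambda>x. v m x - v n x) < e"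
    have "\<exists>N. \<forall>m\<ge>N. \<forall>n\<ge>N. dirichlet \<Omega> (\<lambda>x. v m x - v n x) (\<lambda>x. v m x - v n x) < e" if e: "0 < e" for e
    proof -
      have "0 < c0 * e" using e c0 by simp
      from cauchy[OF this] obtain N where N: "\<And>m n. N \<le> m \<Longrightarrow> N \<le> n \<Longrightarrow>
          ?A (\<lambda>x. v m x - v n x) (\<lambda>x. v m x - v n x) < c0 * e" by blast
      have "dirichlet \<Omega> (\<lambda>x. v m x - v n x) (\<lambda>x. v m x - v n x) < e" if "N \<le> m" "N \<le> n" for m n
      proof -
        have "c0 * dirichlet \<Omega> (\<lambda>x. v m x - v n x) (\<lambda>x. v m x - v n x) < c0 * e"
          using dirA[OF V.diff_mem[OF v v], of m n] N[OF that] by linarith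
        then show ?thesis using c0 by (simp only: mult_less_cancel_left_pos)
      qed
      then show ?thesis by blast
    qed
    from H10_complete[of v, OF v this] obtain u where u: "u \<in> H10 \<Omega>"
      and lim: "(\<lambda>n. dirichlet \<Omega> (\<lambda>x. v n x - u x) (\<lambda>x. v n x - u x)) \<longlonglongrightarrow> 0" by blast
    have "(\<lambda>n. ?A (\<lambda>x. v n x - u x) (\<lambda>x. v n x - u x)) \<longlonglongrightarrow> 0"
    proof (rule tendsto_sandwich[OF _ _ tendsto_const])
      show "(\<lambda>n. (K + K * P) * dirichlet \<Omega> (\<lambda>x. v n x - u x) (\<lambda>x. v n x - u x)) \<longlonglongrightarrow> 0"
        using tendsto_mult_left[OF lim, of "K + K * P"] by simp
    qed (use Adir[OF V.diff_mem[OF v u]] A.nonneg[OF V.diff_mem[OF v u]] in auto)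
    with u show "\<exists>u\<in>H10 \<Omega>. (\<lambda>n. ?A (\<lambda>x. v n x - u x) (\<lambda>x. v n x - u x)) \<longlonglongrightarrow> 0" by blast
  next
    fix n :: nat
    obtain v :: "nat \<Rightarrow> 'a \<Rightarrow> real" where v: "\<forall>k<n. v k \<in> H10 \<Omega>"
      "\<And>r. AE x in lebesgue_on \<Omega>. (\<Sum>k<n. r k * v k x) = 0 \<Longrightarrow> \<forall>k<n. r k = 0"
      using H10_infinite_dim[OF ne, of n] by blast
    have "\<forall>k<n. r k = 0" if "?C (\<lambda>x. \<Sum>k<n. r k * v k x) (\<lambda>x. \<Sum>k<n. r k * v k x) = 0" for r
    proof (rule v(2))
      have "(\<lambda>x. \<Sum>k<n. r k * v k x) \<in> H10 \<Omega>" using v(1) by (intro V.lincomb_mem) simp_all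
      from weighted_mass_null_iff[OF H10_H1[OF \<Omega> this] \<gamma> \<gamma>pp] that
      show "AE x in lebesgue_on \<Omega>. (\<Sum>k<n. r k * v k x) = 0" by blast
    qed
    with v(1) show "\<exists>v :: nat \<Rightarrow> 'a \<Rightarrow> real. (\<forall>k<n. v k \<in> H10 \<Omega>) \<and>
        (\<forall>r. ?C (\<lambda>x. \<Sum>k<n. r k * v k x) (\<lambda>x. \<Sum>k<n. r k * v k x) = 0 \<longrightarrow> (\<forall>k<n. r k = 0))" by blast
  qed
qed

end

section \<open>Derivatives of simple eigenvalues\<close>

context form_pair
begin

text \<open>After removal of the \<open>u k\<close> component, what remains is orthogonal to the
  whole system. It still solves the eigenvalue equation for \<open>\<Lambda> k\<close>, while the
  variational bound holds with a larger \<open>\<Lambda> n\<close>, so it is null. Being null for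
  both forms expresses that \<open>w\<close> is a multiple of \<open>u k\<close> almost
  everywhere.\<close>

lemma eigenfunction_multiple_of_basis:
  assumes sb: "spectral_basis \<Lambda> u" and simple: "\<And>n. n \<noteq> k \<Longrightarrow> \<Lambda> n \<noteq> \<Lambda> k"
    and w: "w \<in> V" "\<And>\<eta>. \<eta> \<in> V \<Longrightarrow> A w \<eta> = \<Lambda> k * C w \<eta>"
  shows "A (\<lambda>x. w x - C w (u k) * u k x) (\<lambda>x. w x - C w (u k) * u k x) = 0"
    and "C (\<lambda>x. w x - C w (u k) * u k x) (\<lambda>x. w x - C w (u k) * u k x) = 0"
proof -
  note basis = basis_mem[OF sb] basis_orth[OF sb] basis_eigen[OF sb]
  let ?z = "\<lambda>x. w x - C w (u k) * u k x"
  have s: "(\<lambda>x. C w (u k) * u k x) \<in> V" by (rule A.scale_mem[OF basis(1)])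
  have z: "?z \<in> V" by (rule A.diff_mem[OF w(1) s])
  have zu: "C ?z (u n) = C w (u n) - C w (u k) * C (u k) (u n)" for n
    unfolding C.diff_left[OF w(1) s basis(1)] C.scale_left[OF basis(1) basis(1)] ..
  have "C w (u n) = 0" if "n \<noteq> k" for n
  proof -
    have "\<Lambda> k * C w (u n) = \<Lambda> n * C w (u n)"
      using w(2)[OF basis(1), of n] basis(3)[OF w(1), of n] A.sym[OF w(1) basis(1), of n]
        C.sym[OF w(1) basis(1), of n] by metis
    then show ?thesis using simple[OF that] by simp
  qed
  then have orth: "C ?z (u n) = 0" for n unfolding zu by (cases "n = k") (simp_all add: basis(2))
  have eig: "A ?z \<eta> = \<Lambda> k * C ?z \<eta>" if \<eta>: "\<eta> \<in> V" for \<eta>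
    unfolding A.diff_left[OF w(1) s \<eta>] C.diff_left[OF w(1) s \<eta>] A.scale_left[OF basis(1) \<eta>] C.scale_left[OF basis(1) \<eta>]
    using w(2)[OF \<eta>] basis(3)[OF \<eta>] by (simp add: algebra_simps)
  obtain n where n: "\<Lambda> k < \<Lambda> n" using eigenvalues_unbounded[OF sb] by blast
  have "\<Lambda> n * C ?z ?z \<le> A ?z ?z" by (rule eigenvalue_min[OF sb z orth])
  then have "\<Lambda> n * C ?z ?z \<le> \<Lambda> k * C ?z ?z" unfolding eig[OF z] .
  moreover have "\<not> \<Lambda> n * C ?z ?z \<le> \<Lambda> k * C ?z ?z" if "0 < C ?z ?z" using that n by simp
  ultimately show 0: "C ?z ?z = 0" using C.nonneg[OF z] by force
  show "A ?z ?z = 0" using eig[OF z] 0 by simp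
qed

end

context perturbed_form_pair
begin

text \<open>Transfers the formula from the constructed basis vector to the prescribed eigenfunction.
  Up to a function of zero energy, \<open>w\<close> is plus or minus \<open>u k\<close>; the bounded
  forms \<open>A'\<close> and \<open>C'\<close> do not see that function, and quadratic expressions
  ignore the sign.\<close>

lemma simple_eigenvalue_derivative_eigenfunction:
  assumes sb: "spectral_basis \<Lambda> u" and simple: "\<And>n. n \<noteq> k \<Longrightarrow> \<Lambda> n \<noteq> \<Lambda> k"
    and sbt: "\<And>t. 0 < t \<Longrightarrow> t \<le> T \<Longrightarrow> form_pair.spectral_basis V (At t) (Ct t) (\<Lambda>t t) (ut t)"
    and w: "w \<in> V" "\<And>\<eta>. \<eta> \<in> V \<Longrightarrow> A w \<eta> = \<Lambda> k * C w \<eta>" "C w w = 1"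
  shows "((\<lambda>t. (\<Lambda>t t k - \<Lambda> k) / t) \<longlongrightarrow> A' w w - \<Lambda> k * C' w w) (at_right 0)"
proof -
  note basis = basis_mem[OF sb] basis_orth[OF sb]
  define r where "r = C w (u k)"
  define z where "z = (\<lambda>x. w x - r * u k x)"
  have z: "z \<in> V" unfolding z_def by (intro A.diff_mem A.scale_mem w(1) basis(1))
  have null: "A z z = 0" "C z z = 0"
    unfolding z_def r_def
    by (rule eigenfunction_multiple_of_basis(1)[OF sb simple w(1,2)],
        assumption, assumption, rule eigenfunction_multiple_of_basis(2)[OF sb simple w(1,2)])
  have w_eq: "w = (\<lambda>x. z x + r * u k x)" by (simp add: z_def)
  have Czu: "C z (u k) = 0" using C.null_left[OF z basis(1)] null(2) by blast
  have "C w w = r\<^sup>2" unfolding w_eq C.quadratic_add[OF z basis(1)] by (simp add: null Czu basis(2))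
  then have r2: "r\<^sup>2 = 1" using w(3) by simp
  have eq: "B w w = B (u k) (u k)"
    if "sym_form V B" and bound: "\<And>v w. v \<in> V \<Longrightarrow> w \<in> V \<Longrightarrow> \<bar>B v w\<bar> \<le> K * (sqrt (A v v) * sqrt (A w w))" for B
  proof -
    have "B z v = 0" if "v \<in> V" for v using bound[OF z that] null by simp
    then show ?thesis
      unfolding w_eq sym_form.quadratic_add[OF \<open>sym_form V B\<close> z basis(1)] by (simp add: r2 z basis(1))
  qed
  have "A' w w = A' (u k) (u k)" by (rule eq[OF form_A']) (rule bound_A')
  moreover have "C' w w = C' (u k) (u k)" by (rule eq[OF form_C']) (rule bound_C')
  moreover have "((\<lambda>t. (\<Lambda>t t k - \<Lambda> k) / t) \<longlongrightarrow> A' (u k) (u k) - \<Lambda> k * C' (u k) (u k)) (at_right 0)"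
    by (rule simple_eigenvalue_derivative[OF sb simple sbt])
  ultimately show ?thesis by simp
qed

end

section \<open>The Dirichlet eigenvalues of the state equation\<close>

lemma state_equation_iff:
  "state_equation \<Omega> a b c \<phi> \<mu> w \<longleftrightarrow> w \<in> H10 \<Omega> \<and> (\<forall>\<eta>\<in>H10 \<Omega>.
    sobolev_form \<Omega> (\<lambda>x. a (\<phi> x)) (\<lambda>x. b (\<phi> x)) w \<eta> = \<mu> * sobolev_form \<Omega> (\<lambda>x. 0) (\<lambda>x. c (\<phi> x)) w \<eta>)"
  by (simp add: state_equation_def sobolev_form_def mult.assoc)

text \<open>The shifted sequence shows that an enumeration exists, so the choice made in
  \<open>eigenvalue\<close> has the defining property. Its multiplicities are then the dimensions of
  the eigenspaces, as are those of \<Lambda>, and a nondecreasing sequence is determined by its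
  multiplicities.\<close>

lemma eigenvalue_eq_spectral_basis:
  fixes \<Omega> :: "'a::euclidean_space set"
  assumes pair: "form_pair (H10 \<Omega>) (sobolev_form \<Omega> (\<lambda>x. a (\<phi> x)) (\<lambda>x. b (\<phi> x)))
      (sobolev_form \<Omega> (\<lambda>x. 0) (\<lambda>x. c (\<phi> x))) (lebesgue_on \<Omega>) \<kappa>"
    and sb: "form_pair.spectral_basis (H10 \<Omega>) (sobolev_form \<Omega> (\<lambda>x. a (\<phi> x)) (\<lambda>x. b (\<phi> x)))
      (sobolev_form \<Omega> (\<lambda>x. 0) (\<lambda>x. c (\<phi> x))) \<Lambda> u"
  shows "eigenvalue \<Omega> a b c \<phi> (Suc k) = \<Lambda> k"
proof -
  interpret form_pair "H10 \<Omega>" "sobolev_form \<Omega> (\<lambda>x. a (\<phi> x)) (\<lambda>x. b (\<phi> x))"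
    "sobolev_form \<Omega> (\<lambda>x. 0) (\<lambda>x. c (\<phi> x))" "lebesgue_on \<Omega>" \<kappa> by (rule pair)
  have dim: "eigenspace_dim \<Omega> a b c \<phi> \<mu> (card {n. \<Lambda> n = \<mu>})" for \<mu>
    using ae_dim_eigenspace[OF sb, of \<mu>] unfolding eigenspace_dim_def state_equation_iff .
  \<comment> \<open>Enumerations count from 1, spectral bases from 0.\<close>
  have shift: "{k. 1 \<le> k \<and> L k = \<mu>} = Suc ` {n. L (Suc n) = \<mu>}" for L :: "nat \<Rightarrow> real" and \<mu>
  proof safe
    fix k :: nat assume "1 \<le> k"
    then show "k \<in> Suc ` {n. L (Suc n) = L k}" by (intro image_eqI[of _ _ "k - 1"]) auto
  qed auto
  have "eigenvalue_enumeration \<Omega> a b c \<phi> (\<lambda>k. \<Lambda> (k - 1))"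
    unfolding eigenvalue_enumeration_def shift
    using eigenvalues_mono[OF sb] finite_multiplicity[OF sb] dim
    by (auto simp: card_image diff_le_mono)
  then have enum: "eigenvalue_enumeration \<Omega> a b c \<phi> (SOME \<Lambda>. eigenvalue_enumeration \<Omega> a b c \<phi> \<Lambda>)"
    by (rule someI[of "eigenvalue_enumeration \<Omega> a b c \<phi>"])
  define L where "L = (SOME \<Lambda>. eigenvalue_enumeration \<Omega> a b c \<phi> \<Lambda>)"
  have L: "\<And>m n. 1 \<le> m \<Longrightarrow> m \<le> n \<Longrightarrow> L m \<le> L n" "\<And>\<mu>. finite {k. 1 \<le> k \<and> L k = \<mu>}"
    "\<And>\<mu>. eigenspace_dim \<Omega> a b c \<phi> \<mu> (card {k. 1 \<le> k \<and> L k = \<mu>})"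
  proof -
    note e = enum[folded L_def, unfolded eigenvalue_enumeration_def]
    show "L m \<le> L n" if "1 \<le> m" "m \<le> n" for m n using conjunct1[OF e, rule_format, OF conjI[OF that]] .
    show "finite {k. 1 \<le> k \<and> L k = \<mu>}"
      "eigenspace_dim \<Omega> a b c \<phi> \<mu> (card {k. 1 \<le> k \<and> L k = \<mu>})" for \<mu>
      using conjunct1[OF spec[OF conjunct2[OF e], of \<mu>]] conjunct2[OF spec[OF conjunct2[OF e], of \<mu>]] .
  qed
  have "L (Suc k) = \<Lambda> k"
  proof (rule mono_enumeration_unique[where f = "\<lambda>k. L (Suc k)" and g = \<Lambda>])
    show "mono (\<lambda>k. L (Suc k))" by (intro monoI L(1)) auto
    show "mono \<Lambda>" using eigenvalues_mono[OF sb] by (rule monoI)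
    show "finite {k. L (Suc k) = \<mu>}" for \<mu>
      using L(2)[of \<mu>] unfolding shift by (rule finite_imageD) simp
    show "finite {k. \<Lambda> k = \<mu>}" for \<mu> by (rule finite_multiplicity[OF sb])
    show "card {k. L (Suc k) = \<mu>} = card {k. \<Lambda> k = \<mu>}" for \<mu>
    proof -
      have "card {k. 1 \<le> k \<and> L k = \<mu>} = card {k. L (Suc k) = \<mu>}" unfolding shift by (simp add: card_image)
      then show ?thesis
        using ae_dim_unique[OF L(3)[of \<mu>, unfolded eigenspace_dim_def] dim[of \<mu>, unfolded eigenspace_dim_def]] by simp
    qed
  qed
  then show ?thesis unfolding eigenvalue_def L_def[symmetric] .
qed

section \<open>Coefficients of class \<open>C\<^sup>1\<^sup>,\<^sup>1\<close>\<close>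

lemma C11_loc_deriv: "C11_loc f \<Longrightarrow> (f has_real_derivative deriv f s) (at s)"
  by (simp add: C11_loc_def DERIV_deriv_iff_real_differentiable)

lemma C11_loc_continuous: "C11_loc f \<Longrightarrow> continuous_on UNIV f"
  by (intro continuous_at_imp_continuous_on ballI DERIV_isCont[OF C11_loc_deriv])

lemma C11_loc_deriv_continuous:
  assumes "C11_loc f"
  shows "continuous_on UNIV (deriv f)"
proof (rule continuous_at_imp_continuous_on, rule ballI)
  fix s :: real
  have "\<exists>L. L-lipschitz_on (cball s 1) (deriv f)" using assms compact_cball unfolding C11_loc_def by blast
  then obtain L where "L-lipschitz_on (cball s 1) (deriv f)" ..
  then have "continuous_on (ball s 1) (deriv f)"
    by (rule continuous_on_subset[OF lipschitz_on_continuous_on]) auto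
  then show "isCont (deriv f) s" by (simp add: continuous_on_eq_continuous_at)
qed

text \<open>The mean value theorem expresses the increment through the derivative at an intermediate
  point, which is Lipschitz close to the derivative at \<open>s\<close>. The interval [-1,1] is the
  range that admissible functions take almost everywhere.\<close>

lemma C11_loc_taylor:
  assumes f: "C11_loc f"
  shows "\<exists>L\<ge>0. \<forall>s\<in>{-1..1}. \<forall>t\<in>{-1..1}. \<bar>f t - f s - deriv f s * (t - s)\<bar> \<le> L * (t - s)\<^sup>2"
proof -
  have "\<exists>L. L-lipschitz_on {-1..1} (deriv f)" using f compact_Icc unfolding C11_loc_def by blast
  then obtain L where L: "L-lipschitz_on {-1..1} (deriv f)" ..
  have L0: "0 \<le> L" using L by (rule lipschitz_on_nonneg)
  have "\<bar>f t - f s - deriv f s * (t - s)\<bar> \<le> L * (t - s)\<^sup>2" if s: "s \<in> {-1..1}" and t: "t \<in> {-1..1}" for s t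
  proof (cases "s = t")
    case False
    have "\<exists>\<xi>. f t - f s = (t - s) * deriv f \<xi> \<and> \<xi> \<in> {-1..1} \<and> \<bar>\<xi> - s\<bar> \<le> \<bar>t - s\<bar>"
    proof (cases "s < t")
      case True
      then obtain \<xi> where "s < \<xi>" "\<xi> < t" "f t - f s = (t - s) * deriv f \<xi>"
        using MVT2[of s t f "deriv f"] C11_loc_deriv[OF f] by blast
      then show ?thesis using s t by (intro exI[of _ \<xi>]) auto
    next
      case *: False
      then have "t < s" using False by simp
      then obtain \<xi> where "t < \<xi>" "\<xi> < s" "f s - f t = (s - t) * deriv f \<xi>"
        using MVT2[of t s f "deriv f"] C11_loc_deriv[OF f] by blast
      then show ?thesis using s t by (intro exI[of _ \<xi>]) (auto simp: algebra_simps)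
    qed
    then obtain \<xi> where \<xi>: "f t - f s = (t - s) * deriv f \<xi>" "\<xi> \<in> {-1..1}" "\<bar>\<xi> - s\<bar> \<le> \<bar>t - s\<bar>" by blast
    have "\<bar>deriv f \<xi> - deriv f s\<bar> \<le> L * \<bar>\<xi> - s\<bar>"
      using lipschitz_onD[OF L \<xi>(2) s] by (simp add: dist_real_def)
    also have "\<dots> \<le> L * \<bar>t - s\<bar>" using \<xi>(3) L0 by (rule mult_left_mono)
    finally have "\<bar>deriv f \<xi> - deriv f s\<bar> * \<bar>t - s\<bar> \<le> L * \<bar>t - s\<bar> * \<bar>t - s\<bar>" by (rule mult_right_mono) simp
    moreover have "f t - f s - deriv f s * (t - s) = (deriv f \<xi> - deriv f s) * (t - s)"
      unfolding \<xi>(1) by (simp add: algebra_simps)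
    ultimately have "\<bar>f t - f s - deriv f s * (t - s)\<bar> \<le> L * (\<bar>t - s\<bar> * \<bar>t - s\<bar>)"
      by (simp only: abs_mult mult.assoc)
    then show ?thesis by (simp only: abs_mult_self_eq power2_eq_square)
  qed simp
  with L0 show ?thesis by blast
qed

lemma bounded_coeff_compose:
  fixes f :: "real \<Rightarrow> real"
  assumes f: "continuous_on UNIV f" and \<phi>: "\<phi> \<in> borel_measurable (lebesgue_on \<Omega>)"
    and le: "AE x in lebesgue_on \<Omega>. \<bar>\<phi> x\<bar> \<le> 1" and K: "\<And>s. s \<in> {-1..1} \<Longrightarrow> \<bar>f s\<bar> \<le> K"
  shows "bounded_coeff \<Omega> K (\<lambda>x. f (\<phi> x))"
proof -
  have "f \<in> borel_measurable borel" using f by (rule borel_measurable_continuous_onI)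
  then have "(\<lambda>x. f (\<phi> x)) \<in> borel_measurable (lebesgue_on \<Omega>)" using \<phi> by (rule measurable_compose[rotated])
  moreover have "AE x in lebesgue_on \<Omega>. \<bar>f (\<phi> x)\<bar> \<le> K"
    using le
  proof eventually_elim
    case (elim x)
    then have "\<phi> x \<in> {-1..1}" unfolding abs_le_iff atLeastAtMost_iff by linarith
    then show ?case by (rule K)
  qed
  ultimately show ?thesis by (simp add: bounded_coeff_def)
qed

lemma continuous_bound_interval:
  assumes "continuous_on UNIV (f :: real \<Rightarrow> real)"
  shows "\<exists>K\<ge>0. \<forall>s\<in>{-1..1}. \<bar>f s\<bar> \<le> K"
proof -
  have "compact (f ` {-1..1})"
    using assms by (intro compact_continuous_image) (auto intro: continuous_on_subset)
  then have "bounded (f ` {-1..1})" by (rule compact_imp_bounded)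
  then obtain K where "0 < K" "\<forall>y\<in>f ` {-1..1}. norm y \<le> K" unfolding bounded_pos by blast
  then show ?thesis by (intro exI[of _ K]) auto
qed

lemma bounded_coeff_mono: "bounded_coeff \<Omega> K \<alpha> \<Longrightarrow> K \<le> K' \<Longrightarrow> bounded_coeff \<Omega> K' \<alpha>"
  unfolding bounded_coeff_def by (auto elim: eventually_mono)

lemma bounded_coeff_mult:
  assumes "bounded_coeff \<Omega> K \<alpha>" "bounded_coeff \<Omega> L \<beta>" "0 \<le> K"
  shows "bounded_coeff \<Omega> (K * L) (\<lambda>x. \<alpha> x * \<beta> x)"
  unfolding bounded_coeff_def
proof
  show "(\<lambda>x. \<alpha> x * \<beta> x) \<in> borel_measurable (lebesgue_on \<Omega>)"
    using assms unfolding bounded_coeff_def by (intro borel_measurable_times) auto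
  have "AE x in lebesgue_on \<Omega>. \<bar>\<alpha> x\<bar> \<le> K" "AE x in lebesgue_on \<Omega>. \<bar>\<beta> x\<bar> \<le> L"
    using assms by (simp_all add: bounded_coeff_def)
  then show "AE x in lebesgue_on \<Omega>. \<bar>\<alpha> x * \<beta> x\<bar> \<le> K * L"
    by eventually_elim (use assms(3) in \<open>auto simp: abs_mult intro!: mult_mono\<close>)
qed

text \<open>The values of \<phi> + t h stay in [-1,1] by convexity, so one constant serves all
  \<open>t\<close> in [0,1].\<close>

lemma bounded_coeff_taylor:
  assumes f: "C11_loc f" and \<phi>: "\<phi> \<in> borel_measurable (lebesgue_on \<Omega>)" and h: "h \<in> borel_measurable (lebesgue_on \<Omega>)"
    and le: "AE x in lebesgue_on \<Omega>. \<bar>\<phi> x\<bar> \<le> 1" "AE x in lebesgue_on \<Omega>. \<bar>\<phi> x + h x\<bar> \<le> 1"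
  shows "\<exists>K\<ge>0. bounded_coeff \<Omega> K (\<lambda>x. deriv f (\<phi> x) * h x) \<and> (\<forall>t\<in>{0..1}.
    bounded_coeff \<Omega> K (\<lambda>x. f (\<phi> x + t * h x)) \<and>
    bounded_coeff \<Omega> (K * t\<^sup>2) (\<lambda>x. f (\<phi> x + t * h x) - f (\<phi> x) - t * (deriv f (\<phi> x) * h x)))"
proof -
  obtain L where L: "0 \<le> L" "\<And>s t. s \<in> {-1..1} \<Longrightarrow> t \<in> {-1..1} \<Longrightarrow> \<bar>f t - f s - deriv f s * (t - s)\<bar> \<le> L * (t - s)\<^sup>2"
    using C11_loc_taylor[OF f] by blast
  obtain K1 where K1: "0 \<le> K1" "\<And>s. s \<in> {-1..1} \<Longrightarrow> \<bar>f s\<bar> \<le> K1"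
    using continuous_bound_interval[OF C11_loc_continuous[OF f]] by blast
  obtain K2 where K2: "0 \<le> K2" "\<And>s. s \<in> {-1..1} \<Longrightarrow> \<bar>deriv f s\<bar> \<le> K2"
    using continuous_bound_interval[OF C11_loc_deriv_continuous[OF f]] by blast
  \<comment> \<open>Bounds for the values, for the derivative times \<open>h\<close>, and for the
    Taylor remainder; the factors 2 and 4 come from \<open>\<bar>h x\<bar> \<le> 2\<close> and its
    square.\<close>
  define K where "K = max K1 (max (K2 * 2) (L * 4))"
  have hb: "AE x in lebesgue_on \<Omega>. \<bar>h x\<bar> \<le> 2" using le by eventually_elim linarith
  have h2: "bounded_coeff \<Omega> 2 h" using h hb by (simp add: bounded_coeff_def)
  have d: "bounded_coeff \<Omega> (K2 * 2) (\<lambda>x. deriv f (\<phi> x) * h x)"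
    by (rule bounded_coeff_mult[OF bounded_coeff_compose[OF C11_loc_deriv_continuous[OF f] \<phi> le(1) K2(2)] h2 K2(1)])
  have conv: "AE x in lebesgue_on \<Omega>. \<bar>\<phi> x + t * h x\<bar> \<le> 1" if t: "t \<in> {0..1}" for t
    using le
  proof eventually_elim
    case (elim x)
    have "\<phi> x + t * h x = (1 - t) * \<phi> x + t * (\<phi> x + h x)" by (simp add: algebra_simps)
    also have "\<bar>\<dots>\<bar> \<le> (1 - t) * \<bar>\<phi> x\<bar> + t * \<bar>\<phi> x + h x\<bar>"
      using t abs_triangle_ineq[of "(1 - t) * \<phi> x" "t * (\<phi> x + h x)"] by (simp add: abs_mult)
    also have "\<dots> \<le> (1 - t) * 1 + t * 1" using t elim by (intro add_mono mult_left_mono) auto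
    finally show ?case by simp
  qed
  have m: "(\<lambda>x. \<phi> x + t * h x) \<in> borel_measurable (lebesgue_on \<Omega>)" for t
    using \<phi> h by (intro borel_measurable_add borel_measurable_times) auto
  have 1: "bounded_coeff \<Omega> K1 (\<lambda>x. f (\<phi> x + t * h x))" if "t \<in> {0..1}" for t
    by (rule bounded_coeff_compose[OF C11_loc_continuous[OF f] m conv[OF that] K1(2)])
  have 2: "bounded_coeff \<Omega> (L * 4 * t\<^sup>2) (\<lambda>x. f (\<phi> x + t * h x) - f (\<phi> x) - t * (deriv f (\<phi> x) * h x))"
    if t: "t \<in> {0..1}" for t
    unfolding bounded_coeff_def
  proof
    have "(\<lambda>x. f (\<phi> x + s * h x)) \<in> borel_measurable (lebesgue_on \<Omega>)" if "s \<in> {0..1}" for s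
      using 1[OF that] by (simp add: bounded_coeff_def)
    from this[OF t] this[of 0] have "(\<lambda>x. f (\<phi> x + t * h x)) \<in> borel_measurable (lebesgue_on \<Omega>)"
      "(\<lambda>x. f (\<phi> x)) \<in> borel_measurable (lebesgue_on \<Omega>)" by simp_all
    from borel_measurable_diff[OF this] borel_measurable_times[OF borel_measurable_const conjunct1[OF d[unfolded bounded_coeff_def]], of t]
    show "(\<lambda>x. f (\<phi> x + t * h x) - f (\<phi> x) - t * (deriv f (\<phi> x) * h x)) \<in> borel_measurable (lebesgue_on \<Omega>)"
      by (rule borel_measurable_diff)
    show "AE x in lebesgue_on \<Omega>. \<bar>f (\<phi> x + t * h x) - f (\<phi> x) - t * (deriv f (\<phi> x) * h x)\<bar> \<le> L * 4 * t\<^sup>2"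
      using conv[OF t] le(1) hb
    proof eventually_elim
      case (elim x)
      have "\<bar>f (\<phi> x + t * h x) - f (\<phi> x) - deriv f (\<phi> x) * (\<phi> x + t * h x - \<phi> x)\<bar> \<le> L * (\<phi> x + t * h x - \<phi> x)\<^sup>2"
        using elim by (intro L(2)) (auto simp: abs_le_iff)
      moreover have "(h x)\<^sup>2 \<le> 2\<^sup>2" using power_mono[OF elim(3), of 2] by simp
      then have "L * (t\<^sup>2 * (h x)\<^sup>2) \<le> L * (t\<^sup>2 * 4)" using L(1) by (intro mult_left_mono) auto
      ultimately show ?case by (simp add: power_mult_distrib mult_ac)
    qed
  qed
  show ?thesis
  proof (intro exI[of _ K] conjI ballI)
    show "0 \<le> K" using K1(1) by (simp add: K_def)
    show "bounded_coeff \<Omega> K (\<lambda>x. deriv f (\<phi> x) * h x)" by (rule bounded_coeff_mono[OF d]) (simp add: K_def)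
    fix t :: real assume t: "t \<in> {0..1}"
    show "bounded_coeff \<Omega> K (\<lambda>x. f (\<phi> x + t * h x))" by (rule bounded_coeff_mono[OF 1[OF t]]) (simp add: K_def)
    show "bounded_coeff \<Omega> (K * t\<^sup>2) (\<lambda>x. f (\<phi> x + t * h x) - f (\<phi> x) - t * (deriv f (\<phi> x) * h x))"
      by (rule bounded_coeff_mono[OF 2[OF t]]) (auto simp: K_def intro!: mult_right_mono)
  qed
qed

lemma bounded_coeff_add:
  assumes "bounded_coeff \<Omega> K \<alpha>" "bounded_coeff \<Omega> L \<beta>"
  shows "bounded_coeff \<Omega> (K + \<bar>r\<bar> * L) (\<lambda>x. \<alpha> x + r * \<beta> x)"
  unfolding bounded_coeff_def
proof
  show "(\<lambda>x. \<alpha> x + r * \<beta> x) \<in> borel_measurable (lebesgue_on \<Omega>)"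
    using assms unfolding bounded_coeff_def by (intro borel_measurable_add borel_measurable_times) auto
  have "AE x in lebesgue_on \<Omega>. \<bar>\<alpha> x\<bar> \<le> K" "AE x in lebesgue_on \<Omega>. \<bar>\<beta> x\<bar> \<le> L"
    using assms by (simp_all add: bounded_coeff_def)
  then show "AE x in lebesgue_on \<Omega>. \<bar>\<alpha> x + r * \<beta> x\<bar> \<le> K + \<bar>r\<bar> * L"
  proof eventually_elim
    case (elim x)
    have "\<bar>r * \<beta> x\<bar> \<le> \<bar>r\<bar> * L" unfolding abs_mult using elim(2) by (rule mult_left_mono) simp
    then show ?case using elim(1) by linarith
  qed
qed

lemma sobolev_form_expand:
  assumes \<Omega>: "open \<Omega>" and uv: "u \<in> H1 \<Omega>" "v \<in> H1 \<Omega>"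
    and \<alpha>: "bounded_coeff \<Omega> K1 \<alpha>1" "bounded_coeff \<Omega> K2 \<alpha>" "bounded_coeff \<Omega> K3 \<alpha>'"
    and \<beta>: "bounded_coeff \<Omega> M1 \<beta>1" "bounded_coeff \<Omega> M2 \<beta>" "bounded_coeff \<Omega> M3 \<beta>'"
  shows "sobolev_form \<Omega> \<alpha>1 \<beta>1 u v - sobolev_form \<Omega> \<alpha> \<beta> u v - t * sobolev_form \<Omega> \<alpha>' \<beta>' u v
    = sobolev_form \<Omega> (\<lambda>x. \<alpha>1 x - \<alpha> x - t * \<alpha>' x) (\<lambda>x. \<beta>1 x - \<beta> x - t * \<beta>' x) u v"
proof -
  have "sobolev_form \<Omega> (\<lambda>x. (\<alpha>1 x + (-1) * \<alpha> x) + (- t) * \<alpha>' x) (\<lambda>x. (\<beta>1 x + (-1) * \<beta> x) + (- t) * \<beta>' x) u v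
      = sobolev_form \<Omega> (\<lambda>x. \<alpha>1 x + (-1) * \<alpha> x) (\<lambda>x. \<beta>1 x + (-1) * \<beta> x) u v + (- t) * sobolev_form \<Omega> \<alpha>' \<beta>' u v"
    by (rule sobolev_form_diff_coeff[OF \<Omega> uv bounded_coeff_add[OF \<alpha>(1,2)] bounded_coeff_add[OF \<beta>(1,2)] \<alpha>(3) \<beta>(3)])
  also have "sobolev_form \<Omega> (\<lambda>x. \<alpha>1 x + (-1) * \<alpha> x) (\<lambda>x. \<beta>1 x + (-1) * \<beta> x) u v
      = sobolev_form \<Omega> \<alpha>1 \<beta>1 u v + (-1) * sobolev_form \<Omega> \<alpha> \<beta> u v"
    by (rule sobolev_form_diff_coeff[OF \<Omega> uv \<alpha>(1) \<beta>(1) \<alpha>(2) \<beta>(2)])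
  finally show ?thesis by simp
qed

text \<open>The Taylor bounds for the coefficients become bounds for the forms relative to the
  energy at t = 0, which is the input of the abstract perturbation result. Positivity is recorded as
  well, since \<Psi> is assumed to be of class C^1 on positive vectors.\<close>

theorem simple_dirichlet_eigenvalue_derivative:
  fixes \<Omega> :: "'a::euclidean_space set"
  assumes \<Omega>: "open \<Omega>" "bounded \<Omega>" "\<Omega> \<noteq> {}"
    and a: "C11_loc a" and b: "C11_loc b" and c: "C11_loc c"
    and c0: "0 < c0" "\<And>s. c0 \<le> a s" "\<And>s. c0 \<le> c s" and b0: "\<And>s. 0 \<le> b s"
    and \<phi>: "\<phi> \<in> borel_measurable (lebesgue_on \<Omega>)" and h: "h \<in> borel_measurable (lebesgue_on \<Omega>)"
    and le: "AE x in lebesgue_on \<Omega>. \<bar>\<phi> x\<bar> \<le> 1" "AE x in lebesgue_on \<Omega>. \<bar>\<phi> x + h x\<bar> \<le> 1"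
    and k: "1 \<le> k" and simple: "simple_eigenvalue \<Omega> a b c \<phi> (eigenvalue \<Omega> a b c \<phi> k)"
    and w: "state_equation \<Omega> a b c \<phi> (eigenvalue \<Omega> a b c \<phi> k) w"
    and normalized: "(LINT x|lebesgue_on \<Omega>. c (\<phi> x) * (w x)\<^sup>2) = 1"
  shows "((\<lambda>t. (eigenvalue \<Omega> a b c (\<lambda>x. \<phi> x + t * h x) k - eigenvalue \<Omega> a b c \<phi> k) / t) \<longlongrightarrow>
      (LINT x|lebesgue_on \<Omega>. deriv a (\<phi> x) * h x * (norm (wgrad \<Omega> w x))\<^sup>2)
      + (LINT x|lebesgue_on \<Omega>. deriv b (\<phi> x) * h x * (w x)\<^sup>2)
      - eigenvalue \<Omega> a b c \<phi> k * (LINT x|lebesgue_on \<Omega>. deriv c (\<phi> x) * h x * (w x)\<^sup>2)) (at_right 0)"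
    and "0 < eigenvalue \<Omega> a b c \<phi> k"
proof -
  let ?M = "lebesgue_on \<Omega>"
  let ?V = "H10 \<Omega>"
  define At where "At t = sobolev_form \<Omega> (\<lambda>x. a (\<phi> x + t * h x)) (\<lambda>x. b (\<phi> x + t * h x))" for t
  define Ct where "Ct t = sobolev_form \<Omega> (\<lambda>x. 0) (\<lambda>x. c (\<phi> x + t * h x))" for t
  define A' where "A' = sobolev_form \<Omega> (\<lambda>x. deriv a (\<phi> x) * h x) (\<lambda>x. deriv b (\<phi> x) * h x)"
  define C' where "C' = sobolev_form \<Omega> (\<lambda>x. 0) (\<lambda>x. deriv c (\<phi> x) * h x)"
  obtain Ka where Ka: "0 \<le> Ka" "bounded_coeff \<Omega> Ka (\<lambda>x. deriv a (\<phi> x) * h x)"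
    "\<And>t. t \<in> {0..1} \<Longrightarrow> bounded_coeff \<Omega> Ka (\<lambda>x. a (\<phi> x + t * h x))"
    "\<And>t. t \<in> {0..1} \<Longrightarrow> bounded_coeff \<Omega> (Ka * t\<^sup>2) (\<lambda>x. a (\<phi> x + t * h x) - a (\<phi> x) - t * (deriv a (\<phi> x) * h x))"
    using bounded_coeff_taylor[OF a \<phi> h le] by blast
  obtain Kb where Kb: "0 \<le> Kb" "bounded_coeff \<Omega> Kb (\<lambda>x. deriv b (\<phi> x) * h x)"
    "\<And>t. t \<in> {0..1} \<Longrightarrow> bounded_coeff \<Omega> Kb (\<lambda>x. b (\<phi> x + t * h x))"
    "\<And>t. t \<in> {0..1} \<Longrightarrow> bounded_coeff \<Omega> (Kb * t\<^sup>2) (\<lambda>x. b (\<phi> x + t * h x) - b (\<phi> x) - t * (deriv b (\<phi> x) * h x))"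
    using bounded_coeff_taylor[OF b \<phi> h le] by blast
  obtain Kc where Kc: "0 \<le> Kc" "bounded_coeff \<Omega> Kc (\<lambda>x. deriv c (\<phi> x) * h x)"
    "\<And>t. t \<in> {0..1} \<Longrightarrow> bounded_coeff \<Omega> Kc (\<lambda>x. c (\<phi> x + t * h x))"
    "\<And>t. t \<in> {0..1} \<Longrightarrow> bounded_coeff \<Omega> (Kc * t\<^sup>2) (\<lambda>x. c (\<phi> x + t * h x) - c (\<phi> x) - t * (deriv c (\<phi> x) * h x))"
    using bounded_coeff_taylor[OF c \<phi> h le] by blast
  define K where "K = max Ka (max Kb Kc)"
  have K: "0 \<le> K" "Ka \<le> K" "Kb \<le> K" "Kc \<le> K" using Ka(1) by (auto simp: K_def)
  have K2: "Ka * t\<^sup>2 \<le> K * t\<^sup>2" "Kb * t\<^sup>2 \<le> K * t\<^sup>2" "Kc * t\<^sup>2 \<le> K * t\<^sup>2" for t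
    using K by (auto intro: mult_right_mono)
  have zero: "bounded_coeff \<Omega> L (\<lambda>x. 0)" if "0 \<le> L" for L using that by (simp add: bounded_coeff_def)
  note bound = bounded_coeff_mono[OF Ka(3) K(2)] bounded_coeff_mono[OF Kb(3) K(3)] bounded_coeff_mono[OF Kc(3) K(4)]
  note bound' = bounded_coeff_mono[OF Ka(2) K(2)] bounded_coeff_mono[OF Kb(2) K(3)] bounded_coeff_mono[OF Kc(2) K(4)]
  note rest = bounded_coeff_mono[OF Ka(4) K2(1)] bounded_coeff_mono[OF Kb(4) K2(2)] bounded_coeff_mono[OF Kc(4) K2(3)]
  have "\<exists>\<kappa>. form_pair ?V (At t) (Ct t) ?M \<kappa>" if t: "t \<in> {0..1}" for t
    unfolding At_def Ct_def
    by (rule sobolev_form_pair[OF \<Omega> bound(1)[OF t] bound(2)[OF t] bound(3)[OF t] K(1) c0(1)]) (auto simp: c0 b0)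
  then obtain \<kappa>t where pair: "\<And>t. t \<in> {0..1} \<Longrightarrow> form_pair ?V (At t) (Ct t) ?M (\<kappa>t t)" by metis
  have "\<exists>\<Lambda> u. form_pair.spectral_basis ?V (At t) (Ct t) \<Lambda> u" if "t \<in> {0..1}" for t
    by (rule form_pair.spectral_basis_exists[OF pair[OF that]])
  then obtain \<Lambda>t ut where sbt: "\<And>t. t \<in> {0..1} \<Longrightarrow> form_pair.spectral_basis ?V (At t) (Ct t) (\<Lambda>t t) (ut t)" by metis
  \<comment> \<open>\<open>k - 1\<close> reconciles \<open>eigenvalue\<close>, which counts from 1,
    with the spectral bases, which count from 0.\<close>
  have ev: "eigenvalue \<Omega> a b c (\<lambda>x. \<phi> x + t * h x) k = \<Lambda>t t (k - 1)" if t: "t \<in> {0..1}" for t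
  proof -
    have "eigenvalue \<Omega> a b c (\<lambda>x. \<phi> x + t * h x) (Suc (k - 1)) = \<Lambda>t t (k - 1)"
      by (rule eigenvalue_eq_spectral_basis[of \<Omega> a "\<lambda>x. \<phi> x + t * h x" b c "\<kappa>t t",
          OF pair[OF t, unfolded At_def Ct_def] sbt[OF t, unfolded At_def Ct_def]])
    moreover have "Suc (k - 1) = k" using k by simp
    ultimately show ?thesis by (simp only:)
  qed
  have zero_in: "(0::real) \<in> {0..1}" by simp
  have A0: "At 0 = sobolev_form \<Omega> (\<lambda>x. a (\<phi> x)) (\<lambda>x. b (\<phi> x))" and C0: "Ct 0 = sobolev_form \<Omega> (\<lambda>x. 0) (\<lambda>x. c (\<phi> x))"
    by (simp_all add: At_def Ct_def)
  interpret P: form_pair ?V "At 0" "Ct 0" ?M "\<kappa>t 0" by (rule pair[OF zero_in])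
  have ev0: "eigenvalue \<Omega> a b c \<phi> k = \<Lambda>t 0 (k - 1)" using ev[OF zero_in] by simp
  show "0 < eigenvalue \<Omega> a b c \<phi> k" unfolding ev0 by (rule P.eigenvalue_pos[OF sbt[OF zero_in]])
  obtain PC where PC: "0 < PC" "\<And>u. u \<in> ?V \<Longrightarrow> mass \<Omega> u u \<le> PC * dirichlet \<Omega> u u"
    using Poincare[OF \<Omega>(1,2)] by blast
  have sub: "?V \<subseteq> H1 \<Omega>" using H10_H1[OF \<Omega>(1)] by blast
  \<comment> \<open>The Dirichlet integral plus the mass is at most \<open>Q\<close> times the
    energy at t = 0: Poincare's inequality gives \<open>1 + PC\<close>, and the lower bound of
    \<open>a\<close> gives \<open>1 / c0\<close>.\<close>
  define Q where "Q = (1 + PC) / c0"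
  have Q: "0 \<le> Q" using PC(1) c0(1) by (simp add: Q_def)
  have sym: "sym_form ?V (sobolev_form \<Omega> \<alpha> \<beta>)" if "bounded_coeff \<Omega> M1 \<alpha>" "bounded_coeff \<Omega> M2 \<beta>" for \<alpha> \<beta> M1 M2
    by (rule sym_form.sym_form_subspace[OF sym_form_sobolev[OF \<Omega>(1) that] P.A.function_space_axioms sub])
  have form_bound: "\<bar>sobolev_form \<Omega> \<alpha> \<beta> v w\<bar> \<le> L * Q * (sqrt (At 0 v v) * sqrt (At 0 w w))"
    if L: "0 \<le> L" "bounded_coeff \<Omega> L \<alpha>" "bounded_coeff \<Omega> L \<beta>" and vw: "v \<in> ?V" "w \<in> ?V" for L \<alpha> \<beta> v w
  proof (rule P.A.form_bound_of_diagonal[OF sym[OF L(2,3)] _ _ vw])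
    show "0 \<le> L * Q" using L(1) Q by simp
    fix u assume u: "u \<in> ?V"
    note uH = H10_H1[OF \<Omega>(1) u]
    have "c0 * dirichlet \<Omega> u u \<le> At 0 u u"
    proof -
      have "sobolev_form \<Omega> (\<lambda>x. c0) (\<lambda>x. 0) u u \<le> At 0 u u"
        unfolding A0
      proof (rule sobolev_form_mono[OF \<Omega>(1) uH])
        show "bounded_coeff \<Omega> c0 (\<lambda>x. c0)" "bounded_coeff \<Omega> 0 (\<lambda>x. 0)" using c0(1) by (auto simp: bounded_coeff_def)
        show "bounded_coeff \<Omega> K (\<lambda>x. a (\<phi> x))" "bounded_coeff \<Omega> K (\<lambda>x. b (\<phi> x))"
          using bound(1)[OF zero_in] bound(2)[OF zero_in] by simp_all
      qed (auto simp: c0 b0)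
      then show ?thesis by (simp add: sobolev_form_def)
    qed
    then have d: "dirichlet \<Omega> u u \<le> At 0 u u / c0" using c0(1) by (simp add: pos_le_divide_eq mult.commute)
    have "\<bar>sobolev_form \<Omega> \<alpha> \<beta> u u\<bar> \<le> L * dirichlet \<Omega> u u + L * mass \<Omega> u u"
      by (rule sobolev_form_diagonal_bound[OF \<Omega>(1) uH L(2,3,1,1)])
    also have "\<dots> \<le> L * dirichlet \<Omega> u u + L * (PC * dirichlet \<Omega> u u)"
      using PC(2)[OF u] L(1) by (intro add_left_mono mult_left_mono)
    also have "\<dots> = L * (1 + PC) * dirichlet \<Omega> u u" by (simp add: algebra_simps)
    also have "\<dots> \<le> L * (1 + PC) * (At 0 u u / c0)" using d L(1) PC(1) by (intro mult_left_mono) auto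
    finally show "\<bar>sobolev_form \<Omega> \<alpha> \<beta> u u\<bar> \<le> L * Q * At 0 u u" by (simp add: Q_def)
  qed
  interpret perturbed_form_pair ?V "At 0" "Ct 0" ?M "\<kappa>t 0" 1 At Ct A' C' \<kappa>t "K * Q"
  proof (intro perturbed_form_pair.intro perturbed_form_pair_axioms.intro)
    show "form_pair ?V (At 0) (Ct 0) ?M (\<kappa>t 0)" by (rule pair[OF zero_in])
    show "form_pair ?V (At t) (Ct t) ?M (\<kappa>t t)" if "0 < t" "t \<le> 1" for t by (rule pair) (use that in simp)
    show "sym_form ?V A'" unfolding A'_def by (rule sym[OF bound'(1,2)])
    show "sym_form ?V C'" unfolding C'_def by (rule sym[OF zero[OF K(1)] bound'(3)])
    show "0 \<le> K * Q" using K(1) Q by simp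
    fix v w assume vw: "v \<in> ?V" "w \<in> ?V"
    note vwH = H10_H1[OF \<Omega>(1) vw(1)] H10_H1[OF \<Omega>(1) vw(2)]
    show "\<bar>A' v w\<bar> \<le> K * Q * (sqrt (At 0 v v) * sqrt (At 0 w w))"
      unfolding A'_def by (rule form_bound[OF K(1) bound'(1,2) vw])
    show "\<bar>C' v w\<bar> \<le> K * Q * (sqrt (At 0 v v) * sqrt (At 0 w w))"
      unfolding C'_def by (rule form_bound[OF K(1) zero[OF K(1)] bound'(3) vw])
    fix t :: real assume t: "0 < t" "t \<le> 1"
    then have t01: "t \<in> {0..1}" by simp
    have Kt: "0 \<le> K * t\<^sup>2" using K(1) by simp
    have "At t v w - At 0 v w - t * A' v w = sobolev_form \<Omega>
        (\<lambda>x. a (\<phi> x + t * h x) - a (\<phi> x) - t * (deriv a (\<phi> x) * h x))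
        (\<lambda>x. b (\<phi> x + t * h x) - b (\<phi> x) - t * (deriv b (\<phi> x) * h x)) v w"
      using sobolev_form_expand[OF \<Omega>(1) vwH bound(1)[OF t01] bound(1)[OF zero_in] bound'(1)
          bound(2)[OF t01] bound(2)[OF zero_in] bound'(2), of t] by (simp add: At_def A'_def)
    then show "\<bar>At t v w - At 0 v w - t * A' v w\<bar> \<le> K * Q * t\<^sup>2 * (sqrt (At 0 v v) * sqrt (At 0 w w))"
      using form_bound[OF Kt rest(1)[OF t01] rest(2)[OF t01] vw] by (simp add: mult_ac)
    have "Ct t v w - Ct 0 v w - t * C' v w = sobolev_form \<Omega> (\<lambda>x. 0)
        (\<lambda>x. c (\<phi> x + t * h x) - c (\<phi> x) - t * (deriv c (\<phi> x) * h x)) v w"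
      using sobolev_form_expand[OF \<Omega>(1) vwH zero[OF K(1)] zero[OF K(1)] zero[OF K(1)]
          bound(3)[OF t01] bound(3)[OF zero_in] bound'(3), of t] by (simp add: Ct_def C'_def)
    then show "\<bar>Ct t v w - Ct 0 v w - t * C' v w\<bar> \<le> K * Q * t\<^sup>2 * (sqrt (At 0 v v) * sqrt (At 0 w w))"
      using form_bound[OF Kt zero[OF Kt] rest(3)[OF t01] vw] by (simp add: mult_ac)
  qed simp
  have isolated: "\<Lambda>t 0 n \<noteq> \<Lambda>t 0 (k - 1)" if "n \<noteq> k - 1" for n
    using simple that unfolding simple_eigenvalue_def eigenspace_dim_def state_equation_iff ev0
    by (intro P.simple_isolated[OF sbt[OF zero_in]]) (simp_all add: A0 C0)
  have wV: "w \<in> ?V" and eig: "\<And>\<eta>. \<eta> \<in> ?V \<Longrightarrow> At 0 w \<eta> = \<Lambda>t 0 (k - 1) * Ct 0 w \<eta>"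
    using w unfolding state_equation_iff ev0 A0 C0 by blast+
  have Cw: "Ct 0 w w = 1" using normalized unfolding C0 sobolev_form_def by (simp add: power2_eq_square)
  have "((\<lambda>t. (\<Lambda>t t (k - 1) - \<Lambda>t 0 (k - 1)) / t) \<longlongrightarrow> A' w w - \<Lambda>t 0 (k - 1) * C' w w) (at_right 0)"
    by (rule simple_eigenvalue_derivative_eigenfunction[OF sbt[OF zero_in] isolated _ wV eig Cw])
      (auto intro!: sbt)
  moreover have "\<forall>\<^sub>F t in at_right 0. (\<Lambda>t t (k - 1) - \<Lambda>t 0 (k - 1)) / t
      = (eigenvalue \<Omega> a b c (\<lambda>x. \<phi> x + t * h x) k - eigenvalue \<Omega> a b c \<phi> k) / t"
    unfolding eventually_at_right_field using ev ev0 by (intro exI[of _ 1]) auto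
  ultimately have "((\<lambda>t. (eigenvalue \<Omega> a b c (\<lambda>x. \<phi> x + t * h x) k - eigenvalue \<Omega> a b c \<phi> k) / t) \<longlongrightarrow>
      A' w w - \<Lambda>t 0 (k - 1) * C' w w) (at_right 0)" by (rule Lim_transform_eventually)
  then show "((\<lambda>t. (eigenvalue \<Omega> a b c (\<lambda>x. \<phi> x + t * h x) k - eigenvalue \<Omega> a b c \<phi> k) / t) \<longlongrightarrow>
      (LINT x|lebesgue_on \<Omega>. deriv a (\<phi> x) * h x * (norm (wgrad \<Omega> w x))\<^sup>2)
      + (LINT x|lebesgue_on \<Omega>. deriv b (\<phi> x) * h x * (w x)\<^sup>2)
      - eigenvalue \<Omega> a b c \<phi> k * (LINT x|lebesgue_on \<Omega>. deriv c (\<phi> x) * h x * (w x)\<^sup>2)) (at_right 0)"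
    unfolding ev0 A'_def C'_def sobolev_form_def by (simp add: dot_square_norm power2_eq_square)
qed

section \<open>The Ginzburg--Landau energy\<close>

text \<open>Real-valued counterpart of \<open>E_GL\<close> without the obstacle. Both agree on
  functions with |\<phi>| \<le> 1 almost everywhere, so the derivative along a segment can be taken
  in the reals.\<close>

definition real_energy :: "'a::euclidean_space set \<Rightarrow> (real \<Rightarrow> real) \<Rightarrow> real \<Rightarrow> ('a \<Rightarrow> real) \<Rightarrow> real" where
  "real_energy \<Omega> \<psi>0 \<epsilon> \<phi> = \<epsilon> / 2 * dirichlet \<Omega> \<phi> \<phi> + 1 / \<epsilon> * (LINT x|lebesgue_on \<Omega>. \<psi>0 (\<phi> x))"

lemma bounded_coeff_integrable:
  assumes "\<Omega> \<in> sets lebesgue" "bounded \<Omega>" "bounded_coeff \<Omega> K \<alpha>"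
  shows "integrable (lebesgue_on \<Omega>) \<alpha>"
proof -
  interpret finite_measure "lebesgue_on \<Omega>"
    by (rule finite_measure_lebesgue_on[OF bounded_set_imp_lmeasurable[OF assms(2,1)]])
  show ?thesis using assms(3) unfolding bounded_coeff_def by (intro integrable_const_bound[of _ K]) auto
qed

lemma E_GL_eq_real_energy:
  fixes \<Omega> :: "'a::euclidean_space set"
  assumes \<Omega>: "open \<Omega>" "bounded \<Omega>" and dw: "double_well \<psi> \<psi>0" and \<epsilon>: "0 < \<epsilon>"
    and \<phi>: "\<phi> \<in> H1 \<Omega>" "AE x in lebesgue_on \<Omega>. \<bar>\<phi> x\<bar> \<le> 1"
  shows "E_GL \<Omega> \<psi> \<epsilon> \<phi> = ereal (real_energy \<Omega> \<psi>0 \<epsilon> \<phi>)"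
proof -
  let ?M = "lebesgue_on \<Omega>"
  have C11: "C11_loc \<psi>0" and \<psi>: "\<And>s. \<psi> s = ereal (\<psi>0 s) + obstacle s" and nn: "\<And>s. 0 \<le> \<psi> s"
    using dw by (auto simp: double_well_def)
  have \<psi>in: "\<psi> s = ereal (\<psi>0 s)" "0 \<le> \<psi>0 s" if "\<bar>s\<bar> \<le> 1" for s
  proof -
    have s: "s \<in> {-1..1}" using that by (auto simp: abs_le_iff)
    then show "\<psi> s = ereal (\<psi>0 s)" unfolding \<psi> obstacle_def by simp
    then show "0 \<le> \<psi>0 s" using nn[of s] by simp
  qed
  have \<phi>m: "\<phi> \<in> borel_measurable ?M" using H1_wgrad(3)[OF \<Omega>(1) \<phi>(1)] by (simp add: L2_iff)
  obtain K where K: "\<And>s. s \<in> {-1..1} \<Longrightarrow> \<bar>\<psi>0 s\<bar> \<le> K"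
    using continuous_bound_interval[OF C11_loc_continuous[OF C11]] by blast
  have i\<psi>: "integrable ?M (\<lambda>x. \<psi>0 (\<phi> x))"
    by (rule bounded_coeff_integrable[OF open_lebesgue[OF \<Omega>(1)] \<Omega>(2)
        bounded_coeff_compose[OF C11_loc_continuous[OF C11] \<phi>m \<phi>(2) K]])
  have ig: "integrable ?M (\<lambda>x. (norm (wgrad \<Omega> \<phi> x))\<^sup>2)" using H1_wgrad(2)[OF \<Omega>(1) \<phi>(1)] by (simp add: L2_iff)
  let ?g = "\<lambda>x. \<epsilon> / 2 * (norm (wgrad \<Omega> \<phi> x))\<^sup>2 + 1 / \<epsilon> * \<psi>0 (\<phi> x)"
  have i: "integrable ?M ?g" using i\<psi> ig by simp
  have g0: "AE x in ?M. 0 \<le> ?g x"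
    using \<phi>(2) by eventually_elim (use \<epsilon> \<psi>in(2) in auto)
  have "(\<integral>\<^sup>+x. e2ennreal (ereal (\<epsilon> / 2 * (norm (wgrad \<Omega> \<phi> x))\<^sup>2) + ereal (1 / \<epsilon>) * \<psi> (\<phi> x)) \<partial>?M)
      = (\<integral>\<^sup>+x. ennreal (?g x) \<partial>?M)"
  proof (rule nn_integral_cong_AE)
    show "AE x in ?M. e2ennreal (ereal (\<epsilon> / 2 * (norm (wgrad \<Omega> \<phi> x))\<^sup>2) + ereal (1 / \<epsilon>) * \<psi> (\<phi> x)) = ennreal (?g x)"
      using \<phi>(2)
    proof eventually_elim
      case (elim x)
      have "ereal (\<epsilon> / 2 * (norm (wgrad \<Omega> \<phi> x))\<^sup>2) + ereal (1 / \<epsilon>) * \<psi> (\<phi> x) = ereal (?g x)"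
        unfolding \<psi>in(1)[OF elim] by simp
      then show ?case by (simp only: e2ennreal_ereal)
    qed
  qed
  also have "\<dots> = ennreal (LINT x|?M. ?g x)" by (rule nn_integral_eq_integral[OF i g0])
  finally have "E_GL \<Omega> \<psi> \<epsilon> \<phi> = ereal (LINT x|?M. ?g x)"
    unfolding E_GL_def by (simp only: enn2ereal_ennreal[OF integral_nonneg_AE[OF g0]])
  also have "(LINT x|?M. ?g x) = real_energy \<Omega> \<psi>0 \<epsilon> \<phi>"
    using i\<psi> ig by (simp add: real_energy_def sobolev_form_def dot_square_norm)
  finally show ?thesis .
qed

text \<open>The gradient part is a quadratic polynomial in \<open>t\<close> and is expanded exactly;
  the potential part follows from the Taylor bound on a set of finite measure. Together the quotient
  differs from its limit by at most \<open>B * t\<close>.\<close>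

lemma real_energy_derivative:
  fixes \<Omega> :: "'a::euclidean_space set"
  assumes \<Omega>: "open \<Omega>" "bounded \<Omega>" and \<psi>0: "C11_loc \<psi>0"
    and \<phi>: "\<phi> \<in> H1 \<Omega>" and h: "h \<in> H1 \<Omega>"
    and le: "AE x in lebesgue_on \<Omega>. \<bar>\<phi> x\<bar> \<le> 1" "AE x in lebesgue_on \<Omega>. \<bar>\<phi> x + h x\<bar> \<le> 1"
  shows "((\<lambda>t. (real_energy \<Omega> \<psi>0 \<epsilon> (\<lambda>x. \<phi> x + t * h x) - real_energy \<Omega> \<psi>0 \<epsilon> \<phi>) / t) \<longlongrightarrow>
    \<epsilon> * (LINT x|lebesgue_on \<Omega>. wgrad \<Omega> \<phi> x \<bullet> wgrad \<Omega> h x)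
    + 1 / \<epsilon> * (LINT x|lebesgue_on \<Omega>. deriv \<psi>0 (\<phi> x) * h x)) (at_right 0)"
proof -
  let ?M = "lebesgue_on \<Omega>"
  note \<Omega>L = open_lebesgue[OF \<Omega>(1)]
  interpret D: nonneg_form "H1 \<Omega>" "dirichlet \<Omega>" by (rule dirichlet_form[OF \<Omega>(1)])
  have m: "\<phi> \<in> borel_measurable ?M" "h \<in> borel_measurable ?M"
    using H1_wgrad(3)[OF \<Omega>(1) \<phi>] H1_wgrad(3)[OF \<Omega>(1) h] by (simp_all add: L2_iff)
  obtain K where K: "0 \<le> K" "bounded_coeff \<Omega> K (\<lambda>x. deriv \<psi>0 (\<phi> x) * h x)"
    "\<And>t. t \<in> {0..1} \<Longrightarrow> bounded_coeff \<Omega> K (\<lambda>x. \<psi>0 (\<phi> x + t * h x))"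
    "\<And>t. t \<in> {0..1} \<Longrightarrow> bounded_coeff \<Omega> (K * t\<^sup>2) (\<lambda>x. \<psi>0 (\<phi> x + t * h x) - \<psi>0 (\<phi> x) - t * (deriv \<psi>0 (\<phi> x) * h x))"
    using bounded_coeff_taylor[OF \<psi>0 m le] by blast
  note int = bounded_coeff_integrable[OF \<Omega>L \<Omega>(2)]
  define \<mu> where "\<mu> = measure ?M (space ?M)"
  define G where "G = (LINT x|?M. deriv \<psi>0 (\<phi> x) * h x)"
  define I where "I t = (LINT x|?M. \<psi>0 (\<phi> x + t * h x))" for t
  have I: "\<bar>I t - I 0 - t * G\<bar> \<le> K * t\<^sup>2 * \<mu>" if t: "t \<in> {0..1}" for t
  proof -
    interpret finite_measure ?M
      by (rule finite_measure_lebesgue_on[OF bounded_set_imp_lmeasurable[OF \<Omega>(2) \<Omega>L]])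
    have eq: "I t - I 0 - t * G = (LINT x|?M. \<psi>0 (\<phi> x + t * h x) - \<psi>0 (\<phi> x) - t * (deriv \<psi>0 (\<phi> x) * h x))"
    proof -
      have i: "integrable ?M (\<lambda>x. \<psi>0 (\<phi> x + t * h x))" "integrable ?M (\<lambda>x. \<psi>0 (\<phi> x))"
        "integrable ?M (\<lambda>x. t * (deriv \<psi>0 (\<phi> x) * h x))"
        using int[OF K(3)[OF t]] int[OF K(3)[of 0]] int[OF K(2)] by simp_all
      show ?thesis
        unfolding Bochner_Integration.integral_diff[OF Bochner_Integration.integrable_diff[OF i(1,2)] i(3)]
          Bochner_Integration.integral_diff[OF i(1,2)] I_def G_def by simp
    qed
    have "\<bar>I t - I 0 - t * G\<bar> \<le> (LINT x|?M. \<bar>\<psi>0 (\<phi> x + t * h x) - \<psi>0 (\<phi> x) - t * (deriv \<psi>0 (\<phi> x) * h x)\<bar>)"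
      unfolding eq by (rule integral_abs_bound)
    also have "\<dots> \<le> (LINT x|?M. K * t\<^sup>2)"
    proof (rule integral_mono_AE)
      show "integrable ?M (\<lambda>x. \<bar>\<psi>0 (\<phi> x + t * h x) - \<psi>0 (\<phi> x) - t * (deriv \<psi>0 (\<phi> x) * h x)\<bar>)"
        by (rule integrable_abs[OF int[OF K(4)[OF t]]])
      show "integrable ?M (\<lambda>x. K * t\<^sup>2)" by (rule integrable_const)
      show "AE x in ?M. \<bar>\<psi>0 (\<phi> x + t * h x) - \<psi>0 (\<phi> x) - t * (deriv \<psi>0 (\<phi> x) * h x)\<bar> \<le> K * t\<^sup>2"
        by (rule conjunct2[OF K(4)[OF t, unfolded bounded_coeff_def]])
    qed
    also have "\<dots> = K * t\<^sup>2 * \<mu>" by (simp add: \<mu>_def)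
    finally show ?thesis .
  qed
  define d where "d = \<epsilon> * dirichlet \<Omega> \<phi> h + 1 / \<epsilon> * G"
  define B where "B = \<bar>\<epsilon> / 2 * dirichlet \<Omega> h h\<bar> + \<bar>1 / \<epsilon>\<bar> * (K * \<mu>)"
  have quot: "\<bar>(real_energy \<Omega> \<psi>0 \<epsilon> (\<lambda>x. \<phi> x + t * h x) - real_energy \<Omega> \<psi>0 \<epsilon> \<phi>) / t - d\<bar> \<le> B * t"
    if t: "0 < t" "t \<le> 1" for t
  proof -
    have eq: "real_energy \<Omega> \<psi>0 \<epsilon> (\<lambda>x. \<phi> x + t * h x) - real_energy \<Omega> \<psi>0 \<epsilon> \<phi> - t * d
        = t\<^sup>2 * (\<epsilon> / 2 * dirichlet \<Omega> h h) + 1 / \<epsilon> * (I t - I 0 - t * G)"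
      unfolding real_energy_def D.quadratic_add[OF \<phi> h] d_def I_def by (simp add: algebra_simps)
    have "\<bar>real_energy \<Omega> \<psi>0 \<epsilon> (\<lambda>x. \<phi> x + t * h x) - real_energy \<Omega> \<psi>0 \<epsilon> \<phi> - t * d\<bar>
        \<le> t\<^sup>2 * \<bar>\<epsilon> / 2 * dirichlet \<Omega> h h\<bar> + \<bar>1 / \<epsilon>\<bar> * (K * t\<^sup>2 * \<mu>)"
    proof -
      have "\<bar>1 / \<epsilon> * (I t - I 0 - t * G)\<bar> \<le> \<bar>1 / \<epsilon>\<bar> * (K * t\<^sup>2 * \<mu>)"
        unfolding abs_mult using I[of t] t by (intro mult_left_mono) auto
      moreover have "\<bar>t\<^sup>2 * (\<epsilon> / 2 * dirichlet \<Omega> h h)\<bar> = t\<^sup>2 * \<bar>\<epsilon> / 2 * dirichlet \<Omega> h h\<bar>" by (simp add: abs_mult)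
      ultimately show ?thesis unfolding eq by linarith
    qed
    also have "\<dots> = t * (B * t)" by (simp add: B_def power2_eq_square algebra_simps)
    finally have "\<bar>real_energy \<Omega> \<psi>0 \<epsilon> (\<lambda>x. \<phi> x + t * h x) - real_energy \<Omega> \<psi>0 \<epsilon> \<phi> - t * d\<bar> / t \<le> t * (B * t) / t"
      using t by (intro divide_right_mono) auto
    moreover have "\<bar>e / t - d\<bar> = \<bar>e - t * d\<bar> / t" for e
    proof -
      have "e / t - d = (e - t * d) / t" using t by (simp add: field_simps)
      then show ?thesis by (simp only: abs_divide abs_of_pos[OF t(1)])
    qed
    ultimately show ?thesis using t by simp
  qed
  have "((\<lambda>t. (real_energy \<Omega> \<psi>0 \<epsilon> (\<lambda>x. \<phi> x + t * h x) - real_energy \<Omega> \<psi>0 \<epsilon> \<phi>) / t - d) \<longlongrightarrow> 0) (at_right 0)"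
  proof (rule Lim_null_comparison)
    show "\<forall>\<^sub>F t in at_right 0. norm ((real_energy \<Omega> \<psi>0 \<epsilon> (\<lambda>x. \<phi> x + t * h x) - real_energy \<Omega> \<psi>0 \<epsilon> \<phi>) / t - d) \<le> B * t"
      unfolding eventually_at_right_field using quot by (intro exI[of _ 1]) auto
    show "((\<lambda>t. B * t) \<longlongrightarrow> 0) (at_right 0)"
      by (rule tendsto_eq_intros refl | simp)+
  qed
  then have "((\<lambda>t. (real_energy \<Omega> \<psi>0 \<epsilon> (\<lambda>x. \<phi> x + t * h x) - real_energy \<Omega> \<psi>0 \<epsilon> \<phi>) / t) \<longlongrightarrow> d) (at_right 0)"
    by (rule LIM_zero_cancel)
  then show ?thesis by (simp add: d_def G_def sobolev_form_def)
qed

text \<open>The curve has a derivative only from the right, so it is differentiated at 0 within the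
  positive half-line, component by component, and then composed with the full derivative of
  \<Psi>.\<close>

lemma chain_rule_right:
  fixes y :: "real \<Rightarrow> real ^ 'l::finite" and \<Psi> :: "real ^ 'l \<Rightarrow> real"
  assumes y: "\<And>j. ((\<lambda>t. (y t $ j - y 0 $ j) / t) \<longlongrightarrow> d j) (at_right 0)" and \<Psi>: "\<Psi> differentiable (at (y 0))"
  shows "((\<lambda>t. (\<Psi> (y t) - \<Psi> (y 0)) / t) \<longlongrightarrow> (\<Sum>j\<in>UNIV. partial_deriv j \<Psi> (y 0) * d j)) (at_right 0)"
proof -
  let ?D = "frechet_derivative \<Psi> (at (y 0))"
  have \<Psi>': "(\<Psi> has_derivative ?D) (at (y 0))" using \<Psi> by (simp add: frechet_derivative_works)
  interpret D: bounded_linear ?D by (rule has_derivative_bounded_linear[OF \<Psi>'])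
  have "((\<lambda>t. y t $ j) has_real_derivative d j) (at 0 within {0<..})" for j
    using y[of j] by (simp add: has_field_derivative_iff)
  then have yj: "((\<lambda>t. y t $ j) has_derivative (\<lambda>t. t * d j)) (at 0 within {0<..})" for j
    by (simp add: has_field_derivative_def mult_commute_abs)
  have "(y has_derivative (\<lambda>t. t *\<^sub>R (\<chi> j. d j))) (at 0 within {0<..})"
  proof (subst has_derivative_componentwise_within, rule ballI)
    fix i :: "real ^ 'l" assume "i \<in> Basis"
    then obtain j where i: "i = axis j 1" by (auto simp: Basis_vec_def)
    show "((\<lambda>t. y t \<bullet> i) has_derivative (\<lambda>t. (t *\<^sub>R (\<chi> j. d j)) \<bullet> i)) (at 0 within {0<..})"
      using yj[of j] by (simp add: i inner_axis)
  qed
  from has_derivative_compose[OF this \<Psi>']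
  have "((\<lambda>t. \<Psi> (y t)) has_real_derivative ?D (\<chi> j. d j)) (at 0 within {0<..})"
    by (simp add: has_field_derivative_def D.scaleR mult_commute_abs)
  then have "((\<lambda>t. (\<Psi> (y t) - \<Psi> (y 0)) / t) \<longlongrightarrow> ?D (\<chi> j. d j)) (at_right 0)"
    by (simp add: has_field_derivative_iff)
  moreover have "?D (\<chi> j. d j) = (\<Sum>j\<in>UNIV. partial_deriv j \<Psi> (y 0) * d j)"
  proof -
    have "(\<chi> j. d j) = (\<Sum>j\<in>UNIV. d j *\<^sub>R axis j 1)"
      using basis_expansion[of "\<chi> j. d j"] by (simp add: scalar_mult_eq_scaleR)
    then show ?thesis by (simp add: D.sum D.scaleR partial_deriv_def mult.commute)
  qed
  ultimately show ?thesis by simp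
qed

section \<open>Variations of a local minimizer\<close>

lemma abs_le_one_segment:
  fixes x y t :: real
  assumes "\<bar>x\<bar> \<le> 1" "\<bar>y\<bar> \<le> 1" "0 \<le> t" "t \<le> 1"
  shows "\<bar>x + t * (y - x)\<bar> \<le> 1"
proof -
  have "\<bar>x + t * (y - x)\<bar> = \<bar>(1 - t) * x + t * y\<bar>" by (simp add: algebra_simps)
  also have "\<dots> \<le> \<bar>(1 - t) * x\<bar> + \<bar>t * y\<bar>" by (rule abs_triangle_ineq)
  also have "\<dots> \<le> (1 - t) * 1 + t * 1" unfolding abs_mult using assms by (intro add_mono mult_mono) auto
  finally show ?thesis by simp
qed

text \<open>The pointwise bound is convex, and the integral is affine along the segment, so both
  integral constraints persist.\<close>

lemma G_set_segment:
  fixes \<Omega> :: "'a::euclidean_space set"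
  assumes \<Omega>: "open \<Omega>" "bounded \<Omega>" and \<phi>: "\<phi> \<in> G_set \<Omega> \<beta>1 \<beta>2" and \<theta>: "\<theta> \<in> G_set \<Omega> \<beta>1 \<beta>2" and t: "0 \<le> t" "t \<le> 1"
  shows "(\<lambda>x. \<phi> x + t * (\<theta> x - \<phi> x)) \<in> G_set \<Omega> \<beta>1 \<beta>2"
proof -
  let ?M = "lebesgue_on \<Omega>"
  let ?I = "\<lambda>u. LINT x|?M. u x"
  have H: "\<phi> \<in> H1 \<Omega>" "\<theta> \<in> H1 \<Omega>" and le: "AE x in ?M. \<bar>\<phi> x\<bar> \<le> 1" "AE x in ?M. \<bar>\<theta> x\<bar> \<le> 1"
    and I: "\<beta>1 * measure lebesgue \<Omega> \<le> ?I \<phi>" "?I \<phi> \<le> \<beta>2 * measure lebesgue \<Omega>"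
      "\<beta>1 * measure lebesgue \<Omega> \<le> ?I \<theta>" "?I \<theta> \<le> \<beta>2 * measure lebesgue \<Omega>"
    using \<phi> \<theta> by (simp_all add: G_set_def)
  have "bounded_coeff \<Omega> 1 \<phi>" "bounded_coeff \<Omega> 1 \<theta>"
    using le H1_wgrad(3)[OF \<Omega>(1) H(1)] H1_wgrad(3)[OF \<Omega>(1) H(2)] by (simp_all add: bounded_coeff_def L2_iff)
  then have i: "integrable ?M \<phi>" "integrable ?M \<theta>"
    using bounded_coeff_integrable[OF open_lebesgue[OF \<Omega>(1)] \<Omega>(2)] by blast+
  have eq: "?I (\<lambda>x. \<phi> x + t * (\<theta> x - \<phi> x)) = (1 - t) * ?I \<phi> + t * ?I \<theta>"
    using i by (simp add: algebra_simps)
  have "\<beta>1 * measure lebesgue \<Omega> = (1 - t) * (\<beta>1 * measure lebesgue \<Omega>) + t * (\<beta>1 * measure lebesgue \<Omega>)"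
    by (simp add: algebra_simps)
  also have "\<dots> \<le> (1 - t) * ?I \<phi> + t * ?I \<theta>"
    using I t by (intro add_mono mult_left_mono) auto
  finally have "\<beta>1 * measure lebesgue \<Omega> \<le> (1 - t) * ?I \<phi> + t * ?I \<theta>" .
  moreover have "(1 - t) * ?I \<phi> + t * ?I \<theta> \<le> \<beta>2 * measure lebesgue \<Omega>"
  proof -
    have "(1 - t) * ?I \<phi> + t * ?I \<theta> \<le> (1 - t) * (\<beta>2 * measure lebesgue \<Omega>) + t * (\<beta>2 * measure lebesgue \<Omega>)"
      using I t by (intro add_mono mult_left_mono) auto
    also have "\<dots> = \<beta>2 * measure lebesgue \<Omega>" by (simp add: algebra_simps)
    finally show ?thesis .
  qed
  moreover have "AE x in ?M. \<bar>\<phi> x + t * (\<theta> x - \<phi> x)\<bar> \<le> 1"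
    using le by eventually_elim (rule abs_le_one_segment[OF _ _ t])
  moreover have "(\<lambda>x. \<phi> x + t * (\<theta> x - \<phi> x)) \<in> H1 \<Omega>"
    using H1_lincomb(1)[OF \<Omega>(1) H(1) H1_lincomb(1)[OF \<Omega>(1) H(2,1), of "-1"], of t] by simp
  ultimately show ?thesis unfolding G_set_def mem_Collect_eq eq by blast
qed

lemma U_set_segment:
  assumes \<phi>: "\<phi> \<in> U_set \<Omega> S0 S1" and \<theta>: "\<theta> \<in> U_set \<Omega> S0 S1"
  shows "(\<lambda>x. \<phi> x + t * (\<theta> x - \<phi> x)) \<in> U_set \<Omega> S0 S1"
proof -
  let ?M = "lebesgue_on \<Omega>"
  have AE: "AE x in ?M. x \<in> S0 \<longrightarrow> \<phi> x = -1" "AE x in ?M. x \<in> S1 \<longrightarrow> \<phi> x = 1"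
    "AE x in ?M. x \<in> S0 \<longrightarrow> \<theta> x = -1" "AE x in ?M. x \<in> S1 \<longrightarrow> \<theta> x = 1"
    and i: "integrable ?M \<phi>" "integrable ?M \<theta>"
    using \<phi> \<theta> by (simp_all add: U_set_def)
  have "integrable ?M (\<lambda>x. \<phi> x + t * (\<theta> x - \<phi> x))" using i by simp
  moreover have "AE x in ?M. x \<in> S0 \<longrightarrow> \<phi> x + t * (\<theta> x - \<phi> x) = -1" using AE(1,3) by eventually_elim simp
  moreover have "AE x in ?M. x \<in> S1 \<longrightarrow> \<phi> x + t * (\<theta> x - \<phi> x) = 1" using AE(2,4) by eventually_elim simp
  ultimately show ?thesis by (simp add: U_set_def)
qed

text \<open>\<Omega> is covered by \<open>\<Omega>t\<close>, \<open>S0\<close> and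
  \<open>S1\<close>: on the first the bound is part of \<open>G_set\<close>, on the other two the
  value is -1 or 1 almost everywhere.\<close>

lemma admissible_abs_le_one:
  fixes \<Omega> :: "'a::euclidean_space set"
  assumes "open \<Omega>" "open \<Omega>t" and \<Omega>t: "\<Omega>t = \<Omega> - (S0 \<union> S1)" and \<phi>: "\<phi> \<in> G_set \<Omega>t \<beta>1 \<beta>2 \<inter> U_set \<Omega> S0 S1"
  shows "AE x in lebesgue_on \<Omega>. \<bar>\<phi> x\<bar> \<le> 1"
proof -
  have on: "(AE x in lebesgue_on S. P x) \<longleftrightarrow> (AE x in lebesgue. x \<in> S \<longrightarrow> P x)" if "open S" for S :: "'a set" and P
    using that by (intro AE_restrict_space_iff) auto
  have "AE x in lebesgue_on \<Omega>t. \<bar>\<phi> x\<bar> \<le> 1" using \<phi> by (simp add: G_set_def)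
  moreover have "AE x in lebesgue_on \<Omega>. x \<in> S0 \<longrightarrow> \<phi> x = -1" "AE x in lebesgue_on \<Omega>. x \<in> S1 \<longrightarrow> \<phi> x = 1"
    using \<phi> by (simp_all add: U_set_def)
  ultimately show ?thesis unfolding on[OF assms(1)] on[OF assms(2)]
    by eventually_elim (use \<Omega>t in auto)
qed

lemma Linf_norm_le:
  assumes "u \<in> borel_measurable (lebesgue_on \<Omega>)" "AE x in lebesgue_on \<Omega>. \<bar>u x\<bar> \<le> r"
  shows "Linf_norm \<Omega> u \<le> ereal r"
  unfolding Linf_norm_def by (rule esssup_I) (use assms in auto)

theorem theorem3p9:
  fixes \<Omega> S0 S1 \<Omega>t :: "'a::euclidean_space set"
    and \<beta>1 \<beta>2 \<epsilon> \<gamma> :: real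
    and a b c \<psi>0 :: "real \<Rightarrow> real"
    and \<psi> :: "real \<Rightarrow> ereal"
    and i :: "'l::{finite,linorder} \<Rightarrow> nat"
    and \<Psi> :: "real ^ ('l::{finite,linorder}) \<Rightarrow> real"
    and \<phi> :: "'a \<Rightarrow> real"
    and w :: "'l \<Rightarrow> 'a \<Rightarrow> real"
  assumes "region \<Omega>" and "bounded \<Omega>" and "lipschitz_boundary \<Omega>"
    and "S0 \<subseteq> \<Omega>" and "S1 \<subseteq> \<Omega>" and "S0 \<inter> S1 = {}"
    and "S0 \<in> sets lebesgue" and "S1 \<in> sets lebesgue"
    and "\<Omega>t = \<Omega> - (S0 \<union> S1)"
    and "region \<Omega>t" and "lipschitz_boundary \<Omega>t"
    and "\<beta>1 \<in> {-1<..<1}" and "\<beta>2 \<in> {-1<..<1}" and "\<beta>1 \<le> \<beta>2"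
    and "\<epsilon> > 0" and "\<gamma> > 0"
    and "C11_loc a" and "C11_loc b" and "C11_loc c"
    and "\<exists>C>0. \<forall>s. a s > C \<and> c s > C"
    and "\<And>s. b s \<ge> 0"
    and "double_well \<psi> \<psi>0"
    and "strict_mono i" and "\<And>j. i j \<ge> 1"
    and "Ck_on 1 {y. \<forall>j. y $ j > 0} \<Psi>"
    and "\<phi> \<in> G_set \<Omega>t \<beta>1 \<beta>2 \<inter> U_set \<Omega> S0 S1"
    and "\<exists>\<delta>>0. \<forall>\<theta>\<in>G_set \<Omega>t \<beta>1 \<beta>2 \<inter> U_set \<Omega> S0 S1.
           Linf_norm \<Omega> (\<lambda>x. \<theta> x - \<phi> x) < ereal \<delta> \<longrightarrow>
           J_cost \<Omega> \<Omega>t a b c i \<Psi> \<gamma> \<psi> \<epsilon> \<theta> \<ge> J_cost \<Omega> \<Omega>t a b c i \<Psi> \<gamma> \<psi> \<epsilon> \<phi>"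
    and "\<And>j. simple_eigenvalue \<Omega> a b c \<phi> (eigenvalue \<Omega> a b c \<phi> (i j))"
    and "\<And>j. eigenfunction \<Omega> a b c \<phi> (eigenvalue \<Omega> a b c \<phi> (i j)) (w j)"
    and "\<And>j. (LINT x|lebesgue_on \<Omega>. c (\<phi> x) * (w j x)\<^sup>2) = 1"
  shows "(\<forall>j. state_equation \<Omega> a b c \<phi> (eigenvalue \<Omega> a b c \<phi> (i j)) (w j)) \<and>
    (\<forall>\<theta>\<in>G_set \<Omega>t \<beta>1 \<beta>2 \<inter> U_set \<Omega> S0 S1.
       0 \<le> \<gamma> * \<epsilon> * (LINT x|lebesgue_on \<Omega>t. wgrad \<Omega>t \<phi> x \<bullet> wgrad \<Omega>t (\<lambda>y. \<theta> y - \<phi> y) x)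
         + \<gamma> / \<epsilon> * (LINT x|lebesgue_on \<Omega>t. deriv \<psi>0 (\<phi> x) * (\<theta> x - \<phi> x))
         + (\<Sum>j\<in>UNIV. partial_deriv j \<Psi> (eigenvalue_vec \<Omega> a b c i \<phi>) *
              ((LINT x|lebesgue_on \<Omega>. deriv a (\<phi> x) * (\<theta> x - \<phi> x) * (norm (wgrad \<Omega> (w j) x))\<^sup>2)
               + (LINT x|lebesgue_on \<Omega>. deriv b (\<phi> x) * (\<theta> x - \<phi> x) * (w j x)\<^sup>2)
               - eigenvalue \<Omega> a b c \<phi> (i j) *
                 (LINT x|lebesgue_on \<Omega>. deriv c (\<phi> x) * (\<theta> x - \<phi> x) * (w j x)\<^sup>2))))"
proof (rule conjI)
  note region = assms(1) and bdd = assms(2) and \<Omega>t_def = assms(9) and region_t = assms(10)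
    and \<epsilon> = assms(15) and \<gamma> = assms(16) and C11 = assms(17-19) and b_nonneg = assms(21) and dw = assms(22)
    and idx = assms(24) and \<Psi> = assms(25) and \<phi> = assms(26) and simple = assms(28) and normalized = assms(30)
  have state: "state_equation \<Omega> a b c \<phi> (eigenvalue \<Omega> a b c \<phi> (i j)) (w j)" for j
    using assms(29)[of j] by (simp add: eigenfunction_def)
  then show "\<forall>j. state_equation \<Omega> a b c \<phi> (eigenvalue \<Omega> a b c \<phi> (i j)) (w j)" by blast
  show "\<forall>\<theta>\<in>G_set \<Omega>t \<beta>1 \<beta>2 \<inter> U_set \<Omega> S0 S1.
       0 \<le> \<gamma> * \<epsilon> * (LINT x|lebesgue_on \<Omega>t. wgrad \<Omega>t \<phi> x \<bullet> wgrad \<Omega>t (\<lambda>y. \<theta> y - \<phi> y) x)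
         + \<gamma> / \<epsilon> * (LINT x|lebesgue_on \<Omega>t. deriv \<psi>0 (\<phi> x) * (\<theta> x - \<phi> x))
         + (\<Sum>j\<in>UNIV. partial_deriv j \<Psi> (eigenvalue_vec \<Omega> a b c i \<phi>) *
              ((LINT x|lebesgue_on \<Omega>. deriv a (\<phi> x) * (\<theta> x - \<phi> x) * (norm (wgrad \<Omega> (w j) x))\<^sup>2)
               + (LINT x|lebesgue_on \<Omega>. deriv b (\<phi> x) * (\<theta> x - \<phi> x) * (w j x)\<^sup>2)
               - eigenvalue \<Omega> a b c \<phi> (i j) *
                 (LINT x|lebesgue_on \<Omega>. deriv c (\<phi> x) * (\<theta> x - \<phi> x) * (w j x)\<^sup>2)))"
  proof (rule ballI)
    fix \<theta> assume \<theta>: "\<theta> \<in> G_set \<Omega>t \<beta>1 \<beta>2 \<inter> U_set \<Omega> S0 S1"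
    have op: "open \<Omega>" "\<Omega> \<noteq> {}" "open \<Omega>t" using region region_t by (auto simp: region_def)
    have bdd_t: "bounded \<Omega>t" unfolding \<Omega>t_def by (rule bounded_subset[OF bdd]) auto
    have G: "\<phi> \<in> G_set \<Omega>t \<beta>1 \<beta>2" "\<theta> \<in> G_set \<Omega>t \<beta>1 \<beta>2"
      and U: "\<phi> \<in> U_set \<Omega> S0 S1" "\<theta> \<in> U_set \<Omega> S0 S1" using \<phi> \<theta> by auto
    define h where "h = (\<lambda>x. \<theta> x - \<phi> x)"
    define y where "y t = eigenvalue_vec \<Omega> a b c i (\<lambda>x. \<phi> x + t * h x)" for t
    define E where "E t = real_energy \<Omega>t \<psi>0 \<epsilon> (\<lambda>x. \<phi> x + t * h x)" for t
    have m: "\<phi> \<in> borel_measurable (lebesgue_on \<Omega>)" "h \<in> borel_measurable (lebesgue_on \<Omega>)"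
      using U unfolding U_set_def h_def by (auto intro!: borel_measurable_diff dest: borel_measurable_integrable)
    have le: "AE x in lebesgue_on \<Omega>. \<bar>\<phi> x\<bar> \<le> 1" "AE x in lebesgue_on \<Omega>. \<bar>\<theta> x\<bar> \<le> 1"
      by (rule admissible_abs_le_one[OF op(1,3) \<Omega>t_def \<phi>], rule admissible_abs_le_one[OF op(1,3) \<Omega>t_def \<theta>])
    then have le': "AE x in lebesgue_on \<Omega>. \<bar>\<phi> x + h x\<bar> \<le> 1" by (simp add: h_def)
    have Gt: "\<phi> \<in> H1 \<Omega>t" "\<theta> \<in> H1 \<Omega>t" "AE x in lebesgue_on \<Omega>t. \<bar>\<phi> x\<bar> \<le> 1" "AE x in lebesgue_on \<Omega>t. \<bar>\<phi> x + h x\<bar> \<le> 1"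
      using G by (simp_all add: G_set_def h_def)
    have hH: "h \<in> H1 \<Omega>t" using H1_lincomb(1)[OF op(3) Gt(2,1), of "-1"] by (simp add: h_def)
    have adm: "(\<lambda>x. \<phi> x + t * h x) \<in> G_set \<Omega>t \<beta>1 \<beta>2 \<inter> U_set \<Omega> S0 S1" if "0 \<le> t" "t \<le> 1" for t
      unfolding h_def by (intro IntI G_set_segment[OF op(3) bdd_t G that] U_set_segment[OF U])
    \<comment> \<open>Along the segment the energy is finite, so the comparison of costs in the
      extended reals can be read in the reals.\<close>
    have J: "J_cost \<Omega> \<Omega>t a b c i \<Psi> \<gamma> \<psi> \<epsilon> (\<lambda>x. \<phi> x + t * h x) = ereal (\<Psi> (y t) + \<gamma> * E t)"
      if "0 \<le> t" "t \<le> 1" for t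
    proof -
      have "E_GL \<Omega>t \<psi> \<epsilon> (\<lambda>x. \<phi> x + t * h x) = ereal (E t)"
        unfolding E_def by (rule E_GL_eq_real_energy[OF op(3) bdd_t dw \<epsilon>])
          (use adm[OF that] in \<open>simp_all add: G_set_def\<close>)
      then show ?thesis by (simp add: J_cost_def y_def)
    qed
    obtain \<delta> where \<delta>: "0 < \<delta>" "\<And>\<theta>. \<theta> \<in> G_set \<Omega>t \<beta>1 \<beta>2 \<inter> U_set \<Omega> S0 S1 \<Longrightarrow> Linf_norm \<Omega> (\<lambda>x. \<theta> x - \<phi> x) < ereal \<delta> \<Longrightarrow>
        J_cost \<Omega> \<Omega>t a b c i \<Psi> \<gamma> \<psi> \<epsilon> \<phi> \<le> J_cost \<Omega> \<Omega>t a b c i \<Psi> \<gamma> \<psi> \<epsilon> \<theta>"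
      using assms(27) by blast
    \<comment> \<open>Almost everywhere \<open>\<bar>h x\<bar> \<le> 2\<close>, so
      \<open>t < \<delta> / 2\<close> puts the competitor into the neighbourhood of local
      minimality, while \<open>t < 1\<close> keeps it on the segment.\<close>
    have min: "0 \<le> (\<Psi> (y t) - \<Psi> (y 0)) / t + \<gamma> * ((E t - E 0) / t)" if t: "0 < t" "t < min 1 (\<delta> / 2)" for t
    proof -
      have "Linf_norm \<Omega> (\<lambda>x. (\<phi> x + t * h x) - \<phi> x) \<le> ereal (t * 2)"
      proof (rule Linf_norm_le)
        show "(\<lambda>x. (\<phi> x + t * h x) - \<phi> x) \<in> borel_measurable (lebesgue_on \<Omega>)" using m(2) by simp
        show "AE x in lebesgue_on \<Omega>. \<bar>(\<phi> x + t * h x) - \<phi> x\<bar> \<le> t * 2"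
          using le
        proof eventually_elim
          case (elim x)
          then have "\<bar>h x\<bar> \<le> 2" unfolding h_def by linarith
          then show ?case using t by (simp add: abs_mult)
        qed
      qed
      also have "\<dots> < ereal \<delta>" using t by simp
      finally have "J_cost \<Omega> \<Omega>t a b c i \<Psi> \<gamma> \<psi> \<epsilon> \<phi> \<le> J_cost \<Omega> \<Omega>t a b c i \<Psi> \<gamma> \<psi> \<epsilon> (\<lambda>x. \<phi> x + t * h x)"
        using t by (intro \<delta>(2) adm) auto
      then have "\<Psi> (y 0) + \<gamma> * E 0 \<le> \<Psi> (y t) + \<gamma> * E t" using J[of 0] J[of t] t by simp
      then have "0 \<le> ((\<Psi> (y t) - \<Psi> (y 0)) + \<gamma> * (E t - E 0)) / t" using t by (simp add: algebra_simps)
      then show ?thesis by (simp add: add_divide_distrib)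
    qed
    obtain C where C: "0 < C" "\<And>s. C < a s" "\<And>s. C < c s" using assms(20) by blast
    define d where "d j = (LINT x|lebesgue_on \<Omega>. deriv a (\<phi> x) * h x * (norm (wgrad \<Omega> (w j) x))\<^sup>2)
      + (LINT x|lebesgue_on \<Omega>. deriv b (\<phi> x) * h x * (w j x)\<^sup>2)
      - eigenvalue \<Omega> a b c \<phi> (i j) * (LINT x|lebesgue_on \<Omega>. deriv c (\<phi> x) * h x * (w j x)\<^sup>2)" for j
    note ev = simple_dirichlet_eigenvalue_derivative[OF op(1) bdd op(2) C11 C(1) less_imp_le[OF C(2)] less_imp_le[OF C(3)]
        b_nonneg m le(1) le' idx simple state normalized]
    have y': "((\<lambda>t. (y t $ j - y 0 $ j) / t) \<longlongrightarrow> d j) (at_right 0)" for j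
      using ev(1)[of j] by (simp add: y_def eigenvalue_vec_def d_def)
    have y0: "y 0 = eigenvalue_vec \<Omega> a b c i \<phi>" by (simp add: y_def)
    \<comment> \<open>Positivity of the eigenvalues places \<open>y 0\<close> in the orthant on
      which \<Psi> is of class C^1.\<close>
    have "y 0 \<in> {y. \<forall>j. y $ j > 0}" using ev(2) by (simp add: y0 eigenvalue_vec_def)
    then have "\<Psi> differentiable (at (y 0))" using \<Psi> by (simp add: One_nat_def)
    from chain_rule_right[OF y' this]
    have lim1: "((\<lambda>t. (\<Psi> (y t) - \<Psi> (y 0)) / t) \<longlongrightarrow> (\<Sum>j\<in>UNIV. partial_deriv j \<Psi> (y 0) * d j)) (at_right 0)" .
    have "C11_loc \<psi>0" using dw by (simp add: double_well_def)
    from real_energy_derivative[OF op(3) bdd_t this Gt(1) hH Gt(3,4), of \<epsilon>]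
    have lim2: "((\<lambda>t. (E t - E 0) / t) \<longlongrightarrow> \<epsilon> * (LINT x|lebesgue_on \<Omega>t. wgrad \<Omega>t \<phi> x \<bullet> wgrad \<Omega>t h x)
        + 1 / \<epsilon> * (LINT x|lebesgue_on \<Omega>t. deriv \<psi>0 (\<phi> x) * h x)) (at_right 0)"
      by (simp add: E_def)
    \<comment> \<open>The difference quotient of the cost is nonnegative for all small positive
      \<open>t\<close>, and this sign survives in the limit.\<close>
    have "0 \<le> (\<Sum>j\<in>UNIV. partial_deriv j \<Psi> (y 0) * d j) + \<gamma> * (\<epsilon> * (LINT x|lebesgue_on \<Omega>t. wgrad \<Omega>t \<phi> x \<bullet> wgrad \<Omega>t h x)
        + 1 / \<epsilon> * (LINT x|lebesgue_on \<Omega>t. deriv \<psi>0 (\<phi> x) * h x))"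
    proof (rule tendsto_lowerbound[OF tendsto_add[OF lim1 tendsto_mult[OF tendsto_const lim2]]])
      show "\<forall>\<^sub>F t in at_right 0. 0 \<le> (\<Psi> (y t) - \<Psi> (y 0)) / t + \<gamma> * ((E t - E 0) / t)"
        unfolding eventually_at_right_field using min \<delta>(1) by (intro exI[of _ "min 1 (\<delta> / 2)"]) auto
    qed simp
    then have "0 \<le> \<gamma> * \<epsilon> * (LINT x|lebesgue_on \<Omega>t. wgrad \<Omega>t \<phi> x \<bullet> wgrad \<Omega>t h x)
         + \<gamma> / \<epsilon> * (LINT x|lebesgue_on \<Omega>t. deriv \<psi>0 (\<phi> x) * h x)
         + (\<Sum>j\<in>UNIV. partial_deriv j \<Psi> (y 0) * d j)"
      by (simp add: algebra_simps)
    then show "0 \<le> \<gamma> * \<epsilon> * (LINT x|lebesgue_on \<Omega>t. wgrad \<Omega>t \<phi> x \<bullet> wgrad \<Omega>t (\<lambda>y. \<theta> y - \<phi> y) x)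
         + \<gamma> / \<epsilon> * (LINT x|lebesgue_on \<Omega>t. deriv \<psi>0 (\<phi> x) * (\<theta> x - \<phi> x))
         + (\<Sum>j\<in>UNIV. partial_deriv j \<Psi> (eigenvalue_vec \<Omega> a b c i \<phi>) *
              ((LINT x|lebesgue_on \<Omega>. deriv a (\<phi> x) * (\<theta> x - \<phi> x) * (norm (wgrad \<Omega> (w j) x))\<^sup>2)
               + (LINT x|lebesgue_on \<Omega>. deriv b (\<phi> x) * (\<theta> x - \<phi> x) * (w j x)\<^sup>2)
               - eigenvalue \<Omega> a b c \<phi> (i j) *
                 (LINT x|lebesgue_on \<Omega>. deriv c (\<phi> x) * (\<theta> x - \<phi> x) * (w j x)\<^sup>2)))"
      unfolding y0 d_def h_def .
  qed
qed

end
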